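(* Let $\gamma\in(\sqrt{8/3},2)$, $\mu>0$, $M=\sqrt{\mu/\sin(\pi\gamma^2/4)}$, and let $u$ be the stable Lévy excursion functional defined in the context. Put $$L_\mu(\gamma)=\frac{2^{1-4/\gamma^2}}{\Gamma(4/\gamma^2)}\sqrt{2\pi}\,M^{\frac4{\gamma^2}+\frac12}\,\frac{\pi}{\cos(4\pi/\gamma^2)}\,\frac{\gamma^4\pi^2}{8}\;(<0),\qquad u_{\rm st}(x)=-\frac{16}{\gamma^4\pi^2}\,\frac{M+u(-xL_\mu(\gamma))}{2M}.$$ Then $u_{\rm st}(0)=0$ and for every $x\le0$, $$-x=\frac{u_{\rm st}(x)}{2}\;{}_2F_1\left(\frac12-\frac4{\gamma^2},\frac12+\frac4{\gamma^2};2;-\frac{\gamma^4\pi^2}{16}u_{\rm st}(x)\right).$$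
   Context: $\beta=\frac4{\gamma^2}+\frac12\in(3/2,2)$. Let $\zeta'$ be the spectrally positive $\beta$-stable Lévy process with Lévy measure $1_{x>0}x^{-1-\beta}dx$, i.e. $\mathbb E[e^{-q\zeta'_t}]=e^{t\Gamma(-\beta)q^\beta}$ for $q\ge 0$. Let $I_t=\inf_{r\le t}\zeta'_r$ and let $\underline N'$ be the excursion measure of $\zeta'-I$ away from $0$, with $-I$ as local time (so that the excursions, indexed by the level $s=-I$, form a Poisson point process with intensity $ds\otimes\underline N'$). For an excursion $e$, $T(e)$ is its duration and $J_e$ the multiset of its positive jump sizes. Let $$g(x)=\frac{2}{\Gamma(4/\gamma^2)}\left(\frac{Mx}{2}\right)^{4/\gamma^2}K_{4/\gamma^2}(Mx),\quad x>0,$$ where $K_\nu$ is the modified Bessel function of the second kind (this is the area Laplace transform $\mathbb E[e^{-\mu A}]$ of a $\gamma$-LQG quantum disk of boundary length $x$). Define $$u(s)=\int\Big(e^{sT(e)}\prod_{x\in J_e}g(x)-1\Big)\underline N'(de),\qquad s\le0.$$ ${}_2F_1$ denotes the Gauss hypergeometric function, analytic on $\mathbb C\setminus[1,\infty)$ (principal branch). *)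

theory Defs
  imports "HOL-Probability.Probability"
begin

section \<open>Cadlag paths and Levy processes\<close>

text \<open>A path is a function on the reals of which only the values at times \<open>t \<ge> 0\<close> matter.\<close>

definition cadlag :: "(real \<Rightarrow> real) \<Rightarrow> bool" where
  "cadlag f \<longleftrightarrow>
     (\<forall>t\<ge>0. (f \<longlongrightarrow> f t) (at_right t)) \<and> (\<forall>t>0. \<exists>l. (f \<longlongrightarrow> l) (at_left t))"

definition jump :: "(real \<Rightarrow> real) \<Rightarrow> real \<Rightarrow> real" where
  "jump f t = f t - Lim (at_left t) f"

definition levy_process :: "'w measure \<Rightarrow> (real \<Rightarrow> 'w \<Rightarrow> real) \<Rightarrow> bool" where
  "levy_process \<Omega> X \<longleftrightarrow>
     prob_space \<Omega> \<and>
     (\<forall>t\<ge>0. X t \<in> borel_measurable \<Omega>) \<and>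
     (\<forall>\<omega>\<in>space \<Omega>. X 0 \<omega> = 0 \<and> cadlag (\<lambda>t. X t \<omega>)) \<and>
     (\<forall>(t :: nat \<Rightarrow> real) n. 0 \<le> t 0 \<and> mono t \<longrightarrow>
        prob_space.indep_vars \<Omega> (\<lambda>_. borel) (\<lambda>i \<omega>. X (t (Suc i)) \<omega> - X (t i) \<omega>) {..<n}) \<and>
     (\<forall>s\<ge>0. \<forall>h\<ge>0. distr \<Omega> borel (\<lambda>\<omega>. X (s + h) \<omega> - X s \<omega>) = distr \<Omega> borel (X h))"

text \<open>The Levy measure of a set is the expected number of jumps in it per unit of time.\<close>

definition has_levy_measure ::
    "'w measure \<Rightarrow> (real \<Rightarrow> 'w \<Rightarrow> real) \<Rightarrow> real measure \<Rightarrow> bool" where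
  "has_levy_measure \<Omega> X \<nu> \<longleftrightarrow>
     sets \<nu> = sets borel \<and> emeasure \<nu> {0} = 0 \<and>
     (\<forall>A\<in>sets borel. 0 \<notin> A \<longrightarrow>
        emeasure \<nu> A =
          (\<integral>\<^sup>+\<omega>. emeasure (count_space UNIV) {t\<in>{0<..1}. jump (\<lambda>r. X r \<omega>) t \<in> A} \<partial>\<Omega>))"

definition spectrally_positive_stable ::
    "real \<Rightarrow> 'w measure \<Rightarrow> (real \<Rightarrow> 'w \<Rightarrow> real) \<Rightarrow> bool" where
  "spectrally_positive_stable \<beta> \<Omega> X \<longleftrightarrow>
     levy_process \<Omega> X \<and>
     has_levy_measure \<Omega> X
       (density lborel (\<lambda>x. ennreal (indicator {0<..} x * x powr (- 1 - \<beta>)))) \<and>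
     (\<forall>t\<ge>0. \<forall>q\<ge>0.
        (\<integral>\<omega>. exp (- q * X t \<omega>) \<partial>\<Omega>) = exp (t * Gamma (- \<beta>) * q powr \<beta>))"


section \<open>Poisson point processes\<close>

text \<open>
  A (simple) point process is given by its random set of points; \<open>emeasure (count_space UNIV)\<close>
  counts points, with value \<open>\<infinity>\<close> on infinite sets. The intensity is meant to be
  sigma-finite. The Poisson weights are written out in order to cover parameter \<open>0\<close>.
\<close>

definition poisson_point_process ::
    "'w measure \<Rightarrow> 'a measure \<Rightarrow> ('w \<Rightarrow> 'a set) \<Rightarrow> bool" where
  "poisson_point_process \<Omega> \<Lambda> P \<longleftrightarrow>
     (AE \<omega> in \<Omega>. P \<omega> \<subseteq> space \<Lambda>) \<and>
     (\<forall>A\<in>sets \<Lambda>. (\<lambda>\<omega>. emeasure (count_space UNIV) (P \<omega> \<inter> A)) \<in> borel_measurable \<Omega>) \<and>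
     (\<forall>A\<in>sets \<Lambda>. emeasure \<Lambda> A < \<infinity> \<longrightarrow>
        (\<forall>k::nat. measure \<Omega> {\<omega>\<in>space \<Omega>. emeasure (count_space UNIV) (P \<omega> \<inter> A) = of_nat k} =
           exp (- measure \<Lambda> A) * measure \<Lambda> A ^ k / fact k)) \<and>
     (\<forall>(A :: nat \<Rightarrow> 'a set) n. disjoint_family_on A {..<n} \<and> (\<forall>i<n. A i \<in> sets \<Lambda>) \<longrightarrow>
        prob_space.indep_vars \<Omega> (\<lambda>_. borel)
          (\<lambda>i \<omega>. emeasure (count_space UNIV) (P \<omega> \<inter> A i)) {..<n})"


section \<open>Excursions above the running infimum\<close>

text \<open>
  An excursion \<open>e\<close> of duration \<open>T\<close> is extended by \<open>0\<close> to times outside \<open>[0, T)\<close>. The value at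
  time \<open>0\<close> is not prescribed; since \<open>e\<close> vanishes at negative times, a nonzero value there
  would count as a jump at time \<open>0\<close>.
\<close>

definition excursions :: "(real \<Rightarrow> real) set" where
  "excursions = {e. cadlag e \<and> (\<forall>t. 0 \<le> e t) \<and> (\<forall>t<0. e t = 0) \<and>
     (\<exists>T>0. (\<forall>t. 0 < t \<and> t < T \<longrightarrow> 0 < e t) \<and> (\<forall>t\<ge>T. e t = 0))}"

definition excursion_space :: "(real \<Rightarrow> real) measure" where
  "excursion_space = restrict_space (\<Pi>\<^sub>M t\<in>UNIV. borel) excursions"

definition duration :: "(real \<Rightarrow> real) \<Rightarrow> real" where
  "duration e = Inf {t. 0 < t \<and> e t = 0}"

definition running_inf :: "(real \<Rightarrow> real) \<Rightarrow> real \<Rightarrow> real" where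
  "running_inf f t = (INF r\<in>{0..t}. f r)"

text \<open>Right-continuous inverse of the local time \<open>- running_inf f\<close>, and its left limits.\<close>

definition inverse_local_time :: "(real \<Rightarrow> real) \<Rightarrow> real \<Rightarrow> real" where
  "inverse_local_time f s = Inf {t. 0 \<le> t \<and> - running_inf f t > s}"

definition inverse_local_time_left :: "(real \<Rightarrow> real) \<Rightarrow> real \<Rightarrow> real" where
  "inverse_local_time_left f s = Lim (at_left s) (inverse_local_time f)"

definition excursion_at :: "(real \<Rightarrow> real) \<Rightarrow> real \<Rightarrow> real \<Rightarrow> real" where
  "excursion_at f s r =
     (let a = inverse_local_time_left f s; b = inverse_local_time f s
      in if 0 \<le> r \<and> r < b - a then f (a + r) - running_inf f (a + r) else 0)"

definition excursion_points :: "(real \<Rightarrow> real) \<Rightarrow> (real \<times> (real \<Rightarrow> real)) set" where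
  "excursion_points f =
     {(s, excursion_at f s) | s. 0 < s \<and> inverse_local_time_left f s < inverse_local_time f s}"

definition is_excursion_measure ::
    "'w measure \<Rightarrow> (real \<Rightarrow> 'w \<Rightarrow> real) \<Rightarrow> (real \<Rightarrow> real) measure \<Rightarrow> bool" where
  "is_excursion_measure \<Omega> X N \<longleftrightarrow>
     sets N = sets excursion_space \<and> sigma_finite_measure N \<and>
     poisson_point_process \<Omega> (restrict_space lborel {0<..} \<Otimes>\<^sub>M N)
       (\<lambda>\<omega>. excursion_points (\<lambda>t. X t \<omega>))"


section \<open>The excursion functional\<close>

text \<open>Unordered product, the multiplicative analogue of \<^const>\<open>infsum\<close>.\<close>

definition unordered_prod :: "('a \<Rightarrow> real) \<Rightarrow> 'a set \<Rightarrow> real" where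
  "unordered_prod f A = Lim (finite_subsets_at_top A) (\<lambda>F. \<Prod>x\<in>F. f x)"

text \<open>The product over the multiset of jump sizes is indexed by the jump times.\<close>

definition prod_over_jumps :: "(real \<Rightarrow> real) \<Rightarrow> (real \<Rightarrow> real) \<Rightarrow> real" where
  "prod_over_jumps g e = unordered_prod (\<lambda>t. g (jump e t)) {t. 0 < jump e t}"

definition excursion_functional ::
    "(real \<Rightarrow> real) measure \<Rightarrow> (real \<Rightarrow> real) \<Rightarrow> real \<Rightarrow> real" where
  "excursion_functional N g s =
     (\<integral>e. (exp (s * duration e) * prod_over_jumps g e - 1) \<partial>N)"


section \<open>Special functions\<close>

text \<open>Modified Bessel function of the second kind; meaningful for real order and argument \<open>x > 0\<close> only.\<close>

definition bessel_K :: "real \<Rightarrow> real \<Rightarrow> real" where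
  "bessel_K \<nu> x = (LBINT t:{0..}. exp (- x * cosh t) * cosh (\<nu> * t))"

text \<open>
  The principal branch of the Gauss hypergeometric function: the (unique) holomorphic function
  on the complex plane slit along \<open>[1, \<infinity>)\<close> which is given by the hypergeometric series on the
  unit disc. Values on the slit are unspecified.
\<close>

definition hyp2F1 :: "complex \<Rightarrow> complex \<Rightarrow> complex \<Rightarrow> complex \<Rightarrow> complex" where
  "hyp2F1 a b c =
     (SOME f. f holomorphic_on - (complex_of_real ` {1..}) \<and>
        (\<forall>z\<in>ball 0 1. f z = eval_fps (fps_hypergeo [a, b] [c] 1) z))"

text \<open>Area Laplace transform of a quantum disk of boundary length \<open>x\<close>.\<close>

definition disk_laplace :: "real \<Rightarrow> real \<Rightarrow> real \<Rightarrow> real" where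
  "disk_laplace \<gamma> M x =
     2 / Gamma (4 / \<gamma>\<^sup>2) * (M * x / 2) powr (4 / \<gamma>\<^sup>2) * bessel_K (4 / \<gamma>\<^sup>2) (M * x)"

end

theory Submission
  imports Defs "HOL-Complex_Analysis.Complex_Analysis" "HOL-Real_Asymp.Real_Asymp"
begin

text \<open>
  Put \<open>\<psi> q = \<Gamma>(-\<beta>) q\<^sup>\<beta> - \<integral> e\<^sup>-\<^sup>q\<^sup>x (1 - g x) x\<^sup>-\<^sup>1\<^sup>-\<^sup>\<beta> dx\<close>, and let \<open>T\<close> be the first passage time of the
  stable process below \<open>-1\<close>. Stopping the martingale \<open>exp (- q X\<^sub>t - t \<psi> q) \<Prod> g(jumps up to t)\<close> at \<open>T\<close> gives
  \<open>E (exp (- T \<psi> q) \<Prod> g(jumps up to T)) = exp (- q)\<close>. The process spends no time at its running infimum, so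
  \<open>T\<close> and the jumps before \<open>T\<close> are those of the excursions with level in \<open>(0, 1]\<close>, and the exponential formula
  for Poisson point processes turns the left-hand side into \<open>exp (u (- \<psi> q))\<close>. Hence \<open>u (- \<psi> q) = - q\<close>.

  It remains to compute \<open>\<psi>\<close>. The integral representation of the Bessel function gives
  \<open>\<psi> q = c (q\<^sup>2 - M\<^sup>2) \<integral> e\<^sup>\<nu>\<^sup>t (q + M cosh t)\<^bsup>-3/2\<^esup> dt\<close> with \<open>\<nu> = 4/\<gamma>\<^sup>2\<close>:
  by a differential equation for the integral,
  the second derivatives of the two sides agree, and their difference, being affine, vanishes since it tends
  to \<open>0\<close> at infinity. Expanding the integral in powers of \<open>z = (M - q) / (2 M)\<close> by Beta integrals, and applying Euler's transformation, yields \<open>z\<close> times the hypergeometric function at \<open>z\<close>.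
\<close>

section \<open>Bessel functions and Laplace transforms\<close>

text \<open>The process is known only through its increments, its Laplace exponent and its expected
  jump counts, so the small-time limits have to come from these. Fatou's lemma on dyadic grids gives
  one inequality between integrals against the Levy measure and one-step means; the reverse one is
  forced by a single function, \<open>test_fun\<close>, for which both quantities are explicit and
  agree. The martingale, too, only ever appears as a product of independent weights over grid cells.
  Two obstacles hide in the passage from T to the excursions. The duration of an excursion is its
  first return to zero, which could be shorter than its time interval if the path rested at its
  infimum. And u is a Bochner integral, so its integrand must be shown integrable; the exponential
  formula gives this because exp (- q) is not zero. The range s <= 0 is reached by q >= M: \<psi>
  vanishes at M, where z = 0, and grows to infinity. Thus u 0 = - M, and \<open>u_st\<close> is z up
  to the factor - 16 / (\<gamma>^4 pi^2).\<close>

lemma nn_integral_Gamma_rate: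
  fixes s a :: real
  assumes "0 < s" "0 < a"
  shows "(\<integral>\<^sup>+x. ennreal (indicator {0<..} x * (x powr (s - 1) * exp (- a * x))) \<partial>lborel)
           = ennreal (Gamma s / a powr s)"
proof -
  have "ennreal (Gamma s) = (\<integral>\<^sup>+t. ennreal (indicator {0..} t * t powr (s - 1) / exp t) \<partial>lborel)"
    using Gamma_conv_nn_integral_real[OF assms(1)] by simp
  also have "\<dots> = (\<integral>\<^sup>+t. ennreal (indicator {0<..} t * (t powr (s - 1) * exp (- t))) \<partial>lborel)"
    by (intro nn_integral_cong_AE AE_I[where N="{0}"])
       (auto simp: indicator_def exp_minus field_simps split: if_splits)
  also have "\<dots> = ennreal a * (\<integral>\<^sup>+x. ennreal (indicator {0<..} (0 + a * x) * ((0 + a * x) powr (s - 1) * exp (- (0 + a * x)))) \<partial>lborel)"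
    using assms(2) by (subst nn_integral_real_affine[where c=a and t=0]) auto
  also have "\<dots> = (\<integral>\<^sup>+x. ennreal a * ennreal (indicator {0<..} (0 + a * x) * ((0 + a * x) powr (s - 1) * exp (- (0 + a * x)))) \<partial>lborel)"
    by (intro nn_integral_cmult[symmetric]) auto
  also have "\<dots> = (\<integral>\<^sup>+x. ennreal (a powr s) * ennreal (indicator {0<..} x * (x powr (s - 1) * exp (- a * x))) \<partial>lborel)"
    using assms(2)
    by (intro nn_integral_cong)
       (auto simp: indicator_def powr_mult ennreal_mult'[symmetric] zero_less_mult_iff powr_diff
          split: if_splits)
  also have "\<dots> = ennreal (a powr s) * (\<integral>\<^sup>+x. ennreal (indicator {0<..} x * (x powr (s - 1) * exp (- a * x))) \<partial>lborel)"
    by (intro nn_integral_cmult) auto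
  finally have *: "ennreal (Gamma s) = \<dots>" .
  have "ennreal (Gamma s / a powr s) = ennreal (Gamma s) * ennreal (1 / a powr s)"
    using assms by (subst ennreal_mult'[symmetric]) (auto simp: Gamma_real_pos less_imp_le)
  also have "\<dots> = ennreal (a powr s * (1 / a powr s)) * (\<integral>\<^sup>+x. ennreal (indicator {0<..} x * (x powr (s - 1) * exp (- a * x))) \<partial>lborel)"
    unfolding * using assms by (subst ennreal_mult') (auto simp: ac_simps)
  finally show ?thesis using assms by simp
qed

lemma has_bochner_integral_Gamma_rate:
  fixes s a :: real
  assumes "0 < s" "0 < a"
  shows "has_bochner_integral lborel (\<lambda>x. indicator {0<..} x * (x powr (s - 1) * exp (- a * x))) (Gamma s / a powr s)"
  using assms
  by (intro has_bochner_integral_nn_integral nn_integral_Gamma_rate)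
     (auto simp: Gamma_real_pos less_imp_le)

text \<open>The change of variables y = (x / 2) e^t turns x cosh t into y + x^2 / (4 y). The left
  side is the Bessel integral; in the integral on the right x occurs only in a factor at most 1, so
  that it behaves well as x tends to 0.\<close>

lemma substitution_log_scale:
  fixes x \<nu> :: real
  assumes "0 < x" "0 < \<nu>"
  shows "integrable lborel (\<lambda>t. exp (- x * cosh t + \<nu> * t))" (is ?A)
    and "(x / 2) powr \<nu> * (\<integral>t. exp (- x * cosh t + \<nu> * t) \<partial>lborel)
          = (\<integral>y. indicator {0<..} y * (y powr (\<nu> - 1) * exp (- y - x\<^sup>2 / (4 * y))) \<partial>lborel)" (is ?B)
proof -
  define f where "f = (\<lambda>t. exp (- x * cosh t + \<nu> * t))"
  define g where "g = (\<lambda>y. ln (2 * y / x))"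
  have fnn: "0 \<le> f t" for t unfolding f_def by simp
  have fg: "f (g y) / y = (2 / x) powr \<nu> * (y powr (\<nu> - 1) * exp (- y - x\<^sup>2 / (4 * y)))" if "0 < y" for y
  proof -
    have "exp (\<nu> * ln (2 * y / x)) = (2 / x) powr \<nu> * y powr \<nu>"
      using that assms by (simp add: powr_mult[symmetric]) (simp add: powr_def field_simps)
    moreover have "cosh (ln (2 * y / x)) = (2 * y / x + x / (2 * y)) / 2"
      using that assms by (simp add: cosh_ln_real inverse_eq_divide)
    then have "- x * cosh (ln (2 * y / x)) = - y - x\<^sup>2 / (4 * y)"
      using that assms by (simp add: field_simps power2_eq_square)
    ultimately show ?thesis
      using that unfolding f_def g_def exp_add by (simp add: powr_diff)
  qed
  have int1: "set_integrable lborel {0<..} (\<lambda>y. f (g y) / y)"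
    unfolding set_integrable_def
  proof (rule Bochner_Integration.integrable_bound)
    show "integrable lborel (\<lambda>y. (2 / x) powr \<nu> * (indicator {0<..} y * (y powr (\<nu> - 1) * exp (- 1 * y))))"
      using has_bochner_integral_Gamma_rate[of \<nu> 1] assms
      by (intro integrable_mult_right) (auto simp: has_bochner_integral_iff)
    show "AE y in lborel. norm (indicat_real {0<..} y *\<^sub>R (f (g y) / y))
            \<le> norm ((2 / x) powr \<nu> * (indicator {0<..} y * (y powr (\<nu> - 1) * exp (- 1 * y))))"
      using fnn by (intro AE_I2) (auto simp: fg indicator_def intro!: mult_left_mono)
  qed (auto simp: f_def g_def cosh_def)
  have ei: "einterval 0 \<infinity> = {0<..}" "einterval (-\<infinity>) \<infinity> = UNIV"
    by (auto simp: einterval_def)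
  have *: "set_integrable lborel (einterval (-\<infinity>) \<infinity>) f"
       "(LBINT x=-\<infinity>..\<infinity>. f x) = (LBINT y=0..\<infinity>. f (g y) * (1 / y))"
  proof -
    have 1: "((ereal \<circ> g \<circ> real_of_ereal) \<longlongrightarrow> - \<infinity>) (at_right 0)"
      unfolding zero_ereal_def ereal_tendsto_simps g_def
    proof (rule filterlim_compose[OF ln_at_0])
      show "LIM y at_right 0. 2 * y / x :> at_right 0"
        unfolding filterlim_at using assms
        by (auto intro!: tendsto_eq_intros simp: eventually_at_filter)
    qed
    have 2: "((ereal \<circ> g \<circ> real_of_ereal) \<longlongrightarrow> \<infinity>) (at_left \<infinity>)"
      unfolding ereal_tendsto_simps g_def
    proof (rule filterlim_compose[OF ln_at_top])
      have "LIM y at_top. (2 / x) * y :> at_top"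
        using assms by (intro filterlim_tendsto_pos_mult_at_top[OF tendsto_const]) (auto simp: filterlim_ident)
      then show "LIM y at_top. 2 * y / x :> at_top" by simp
    qed
    have 3: "set_integrable lborel (einterval 0 \<infinity>) (\<lambda>x. f (g x) * (1 / x))"
      using int1 by (simp add: ei)
    have 4: "0 \<le> 1 / y" if "0 \<le> ereal y" for y using that by (simp add: zero_ereal_def)
    have 5: "DERIV g y :> 1 / y" if "0 < ereal y" for y
      using that assms unfolding g_def by (auto intro!: derivative_eq_intros simp: zero_ereal_def)
    have 6: "isCont (\<lambda>y. 1 / y) y" if "0 < ereal y" for y::real
      using that by (auto intro!: continuous_intros simp: zero_ereal_def)
    have 7: "isCont f (g y)" for y unfolding f_def by (intro continuous_intros)
    have 8: "0 < (\<infinity>::ereal)" by simp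
    note S = interval_integral_substitution_nonneg[OF 8 5 7 6 fnn 4 1 2 3]
    show "set_integrable lborel (einterval (-\<infinity>) \<infinity>) f"
       "(LBINT x=-\<infinity>..\<infinity>. f x) = (LBINT y=0..\<infinity>. f (g y) * (1 / y))"
      using S by simp_all
  qed
  show ?A using *(1) unfolding ei set_integrable_def f_def by simp
  have "(\<integral>t. f t \<partial>lborel) = (LBINT x=-\<infinity>..\<infinity>. f x)"
    by (simp add: interval_lebesgue_integral_def ei set_lebesgue_integral_def)
  also have "\<dots> = (\<integral>y. indicator {0<..} y * (f (g y) / y) \<partial>lborel)"
    unfolding * by (simp add: interval_lebesgue_integral_def ei set_lebesgue_integral_def)
  also have "\<dots> = (\<integral>y. (2 / x) powr \<nu> * (indicator {0<..} y * (y powr (\<nu> - 1) * exp (- y - x\<^sup>2 / (4 * y)))) \<partial>lborel)"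
    by (intro Bochner_Integration.integral_cong) (auto simp: fg[symmetric] indicator_def)
  finally have "(\<integral>t. f t \<partial>lborel) = (2 / x) powr \<nu> * (\<integral>y. indicator {0<..} y * (y powr (\<nu> - 1) * exp (- y - x\<^sup>2 / (4 * y))) \<partial>lborel)"
    by simp
  moreover have "(x / 2) powr \<nu> * (2 / x) powr \<nu> = 1"
    using assms by (subst powr_mult[symmetric]) auto
  ultimately show ?B unfolding f_def by simp
qed

lemma integral_symmetrize:
  fixes h :: "real \<Rightarrow> 'b::{banach,second_countable_topology}"
  assumes "integrable lborel h"
  shows "integrable lborel (\<lambda>t. indicator {0..} t *\<^sub>R (h t + h (- t)))"
    and "(\<integral>t. h t \<partial>lborel) = (\<integral>t. indicator {0..} t *\<^sub>R (h t + h (- t)) \<partial>lborel)"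
proof -
  have i1: "integrable lborel (\<lambda>t. indicator {0..} t *\<^sub>R h t)" "integrable lborel (\<lambda>t. indicator {..0} t *\<^sub>R h t)"
    using assms by (auto intro!: integrable_mult_indicator)
  from i1(2) have i2: "integrable lborel (\<lambda>t. indicator {0..} t *\<^sub>R h (- t))"
    by (subst lborel_integrable_real_affine_iff[symmetric, where c="-1" and t=0])
       (auto simp: indicator_def)
  show "integrable lborel (\<lambda>t. indicator {0..} t *\<^sub>R (h t + h (- t)))"
    unfolding scaleR_add_right using i1(1) i2 by (rule Bochner_Integration.integrable_add)
  have "(\<integral>t. h t \<partial>lborel) = (\<integral>t. indicator {0..} t *\<^sub>R h t + indicator {..0} t *\<^sub>R h t \<partial>lborel)"
    using assms by (intro integral_cong_AE AE_I[where N="{0}"]) (auto simp: indicator_def)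
  also have "\<dots> = (\<integral>t. indicator {0..} t *\<^sub>R h t \<partial>lborel) + (\<integral>t. indicator {..0} t *\<^sub>R h t \<partial>lborel)"
    by (rule Bochner_Integration.integral_add[OF i1])
  also have "(\<integral>t. indicator {..0} t *\<^sub>R h t \<partial>lborel) = (\<integral>t. indicator {0..} t *\<^sub>R h (- t) \<partial>lborel)"
    by (subst lborel_integral_real_affine[where c="-1" and t=0]) (auto simp: indicator_def intro!: Bochner_Integration.integral_cong)
  also have "(\<integral>t. indicator {0..} t *\<^sub>R h t \<partial>lborel) + \<dots> = (\<integral>t. indicator {0..} t *\<^sub>R (h t + h (- t)) \<partial>lborel)"
    unfolding scaleR_add_right by (rule Bochner_Integration.integral_add[OF i1(1) i2, symmetric])
  finally show "(\<integral>t. h t \<partial>lborel) = (\<integral>t. indicator {0..} t *\<^sub>R (h t + h (- t)) \<partial>lborel)" .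
qed

text \<open>As cosh is even, folding the line at 0 replaces e^(\<nu> t) by 2 cosh (\<nu> t). The
  exponential form on the whole line is the one that combines with Fubini and with integration by
  parts.\<close>

lemma bessel_K_eq:
  assumes "0 < x" "0 < \<nu>"
  shows "bessel_K \<nu> x = (\<integral>t. exp (- x * cosh t + \<nu> * t) \<partial>lborel) / 2"
proof -
  have *: "exp (- x * cosh t + \<nu> * t) + exp (- x * cosh (- t) + \<nu> * - t) = 2 * (exp (- x * cosh t) * cosh (\<nu> * t))" for t
  proof -
    have E: "exp (\<nu> * t) = cosh (\<nu> * t) + sinh (\<nu> * t)" "exp (\<nu> * - t) = cosh (\<nu> * t) - sinh (\<nu> * t)"
      by (simp_all add: cosh_plus_sinh cosh_minus_sinh)
    show ?thesis unfolding exp_add cosh_minus E by (simp add: algebra_simps)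
  qed
  have "(\<integral>t. exp (- x * cosh t + \<nu> * t) \<partial>lborel) =
      (\<integral>t. indicator {0..} t *\<^sub>R (exp (- x * cosh t + \<nu> * t) + exp (- x * cosh (- t) + \<nu> * - t)) \<partial>lborel)"
    by (rule integral_symmetrize(2)) (rule substitution_log_scale(1)[OF assms])
  also have "\<dots> = (\<integral>t. 2 * (indicator {0..} t *\<^sub>R (exp (- x * cosh t) * cosh (\<nu> * t))) \<partial>lborel)"
    by (intro Bochner_Integration.integral_cong refl)
       (simp only: *, simp)
  finally show ?thesis unfolding bessel_K_def set_lebesgue_integral_def by simp
qed

text \<open>The first form reads E exp (- (M x)^2 / (4 Y)) with Y of Gamma law of parameter \<nu>;
  it makes positivity, the bound 1, continuity and the behaviour at 0 visible. The second form
  serves to exchange integrals in the Laplace transform.\<close>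

lemma disk_laplace_eq:
  assumes "0 < M" "0 < x" "0 < 4 / \<gamma>\<^sup>2"
  shows "disk_laplace \<gamma> M x = (\<integral>y. indicator {0<..} y * (y powr (4 / \<gamma>\<^sup>2 - 1) * exp (- y - (M * x)\<^sup>2 / (4 * y))) \<partial>lborel) / Gamma (4 / \<gamma>\<^sup>2)"
    and "disk_laplace \<gamma> M x = (M * x / 2) powr (4 / \<gamma>\<^sup>2) / Gamma (4 / \<gamma>\<^sup>2) * (\<integral>t. exp (- (M * x) * cosh t + 4 / \<gamma>\<^sup>2 * t) \<partial>lborel)"
proof -
  have Mx: "0 < M * x" using assms by simp
  note S = substitution_log_scale(2)[OF Mx assms(3)] and B = bessel_K_eq[OF Mx assms(3)]
  show 2: "disk_laplace \<gamma> M x = (M * x / 2) powr (4 / \<gamma>\<^sup>2) / Gamma (4 / \<gamma>\<^sup>2) * (\<integral>t. exp (- (M * x) * cosh t + 4 / \<gamma>\<^sup>2 * t) \<partial>lborel)"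
    unfolding disk_laplace_def B by simp
  show "disk_laplace \<gamma> M x = (\<integral>y. indicator {0<..} y * (y powr (4 / \<gamma>\<^sup>2 - 1) * exp (- y - (M * x)\<^sup>2 / (4 * y))) \<partial>lborel) / Gamma (4 / \<gamma>\<^sup>2)"
    unfolding S[symmetric] 2 by simp
qed

text \<open>A factor x is paid for with half of the exponential rate. This keeps Laplace transforms
  finite after differentiation and supplies the dominating functions.\<close>

lemma integrable_power_exp_bound:
  fixes q x :: real
  assumes "0 < q" "0 \<le> x"
  shows "x * exp (- q * x) \<le> (2 / q) * exp (- (q / 2) * x)"
proof -
  have "q / 2 * x \<le> exp (q / 2 * x)" using exp_ge_add_one_self[of "q / 2 * x"] by linarith
  then have "x \<le> 2 / q * exp (q / 2 * x)" using assms by (simp add: field_simps)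
  then have "x * exp (- q * x) \<le> 2 / q * exp (q / 2 * x) * exp (- q * x)" by (intro mult_right_mono) auto
  also have "\<dots> = 2 / q * exp (- (q / 2) * x)" by (simp add: mult.assoc flip: exp_add)
  finally show ?thesis .
qed

text \<open>The mean value bound dominates the difference quotients by h. The field is left general
  because the lemma serves both the real Laplace transforms and the complex integral behind the
  hypergeometric function.\<close>

lemma has_field_derivative_integral_parametric:
  fixes f f' :: "'a :: {real_normed_field, banach, second_countable_topology} \<Rightarrow> 'b \<Rightarrow> 'a"
  assumes e: "0 < e"
    and int: "\<And>z. z \<in> ball z0 e \<Longrightarrow> integrable M (f z)"
    and der: "\<And>z x. z \<in> ball z0 e \<Longrightarrow> x \<in> space M \<Longrightarrow> ((\<lambda>w. f w x) has_field_derivative f' z x) (at z)"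
    and bound: "\<And>z x. z \<in> ball z0 e \<Longrightarrow> x \<in> space M \<Longrightarrow> norm (f' z x) \<le> h x"
    and h: "integrable M h"
    and meas: "f' z0 \<in> borel_measurable M"
  shows "((\<lambda>z. \<integral>x. f z x \<partial>M) has_field_derivative (\<integral>x. f' z0 x \<partial>M)) (at z0)"
  unfolding has_field_derivative_iff tendsto_at_iff_sequentially comp_def
proof (intro allI impI)
  fix X :: "nat \<Rightarrow> 'a"
  assume X: "\<forall>i. X i \<in> UNIV - {z0}" "X \<longlonglongrightarrow> z0"
  from X(2) e obtain K where K: "\<And>n. n \<ge> K \<Longrightarrow> X n \<in> ball z0 e"
    unfolding lim_sequentially by (force simp: dist_commute)
  have z0: "z0 \<in> ball z0 e" using e by simp
  \<comment> \<open>The shift by K discards the terms of the sequence that may lie outside the ball,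
    where nothing is assumed.\<close>
  have "(\<lambda>i. (\<integral>x. (f (X (i + K)) x - f z0 x) / (X (i + K) - z0) \<partial>M)) \<longlonglongrightarrow> (\<integral>x. f' z0 x \<partial>M)"
  proof (rule integral_dominated_convergence[where w=h])
    show "(\<lambda>x. (f (X (i + K)) x - f z0 x) / (X (i + K) - z0)) \<in> borel_measurable M" for i
      using int[OF K[of "i + K"]] int[OF z0] by simp
    show "AE x in M. (\<lambda>i. (f (X (i + K)) x - f z0 x) / (X (i + K) - z0)) \<longlonglongrightarrow> f' z0 x"
    proof (intro AE_I2)
      fix x assume x: "x \<in> space M"
      from der[OF z0 x] have "((\<lambda>y. (f y x - f z0 x) / (y - z0)) \<longlongrightarrow> f' z0 x) (at z0)"
        by (simp add: has_field_derivative_iff)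
      with X have "(\<lambda>i. (f (X i) x - f z0 x) / (X i - z0)) \<longlonglongrightarrow> f' z0 x"
        unfolding tendsto_at_iff_sequentially comp_def by blast
      then show "(\<lambda>i. (f (X (i + K)) x - f z0 x) / (X (i + K) - z0)) \<longlonglongrightarrow> f' z0 x"
        by (rule LIMSEQ_ignore_initial_segment)
    qed
    show "AE x in M. norm ((f (X (i + K)) x - f z0 x) / (X (i + K) - z0)) \<le> h x" for i
    proof (intro AE_I2)
      fix x assume x: "x \<in> space M"
      have "norm (f (X (i + K)) x - f z0 x) \<le> h x * norm (X (i + K) - z0)"
        by (rule field_differentiable_bound[of "ball z0 e" _ "\<lambda>z. f' z x"])
           (use der bound x K[of "i+K"] z0 in \<open>auto intro: has_field_derivative_at_within\<close>)
      moreover have "X (i + K) \<noteq> z0" using X by auto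
      ultimately show "norm ((f (X (i + K)) x - f z0 x) / (X (i + K) - z0)) \<le> h x"
        by (simp add: norm_divide field_simps)
    qed
  qed (use meas h in auto)
  also have "(\<lambda>i. (\<integral>x. (f (X (i + K)) x - f z0 x) / (X (i + K) - z0) \<partial>M))
     = (\<lambda>i. ((\<integral>x. f (X (i + K)) x \<partial>M) - (\<integral>x. f z0 x \<partial>M)) / (X (i + K) - z0))"
    using int[OF K] int[OF z0]
    by (intro ext) (simp add: Bochner_Integration.integral_diff del: Bochner_Integration.integral_divide_zero flip: Bochner_Integration.integral_divide_zero)
  finally show "(\<lambda>i. ((\<integral>x. f (X i) x \<partial>M) - (\<integral>x. f z0 x \<partial>M)) / (X i - z0)) \<longlonglongrightarrow> (\<integral>x. f' z0 x \<partial>M)"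
    by (rule LIMSEQ_offset)
qed

section \<open>Laplace transforms on the half line\<close>

definition laplace :: "(real \<Rightarrow> real) \<Rightarrow> real \<Rightarrow> real" where
  "laplace h q = (\<integral>x. indicator {0<..} x * (exp (- q * x) * h x) \<partial>lborel)"

definition laplace_ok :: "(real \<Rightarrow> real) \<Rightarrow> bool" where
  "laplace_ok h \<longleftrightarrow> (\<forall>q>0. integrable lborel (\<lambda>x. indicator {0<..} x * (exp (- q * x) * h x)))"

lemma laplace_okD: "laplace_ok h \<Longrightarrow> 0 < q \<Longrightarrow> integrable lborel (\<lambda>x. indicator {0<..} x * (exp (- q * x) * h x))"
  unfolding laplace_ok_def by blast

lemma laplace_ok_times_id:
  assumes "laplace_ok h"
  shows "laplace_ok (\<lambda>x. x * h x)"
  unfolding laplace_ok_def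
proof (intro allI impI)
  fix q :: real assume q: "0 < q"
  have m: "(\<lambda>x. indicator {0<..} x * (exp (- (q/2) * x) * h x)) \<in> borel_measurable lborel"
    using laplace_okD[OF assms, of "q/2"] q by auto
  have "(\<lambda>x. (x * exp (- (q/2) * x)) * (indicator {0<..} x * (exp (- (q/2) * x) * h x))) \<in> borel_measurable lborel"
    by (intro borel_measurable_times m) auto
  also have "(\<lambda>x. (x * exp (- (q/2) * x)) * (indicator {0<..} x * (exp (- (q/2) * x) * h x)))
     = (\<lambda>x. indicator {0<..} x * (exp (- q * x) * (x * h x)))"
    by (auto simp: fun_eq_iff mult_ac simp flip: exp_add)
  finally have m': "(\<lambda>x. indicator {0<..} x * (exp (- q * x) * (x * h x))) \<in> borel_measurable lborel" .
  show "integrable lborel (\<lambda>x. indicator {0<..} x * (exp (- q * x) * (x * h x)))"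
  proof (rule Bochner_Integration.integrable_bound[OF _ m'])
    show "integrable lborel (\<lambda>x. (2 / q) * (indicator {0<..} x * (exp (- (q/2) * x) * h x)))"
      by (intro integrable_mult_right laplace_okD[OF assms]) (use q in auto)
    show "AE x in lborel. norm (indicator {0<..} x * (exp (- q * x) * (x * h x)))
             \<le> norm ((2 / q) * (indicator {0<..} x * (exp (- (q/2) * x) * h x)))"
    proof (intro AE_I2)
      fix x :: real
      have "x * exp (- q * x) * \<bar>h x\<bar> \<le> (2 / q) * exp (- (q / 2) * x) * \<bar>h x\<bar>" if "0 < x"
        using that q by (intro mult_right_mono integrable_power_exp_bound) auto
      then show "norm (indicator {0<..} x * (exp (- q * x) * (x * h x)))
             \<le> norm ((2 / q) * (indicator {0<..} x * (exp (- (q/2) * x) * h x)))"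
        using q by (cases "0 < x") (auto simp: abs_mult mult_ac)
    qed
  qed
qed

lemma laplace_has_derivative:
  assumes "laplace_ok h" "0 < q"
  shows "(laplace h has_field_derivative - laplace (\<lambda>x. x * h x) q) (at q)"
proof -
  have ok2: "laplace_ok (\<lambda>x. x * h x)" by (rule laplace_ok_times_id) fact
  have pos: "q / 2 < z" if "z \<in> ball q (q / 2)" for z
    using that unfolding mem_ball dist_real_def by linarith
  have "((\<lambda>q. \<integral>x. indicator {0<..} x * (exp (- q * x) * h x) \<partial>lborel) has_field_derivative
      (\<integral>x. - (indicator {0<..} x * (exp (- q * x) * (x * h x))) \<partial>lborel)) (at q)"
  proof (rule has_field_derivative_integral_parametric[where e="q/2" and
         f'="\<lambda>q x. - (indicator {0<..} x * (exp (- q * x) * (x * h x)))"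
         and h="\<lambda>x. \<bar>indicator {0<..} x * (exp (- (q/2) * x) * (x * h x))\<bar>"])
    show "integrable lborel (\<lambda>x. indicator {0<..} x * (exp (- z * x) * h x))" if "z \<in> ball q (q / 2)" for z
      using pos[OF that] assms by (intro laplace_okD) auto
    show "((\<lambda>w. indicator {0<..} x * (exp (- w * x) * h x)) has_field_derivative
        - (indicator {0<..} x * (exp (- z * x) * (x * h x)))) (at z)" for x z :: real
      by (auto intro!: derivative_eq_intros)
    show "norm (- (indicator {0<..} x * (exp (- z * x) * (x * h x)))) \<le> \<bar>indicator {0<..} x * (exp (- (q/2) * x) * (x * h x))\<bar>"
      if "z \<in> ball q (q / 2)" for z x :: real
    proof (cases "0 < x")
      case True
      then have "exp (- z * x) \<le> exp (- (q/2) * x)" using pos[OF that] by simp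
      then show ?thesis using True by (auto simp: abs_mult intro!: mult_right_mono)
    qed auto
    show "integrable lborel (\<lambda>x. \<bar>indicator {0<..} x * (exp (- (q/2) * x) * (x * h x))\<bar>)"
      using assms by (intro integrable_abs laplace_okD[OF ok2]) auto
    show "(\<lambda>x. - (indicator {0<..} x * (exp (- q * x) * (x * h x)))) \<in> borel_measurable lborel"
      using laplace_okD[OF ok2 assms(2)] by auto
  qed (use assms in auto)
  then show ?thesis unfolding laplace_def by simp
qed

lemma laplace_cmult: "laplace (\<lambda>x. c * h x) q = c * laplace h q"
proof -
  have "laplace (\<lambda>x. c * h x) q = (\<integral>x. c * (indicator {0<..} x * (exp (- q * x) * h x)) \<partial>lborel)"
    unfolding laplace_def by (intro Bochner_Integration.integral_cong) auto
  then show ?thesis by (simp add: laplace_def)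
qed

lemma laplace_ok_powr:
  fixes s :: real
  assumes "- 1 < s"
  shows "laplace_ok (\<lambda>x. x powr s)" and "0 < q \<Longrightarrow> laplace (\<lambda>x. x powr s) q = Gamma (s + 1) / q powr (s + 1)"
  using has_bochner_integral_Gamma_rate[of "s + 1"] has_bochner_integral_Gamma_rate[of "s + 1" q] assms
  unfolding laplace_ok_def laplace_def has_bochner_integral_iff by (auto simp: mult.commute[of "_ powr s"])

lemma laplace_ok_bound:
  assumes "laplace_ok k" "h \<in> borel_measurable lborel" "\<And>x. 0 < x \<Longrightarrow> \<bar>h x\<bar> \<le> k x"
  shows "laplace_ok h" and "0 < q \<Longrightarrow> \<bar>laplace h q\<bar> \<le> laplace k q"
proof -
  have b: "norm (indicator {0<..} x * (exp (- q * x) * h x)) \<le> indicator {0<..} x * (exp (- q * x) * k x)" for q x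
    using assms(3)[of x] by (cases "0 < x") (auto simp: abs_mult intro!: mult_left_mono)
  show ok: "laplace_ok h"
    unfolding laplace_ok_def
  proof (intro allI impI)
    fix q :: real assume "0 < q"
    show "integrable lborel (\<lambda>x. indicator {0<..} x * (exp (- q * x) * h x))"
    proof (rule Bochner_Integration.integrable_bound[OF laplace_okD[OF assms(1) \<open>0 < q\<close>]])
      show "AE x in lborel. norm (indicator {0<..} x * (exp (- q * x) * h x)) \<le> norm (indicator {0<..} x * (exp (- q * x) * k x))"
        by (intro AE_I2 order_trans[OF b]) simp
    qed (use assms(2) in auto)
  qed
  assume q: "0 < q"
  have "\<bar>laplace h q\<bar> \<le> (\<integral>x. norm (indicator {0<..} x * (exp (- q * x) * h x)) \<partial>lborel)"
    unfolding laplace_def using integral_norm_bound[of lborel "\<lambda>x. indicator {0<..} x * (exp (- q * x) * h x)"] by simp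
  also have "\<dots> \<le> laplace k q" unfolding laplace_def
    by (intro integral_mono integrable_norm laplace_okD ok assms q b)
  finally show "\<bar>laplace h q\<bar> \<le> laplace k q" .
qed

lemma laplace_diff:
  assumes "laplace_ok h" "laplace_ok k" "0 < q"
  shows "laplace (\<lambda>x. h x - k x) q = laplace h q - laplace k q"
proof -
  have "laplace (\<lambda>x. h x - k x) q = (\<integral>x. indicator {0<..} x * (exp (- q * x) * h x) - indicator {0<..} x * (exp (- q * x) * k x) \<partial>lborel)"
    unfolding laplace_def by (intro Bochner_Integration.integral_cong) (auto simp: algebra_simps)
  also have "\<dots> = laplace h q - laplace k q" unfolding laplace_def
    by (intro Bochner_Integration.integral_diff laplace_okD assms)
  finally show ?thesis .
qed

lemma laplace_cong: "(\<And>x. 0 < x \<Longrightarrow> h x = k x) \<Longrightarrow> laplace h q = laplace k q"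
  unfolding laplace_def by (intro Bochner_Integration.integral_cong) (auto simp: indicator_def)

section \<open>The jump weight and the exponent of the weighted process\<close>

locale disk =
  fixes \<gamma> M \<nu> :: real
  assumes M_pos: "0 < M" and \<nu>_eq: "\<nu> = 4 / \<gamma>\<^sup>2" and \<nu>: "1 < \<nu>" "\<nu> < 3 / 2"
begin

text \<open>The value 1 for x <= 0 is the continuous extension of the disk weight. It makes g a
  weight for increments of either sign and - ln g a function that ignores nonpositive jumps.\<close>

definition g :: "real \<Rightarrow> real" where
  "g x = (if 0 < x then disk_laplace \<gamma> M x else 1)"

text \<open>The integrand of the Gamma mixture. The truncation \<open>max x 0\<close> builds the
  extension by 1 into the formula, so that bounds and continuity need no case distinction.\<close>

definition gint :: "real \<Rightarrow> real \<Rightarrow> real" where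
  "gint x y = indicator {0<..} y * (y powr (\<nu> - 1) * exp (- y - (M * max x 0)\<^sup>2 / (4 * y)))"

lemma Gamma_\<nu>_pos: "0 < Gamma \<nu>"
  using \<nu> by (intro Gamma_real_pos) auto

lemma gint_bounds: "0 \<le> gint x y" "gint x y \<le> gint 0 y"
  unfolding gint_def by (auto intro!: mult_left_mono simp: indicator_def)

lemma gint_measurable [measurable]: "gint x \<in> borel_measurable lborel"
  unfolding gint_def by measurable

lemma gint_0: "has_bochner_integral lborel (gint 0) (Gamma \<nu>)"
  using has_bochner_integral_Gamma_rate[of \<nu> 1] \<nu> unfolding gint_def by simp

lemma gint_integrable: "integrable lborel (gint x)"
  by (rule Bochner_Integration.integrable_bound[where f="gint 0"])
     (use gint_0 gint_bounds gint_bounds(1)[of 0] in \<open>auto simp: has_bochner_integral_iff\<close>)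

lemma g_eq: "g x = (\<integral>y. gint x y \<partial>lborel) / Gamma \<nu>"
proof (cases "0 < x")
  case True
  with disk_laplace_eq(1)[of M x \<gamma>] M_pos \<nu> show ?thesis
    unfolding g_def gint_def \<nu>_eq[symmetric] by simp
next
  case False
  then have "gint x = gint 0" by (simp add: gint_def max_def fun_eq_iff)
  then show ?thesis using gint_0 Gamma_\<nu>_pos False by (simp add: g_def has_bochner_integral_iff)
qed

lemma g_pos: "0 < g x"
proof -
  have "(\<integral>y. gint x y \<partial>lborel) \<noteq> 0"
  proof
    assume "(\<integral>y. gint x y \<partial>lborel) = 0"
    then have "AE y in lborel. gint x y = 0"
      using integral_nonneg_eq_0_iff_AE[OF gint_integrable[of x]] gint_bounds by simp
    then have "AE y in lborel. \<not> (y \<in> {0<..(1::real)})"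
      by (rule AE_mp) (auto simp: gint_def)
    from emeasure_eq_0_AE[OF this] have "emeasure lborel {0<..(1::real)} = 0"
      by (simp add: greaterThanAtMost_def greaterThan_def atMost_def Int_def)
    then show False by simp
  qed
  moreover have "0 \<le> (\<integral>y. gint x y \<partial>lborel)" by (intro Bochner_Integration.integral_nonneg gint_bounds)
  ultimately show ?thesis unfolding g_eq using Gamma_\<nu>_pos by simp
qed

lemma g_nonpos [simp]: "x \<le> 0 \<Longrightarrow> g x = 1"
  by (simp add: g_def)

lemma g_le_1: "g x \<le> 1"
proof -
  have "(\<integral>y. gint x y \<partial>lborel) \<le> (\<integral>y. gint 0 y \<partial>lborel)"
    by (intro integral_mono gint_integrable gint_bounds)
  then show ?thesis unfolding g_eq using gint_0 Gamma_\<nu>_pos by (simp add: has_bochner_integral_iff)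
qed

text \<open>Gamma (\<nu> - 1) / Gamma \<nu> is the mean of 1 / Y for Y of Gamma law of parameter
  \<nu>, and M^2 / 4 comes from the exponent (M x)^2 / (4 Y).\<close>

definition C :: real where "C = M\<^sup>2 / 4 * Gamma (\<nu> - 1) / Gamma \<nu>"

lemma C_pos: "0 < C"
  using M_pos \<nu> Gamma_\<nu>_pos unfolding C_def by (auto intro!: divide_pos_pos mult_pos_pos)

text \<open>Integrate 1 - e^(- a) <= a with a = (M x)^2 / (4 y) against the Gamma density. The mean
  of 1 / Y is finite because \<nu> > 1. The bound makes 1 - g integrable against the Levy measure,
  as \<beta> < 2.\<close>

lemma g_quadratic: "1 - g x \<le> C * x\<^sup>2"
proof (cases "0 < x")
  case x: True
  have "(\<integral>y. gint 0 y \<partial>lborel) - (\<integral>y. gint x y \<partial>lborel) = (\<integral>y. gint 0 y - gint x y \<partial>lborel)"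
    by (intro Bochner_Integration.integral_diff[symmetric] gint_integrable)
  also have "\<dots> \<le> (\<integral>y. (M * x)\<^sup>2 / 4 * (indicator {0<..} y * (y powr (\<nu> - 1 - 1) * exp (- 1 * y))) \<partial>lborel)"
  proof (intro integral_mono Bochner_Integration.integrable_diff gint_integrable integrable_mult_right)
    show "integrable lborel (\<lambda>y. indicator {0<..} y * (y powr (\<nu> - 1 - 1) * exp (- 1 * y)))"
      using has_bochner_integral_Gamma_rate[of "\<nu> - 1" 1] \<nu> by (auto simp: has_bochner_integral_iff)
    fix y :: real
    show "gint 0 y - gint x y \<le> (M * x)\<^sup>2 / 4 * (indicator {0<..} y * (y powr (\<nu> - 1 - 1) * exp (- 1 * y)))"
    proof (cases "0 < y")
      case y: True
      have "gint 0 y - gint x y = y powr (\<nu> - 1) * exp (- y) * (1 - exp (- (M * x)\<^sup>2 / (4 * y)))"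
      proof -
        have "exp (- y - K) = exp (- y) * exp (- K)" for K :: real by (simp flip: exp_add)
        then show ?thesis using x y unfolding gint_def by (simp add: right_diff_distrib mult.assoc)
      qed
      also have "\<dots> \<le> y powr (\<nu> - 1) * exp (- y) * ((M * x)\<^sup>2 / (4 * y))"
        using exp_ge_add_one_self[of "- (M * x)\<^sup>2 / (4 * y)"] by (intro mult_left_mono) auto
      also have "\<dots> = (M * x)\<^sup>2 / 4 * (y powr (\<nu> - 1 - 1) * exp (- 1 * y))"
        using y by (simp add: powr_diff field_simps power2_eq_square)
      finally show ?thesis using y by simp
    qed (simp add: gint_def)
  qed
  also have "\<dots> = (M * x)\<^sup>2 / 4 * Gamma (\<nu> - 1)"
    using has_bochner_integral_Gamma_rate[of "\<nu> - 1" 1] \<nu> by (auto simp: has_bochner_integral_iff)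
  finally have "Gamma \<nu> - (\<integral>y. gint x y \<partial>lborel) \<le> (M * x)\<^sup>2 / 4 * Gamma (\<nu> - 1)"
    using gint_0 by (simp add: has_bochner_integral_iff)
  then have "(Gamma \<nu> - (\<integral>y. gint x y \<partial>lborel)) / Gamma \<nu> \<le> (M * x)\<^sup>2 / 4 * Gamma (\<nu> - 1) / Gamma \<nu>"
    using Gamma_\<nu>_pos by (intro divide_right_mono) auto
  then show ?thesis
    unfolding g_eq C_def using Gamma_\<nu>_pos by (simp add: diff_divide_distrib power_mult_distrib mult_ac)
qed (use C_pos in auto)

lemma continuous_g: "continuous_on UNIV g"
proof (rule continuous_on_sequentiallyI)
  fix u :: "nat \<Rightarrow> real" and a
  assume u: "u \<longlonglongrightarrow> a"
  have "(\<lambda>n. (\<integral>y. gint (u n) y \<partial>lborel)) \<longlonglongrightarrow> (\<integral>y. gint a y \<partial>lborel)"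
  proof (rule integral_dominated_convergence[where w="gint 0"])
    show "integrable lborel (gint 0)" by (rule gint_integrable)
    show "AE y in lborel. (\<lambda>i. gint (u i) y) \<longlonglongrightarrow> gint a y"
    proof (intro AE_I2)
      fix y :: real
      have *: "(\<lambda>i. max (u i) 0) \<longlonglongrightarrow> max a 0" by (intro tendsto_intros u)
      show "(\<lambda>i. gint (u i) y) \<longlonglongrightarrow> gint a y"
      proof (cases "0 < y")
        case True then show ?thesis unfolding gint_def by (intro tendsto_intros *) auto
      qed (simp add: gint_def)
    qed
    show "AE x in lborel. norm (gint (u i) x) \<le> gint 0 x" for i
      using gint_bounds by (intro AE_I2) simp
  qed simp_all
  then show "(\<lambda>n. g (u n)) \<longlonglongrightarrow> g a" unfolding g_eq
    by (intro tendsto_divide tendsto_const) (use Gamma_\<nu>_pos in auto)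
qed

lemma g_measurable [measurable]: "g \<in> borel_measurable borel"
  by (rule borel_measurable_continuous_onI[OF continuous_g])

definition \<beta> :: real where "\<beta> = \<nu> + 1 / 2"

definition k0 :: "real \<Rightarrow> real" where "k0 x = (1 - g x) * x powr (- 1 - \<beta>)"
definition h0 :: "real \<Rightarrow> real" where "h0 x = g x * x powr (1 - \<beta>)"

text \<open>\<open>A1\<close> and \<open>A2\<close> are minus the first and the second derivative of \<open>A\<close>, and likewise for \<open>P\<close>;
  moreover \<open>P\<close> is the second derivative of \<open>\<psi>\<close>.\<close>

definition A :: "real \<Rightarrow> real" where "A = laplace k0"
definition A1 :: "real \<Rightarrow> real" where "A1 = laplace (\<lambda>x. x * k0 x)"
definition A2 :: "real \<Rightarrow> real" where "A2 = laplace (\<lambda>x. x * (x * k0 x))"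
definition P :: "real \<Rightarrow> real" where "P = laplace h0"
definition P1 :: "real \<Rightarrow> real" where "P1 = laplace (\<lambda>x. x * h0 x)"
definition P2 :: "real \<Rightarrow> real" where "P2 = laplace (\<lambda>x. x * (x * h0 x))"
definition \<psi> :: "real \<Rightarrow> real" where "\<psi> q = Gamma (- \<beta>) * q powr \<beta> - A q"

lemma \<beta>: "3 / 2 < \<beta>" "\<beta> < 2"
  using \<nu> by (auto simp: \<beta>_def)

lemma laplace_powr:
  assumes "- 1 < s" "0 < q" "s + 1 = t" "- t = r"
  shows "laplace (\<lambda>x. x powr s) q = Gamma t * q powr r"
  using laplace_ok_powr(2)[OF assms(1,2)] unfolding assms(3) assms(4)[symmetric] powr_minus divide_inverse .

lemma h0_measurable [measurable]: "h0 \<in> borel_measurable borel"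
  and k0_measurable [measurable]: "k0 \<in> borel_measurable borel"
  unfolding h0_def k0_def by measurable

lemma ok_h0: "laplace_ok h0"
  by (rule laplace_ok_bound(1)[OF laplace_ok_powr(1)[of "1 - \<beta>"]])
     (use \<beta> g_pos g_le_1 in \<open>auto simp: h0_def abs_mult less_imp_le intro!: mult_left_le_one_le\<close>)

lemma k0_bound: "0 < x \<Longrightarrow> \<bar>k0 x\<bar> \<le> C * x powr (1 - \<beta>)"
proof -
  assume x: "0 < x"
  have "\<bar>k0 x\<bar> \<le> C * (x\<^sup>2 * x powr (- 1 - \<beta>))"
    using g_quadratic[of x] g_le_1[of x] unfolding k0_def mult.assoc[symmetric] by (auto simp: abs_mult intro!: mult_right_mono)
  also have "x\<^sup>2 * x powr (- 1 - \<beta>) = x powr (1 - \<beta>)"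
  proof -
    have "x\<^sup>2 * x powr (- 1 - \<beta>) = x powr 2 * x powr (- 1 - \<beta>)" using x by simp
    also have "\<dots> = x powr (2 + (- 1 - \<beta>))" by (rule powr_add[symmetric])
    also have "2 + (- 1 - \<beta>) = 1 - \<beta>" by simp
    finally show ?thesis .
  qed
  finally show ?thesis .
qed

lemma laplace_ok_cmult: "laplace_ok h \<Longrightarrow> laplace_ok (\<lambda>x. c * h x)"
proof -
  have "(\<lambda>x. indicator {0<..} x * (exp (- q * x) * (c * h x))) = (\<lambda>x. c * (indicator {0<..} x * (exp (- q * x) * h x)))" for q
    by (auto simp: fun_eq_iff)
  then show "laplace_ok h \<Longrightarrow> laplace_ok (\<lambda>x. c * h x)"
    unfolding laplace_ok_def by auto
qed

lemma ok_k0: "laplace_ok k0"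
  by (rule laplace_ok_bound(1)[OF laplace_ok_cmult[OF laplace_ok_powr(1)[of "1 - \<beta>"]]])
     (use \<beta> k0_bound in \<open>auto\<close>)

lemma A_bound: "0 < q \<Longrightarrow> \<bar>A q\<bar> \<le> C * Gamma (2 - \<beta>) * q powr (\<beta> - 2)"
proof -
  assume q: "0 < q"
  have "\<bar>A q\<bar> \<le> laplace (\<lambda>x. C * x powr (1 - \<beta>)) q" unfolding A_def
    by (rule laplace_ok_bound(2)[OF laplace_ok_cmult[OF laplace_ok_powr(1)[of "1 - \<beta>"]]])
       (use \<beta> k0_bound q in \<open>auto\<close>)
  also have "\<dots> = C * laplace (\<lambda>x. x powr (1 - \<beta>)) q" by (rule laplace_cmult)
  also have "laplace (\<lambda>x. x powr (1 - \<beta>)) q = Gamma (2 - \<beta>) * q powr (\<beta> - 2)"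
    by (rule laplace_powr[OF _ q]) (use \<beta> in linarith)+
  finally show ?thesis by (simp only: mult.assoc)
qed

text \<open>Two factors x more than in \<open>A\<close> give two powers of 1 / q more. Hence q^2
  \<open>A2\<close> q is still of order q^(\<beta> - 2) and vanishes at infinity.\<close>

lemma A2_bound: "0 < q \<Longrightarrow> \<bar>A2 q\<bar> \<le> C * Gamma (4 - \<beta>) * q powr (\<beta> - 4)"
proof -
  assume q: "0 < q"
  have "\<bar>A2 q\<bar> \<le> laplace (\<lambda>x. C * x powr (3 - \<beta>)) q" unfolding A2_def
  proof (rule laplace_ok_bound(2)[OF laplace_ok_cmult[OF laplace_ok_powr(1)[of "3 - \<beta>"]]])
    fix x :: real assume x: "0 < x"
    have "\<bar>x * (x * k0 x)\<bar> \<le> x * (x * (C * x powr (1 - \<beta>)))"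
      using x k0_bound[OF x] by (auto simp: abs_mult)
    also have "\<dots> = C * (x powr 2 * x powr (1 - \<beta>))"
      using x by (simp add: power2_eq_square)
    also have "x powr 2 * x powr (1 - \<beta>) = x powr (2 + (1 - \<beta>))" by (rule powr_add[symmetric])
    also have "2 + (1 - \<beta>) = 3 - \<beta>" by simp
    finally show "\<bar>x * (x * k0 x)\<bar> \<le> C * x powr (3 - \<beta>)" .
  qed (use \<beta> q in \<open>auto\<close>)
  also have "\<dots> = C * laplace (\<lambda>x. x powr (3 - \<beta>)) q" by (rule laplace_cmult)
  also have "laplace (\<lambda>x. x powr (3 - \<beta>)) q = Gamma (4 - \<beta>) * q powr (\<beta> - 4)"
    by (rule laplace_powr[OF _ q]) (use \<beta> in linarith)+
  finally show ?thesis by (simp only: mult.assoc)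
qed

lemma \<beta>_not_int: "- \<beta> \<notin> \<int>\<^sub>\<le>\<^sub>0" "1 - \<beta> \<notin> \<int>\<^sub>\<le>\<^sub>0"
proof -
  have "- \<beta> \<notin> \<int>"
  proof
    assume "- \<beta> \<in> \<int>"
    then obtain n where n: "- \<beta> = of_int n" by (rule Ints_cases)
    with \<beta> have "of_int (-2) < (of_int n :: real)" "of_int n < (of_int (-1) :: real)" by linarith+
    then show False unfolding of_int_less_iff by linarith
  qed
  then show "- \<beta> \<notin> \<int>\<^sub>\<le>\<^sub>0" using nonpos_Ints_Int by blast
  have "1 - \<beta> \<notin> \<int>"
  proof
    assume "1 - \<beta> \<in> \<int>"
    from Ints_diff[OF this Ints_1] \<open>- \<beta> \<notin> \<int>\<close> show False by simp
  qed
  then show "1 - \<beta> \<notin> \<int>\<^sub>\<le>\<^sub>0" using nonpos_Ints_Int by blast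
qed

text \<open>The factor is \<beta> (\<beta> - 1) = (\<nu> + 1/2) (\<nu> - 1/2); it recurs as the
  constant m in the closed form of \<psi>.\<close>

lemma Gamma_2\<beta>: "Gamma (2 - \<beta>) = (\<nu>\<^sup>2 - 1 / 4) * Gamma (- \<beta>)"
proof -
  have e: "- \<beta> + 1 = 1 - \<beta>" "1 - \<beta> + 1 = 2 - \<beta>" by linarith+
  have 1: "Gamma (1 - \<beta>) = - \<beta> * Gamma (- \<beta>)"
    using Gamma_plus1[OF \<beta>_not_int(1)] unfolding e .
  have "Gamma (2 - \<beta>) = (1 - \<beta>) * Gamma (1 - \<beta>)"
    using Gamma_plus1[OF \<beta>_not_int(2)] unfolding e .
  also have "\<dots> = (1 - \<beta>) * (- \<beta> * Gamma (- \<beta>))" unfolding 1 ..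
  also have "\<dots> = (1 - \<beta>) * (- \<beta>) * Gamma (- \<beta>)" by (rule mult.assoc[symmetric])
  also have "(1 - \<beta>) * (- \<beta>) = \<nu>\<^sup>2 - 1 / 4" unfolding \<beta>_def by (simp add: algebra_simps power2_eq_square)
  finally show ?thesis .
qed

lemma A2_eq: "0 < q \<Longrightarrow> A2 q = Gamma (2 - \<beta>) * q powr (\<beta> - 2) - P q"
proof -
  assume q: "0 < q"
  have "A2 q = laplace (\<lambda>x. x powr (1 - \<beta>) - h0 x) q" unfolding A2_def
  proof (rule laplace_cong)
    fix x :: real assume x: "0 < x"
    have "1 - \<beta> = 2 + (- 1 - \<beta>)" by linarith
    then have "x powr (1 - \<beta>) = x powr (2 + (- 1 - \<beta>))" by (rule arg_cong)
    also have "\<dots> = x powr 2 * x powr (- 1 - \<beta>)" by (rule powr_add)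
    also have "x powr 2 = x * x" using x by (simp add: powr_numeral power2_eq_square)
    finally show "x * (x * k0 x) = x powr (1 - \<beta>) - h0 x"
      unfolding k0_def h0_def by (simp add: algebra_simps)
  qed
  also have "\<dots> = laplace (\<lambda>x. x powr (1 - \<beta>)) q - P q"
    unfolding P_def by (intro laplace_diff ok_h0 laplace_ok_powr q) (use \<beta> in auto)
  also have "laplace (\<lambda>x. x powr (1 - \<beta>)) q = Gamma (2 - \<beta>) * q powr (\<beta> - 2)"
    by (rule laplace_powr[OF _ q]) (use \<beta> in linarith)+
  finally show ?thesis .
qed

section \<open>Integral representation and differential equation of the second derivative\<close>

definition J :: "real \<Rightarrow> real \<Rightarrow> real" where
  "J r q = (\<integral>t. exp (\<nu> * t) * (q + M * cosh t) powr (- r) \<partial>lborel)"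

lemma cosh_measurable [measurable]: "cosh \<in> borel_measurable (borel :: real measure)"
  by (intro borel_measurable_continuous_onI continuous_intros)

lemma integral_lincomb3:
  fixes f1 f2 f3 :: "'b \<Rightarrow> real"
  assumes "integrable N f1" "integrable N f2" "integrable N f3"
  shows "(\<integral>t. a * f1 t + b * f2 t - c * f3 t \<partial>N) = a * (\<integral>t. f1 t \<partial>N) + b * (\<integral>t. f2 t \<partial>N) - c * (\<integral>t. f3 t \<partial>N)"
  using assms by simp

lemma pos_R: "0 < q \<Longrightarrow> 0 < q + M * cosh t"
  using M_pos by (intro add_pos_nonneg) (auto simp: cosh_real_nonneg)

text \<open>Tonelli for one integrand of two variables: integrating over t gives the Bessel form of
  g, integrating over x gives a Gamma integral with rate q + M cosh t. The orders r = 3/2, 5/2, 7/2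
  will be \<open>P\<close>, \<open>P1\<close>, \<open>P2\<close> up to constants.\<close>

lemma J_aux:
  assumes q: "0 < q" and r: "\<nu> < r"
  shows "integrable lborel (\<lambda>t. exp (\<nu> * t) * (q + M * cosh t) powr (- r))"
    and "laplace (\<lambda>x. g x * x powr (r - 1 - \<nu>)) q = (M / 2) powr \<nu> / Gamma \<nu> * Gamma r * J r q"
proof -
  define K where "K = (M / 2) powr \<nu> / Gamma \<nu>"
  have K: "0 < K" unfolding K_def using M_pos Gamma_\<nu>_pos by simp
  have r0: "0 < r" using r \<nu> by simp
  have ok: "laplace_ok (\<lambda>x. g x * x powr (r - 1 - \<nu>))"
    by (rule laplace_ok_bound(1)[OF laplace_ok_powr(1)[of "r - 1 - \<nu>"]])
       (use r g_pos g_le_1 in \<open>auto simp: abs_mult less_imp_le intro!: mult_left_le_one_le\<close>)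
  define f where "f x t = ennreal (indicator {0<..} x * (exp (\<nu> * t) * (x powr (r - 1) * exp (- (q + M * cosh t) * x))))" for x t :: real
  have [measurable]: "case_prod f \<in> borel_measurable (lborel \<Otimes>\<^sub>M lborel)"
    unfolding f_def by measurable
  have 1: "ennreal (indicator {0<..} x * (exp (- q * x) * (g x * x powr (r - 1 - \<nu>)))) = ennreal K * (\<integral>\<^sup>+t. f x t \<partial>lborel)" for x
  proof (cases "0 < x")
    case x: True
    note S = substitution_log_scale(1)[of "M * x" \<nu>]
    have "g x = (M * x / 2) powr \<nu> / Gamma \<nu> * (\<integral>t. exp (- (M * x) * cosh t + \<nu> * t) \<partial>lborel)"
      using disk_laplace_eq(2)[of M x \<gamma>] x M_pos \<nu> unfolding g_def \<nu>_eq[symmetric] by simp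
    also have "(M * x / 2) powr \<nu> = (M / 2) powr \<nu> * x powr \<nu>"
      using M_pos x by (simp flip: powr_mult)
    finally have "g x = K * x powr \<nu> * (\<integral>t. exp (- (M * x) * cosh t + \<nu> * t) \<partial>lborel)" unfolding K_def by simp
    then have "exp (- q * x) * (g x * x powr (r - 1 - \<nu>)) = K * ((exp (- q * x) * (x powr \<nu> * x powr (r - 1 - \<nu>))) * (\<integral>t. exp (- (M * x) * cosh t + \<nu> * t) \<partial>lborel))"
      by (simp only: mult_ac)
    also have "x powr \<nu> * x powr (r - 1 - \<nu>) = x powr (r - 1)"
      by (simp flip: powr_add)
    also have "(exp (- q * x) * x powr (r - 1)) * (\<integral>t. exp (- (M * x) * cosh t + \<nu> * t) \<partial>lborel) = (\<integral>t. (exp (- q * x) * x powr (r - 1)) * exp (- (M * x) * cosh t + \<nu> * t) \<partial>lborel)"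
      by simp
    finally have e: "exp (- q * x) * (g x * x powr (r - 1 - \<nu>)) = K * (\<integral>t. (exp (- q * x) * x powr (r - 1)) * exp (- (M * x) * cosh t + \<nu> * t) \<partial>lborel)" .
    have int: "integrable lborel (\<lambda>t. (exp (- q * x) * x powr (r - 1)) * exp (- (M * x) * cosh t + \<nu> * t))"
      by (intro integrable_mult_right S) (use x M_pos \<nu> in auto)
    have "(exp (- q * x) * x powr (r - 1)) * exp (- (M * x) * cosh t + \<nu> * t) = exp (\<nu> * t) * (x powr (r - 1) * exp (- (q + M * cosh t) * x))" for t
    proof -
      have "exp (- q * x) * exp (- (M * x) * cosh t + \<nu> * t) = exp (\<nu> * t) * exp (- (q + M * cosh t) * x)"
        unfolding exp_add[symmetric] by (simp add: algebra_simps)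
      then have "x powr (r - 1) * (exp (- q * x) * exp (- (M * x) * cosh t + \<nu> * t)) = x powr (r - 1) * (exp (\<nu> * t) * exp (- (q + M * cosh t) * x))"
        by (rule arg_cong)
      then show ?thesis by (simp only: mult_ac)
    qed
    note e = e[unfolded this] and int = int[unfolded this]
    have "(\<integral>\<^sup>+t. f x t \<partial>lborel) = (\<integral>\<^sup>+t. ennreal (exp (\<nu> * t) * (x powr (r - 1) * exp (- (q + M * cosh t) * x))) \<partial>lborel)"
      unfolding f_def using x by simp
    also have "\<dots> = ennreal (\<integral>t. exp (\<nu> * t) * (x powr (r - 1) * exp (- (q + M * cosh t) * x)) \<partial>lborel)"
      by (rule nn_integral_eq_integral[OF int]) auto
    finally show ?thesis using K x e by (simp add: ennreal_mult')
  qed (simp add: f_def)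
  have 2: "(\<integral>\<^sup>+x. f x t \<partial>lborel) = ennreal (Gamma r) * ennreal (exp (\<nu> * t) * (q + M * cosh t) powr (- r))" for t
  proof -
    have "(\<integral>\<^sup>+x. f x t \<partial>lborel) = (\<integral>\<^sup>+x. ennreal (exp (\<nu> * t)) * ennreal (indicator {0<..} x * (x powr (r - 1) * exp (- (q + M * cosh t) * x))) \<partial>lborel)"
      unfolding f_def by (intro nn_integral_cong) (auto simp: indicator_def simp flip: ennreal_mult')
    also have "\<dots> = ennreal (exp (\<nu> * t)) * (\<integral>\<^sup>+x. ennreal (indicator {0<..} x * (x powr (r - 1) * exp (- (q + M * cosh t) * x))) \<partial>lborel)"
      by (rule nn_integral_cmult) auto
    also have "\<dots> = ennreal (exp (\<nu> * t)) * ennreal (Gamma r / (q + M * cosh t) powr r)"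
      by (subst nn_integral_Gamma_rate[OF r0 pos_R[OF q]]) simp
    also have "\<dots> = ennreal (exp (\<nu> * t) * (Gamma r / (q + M * cosh t) powr r))"
      using Gamma_real_pos[OF r0] by (simp flip: ennreal_mult')
    also have "exp (\<nu> * t) * (Gamma r / (q + M * cosh t) powr r) = Gamma r * (exp (\<nu> * t) * (q + M * cosh t) powr (- r))"
      unfolding powr_minus divide_inverse by (rule mult.left_commute)
    also have "ennreal \<dots> = ennreal (Gamma r) * ennreal (exp (\<nu> * t) * (q + M * cosh t) powr (- r))"
      using Gamma_real_pos[OF r0] by (intro ennreal_mult') simp
    finally show ?thesis .
  qed
  define L where "L = laplace (\<lambda>x. g x * x powr (r - 1 - \<nu>)) q"
  have "ennreal L = (\<integral>\<^sup>+x. ennreal (indicator {0<..} x * (exp (- q * x) * (g x * x powr (r - 1 - \<nu>)))) \<partial>lborel)"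
    unfolding L_def laplace_def
    by (rule nn_integral_eq_integral[symmetric, OF laplace_okD[OF ok q]]) (use g_pos in \<open>auto simp: less_imp_le\<close>)
  also have "\<dots> = ennreal K * (\<integral>\<^sup>+x. \<integral>\<^sup>+t. f x t \<partial>lborel \<partial>lborel)"
    unfolding 1 by (rule nn_integral_cmult) measurable
  also have "(\<integral>\<^sup>+x. \<integral>\<^sup>+t. f x t \<partial>lborel \<partial>lborel) = (\<integral>\<^sup>+t. \<integral>\<^sup>+x. f x t \<partial>lborel \<partial>lborel)"
    by (rule lborel_pair.Fubini'[symmetric]) measurable
  also have "\<dots> = ennreal (Gamma r) * (\<integral>\<^sup>+t. ennreal (exp (\<nu> * t) * (q + M * cosh t) powr (- r)) \<partial>lborel)"
    unfolding 2 by (rule nn_integral_cmult) measurable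
  finally have 3: "ennreal L = ennreal K * (ennreal (Gamma r) * (\<integral>\<^sup>+t. ennreal (exp (\<nu> * t) * (q + M * cosh t) powr (- r)) \<partial>lborel))" .
  \<comment> \<open>Integrability in t is not estimated but read off: the other side of Tonelli's
    identity is a finite Laplace transform and the constants are positive.\<close>
  have fin: "(\<integral>\<^sup>+t. ennreal (exp (\<nu> * t) * (q + M * cosh t) powr (- r)) \<partial>lborel) < \<infinity>"
  proof (rule ccontr)
    assume "\<not> ?thesis"
    then have "(\<integral>\<^sup>+t. ennreal (exp (\<nu> * t) * (q + M * cosh t) powr (- r)) \<partial>lborel) = \<top>"
      by (simp add: less_top[symmetric])
    with 3 K Gamma_real_pos[OF r0] show False by (simp add: ennreal_mult_top)
  qed
  show int: "integrable lborel (\<lambda>t. exp (\<nu> * t) * (q + M * cosh t) powr (- r))"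
    by (rule integrableI_nonneg[OF _ _ fin]) auto
  have J0: "0 \<le> J r q" unfolding J_def by (intro Bochner_Integration.integral_nonneg) auto
  have L0: "0 \<le> L" unfolding L_def laplace_def
    using g_pos by (intro Bochner_Integration.integral_nonneg) (auto simp: less_imp_le)
  have "ennreal L = ennreal K * (ennreal (Gamma r) * ennreal (J r q))"
    unfolding 3 J_def by (subst nn_integral_eq_integral[OF int]) auto
  also have "\<dots> = ennreal (K * (Gamma r * J r q))"
    using J0 K Gamma_real_pos[OF r0] by (simp add: ennreal_mult')
  finally have "L = K * (Gamma r * J r q)"
    using L0 J0 K Gamma_real_pos[OF r0] by (subst (asm) ennreal_inj) (auto intro!: mult_nonneg_nonneg)
  then show "laplace (\<lambda>x. g x * x powr (r - 1 - \<nu>)) q = (M / 2) powr \<nu> / Gamma \<nu> * Gamma r * J r q"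
    unfolding L_def K_def by (simp only: mult.assoc)
qed

text \<open>The bound cosh t >= e^|t| / 2 is used at both ends of the line. The exponent \<nu> - 3/2
  is negative, so boundary terms at both infinities vanish.\<close>

lemma exp_cosh_bound: "exp (\<nu> * t) * (q + M * cosh t) powr (- (3/2)) \<le> (M / 2) powr (- (3/2)) * exp ((\<nu> - 3/2) * \<bar>t\<bar>)"
  if "0 < q" for q t
proof -
  have "exp \<bar>t\<bar> \<le> 2 * cosh t" by (simp add: cosh_def abs_if)
  then have "M / 2 * exp \<bar>t\<bar> \<le> q + M * cosh t" using M_pos that by (auto simp: field_simps intro: order_trans[OF mult_left_mono])
  then have "(q + M * cosh t) powr (- (3/2)) \<le> (M / 2 * exp \<bar>t\<bar>) powr (- (3/2))"
    using M_pos by (intro powr_mono2') auto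
  also have "\<dots> = (M / 2) powr (- (3/2)) * exp (- (3/2) * \<bar>t\<bar>)"
    using M_pos by (subst powr_mult) (auto simp: powr_def)
  finally have "exp (\<nu> * t) * (q + M * cosh t) powr (- (3/2)) \<le> exp (\<nu> * \<bar>t\<bar>) * ((M / 2) powr (- (3/2)) * exp (- (3/2) * \<bar>t\<bar>))"
    using \<nu> by (intro mult_mono) auto
  also have "\<dots> = (M / 2) powr (- (3/2)) * exp ((\<nu> - 3/2) * \<bar>t\<bar>)"
    by (simp add: mult_exp_exp left_diff_distrib)
  finally show ?thesis .
qed

text \<open>With R = q + M cosh t and w = R^(- 3/2), two integrations by parts give that the
  integrals of \<nu>^2 e^(\<nu> t) w and of e^(\<nu> t) w'' agree; w'' is then expressed by the
  powers R^(- 3/2), R^(- 5/2), R^(- 7/2).\<close>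

lemma J_ODE:
  assumes q: "0 < q"
  shows "\<nu>\<^sup>2 * J (3/2) q = 9/4 * J (3/2) q - 6 * q * J (5/2) q + 15/4 * (q\<^sup>2 - M\<^sup>2) * J (7/2) q"
proof -
  define R where "R t = q + M * cosh t" for t
  have R: "0 < R t" for t unfolding R_def by (rule pos_R[OF q])
  \<comment> \<open>This is e^(\<nu> t) (\<nu> w - w'), whose derivative is e^(\<nu> t) (\<nu>^2 w -
    w''). Both integrations by parts thus become one application of the fundamental theorem to a
    function vanishing at both ends.\<close>
  define H where "H t = \<nu> * exp (\<nu> * t) * R t powr (- (3/2)) + exp (\<nu> * t) * (3/2) * M * sinh t * R t powr (- (5/2))" for t
  define H' where "H' t = (\<nu>\<^sup>2 - 9/4) * (exp (\<nu> * t) * R t powr (- (3/2))) + 6 * q * (exp (\<nu> * t) * R t powr (- (5/2)))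
      - 15/4 * (q\<^sup>2 - M\<^sup>2) * (exp (\<nu> * t) * R t powr (- (7/2)))" for t
  have i: "integrable lborel (\<lambda>t. exp (\<nu> * t) * R t powr (- (3/2)))" "integrable lborel (\<lambda>t. exp (\<nu> * t) * R t powr (- (5/2)))"
    "integrable lborel (\<lambda>t. exp (\<nu> * t) * R t powr (- (7/2)))"
    unfolding R_def by (rule J_aux(1)[OF q]; use \<nu> in simp)+
  have intH': "integrable lborel H'" unfolding H'_def
    by (intro Bochner_Integration.integrable_add Bochner_Integration.integrable_diff integrable_mult_right i)
  have val: "(\<integral>t. H' t \<partial>lborel) = (\<nu>\<^sup>2 - 9/4) * J (3/2) q + 6 * q * J (5/2) q - 15/4 * (q\<^sup>2 - M\<^sup>2) * J (7/2) q"
    unfolding H'_def J_def R_def[symmetric]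
    by (rule integral_lincomb3[OF i])
  have dR: "(R has_real_derivative M * sinh t) (at t)" for t
    unfolding R_def by (auto intro!: derivative_eq_intros)
  have dpow: "((\<lambda>t. R t powr (- s)) has_real_derivative - s * R t powr (- s - 1) * (M * sinh t)) (at t)" for s t
    using DERIV_chain2[where f="\<lambda>z. z powr (- s)" and g=R, OF has_real_derivative_powr[OF R] dR] by simp
  have dH: "(H has_real_derivative H' t) (at t)" for t
  proof -
    have p: "R t powr (- (3/2) - 1) = R t powr (- (5/2))" "R t powr (- (5/2) - 1) = R t powr (- (7/2))" by simp_all
    have "(H has_real_derivative \<nu> * (\<nu> * exp (\<nu> * t)) * R t powr (- (3/2)) + \<nu> * exp (\<nu> * t) * (- (3/2) * R t powr (- (5/2)) * (M * sinh t))
        + (\<nu> * exp (\<nu> * t) * (3/2) * M * sinh t * R t powr (- (5/2)) + exp (\<nu> * t) * (3/2) * M * cosh t * R t powr (- (5/2))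
           + exp (\<nu> * t) * (3/2) * M * sinh t * (- (5/2) * R t powr (- (7/2)) * (M * sinh t)))) (at t)"
      unfolding H_def
      by (rule derivative_eq_intros dpow[unfolded p] refl | simp add: p)+ (simp add: algebra_simps)
    also have "\<nu> * (\<nu> * exp (\<nu> * t)) * R t powr (- (3/2)) + \<nu> * exp (\<nu> * t) * (- (3/2) * R t powr (- (5/2)) * (M * sinh t))
        + (\<nu> * exp (\<nu> * t) * (3/2) * M * sinh t * R t powr (- (5/2)) + exp (\<nu> * t) * (3/2) * M * cosh t * R t powr (- (5/2))
           + exp (\<nu> * t) * (3/2) * M * sinh t * (- (5/2) * R t powr (- (7/2)) * (M * sinh t))) = H' t"
    proof -
      define E a where "E = exp (\<nu> * t)" and "a = R t powr (- (7/2))"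
      have a1: "R t powr (- (5/2)) = R t * a"
      proof -
        have "R t powr (- (5/2)) = R t powr (1 + - (7/2))" by simp
        also have "\<dots> = R t * a" unfolding a_def powr_add using R[of t] by simp
        finally show ?thesis .
      qed
      have a2: "R t powr (- (3/2)) = (R t)\<^sup>2 * a"
      proof -
        have "R t powr (- (3/2)) = R t powr (2 + - (7/2))" by simp
        also have "\<dots> = R t powr 2 * R t powr (- (7/2))" by (rule powr_add)
        also have "\<dots> = (R t)\<^sup>2 * a" unfolding a_def using R[of t] by simp
        finally show ?thesis .
      qed
      \<comment> \<open>Both M cosh t and (M sinh t)^2 are polynomials in R t, which eliminates the
        hyperbolic functions from the derivative.\<close>
      have c: "M * cosh t = R t - q" unfolding R_def by simp
      have "M\<^sup>2 * (sinh t)\<^sup>2 = (M * cosh t)\<^sup>2 - M\<^sup>2" using cosh_square_eq[of t] by (simp add: power_mult_distrib algebra_simps)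
      then have s: "(M * sinh t)\<^sup>2 = (R t - q)\<^sup>2 - M\<^sup>2" unfolding c by (simp add: power_mult_distrib)
      have "\<nu> * (\<nu> * E) * ((R t)\<^sup>2 * a) + \<nu> * E * (- (3/2) * (R t * a) * (M * sinh t))
        + (\<nu> * E * (3/2) * M * sinh t * (R t * a) + E * (3/2) * M * cosh t * (R t * a)
           + E * (3/2) * M * sinh t * (- (5/2) * a * (M * sinh t)))
         = E * a * (\<nu>\<^sup>2 * (R t)\<^sup>2 + (3/2) * (M * cosh t) * R t - 15/4 * (M * sinh t)\<^sup>2)"
        by (simp add: algebra_simps power2_eq_square)
      also have "\<dots> = (\<nu>\<^sup>2 - 9/4) * (E * ((R t)\<^sup>2 * a)) + 6 * q * (E * (R t * a)) - 15/4 * (q\<^sup>2 - M\<^sup>2) * (E * a)"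
        unfolding c s by (simp add: field_simps power2_eq_square)
      finally show ?thesis unfolding H'_def a1 a2 E_def[symmetric] a_def[symmetric] .
    qed
    finally show ?thesis .
  qed
  have Hb: "\<bar>H t\<bar> \<le> (\<nu> + 3/2) * ((M / 2) powr (- (3/2)) * exp ((\<nu> - 3/2) * \<bar>t\<bar>))" for t
  proof -
    have p52: "R t powr (- (3/2)) = R t * R t powr (- (5/2))"
    proof -
      have "R t powr (- (3/2)) = R t powr (1 + - (5/2))" by simp
      also have "\<dots> = R t * R t powr (- (5/2))" unfolding powr_add using R[of t] by simp
      finally show ?thesis .
    qed
    have "\<bar>M * sinh t\<bar> \<le> R t"
    proof -
      have "\<bar>sinh t\<bar> \<le> cosh t"
        using sinh_le_cosh_real[of t] sinh_le_cosh_real[of "- t"] by (simp only: sinh_minus cosh_minus abs_le_iff)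
      then have "M * \<bar>sinh t\<bar> \<le> M * cosh t" using M_pos by (intro mult_left_mono) auto
      then show ?thesis unfolding R_def abs_mult abs_of_pos[OF M_pos] using q by linarith
    qed
    then have "\<bar>M * sinh t\<bar> * R t powr (- (5/2)) \<le> R t powr (- (3/2))"
      unfolding p52 by (intro mult_right_mono) auto
    then have "exp (\<nu> * t) * (3/2) * (\<bar>M * sinh t\<bar> * R t powr (- (5/2))) \<le> exp (\<nu> * t) * (3/2) * R t powr (- (3/2))"
      by (intro mult_left_mono) auto
    moreover have "\<bar>H t\<bar> \<le> \<nu> * exp (\<nu> * t) * R t powr (- (3/2)) + exp (\<nu> * t) * (3/2) * (\<bar>M * sinh t\<bar> * R t powr (- (5/2)))"
      unfolding H_def by (rule order_trans[OF abs_triangle_ineq]) (use \<nu> in \<open>auto simp: abs_mult\<close>)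
    ultimately have "\<bar>H t\<bar> \<le> \<nu> * exp (\<nu> * t) * R t powr (- (3/2)) + exp (\<nu> * t) * (3/2) * R t powr (- (3/2))"
      by linarith
    also have "\<dots> = (\<nu> + 3/2) * (exp (\<nu> * t) * R t powr (- (3/2)))"
      by (simp add: algebra_simps)
    also have "\<dots> \<le> (\<nu> + 3/2) * ((M / 2) powr (- (3/2)) * exp ((\<nu> - 3/2) * \<bar>t\<bar>))"
      unfolding R_def using \<nu> by (intro mult_left_mono exp_cosh_bound q) auto
    finally show ?thesis .
  qed
  have e_top: "((\<lambda>t. exp ((\<nu> - 3/2) * t)) \<longlongrightarrow> 0) at_top"
    using \<nu> by (intro filterlim_compose[OF exp_at_bot] filterlim_tendsto_neg_mult_at_bot[OF tendsto_const]) (auto simp: filterlim_ident)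
  have top: "(H \<longlongrightarrow> 0) at_top"
  proof (rule Lim_null_comparison)
    show "\<forall>\<^sub>F t in at_top. norm (H t) \<le> (\<nu> + 3/2) * ((M / 2) powr (- (3/2)) * exp ((\<nu> - 3/2) * t))"
      using eventually_ge_at_top[of 0]
    proof eventually_elim
      case (elim t) then show ?case using Hb[of t] by simp
    qed
    show "((\<lambda>t. (\<nu> + 3/2) * ((M / 2) powr (- (3/2)) * exp ((\<nu> - 3/2) * t))) \<longlongrightarrow> 0) at_top"
      by (intro tendsto_mult_right_zero e_top)
  qed
  have bot: "(H \<longlongrightarrow> 0) at_bot"
  proof (rule Lim_null_comparison)
    show "\<forall>\<^sub>F t in at_bot. norm (H t) \<le> (\<nu> + 3/2) * ((M / 2) powr (- (3/2)) * exp ((\<nu> - 3/2) * - t))"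
      using eventually_le_at_bot[of 0]
    proof eventually_elim
      case (elim t) then show ?case using Hb[of t] by simp
    qed
    show "((\<lambda>t. (\<nu> + 3/2) * ((M / 2) powr (- (3/2)) * exp ((\<nu> - 3/2) * - t))) \<longlongrightarrow> 0) at_bot"
      by (intro tendsto_mult_right_zero filterlim_compose[OF e_top] filterlim_uminus_at_top_at_bot)
  qed
  have "(LBINT t=-\<infinity>..\<infinity>. H' t) = 0 - 0"
  proof (rule interval_integral_FTC_integrable[where F=H])
    show "(H has_vector_derivative H' t) (at t)" for t
      using dH by (simp add: has_real_derivative_iff_has_vector_derivative)
    show "isCont H' t" for t
    proof -
      have "isCont R t" unfolding R_def by (intro continuous_intros)
      then show ?thesis unfolding H'_def using R[of t] by (auto intro!: continuous_intros)
    qed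
    show "set_integrable lborel (einterval (- \<infinity>) \<infinity>) H'"
      using intH' by (simp add: einterval_def set_integrable_def)
    show "((H \<circ> real_of_ereal) \<longlongrightarrow> 0) (at_right (- \<infinity>))" "((H \<circ> real_of_ereal) \<longlongrightarrow> 0) (at_left \<infinity>)"
      unfolding ereal_tendsto_simps1 by (rule bot top)+
  qed simp
  then have "(\<integral>t. H' t \<partial>lborel) = 0"
    by (simp add: interval_lebesgue_integral_def einterval_def set_lebesgue_integral_def)
  with val show ?thesis by (simp add: algebra_simps)
qed

text \<open>The values Gamma (5/2) and Gamma (7/2) absorb the factors 3/2 and 15/4. As P' = -
  \<open>P1\<close> and P'' = \<open>P2\<close>, the equation says that (q^2 - M^2) P has second
  derivative (\<nu>^2 - 1/4) P, which is the reason for the closed form of \<psi>.\<close>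

lemma P_ODE:
  assumes q: "0 < q"
  shows "\<nu>\<^sup>2 * P q = 9/4 * P q - 4 * q * P1 q + (q\<^sup>2 - M\<^sup>2) * P2 q"
proof -
  define c where "c = (M / 2) powr \<nu> / Gamma \<nu>"
  have G: "Gamma (5/2 :: real) = 3/2 * Gamma (3/2)" "Gamma (7/2 :: real) = 15/4 * Gamma (3/2)"
  proof -
    have n: "(3/2 :: real) \<notin> \<int>\<^sub>\<le>\<^sub>0" "(5/2 :: real) \<notin> \<int>\<^sub>\<le>\<^sub>0"
      using nonpos_Ints_nonpos[of "3/2 :: real"] nonpos_Ints_nonpos[of "5/2 :: real"] by auto
    show "Gamma (5/2 :: real) = 3/2 * Gamma (3/2)" using Gamma_plus1[OF n(1)] by simp
    with Gamma_plus1[OF n(2)] show "Gamma (7/2 :: real) = 15/4 * Gamma (3/2)" by simp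
  qed
  have 0: "P q = c * Gamma (3/2) * J (3/2) q"
    using J_aux(2)[OF q, of "3/2"] \<nu> unfolding P_def c_def h0_def \<beta>_def by (simp add: algebra_simps)
  have 1: "P1 q = c * Gamma (5/2) * J (5/2) q"
  proof -
    have "P1 q = laplace (\<lambda>x. g x * x powr (5/2 - 1 - \<nu>)) q" unfolding P1_def
    proof (rule laplace_cong)
      fix x :: real assume x: "0 < x"
      have "x powr (5/2 - 1 - \<nu>) = x powr (1 + (1 - \<beta>))" unfolding \<beta>_def by (rule arg_cong) simp
      also have "\<dots> = x powr 1 * x powr (1 - \<beta>)" by (rule powr_add)
      finally show "x * h0 x = g x * x powr (5/2 - 1 - \<nu>)" using x unfolding h0_def by simp
    qed
    then show ?thesis using J_aux(2)[OF q, of "5/2"] \<nu> unfolding c_def by simp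
  qed
  have 2: "P2 q = c * Gamma (7/2) * J (7/2) q"
  proof -
    have "P2 q = laplace (\<lambda>x. g x * x powr (7/2 - 1 - \<nu>)) q" unfolding P2_def
    proof (rule laplace_cong)
      fix x :: real assume x: "0 < x"
      have "x powr (7/2 - 1 - \<nu>) = x powr (2 + (1 - \<beta>))" unfolding \<beta>_def by (rule arg_cong) simp
      also have "\<dots> = x powr 2 * x powr (1 - \<beta>)" by (rule powr_add)
      also have "x powr 2 = x * x" using x by (simp add: power2_eq_square)
      finally show "x * (x * h0 x) = g x * x powr (7/2 - 1 - \<nu>)" unfolding h0_def by simp
    qed
    then show ?thesis using J_aux(2)[OF q, of "7/2"] \<nu> unfolding c_def by simp
  qed
  have "c * Gamma (3/2) * (\<nu>\<^sup>2 * J (3/2) q) = c * Gamma (3/2) * (9/4 * J (3/2) q - 6 * q * J (5/2) q + 15/4 * (q\<^sup>2 - M\<^sup>2) * J (7/2) q)"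
    unfolding J_ODE[OF q] ..
  then show ?thesis unfolding 0 1 2 G by (simp add: field_simps)
qed

lemma \<nu>_sq_pos: "0 < \<nu>\<^sup>2 - 1 / 4"
proof -
  have "1 < \<nu>\<^sup>2" using \<nu> by (simp add: one_less_power)
  then show ?thesis by simp
qed

lemma Gamma_\<beta>_pos: "0 < Gamma (- \<beta>)"
proof -
  have "0 < Gamma (2 - \<beta>)" using \<beta> by (intro Gamma_real_pos) auto
  then show ?thesis unfolding Gamma_2\<beta> using \<nu>_sq_pos by (simp add: zero_less_mult_iff)
qed

lemma affine_vanishing:
  fixes D D1 :: "real \<Rightarrow> real"
  assumes D: "\<And>q. 0 < q \<Longrightarrow> (D has_field_derivative D1 q) (at q)"
    and D1: "\<And>q. 0 < q \<Longrightarrow> (D1 has_field_derivative 0) (at q)"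
    and lim: "(D \<longlongrightarrow> 0) at_top" and q: "0 < q"
  shows "D q = 0"
proof -
  have D1c: "D1 q = D1 1" if "0 < q" for q
  proof -
    have "\<exists>c. \<forall>x\<in>{0<..}. D1 x = c"
      by (rule has_field_derivative_zero_constant) (auto intro: has_field_derivative_at_within D1)
    then show ?thesis using that by auto
  qed
  define a where "a = D1 1"
  have "\<exists>c. \<forall>x\<in>{0<..}. D x - a * x = c"
  proof (rule has_field_derivative_zero_constant)
    fix x :: real assume "x \<in> {0<..}"
    then have "((\<lambda>x. D x - a * x) has_field_derivative D1 x - a) (at x)"
      by (auto intro!: derivative_eq_intros D)
    then show "((\<lambda>x. D x - a * x) has_field_derivative 0) (at x within {0<..})"
      using D1c[of x] \<open>x \<in> {0<..}\<close> by (auto simp: a_def intro: has_field_derivative_at_within)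
  qed auto
  then obtain b where b: "\<And>x. 0 < x \<Longrightarrow> D x = a * x + b" by (auto simp: algebra_simps)
  have lim': "((\<lambda>x. a * x + b) \<longlongrightarrow> 0) at_top"
    by (rule Lim_transform_eventually[OF lim]) (rule eventually_mono[OF eventually_gt_at_top[of 0]], rule b)
  have "((\<lambda>x. (a * x + b) * inverse x) \<longlongrightarrow> 0 * 0) at_top"
    by (intro tendsto_mult lim' tendsto_inverse_0_at_top filterlim_ident)
  moreover have "((\<lambda>x. (a * x + b) * inverse x) \<longlongrightarrow> a) at_top"
  proof -
    have "((\<lambda>x. a + b * inverse x) \<longlongrightarrow> a + b * 0) at_top"
      by (intro tendsto_intros tendsto_inverse_0_at_top filterlim_ident)
    then have "((\<lambda>x. a + b * inverse x) \<longlongrightarrow> a) at_top" by simp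
    then show ?thesis
      by (rule Lim_transform_eventually) (rule eventually_mono[OF eventually_gt_at_top[of 0]], simp add: field_simps)
  qed
  ultimately have "a = 0" using tendsto_unique trivial_limit_at_top_linorder by fastforce
  with lim' have "b = 0" by (simp add: tendsto_const_iff)
  show ?thesis using b[OF q] \<open>a = 0\<close> \<open>b = 0\<close> by simp
qed

lemma \<psi>_closed_form:
  assumes q: "0 < q"
  shows "\<psi> q = (q\<^sup>2 - M\<^sup>2) * P q / (\<nu>\<^sup>2 - 1 / 4)"
proof -
  define m where "m = \<nu>\<^sup>2 - 1 / 4"
  have m: "0 < m" unfolding m_def by (rule \<nu>_sq_pos)
  have bb: "\<beta> * (\<beta> - 1) = m" unfolding m_def \<beta>_def by (simp add: algebra_simps power2_eq_square)
  define D where "D q = \<psi> q - (q\<^sup>2 - M\<^sup>2) * P q / m" for q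
  define D1 where "D1 q = Gamma (- \<beta>) * (\<beta> * q powr (\<beta> - 1)) + A1 q - (2 * q * P q - (q\<^sup>2 - M\<^sup>2) * P1 q) / m" for q
  have dP: "(P has_field_derivative - P1 q) (at q)" if "0 < q" for q
    using laplace_has_derivative[OF ok_h0 that] unfolding P_def P1_def .
  have dP1: "(P1 has_field_derivative - P2 q) (at q)" if "0 < q" for q
    using laplace_has_derivative[OF laplace_ok_times_id[OF ok_h0] that] unfolding P2_def P1_def .
  have dA: "(A has_field_derivative - A1 q) (at q)" if "0 < q" for q
    using laplace_has_derivative[OF ok_k0 that] unfolding A_def A1_def .
  have dA1: "(A1 has_field_derivative - A2 q) (at q)" if "0 < q" for q
    using laplace_has_derivative[OF laplace_ok_times_id[OF ok_k0] that] unfolding A2_def A1_def .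
  have dpow: "((\<lambda>q. q powr s) has_field_derivative s * q powr (s - 1)) (at q)" if "0 < q" for q s :: real
    using has_real_derivative_powr[OF that] .
  have "D q = 0"
  proof (rule affine_vanishing[OF _ _ _ q])
    fix q :: real assume q: "0 < q"
    show "(D has_field_derivative D1 q) (at q)"
      unfolding D_def \<psi>_def D1_def using m q
      by (auto intro!: derivative_eq_intros dP[OF q] dA[OF q] dpow[OF q] simp: field_simps)
    have "(D1 has_field_derivative Gamma (- \<beta>) * (\<beta> * ((\<beta> - 1) * q powr (\<beta> - 1 - 1))) + - A2 q
         - (2 * P q + 2 * q * - P1 q - (2 * q * P1 q + (q\<^sup>2 - M\<^sup>2) * - P2 q)) / m) (at q)"
      unfolding D1_def using m q
      by (auto intro!: derivative_eq_intros dP[OF q] dP1[OF q] dA1[OF q] dpow[OF q] simp: field_simps)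
    also have "Gamma (- \<beta>) * (\<beta> * ((\<beta> - 1) * q powr (\<beta> - 1 - 1))) + - A2 q
         - (2 * P q + 2 * q * - P1 q - (2 * q * P1 q + (q\<^sup>2 - M\<^sup>2) * - P2 q)) / m = 0"
    proof -
      have "2 * P q + 2 * q * - P1 q - (2 * q * P1 q + (q\<^sup>2 - M\<^sup>2) * - P2 q) = m * P q"
        using P_ODE[OF q] unfolding m_def by (simp add: algebra_simps)
      then have e: "(2 * P q + 2 * q * - P1 q - (2 * q * P1 q + (q\<^sup>2 - M\<^sup>2) * - P2 q)) / m = P q" using m by simp
      have "A2 q = (\<nu>\<^sup>2 - 1 / 4) * Gamma (- \<beta>) * q powr (\<beta> - 2) - P q"
        using A2_eq[OF q] unfolding Gamma_2\<beta> .
      then have "A2 q = Gamma (- \<beta>) * ((\<beta> * (\<beta> - 1)) * q powr (\<beta> - 2)) - P q" unfolding bb m_def by simp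
      moreover have "\<beta> - 1 - 1 = \<beta> - 2" by simp
      ultimately show ?thesis unfolding e by simp
    qed
    finally show "(D1 has_field_derivative 0) (at q)" .
  next
    have tA: "(A \<longlongrightarrow> 0) at_top"
    proof (rule Lim_null_comparison)
      show "\<forall>\<^sub>F q in at_top. norm (A q) \<le> C * Gamma (2 - \<beta>) * q powr (\<beta> - 2)"
        using eventually_gt_at_top[of 0] by eventually_elim (simp add: A_bound)
      show "((\<lambda>q. C * Gamma (2 - \<beta>) * q powr (\<beta> - 2)) \<longlongrightarrow> 0) at_top"
        by (intro tendsto_mult_right_zero tendsto_neg_powr filterlim_ident) (use \<beta> in auto)
    qed
    have t2: "((\<lambda>q. (q\<^sup>2 - M\<^sup>2) * A2 q / m) \<longlongrightarrow> 0) at_top"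
    proof (rule Lim_null_comparison)
      show "\<forall>\<^sub>F q in at_top. norm ((q\<^sup>2 - M\<^sup>2) * A2 q / m) \<le> C * Gamma (4 - \<beta>) / m * q powr (\<beta> - 2)"
        using eventually_gt_at_top[of M]
      proof eventually_elim
        case (elim q)
        have q: "0 < q" using elim M_pos by simp
        have "\<bar>q\<^sup>2 - M\<^sup>2\<bar> \<le> q powr 2"
          using power_strict_mono[OF elim, of 2] zero_le_power2[of M] M_pos q by (auto simp: abs_if)
        then have "\<bar>q\<^sup>2 - M\<^sup>2\<bar> * \<bar>A2 q\<bar> / m \<le> q powr 2 * (C * Gamma (4 - \<beta>) * q powr (\<beta> - 4)) / m"
          using A2_bound[OF q] m by (intro divide_right_mono mult_mono) auto
        also have "\<dots> = C * Gamma (4 - \<beta>) / m * (q powr 2 * q powr (\<beta> - 4))" by simp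
        also have "q powr 2 * q powr (\<beta> - 4) = q powr (\<beta> - 2)"
          unfolding powr_add[symmetric] by (rule arg_cong) simp
        finally show ?case using m by (simp add: abs_mult)
      qed
      show "((\<lambda>q. C * Gamma (4 - \<beta>) / m * q powr (\<beta> - 2)) \<longlongrightarrow> 0) at_top"
        by (intro tendsto_mult_right_zero tendsto_neg_powr filterlim_ident) (use \<beta> in auto)
    qed
    have t3: "((\<lambda>q. M\<^sup>2 * Gamma (- \<beta>) * q powr (\<beta> - 2)) \<longlongrightarrow> 0) at_top"
      by (intro tendsto_mult_right_zero tendsto_neg_powr filterlim_ident) (use \<beta> in auto)
    \<comment> \<open>Expressing \<open>P\<close> through \<open>A2\<close> cancels the terms of
      order q^\<beta> in \<psi> and in its closed form. What remains of the difference is a sum of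
      three terms, each of order at most q^(\<beta> - 2).\<close>
    have "((\<lambda>q. - A q + (q\<^sup>2 - M\<^sup>2) * A2 q / m + M\<^sup>2 * Gamma (- \<beta>) * q powr (\<beta> - 2)) \<longlongrightarrow> - 0 + 0 + 0) at_top"
      by (intro tendsto_intros tA t2 t3)
    moreover have "\<forall>\<^sub>F q in at_top. - A q + (q\<^sup>2 - M\<^sup>2) * A2 q / m + M\<^sup>2 * Gamma (- \<beta>) * q powr (\<beta> - 2) = D q"
      using eventually_gt_at_top[of 0]
    proof eventually_elim
      case q: (elim q)
      have "A2 q / m = (m * Gamma (- \<beta>) * q powr (\<beta> - 2) - P q) / m"
        using A2_eq[OF q] unfolding Gamma_2\<beta> m_def[symmetric] by simp
      also have "\<dots> = Gamma (- \<beta>) * q powr (\<beta> - 2) - P q / m" using m by (simp add: diff_divide_distrib)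
      finally have e: "A2 q / m = Gamma (- \<beta>) * q powr (\<beta> - 2) - P q / m" .
      have "q powr \<beta> = q powr (2 + (\<beta> - 2))" by simp
      also have "\<dots> = q powr 2 * q powr (\<beta> - 2)" by (rule powr_add)
      also have "q powr 2 = q\<^sup>2" using q by simp
      finally have "D q = Gamma (- \<beta>) * (q\<^sup>2 * q powr (\<beta> - 2)) - A q - (q\<^sup>2 - M\<^sup>2) * (P q / m)"
        unfolding D_def \<psi>_def by simp
      moreover have "- A q + (q\<^sup>2 - M\<^sup>2) * A2 q / m = - A q + (q\<^sup>2 - M\<^sup>2) * (Gamma (- \<beta>) * q powr (\<beta> - 2) - P q / m)"
        unfolding e[symmetric] by simp
      ultimately show ?case by (simp add: algebra_simps)
    qed
    ultimately show "(D \<longlongrightarrow> 0) at_top" by (auto intro: Lim_transform_eventually)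
  qed
  then show ?thesis unfolding D_def m_def by simp
qed

end

section \<open>The hypergeometric function\<close>

text \<open>Under t = ln (x / (1 - x)) one has e^t = x / (1 - x), 1 + cosh t = 1 / (2 x (1 - x)) and
  dt = dx / (x (1 - x)), so a Beta integral appears.\<close>

lemma has_bochner_integral_Beta_cosh:
  fixes \<mu> \<nu> :: real
  assumes "0 \<le> \<nu>" "\<nu> < \<mu>"
  shows "has_bochner_integral lborel (\<lambda>t. exp (\<nu> * t) * (1 + cosh t) powr (- \<mu>)) (2 powr \<mu> * Beta (\<mu> + \<nu>) (\<mu> - \<nu>))"
proof -
  define f where "f t = exp (\<nu> * t) * (1 + cosh t) powr (- \<mu>)" for t :: real
  define g where "g x = ln (x / (1 - x))" for x :: real
  define g' where "g' x = 1 / (x * (1 - x))" for x :: real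
  have fnn: "0 \<le> f t" for t unfolding f_def by simp
  have fg: "f (g x) * g' x = 2 powr \<mu> * (x powr (\<mu> + \<nu> - 1) * (1 - x) powr (\<mu> - \<nu> - 1))"
    if x: "0 < x" "x < 1" for x
  proof -
    define y where "y = 1 - x"
    have y: "0 < y" "x + y = 1" using x by (auto simp: y_def)
    have "cosh (g x) = (x / y + y / x) / 2"
      unfolding g_def y_def[symmetric] using x y by (subst cosh_ln_real) (auto simp: inverse_eq_divide)
    then have "1 + cosh (g x) = (2 * x * y + x\<^sup>2 + y\<^sup>2) / (2 * x * y)"
      using x y by (simp add: field_simps power2_eq_square)
    also have "2 * x * y + x\<^sup>2 + y\<^sup>2 = (x + y)\<^sup>2" by (simp add: power2_eq_square algebra_simps)
    finally have "1 + cosh (g x) = 1 / (2 * x * y)" using y by simp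
    then have "(1 + cosh (g x)) powr (- \<mu>) = (2 * x * y) powr \<mu>"
      using x y by (simp add: powr_minus powr_divide)
    also have "\<dots> = 2 powr \<mu> * (x powr \<mu> * y powr \<mu>)" using x y by (simp add: powr_mult)
    finally have 1: "(1 + cosh (g x)) powr (- \<mu>) = 2 powr \<mu> * (x powr \<mu> * y powr \<mu>)" .
    have "exp (\<nu> * g x) = (x / y) powr \<nu>" using x y unfolding g_def y_def by (simp add: powr_def)
    also have "\<dots> = x powr \<nu> * y powr (- \<nu>)" using x y by (simp add: powr_divide powr_minus_divide)
    finally have 2: "exp (\<nu> * g x) = x powr \<nu> * y powr (- \<nu>)" .
    have 3: "g' x = x powr (- 1) * y powr (- 1)" unfolding g'_def y_def[symmetric] using x y
      by (simp add: powr_minus_divide)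
    have a: "x powr (\<mu> + \<nu> - 1) = x powr \<mu> * x powr \<nu> * x powr (- 1)"
      unfolding powr_add[symmetric] by (rule arg_cong) simp
    have b: "y powr (\<mu> - \<nu> - 1) = y powr \<mu> * y powr (- \<nu>) * y powr (- 1)"
      unfolding powr_add[symmetric] by (rule arg_cong) simp
    show ?thesis unfolding f_def 1 2 3 y_def[symmetric] a b by (simp only: mult_ac)
  qed
  have B: "has_bochner_integral lborel (\<lambda>x. indicator {0<..<1} x * (x powr (\<mu> + \<nu> - 1) * (1 - x) powr (\<mu> - \<nu> - 1))) (Beta (\<mu> + \<nu>) (\<mu> - \<nu>))"
  proof -
    note ab = integrable_Beta[of "\<mu> + \<nu>" "\<mu> - \<nu>"] has_integral_Beta_real[of "\<mu> + \<nu>" "\<mu> - \<nu>"]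
    have i: "set_integrable lborel {0..1} (\<lambda>x. x powr (\<mu> + \<nu> - 1) * (1 - x) powr (\<mu> - \<nu> - 1))"
      using ab(1) assms by simp
    have "(LINT x:{0..1}|lborel. x powr (\<mu> + \<nu> - 1) * (1 - x) powr (\<mu> - \<nu> - 1)) = Beta (\<mu> + \<nu>) (\<mu> - \<nu>)"
      using set_borel_integral_eq_integral(2)[OF i] ab(2) assms by (simp add: integral_unique)
    with i have "has_bochner_integral lborel (\<lambda>x. indicator {0..1} x * (x powr (\<mu> + \<nu> - 1) * (1 - x) powr (\<mu> - \<nu> - 1))) (Beta (\<mu> + \<nu>) (\<mu> - \<nu>))"
      unfolding has_bochner_integral_iff set_integrable_def set_lebesgue_integral_def by simp
    also have "?this \<longleftrightarrow> ?thesis"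
      by (intro has_bochner_integral_cong refl) (auto simp: indicator_def)
    finally show ?thesis .
  qed
  have ei: "einterval 0 1 = {0<..<1}" "einterval (-\<infinity>) \<infinity> = UNIV"
    by (auto simp: einterval_def zero_ereal_def one_ereal_def)
  have indfg: "(\<lambda>x. indicator {0<..<1} x * (f (g x) * g' x)) = (\<lambda>x. 2 powr \<mu> * (indicator {0<..<1} x * (x powr (\<mu> + \<nu> - 1) * (1 - x) powr (\<mu> - \<nu> - 1))))"
    by (auto simp: fun_eq_iff indicator_def fg)
  have 1: "((ereal \<circ> g \<circ> real_of_ereal) \<longlongrightarrow> - \<infinity>) (at_right 0)"
    unfolding zero_ereal_def ereal_tendsto_simps g_def
  proof (rule filterlim_compose[OF ln_at_0])
    show "LIM y at_right 0. y / (1 - y) :> at_right (0 :: real)"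
      unfolding filterlim_at
      by (auto intro!: tendsto_eq_intros simp: eventually_at_right_field intro!: exI[of _ 1])
  qed
  have 2: "((ereal \<circ> g \<circ> real_of_ereal) \<longlongrightarrow> \<infinity>) (at_left 1)"
    unfolding one_ereal_def ereal_tendsto_simps g_def
  proof (rule filterlim_compose[OF ln_at_top])
    show "LIM y at_left 1. y / (1 - y) :> (at_top :: real filter)"
      by real_asymp
  qed
  have 3: "set_integrable lborel (einterval 0 1) (\<lambda>x. f (g x) * g' x)"
    using B unfolding ei set_integrable_def has_bochner_integral_iff by (simp add: indfg)
  have 4: "0 \<le> g' y" if "0 \<le> ereal y" "ereal y \<le> 1" for y
    using that by (auto simp: g'_def zero_ereal_def one_ereal_def)
  have 5: "DERIV g y :> g' y" if "0 < ereal y" "ereal y < 1" for y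
  proof -
    have y: "0 < y" "y < 1" using that by (auto simp: zero_ereal_def one_ereal_def)
    have "DERIV (\<lambda>y. ln (y / (1 - y))) y :> 1 / (y / (1 - y)) * ((1 * (1 - y) - y * (0 - 1)) / ((1 - y) * (1 - y)))"
      using y by (intro DERIV_chain2[where f=ln] DERIV_ln_divide derivative_intros) auto
    also have "1 / (y / (1 - y)) * ((1 * (1 - y) - y * (0 - 1)) / ((1 - y) * (1 - y))) = g' y"
    proof -
      obtain d where d: "d = 1 - y" "0 < d" using y by simp
      have "1 * d - y * (0 - 1) = 1" using d by simp
      then show ?thesis unfolding g'_def d(1)[symmetric] using y d(2) by simp
    qed
    finally show ?thesis unfolding g_def[abs_def] .
  qed
  have 6: "isCont g' y" if "0 < ereal y" "ereal y < 1" for y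
    using that unfolding g'_def by (auto intro!: continuous_intros simp: zero_ereal_def one_ereal_def)
  have 7: "isCont f (g y)" for y unfolding f_def
    by (intro continuous_intros) (use cosh_real_ge_1[of "g y"] in auto)
  have 8: "0 < (1::ereal)" by simp
  note S = interval_integral_substitution_nonneg[OF 8 5 7 6 fnn 4 1 2 3]
  have int: "integrable lborel f" using S(1) unfolding ei set_integrable_def by simp
  have "(\<integral>t. f t \<partial>lborel) = (LBINT x=-\<infinity>..\<infinity>. f x)"
    by (simp add: interval_lebesgue_integral_def ei set_lebesgue_integral_def)
  also have "\<dots> = (LBINT x=0..1. f (g x) * g' x)" by (rule S(2))
  also have "\<dots> = (\<integral>x. indicator {0<..<1} x * (f (g x) * g' x) \<partial>lborel)"
    by (simp add: interval_lebesgue_integral_def ei set_lebesgue_integral_def)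
  also have "\<dots> = 2 powr \<mu> * Beta (\<mu> + \<nu>) (\<mu> - \<nu>)"
    unfolding indfg using B by (simp add: has_bochner_integral_iff)
  finally show ?thesis using int unfolding f_def has_bochner_integral_iff by simp
qed

section \<open>An integral on the slit plane and its power series\<close>

definition slit :: "complex set" where "slit = - (complex_of_real ` {1..})"

lemma open_slit: "open slit"
proof -
  have "closed (complex_of_real ` {1..})"
    by (rule closed_injective_linear_image) (auto intro: linearI simp: inj_on_def)
  then show ?thesis unfolding slit_def by (rule open_Compl)
qed

lemma connected_slit: "connected slit"
proof (rule starlike_imp_connected, unfold starlike_def, intro bexI ballI subsetI)
  show "0 \<in> slit" by (auto simp: slit_def image_iff complex_eq_iff)
  fix x w assume x: "x \<in> slit" and w: "w \<in> closed_segment 0 x"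
  from w obtain u where u: "0 \<le> u" "u \<le> 1" "w = u *\<^sub>R x" by (auto simp: closed_segment_def)
  show "w \<in> slit" unfolding slit_def
  proof
    assume "w \<in> complex_of_real ` {1..}"
    then obtain r where r: "1 \<le> r" "w = complex_of_real r" by auto
    with u have u0: "0 < u" by (cases "u = 0") auto
    have "x = complex_of_real (r / u)" using u r u0 by (simp add: scaleR_conv_of_real field_simps)
    moreover have "1 \<le> r / u" using u u0 r by (simp add: field_simps)
    ultimately show False using x by (auto simp: slit_def simp del: of_real_divide)
  qed
qed

lemma ball_subset_slit: "ball 0 1 \<subseteq> slit"
  unfolding slit_def by auto

lemma of_real_in_slit: "x < 1 \<Longrightarrow> complex_of_real x \<in> slit"
  unfolding slit_def by auto

lemma norm_powr_of_real: "w \<noteq> 0 \<Longrightarrow> norm ((w :: complex) powr complex_of_real a) = norm w powr a"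
  by (simp add: powr_def)

text \<open>The quantity 1 + cosh t - 2 z vanishes only at a point z of the cut. The bound is
  uniform in t and locally uniform in z, hence dominates the integrand and its derivative near
  \<open>z0\<close>.\<close>

lemma slit_lower_bound:
  assumes "z0 \<in> slit"
  obtains e c where "0 < e" "0 < c" "ball z0 e \<subseteq> slit"
    "\<And>z t. z \<in> ball z0 e \<Longrightarrow> c * (1 + cosh t) \<le> norm (complex_of_real (1 + cosh t) - 2 * z)"
proof -
  from open_slit assms obtain d where d: "0 < d" "cball z0 d \<subseteq> slit"
    by (auto simp: open_contains_cball)
  define e where "e = d / 2"
  define B where "B = norm z0 + e + 1"
  \<comment> \<open>The value 1/2 serves large cosh t, where z is negligible; d / (4 * B) serves the
    remaining t, where the distance of z from the cut is at least d / 2 and 1 + cosh t is below 4 *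
    B.\<close>
  define c where "c = min (1/2) (d / (4 * B))"
  have B: "0 < B" unfolding B_def e_def using d by (intro add_nonneg_pos) auto
  have "c * (1 + cosh t) \<le> norm (complex_of_real (1 + cosh t) - 2 * z)" if z: "z \<in> ball z0 e" for z t
  proof -
    have nz: "norm z < B - 1" using z norm_triangle_ineq[of z0 "z - z0"] unfolding B_def by (simp add: dist_norm norm_minus_commute)
    have ge1: "1 \<le> cosh t" by (rule cosh_real_ge_1)
    show ?thesis
    proof (cases "4 * B \<le> 1 + cosh t")
      case True
      have "c * (1 + cosh t) \<le> (1/2) * (1 + cosh t)" unfolding c_def using ge1 by (intro mult_right_mono) auto
      also have "\<dots> \<le> (1 + cosh t) - 2 * norm z" using True nz by (simp add: field_simps)
      also have "\<dots> \<le> norm (complex_of_real (1 + cosh t) - 2 * z)"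
        using norm_triangle_ineq2[of "complex_of_real (1 + cosh t)" "2 * z"] ge1 by (simp add: norm_mult del: of_real_add)
      finally show ?thesis .
    next
      case False
      have "c * (1 + cosh t) \<le> d / (4 * B) * (1 + cosh t)" unfolding c_def using ge1 by (intro mult_right_mono) auto
      also have "\<dots> \<le> d / (4 * B) * (4 * B)" using False B d by (intro mult_left_mono) auto
      also have "\<dots> = d" using B by simp
      also have "d \<le> 2 * norm (complex_of_real ((1 + cosh t) / 2) - z)"
      proof (rule ccontr)
        assume "\<not> ?thesis"
        then have "dist z (complex_of_real ((1 + cosh t) / 2)) < d / 2" by (simp add: dist_norm norm_minus_commute)
        with z have "dist z0 (complex_of_real ((1 + cosh t) / 2)) < d"
          using dist_triangle[of z0 "complex_of_real ((1 + cosh t) / 2)" z] unfolding e_def by simp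
        with d have "complex_of_real ((1 + cosh t) / 2) \<in> slit" by (auto simp del: of_real_divide of_real_add)
        then show False using ge1 by (auto simp: slit_def simp del: of_real_divide of_real_add)
      qed
      also have "\<dots> = norm (2 * (complex_of_real ((1 + cosh t) / 2) - z))" by (simp only: norm_mult norm_numeral)
      also have "2 * (complex_of_real ((1 + cosh t) / 2) - z) = complex_of_real (1 + cosh t) - 2 * z" by (simp add: algebra_simps)
      finally show ?thesis .
    qed
  qed
  moreover have "ball z0 e \<subseteq> slit"
    using d unfolding e_def by (auto simp: subset_iff)
  ultimately show ?thesis using that[of e c] d B unfolding e_def c_def by auto
qed

text \<open>So the principal power of this quantity is holomorphic in z on the whole slit plane: the
  cut of the power is met only on the cut of z.\<close>

lemma slit_not_nonpos:
  assumes "z \<in> slit" "1 \<le> s"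
  shows "complex_of_real (1 + s) - 2 * z \<notin> \<real>\<^sub>\<le>\<^sub>0"
proof
  assume "complex_of_real (1 + s) - 2 * z \<in> \<real>\<^sub>\<le>\<^sub>0"
  then obtain r where r: "r \<le> 0" "complex_of_real (1 + s) - 2 * z = complex_of_real r"
    by (auto elim!: nonpos_Reals_cases)
  then have "z = complex_of_real ((1 + s - r) / 2)" by (auto simp: algebra_simps)
  moreover have "1 \<le> (1 + s - r) / 2" using r assms by simp
  ultimately show False using assms by (auto simp: slit_def simp del: of_real_divide of_real_add of_real_diff)
qed

text \<open>At z = (M - q) / (2 M) one has 1 + cosh t - 2 z = q / M + cosh t, so this is the complex
  continuation of M^(3/2) \<open>J\<close> (3/2) q in the variable z.\<close>

definition cosh_integral :: "real \<Rightarrow> complex \<Rightarrow> complex" where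
  "cosh_integral \<nu> z = (\<integral>t. complex_of_real (exp (\<nu> * t)) * (complex_of_real (1 + cosh t) - 2 * z) powr (complex_of_real (- (3/2))) \<partial>lborel)"

lemma cosh_integral_holomorphic:
  assumes "0 \<le> \<nu>" "\<nu> < 3/2"
  shows "cosh_integral \<nu> holomorphic_on slit"
proof -
  have "\<exists>D. (cosh_integral \<nu> has_field_derivative D) (at z0)" if z0: "z0 \<in> slit" for z0
  proof -
    from slit_lower_bound[OF z0] obtain e c where ec: "0 < e" "0 < c" "ball z0 e \<subseteq> slit"
      "\<And>z t. z \<in> ball z0 e \<Longrightarrow> c * (1 + cosh t) \<le> norm (complex_of_real (1 + cosh t) - 2 * z)" by metis
    define w where "w z t = complex_of_real (1 + cosh t) - 2 * z" for z t
    have wnz: "w z t \<notin> \<real>\<^sub>\<le>\<^sub>0" "w z t \<noteq> 0" if "z \<in> ball z0 e" for z t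
    proof -
      show *: "w z t \<notin> \<real>\<^sub>\<le>\<^sub>0" unfolding w_def by (rule slit_not_nonpos) (use that ec cosh_real_ge_1 in auto)
      then show "w z t \<noteq> 0" by auto
    qed
    have wm [measurable]: "(\<lambda>t. w z t powr a) \<in> borel_measurable lborel" if "z \<in> ball z0 e" for z a
    proof -
      have "continuous_on UNIV (\<lambda>t. w z t powr a)"
        by (intro continuous_at_imp_continuous_on ballI isCont_powr_complex wnz(1) that)
           (unfold w_def, auto intro!: continuous_intros)
      then show ?thesis by (simp add: borel_measurable_continuous_onI)
    qed
    have bound: "norm (complex_of_real (exp (\<nu> * t)) * w z t powr complex_of_real (- r)) \<le> c powr (- r) * (exp (\<nu> * t) * (1 + cosh t) powr (- r))"
      if "z \<in> ball z0 e" "0 < r" for z t r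
    proof -
      have "norm (w z t) powr (- r) \<le> (c * (1 + cosh t)) powr (- r)"
        using ec(4)[OF that(1)] ec(2) that(2) cosh_real_ge_1[of t] unfolding w_def[symmetric]
        by (intro powr_mono2') auto
      also have "\<dots> = c powr (- r) * (1 + cosh t) powr (- r)"
        using ec(2) cosh_real_ge_1[of t] by (intro powr_mult) 
      finally have "exp (\<nu> * t) * norm (w z t) powr (- r) \<le> exp (\<nu> * t) * (c powr (- r) * (1 + cosh t) powr (- r))"
        by (intro mult_left_mono) auto
      then show ?thesis
        unfolding norm_mult norm_powr_of_real[OF wnz(2)[OF that(1)]] by (simp add: mult_ac)
    qed
    have Bint: "integrable lborel (\<lambda>t. c powr (- r) * (exp (\<nu> * t) * (1 + cosh t) powr (- r)))" if "3/2 \<le> r" for r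
      using has_bochner_integral_Beta_cosh[of \<nu> r] assms that
      by (intro integrable_mult_right) (auto simp: has_bochner_integral_iff)
    have "((\<lambda>z. \<integral>t. complex_of_real (exp (\<nu> * t)) * w z t powr complex_of_real (- (3/2)) \<partial>lborel) has_field_derivative
       (\<integral>t. 3 * (complex_of_real (exp (\<nu> * t)) * w z0 t powr complex_of_real (- (5/2))) \<partial>lborel)) (at z0)"
    proof (rule has_field_derivative_integral_parametric[where e=e and
          f'="\<lambda>z t. 3 * (complex_of_real (exp (\<nu> * t)) * w z t powr complex_of_real (- (5/2)))"
          and h="\<lambda>t. 3 * (c powr (- (5/2)) * (exp (\<nu> * t) * (1 + cosh t) powr (- (5/2))))"])
      show "0 < e" by fact
      show "integrable lborel (\<lambda>t. complex_of_real (exp (\<nu> * t)) * w z t powr complex_of_real (- (3/2)))" if "z \<in> ball z0 e" for z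
      proof (rule Bochner_Integration.integrable_bound[OF Bint[of "3/2"]])
        show "(\<lambda>t. complex_of_real (exp (\<nu> * t)) * w z t powr complex_of_real (- (3/2))) \<in> borel_measurable lborel"
          by (intro borel_measurable_times wm that) measurable
        show "AE t in lborel. norm (complex_of_real (exp (\<nu> * t)) * w z t powr complex_of_real (- (3/2)))
          \<le> norm (c powr (- (3/2)) * (exp (\<nu> * t) * (1 + cosh t) powr (- (3/2))))"
          by (intro AE_I2 order_trans[OF bound[OF that]]) auto
      qed simp
      show "((\<lambda>z. complex_of_real (exp (\<nu> * t)) * w z t powr complex_of_real (- (3/2))) has_field_derivative
          3 * (complex_of_real (exp (\<nu> * t)) * w z t powr complex_of_real (- (5/2)))) (at z)" if "z \<in> ball z0 e" for z t
      proof -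
        have "((\<lambda>z. w z t powr complex_of_real (- (3/2))) has_field_derivative
           complex_of_real (- (3/2)) * w z t powr (complex_of_real (- (3/2)) - 1) * (- 2)) (at z)"
          by (rule DERIV_chain2[where g="\<lambda>z. w z t" and f="\<lambda>y. y powr complex_of_real (- (3/2))", OF has_field_derivative_powr[OF wnz(1)[OF that]]])
             (auto simp: w_def intro!: derivative_eq_intros)
        moreover have "complex_of_real (- (3/2)) - 1 = complex_of_real (- (5/2))" by (simp add: complex_eq_iff)
        ultimately have "((\<lambda>z. w z t powr complex_of_real (- (3/2))) has_field_derivative
           3 * w z t powr complex_of_real (- (5/2))) (at z)" by simp
        from DERIV_cmult[OF this, of "complex_of_real (exp (\<nu> * t))"] show ?thesis by (simp add: mult_ac)
      qed
      show "norm (3 * (complex_of_real (exp (\<nu> * t)) * w z t powr complex_of_real (- (5/2)))) \<le> 3 * (c powr (- (5/2)) * (exp (\<nu> * t) * (1 + cosh t) powr (- (5/2))))"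
        if "z \<in> ball z0 e" for z t
        using bound[OF that, of "5/2" t] by (simp add: norm_mult)
      show "integrable lborel (\<lambda>t. 3 * (c powr (- (5/2)) * (exp (\<nu> * t) * (1 + cosh t) powr (- (5/2)))))"
        by (intro integrable_mult_right[OF Bint]) simp
      show "(\<lambda>t. 3 * (complex_of_real (exp (\<nu> * t)) * w z0 t powr complex_of_real (- (5/2)))) \<in> borel_measurable lborel"
        by (intro borel_measurable_times wm) (use ec in auto)
    qed
    then show ?thesis unfolding cosh_integral_def w_def by blast
  qed
  then show ?thesis by (auto simp: holomorphic_on_open[OF open_slit])
qed

text \<open>Obtained by expanding (1 - 2 z / (1 + cosh t))^(- 3/2) in the binomial series and
  integrating each term, which is a Beta integral with exponent 3/2 + n.\<close>

definition cosh_coeff :: "real \<Rightarrow> nat \<Rightarrow> real" where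
  "cosh_coeff \<nu> n = pochhammer (3/2) n / fact n * 2 ^ n * (2 powr (3/2 + n) * Beta (3/2 + n + \<nu>) (3/2 + n - \<nu>))"

lemma Beta_Suc_Suc:
  fixes a b :: real
  assumes "0 < a" "0 < b"
  shows "Beta (a + 1) (b + 1) = Beta a b * (a * b / ((a + b) * (a + b + 1)))"
proof -
  have n: "a \<notin> \<int>\<^sub>\<le>\<^sub>0" "b \<notin> \<int>\<^sub>\<le>\<^sub>0" "a + b \<notin> \<int>\<^sub>\<le>\<^sub>0" "a + b + 1 \<notin> \<int>\<^sub>\<le>\<^sub>0"
    using assms nonpos_Ints_nonpos[of a] nonpos_Ints_nonpos[of b] nonpos_Ints_nonpos[of "a + b"] nonpos_Ints_nonpos[of "a + b + 1"] by auto
  have e: "a + 1 + (b + 1) = a + b + 1 + 1" by simp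
  show ?thesis
    unfolding Beta_def e Gamma_plus1[OF n(1)] Gamma_plus1[OF n(2)] Gamma_plus1[OF n(4)] Gamma_plus1[OF n(3)]
    using assms by (simp add: mult_ac)
qed

lemma cosh_coeff_0:
  assumes "0 \<le> \<nu>" "\<nu> < 3/2"
  shows "cosh_coeff \<nu> 0 = sqrt 2 * Gamma (3/2 + \<nu>) * Gamma (3/2 - \<nu>)"
proof -
  have "Gamma (3 :: real) = 2" using Gamma_fact[of 2, where ?'a=real] by (simp add: numeral_3_eq_3)
  moreover have "2 powr (3/2) = 2 * sqrt (2 :: real)"
  proof -
    have "2 powr (3/2) = 2 powr (1 + 1/2 :: real)" by simp
    also have "\<dots> = 2 powr 1 * 2 powr (1/2 :: real)" by (rule powr_add)
    finally show ?thesis by (simp add: powr_half_sqrt)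
  qed
  ultimately show ?thesis unfolding cosh_coeff_def Beta_def by simp
qed

lemma cosh_coeff_pos:
  assumes "0 \<le> \<nu>" "\<nu> < 3/2"
  shows "0 < cosh_coeff \<nu> 0"
proof -
  have "0 < Gamma (3/2 + \<nu>)" "0 < Gamma (3/2 - \<nu>)" by (rule Gamma_real_pos, use assms in linarith)+
  then show ?thesis unfolding cosh_coeff_0[OF assms] by simp
qed

lemma cosh_coeff_Suc:
  assumes "0 \<le> \<nu>" "\<nu> < 3/2"
  shows "cosh_coeff \<nu> (Suc n) = cosh_coeff \<nu> n * ((3/2 + \<nu> + real n) * (3/2 - \<nu> + real n) / ((real n + 1) * (real n + 2)))"
proof -
  define x y where "x = 3/2 + n + \<nu>" and "y = 3/2 + n - \<nu>"
  have xy: "0 < x" "0 < y" "x + y = 3 + 2 * n" using assms unfolding x_def y_def by auto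
  have e: "3/2 + real (Suc n) + \<nu> = x + 1" "3/2 + real (Suc n) - \<nu> = y + 1" unfolding x_def y_def by auto
  have p: "2 powr (3/2 + real (Suc n)) = 2 * 2 powr (3/2 + real n)"
  proof -
    have "2 powr (3/2 + real (Suc n)) = 2 powr (1 + (3/2 + real n))" by (simp add: algebra_simps)
    also have "\<dots> = 2 powr 1 * 2 powr (3/2 + real n)" by (rule powr_add)
    finally show ?thesis by simp
  qed
  have f: "fact (Suc n) = (real n + 1) * fact n" by (simp add: algebra_simps)
  have "cosh_coeff \<nu> (Suc n) = cosh_coeff \<nu> n * ((3/2 + real n) / (real n + 1) * 4 * (x * y / ((x + y) * (x + y + 1))))"
  proof -
    have *: "P * u / (v * F) * (2 * w) * ((2 * r) * (B * t)) = P / F * w * (r * B) * (u / v * 4 * t)"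
      if "v \<noteq> 0" "F \<noteq> 0" for P u v F w r B t :: real using that by (simp add: field_simps)
    show ?thesis
      unfolding cosh_coeff_def e Beta_Suc_Suc[OF xy(1,2)] p pochhammer_Suc f x_def[symmetric] y_def[symmetric] power_Suc
      by (rule *) simp_all
  qed
  \<comment> \<open>Here x + y = 2 (3/2 + n): the denominator of the Beta recurrence contains the
    factor 3/2 + n that the Pochhammer symbol has just contributed.\<close>
  also have "(x + y) * (x + y + 1) = 4 * ((3/2 + real n) * (real n + 2))" unfolding xy(3) by (simp add: algebra_simps)
  also have "(3/2 + real n) / (real n + 1) * 4 * (x * y / (4 * ((3/2 + real n) * (real n + 2)))) = x * y / ((real n + 1) * (real n + 2))"
  proof -
    have "u / v * 4 * (z / (4 * (u * w))) = z / (v * w)" if "u \<noteq> 0" for u v w z :: real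
      using that by simp
    from this[of "3/2 + real n" "real n + 1" "x * y" "real n + 2"] show ?thesis by linarith
  qed
  also have "x * y = (3/2 + \<nu> + real n) * (3/2 - \<nu> + real n)" unfolding x_def y_def by (simp add: algebra_simps)
  finally show ?thesis .
qed

text \<open>So the integral is \<open>cosh_coeff\<close> \<nu> 0 times the hypergeometric series
  with parameters 3/2 + \<nu>, 3/2 - \<nu>; 2. Both upper parameters exceed those of the theorem by
  1.\<close>

lemma cosh_coeff_eq:
  assumes "0 \<le> \<nu>" "\<nu> < 3/2"
  shows "cosh_coeff \<nu> n = cosh_coeff \<nu> 0 * (pochhammer (3/2 + \<nu>) n * pochhammer (3/2 - \<nu>) n / (pochhammer 2 n * fact n))"
proof (induction n)
  case (Suc n)
  have f: "fact (Suc n) = (real n + 1) * fact n" by (simp add: algebra_simps)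
  have *: "c * (A * B / (D * F)) * (s * t / (v * w)) = c * ((A * s) * (B * t) / ((D * w) * (v * F)))"
    for c A B D F s t v w :: real by (simp add: mult_ac)
  show ?case unfolding cosh_coeff_Suc[OF assms] Suc pochhammer_Suc f add.commute[of 2] by (rule *)
qed simp

lemma powr_times_of_real:
  assumes "0 < r" "u \<noteq> 0"
  shows "(complex_of_real r * u) powr complex_of_real A = complex_of_real (r powr A) * u powr complex_of_real A"
proof -
  have "(complex_of_real r * u) powr complex_of_real A = exp (complex_of_real (A * ln r) + complex_of_real A * Ln u)"
    using assms by (simp add: powr_def Ln_times_of_real Ln_of_real distrib_left)
  also have "\<dots> = complex_of_real (exp (A * ln r)) * u powr complex_of_real A"
    using assms unfolding exp_add exp_of_real by (simp add: powr_def)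
  finally show ?thesis using assms by (simp add: powr_def)
qed

text \<open>Since 1 + cosh t >= 2, the ratio 2 z / (1 + cosh t) has modulus at most |z|, uniformly
  in t. The n-th term is therefore dominated by a n |z|^n times the fixed integrable function
  \<open>E\<close> 0, and summation and integration may be exchanged.\<close>

lemma cosh_integral_sums:
  assumes \<nu>: "0 \<le> \<nu>" "\<nu> < 3/2" and z: "norm z < 1"
  shows "(\<lambda>n. complex_of_real (cosh_coeff \<nu> n) * z ^ n) sums cosh_integral \<nu> z"
proof -
  define a where "a n = pochhammer (3/2 :: real) n / fact n" for n
  have a_nonneg: "0 \<le> a n" for n unfolding a_def by (intro divide_nonneg_nonneg) (auto intro!: less_imp_le pochhammer_pos)
  have binom: "(\<lambda>n. complex_of_real (a n) * w ^ n) sums (1 - w) powr complex_of_real (- (3/2))" if "norm w < 1" for w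
  proof -
    have "(\<lambda>n. (complex_of_real (- (3/2)) gchoose n) * (- w) ^ n) sums (1 + (- w)) powr complex_of_real (- (3/2))"
      by (rule gen_binomial_complex) (use that in simp)
    also have "(\<lambda>n. (complex_of_real (- (3/2)) gchoose n) * (- w) ^ n) = (\<lambda>n. complex_of_real (a n) * w ^ n)"
    proof
      fix n
      have "complex_of_real (- (3/2)) gchoose n = (- 1) ^ n * pochhammer (complex_of_real (3/2)) n / fact n"
        by (simp add: gbinomial_pochhammer)
      also have "\<dots> = (- 1) ^ n * complex_of_real (a n)"
        unfolding a_def of_real_divide[of "pochhammer _ _"] of_real_fact pochhammer_of_real[symmetric] times_divide_eq_right ..
      finally have 1: "complex_of_real (- (3/2)) gchoose n = (- 1) ^ n * complex_of_real (a n)" .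
      have 2: "(- 1) ^ n * (- 1) ^ n = (1 :: complex)" by (simp flip: power_mult_distrib)
      have "(complex_of_real (- (3/2)) gchoose n) * (- w) ^ n = ((- 1) ^ n * (- 1) ^ n) * (complex_of_real (a n) * w ^ n)"
        unfolding 1 power_minus[of w] by (simp only: mult_ac)
      then show "(complex_of_real (- (3/2)) gchoose n) * (- w) ^ n = complex_of_real (a n) * w ^ n"
        unfolding 2 by simp
    qed
    finally show ?thesis by simp
  qed
  have summ: "summable (\<lambda>n. a n * norm z ^ n)"
  proof -
    have "summable (\<lambda>n. complex_of_real (a n) * complex_of_real (norm z) ^ n)"
      using binom[of "complex_of_real (norm z)"] z by (auto simp: sums_iff)
    then have "summable (\<lambda>n. complex_of_real (a n * norm z ^ n))" by simp
    then show ?thesis by (simp only: summable_complex_of_real)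
  qed
  define E where "E n t = exp (\<nu> * t) * (1 + cosh t) powr (- (3/2 + real n))" for n t
  have E: "has_bochner_integral lborel (E n) (2 powr (3/2 + n) * Beta (3/2 + n + \<nu>) (3/2 + n - \<nu>))" for n
    unfolding E_def by (rule has_bochner_integral_Beta_cosh) (use \<nu> in auto)
  have E0: "0 \<le> E n t" for n t unfolding E_def by simp
  have cpos: "1 + cosh t > 0" "2 \<le> 1 + cosh t" for t :: real using cosh_real_ge_1[of t] by auto
  have EE: "E n t = E 0 t * (1 / (1 + cosh t)) ^ n" for n t
  proof -
    have "(1 + cosh t) powr (- (3/2 + real n)) = (1 + cosh t) powr (- (3/2) + - real n)" by (simp add: algebra_simps)
    also have "\<dots> = (1 + cosh t) powr (- (3/2)) * (1 + cosh t) powr (- real n)" by (rule powr_add)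
    also have "(1 + cosh t) powr (- real n) = (1 / (1 + cosh t)) ^ n"
      using cpos[of t] by (simp add: powr_minus powr_realpow power_one_over inverse_eq_divide)
    finally show ?thesis unfolding E_def by simp
  qed
  define f where "f n t = complex_of_real (a n * 2 ^ n * E n t) * z ^ n" for n t
  have fE: "norm (f n t) = a n * norm z ^ n * (2 ^ n * E n t)" for n t
    unfolding f_def using a_nonneg[of n] E0[of n t] by (simp add: norm_mult norm_power abs_mult)
  have fE': "2 ^ n * E n t \<le> E 0 t" for n t
  proof -
    have "2 ^ n * E n t = E 0 t * (2 / (1 + cosh t)) ^ n" unfolding EE[of n t] by (simp add: power_divide)
    also have "\<dots> \<le> E 0 t * 1" using cpos[of t] E0[of 0 t] by (intro mult_left_mono power_le_one) auto
    finally show ?thesis by simp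
  qed
  have fint: "integrable lborel (f n)" for n
    unfolding f_def using E[of n] by (intro integrable_mult_left integrable_of_real integrable_mult_right) (auto simp: has_bochner_integral_iff)
  have fsum: "(\<lambda>n. f n t) sums (complex_of_real (exp (\<nu> * t)) * (complex_of_real (1 + cosh t) - 2 * z) powr (complex_of_real (- (3/2))))" for t
  proof -
    define w where "w = 2 * z / complex_of_real (1 + cosh t)"
    have w: "norm w < 1"
    proof -
      have "norm w = 2 * norm z / (1 + cosh t)" unfolding w_def using cpos[of t] by (simp add: norm_mult norm_divide del: of_real_add)
      also have "\<dots> < 1" using z cpos[of t] by (simp add: field_simps)
      finally show ?thesis .
    qed
    have f1: "complex_of_real (1 + cosh t) - 2 * z = complex_of_real (1 + cosh t) * (1 - w)"
      unfolding w_def using cpos[of t] by (simp add: right_diff_distrib del: of_real_add)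
    have f2: "1 - w \<noteq> 0" using w by auto
    have "(complex_of_real (1 + cosh t) - 2 * z) powr complex_of_real (- (3/2))
       = complex_of_real ((1 + cosh t) powr (- (3/2))) * (1 - w) powr complex_of_real (- (3/2))"
      unfolding f1 by (rule powr_times_of_real[OF cpos(1) f2])
    then have *: "complex_of_real (exp (\<nu> * t)) * (complex_of_real (1 + cosh t) - 2 * z) powr (complex_of_real (- (3/2)))
      = complex_of_real (E 0 t) * (1 - w) powr complex_of_real (- (3/2))"
      unfolding E_def by simp
    have "f n t = complex_of_real (E 0 t) * (complex_of_real (a n) * w ^ n)" for n
      unfolding f_def EE[of n t] w_def by (simp add: power_mult_distrib power_divide)
    with sums_mult[OF binom[OF w], of "complex_of_real (E 0 t)"] * show ?thesis by simp
  qed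
  have "(\<lambda>n. (\<integral>t. f n t \<partial>lborel)) sums (\<integral>t. (\<Sum>n. f n t) \<partial>lborel)"
  proof (rule sums_integral[OF fint])
    show "AE t in lborel. summable (\<lambda>n. norm (f n t))"
    proof (intro AE_I2)
      fix t
      have b: "norm (norm (f n t)) \<le> (a n * norm z ^ n) * E 0 t" for n
        unfolding fE using fE'[of n t] a_nonneg[of n] E0[of n t] by (auto intro!: mult_left_mono)
      show "summable (\<lambda>n. norm (f n t))"
        by (rule summable_comparison_test'[OF summable_mult2[OF summ]]) (rule b)
    qed
    have "norm (\<integral>t. norm (f n t) \<partial>lborel) \<le> (a n * norm z ^ n) * (\<integral>t. E 0 t \<partial>lborel)" for n
    proof -
      have "(\<integral>t. norm (f n t) \<partial>lborel) \<le> (\<integral>t. (a n * norm z ^ n) * E 0 t \<partial>lborel)"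
        using E[of 0] fE' a_nonneg[of n]
        by (intro integral_mono integrable_norm fint integrable_mult_right) (auto simp: fE has_bochner_integral_iff intro!: mult_left_mono)
      then show ?thesis by (simp add: Bochner_Integration.integral_nonneg)
    qed
    then show "summable (\<lambda>n. \<integral>t. norm (f n t) \<partial>lborel)"
      by (intro summable_comparison_test'[OF summable_mult2[OF summ]])
  qed
  also have "(\<lambda>t. \<Sum>n. f n t) = (\<lambda>t. complex_of_real (exp (\<nu> * t)) * (complex_of_real (1 + cosh t) - 2 * z) powr (complex_of_real (- (3/2))))"
    using fsum by (auto simp: sums_iff)
  also have "(\<lambda>n. (\<integral>t. f n t \<partial>lborel)) = (\<lambda>n. complex_of_real (cosh_coeff \<nu> n) * z ^ n)"
  proof
    fix n
    have "(\<integral>t. f n t \<partial>lborel) = (\<integral>t. complex_of_real (a n * 2 ^ n * E n t) \<partial>lborel) * z ^ n" unfolding f_def by simp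
    also have "(\<integral>t. complex_of_real (a n * 2 ^ n * E n t) \<partial>lborel) = complex_of_real (\<integral>t. a n * 2 ^ n * E n t \<partial>lborel)"
      by (rule integral_complex_of_real)
    also have "(\<integral>t. a n * 2 ^ n * E n t \<partial>lborel) = cosh_coeff \<nu> n"
      using E[of n] unfolding cosh_coeff_def a_def by (simp add: has_bochner_integral_iff)
    finally show "(\<integral>t. f n t \<partial>lborel) = complex_of_real (cosh_coeff \<nu> n) * z ^ n" .
  qed
  finally show ?thesis unfolding cosh_integral_def .
qed

text \<open>Euler's transformation turns the parameters of the coefficients into those of the theorem.\<close>

lemma hyp2F1_eq:
  assumes \<nu>: "0 \<le> \<nu>" "\<nu> < 3/2" and z: "z \<in> slit"
  shows "hyp2F1 (complex_of_real (1/2 - \<nu>)) (complex_of_real (1/2 + \<nu>)) 2 z = (1 - z) * cosh_integral \<nu> z / complex_of_real (cosh_coeff \<nu> 0)"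
proof -
  define a b where "a = complex_of_real (1/2 - \<nu>)" and "b = complex_of_real (1/2 + \<nu>)"
  define F where "F z = (1 - z) * cosh_integral \<nu> z / complex_of_real (cosh_coeff \<nu> 0)" for z
  have c0: "cosh_coeff \<nu> 0 \<noteq> 0" using cosh_coeff_pos[OF \<nu>] by simp
  have hol: "F holomorphic_on slit" unfolding F_def
    by (intro holomorphic_intros cosh_integral_holomorphic \<nu>) (use c0 in auto)
  define c where "c n = pochhammer (a + 1) n * pochhammer (b + 1) n / (pochhammer 2 n * fact n)" for n
  have c_eq: "complex_of_real (cosh_coeff \<nu> n) = complex_of_real (cosh_coeff \<nu> 0) * c n" for n
  proof -
    have "a + 1 = complex_of_real (3/2 - \<nu>)" "b + 1 = complex_of_real (3/2 + \<nu>)" "(2 :: complex) = complex_of_real 2"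
      unfolding a_def b_def by (auto simp: complex_eq_iff)
    then have "c n = complex_of_real (pochhammer (3/2 + \<nu>) n * pochhammer (3/2 - \<nu>) n / (pochhammer 2 n * fact n))"
      unfolding c_def by (simp only: pochhammer_of_real of_real_mult of_real_divide of_real_fact mult_ac)
    then show ?thesis unfolding cosh_coeff_eq[OF \<nu>, of n] by (simp only: of_real_mult)
  qed
  define d where "d n = fps_hypergeo [a, b] [2] 1 $ n" for n
  have d0: "d 0 = 1" "c 0 = 1" unfolding d_def c_def by auto
  \<comment> \<open>This is multiplication of the series by 1 - z, read on coefficients. It reduces
    to (a + 1 + n) (b + 1 + n) - (2 + n) (1 + n) = a b, which holds because a + b = 1.\<close>
  have dSuc: "d (Suc n) = c (Suc n) - c n" for n
  proof -
    define K where "K = pochhammer (a + 1) n * pochhammer (b + 1) n / (pochhammer 2 (Suc n) * fact (Suc n))"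
    have p: "pochhammer (2::complex) n \<noteq> 0"
      using pochhammer_of_real[of "2::real" n, where ?'a=complex] pochhammer_pos[of "2::real" n] by auto
    have ab: "a + b = 1" unfolding a_def b_def by (simp add: complex_eq_iff)
    have n0: "of_nat n + (1::complex) \<noteq> 0" "of_nat n + (2::complex) \<noteq> 0" by (auto simp: complex_eq_iff)
    have f: "fact (Suc n) = (1 + of_nat n) * (fact n :: complex)" by (simp add: algebra_simps)
    have "d (Suc n) = pochhammer a (Suc n) * pochhammer b (Suc n) / (pochhammer 2 (Suc n) * fact (Suc n))"
      unfolding d_def by (simp del: fact_Suc)
    then have d1: "d (Suc n) = K * (a * b)"
      unfolding K_def pochhammer_rec[of a] pochhammer_rec[of b] by (simp only: times_divide_eq_left times_divide_eq_right mult_ac)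
    have c1: "c (Suc n) = K * ((a + 1 + of_nat n) * (b + 1 + of_nat n))"
      unfolding c_def K_def pochhammer_Suc[of "a + 1"] pochhammer_Suc[of "b + 1"] by (simp only: times_divide_eq_left times_divide_eq_right mult_ac)
    have c2: "c n = K * ((2 + of_nat n) * (1 + of_nat n))"
    proof -
      have *: "X / (D * F) = X / ((D * w) * (v * F)) * (w * v)" if "v \<noteq> 0" "w \<noteq> 0" for X D F v w :: complex
        using that by simp
      show ?thesis unfolding c_def K_def pochhammer_Suc[of 2] f by (rule *) (use n0 in \<open>simp_all only: add.commute not_False_eq_True\<close>)
    qed
    have e: "a * b = (a + 1 + of_nat n) * (b + 1 + of_nat n) - (2 + of_nat n) * (1 + of_nat n)"
    proof -
      have b: "b = 1 - a" using ab by (simp add: algebra_simps)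
      show ?thesis unfolding b by (simp add: algebra_simps)
    qed
    show ?thesis unfolding d1 c1 c2 e by (rule right_diff_distrib)
  qed
  have series: "F w = eval_fps (fps_hypergeo [a, b] [2] 1) w" if w: "w \<in> ball 0 1" for w
  proof -
    define S where "S = cosh_integral \<nu> w / complex_of_real (cosh_coeff \<nu> 0)"
    have S: "(\<lambda>n. c n * w ^ n) sums S"
    proof -
      have "complex_of_real (cosh_coeff \<nu> n) * w ^ n / complex_of_real (cosh_coeff \<nu> 0) = c n * w ^ n" for n
        by (subst c_eq) (use c0 in simp)
      moreover have "norm w < 1" using w by simp
      from sums_divide[OF cosh_integral_sums[OF \<nu> this], of "complex_of_real (cosh_coeff \<nu> 0)"]
      have "(\<lambda>n. complex_of_real (cosh_coeff \<nu> n) * w ^ n / complex_of_real (cosh_coeff \<nu> 0)) sums S" unfolding S_def .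
      ultimately show ?thesis by presburger
    qed
    then have "(\<lambda>n. c (Suc n) * w ^ Suc n) sums (S - 1)"
      by (subst sums_Suc_iff) (simp add: d0)
    moreover have "(\<lambda>n. w * (c n * w ^ n)) sums (w * S)" by (rule sums_mult[OF S])
    ultimately have "(\<lambda>n. c (Suc n) * w ^ Suc n - w * (c n * w ^ n)) sums (S - 1 - w * S)" by (rule sums_diff)
    then have "(\<lambda>n. d (Suc n) * w ^ Suc n) sums (S - 1 - w * S)"
      by (simp only: dSuc left_diff_distrib right_diff_distrib power_Suc mult_ac)
    then have "(\<lambda>n. d n * w ^ n) sums (S - 1 - w * S + d 0 * w ^ 0)" by (subst (asm) sums_Suc_iff) (simp add: d0)
    then have "(\<lambda>n. d n * w ^ n) sums F w" by (simp add: d0 F_def S_def diff_divide_distrib left_diff_distrib)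
    then show ?thesis unfolding eval_fps_def d_def by (simp add: sums_iff)
  qed
  define h where "h = hyp2F1 a b 2"
  \<comment> \<open>\<open>F\<close> witnesses that the choice in \<open>hyp2F1\<close> is from a
    nonempty set. The chosen function may differ from \<open>F\<close> a priori, but both are given
    by the series on the unit disc, and the slit plane is connected.\<close>
  have "\<exists>f. f holomorphic_on - (complex_of_real ` {1..}) \<and> (\<forall>z\<in>ball 0 1. f z = eval_fps (fps_hypergeo [a, b] [2] 1) z)"
    using hol series unfolding slit_def by blast
  from someI_ex[OF this] have h: "h holomorphic_on slit" "\<And>z. z \<in> ball 0 1 \<Longrightarrow> h z = eval_fps (fps_hypergeo [a, b] [2] 1) z"
    unfolding h_def hyp2F1_def slit_def by blast+
  have "h z = F z"
    by (rule analytic_continuation_open[OF open_ball open_slit _ connected_slit ball_subset_slit h(1) hol _ z])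
       (use h(2) series in auto)
  then show ?thesis unfolding h_def F_def a_def b_def .
qed

context disk
begin

text \<open>With q = M (1 - 2 z) the prefactor q^2 - M^2 is - 4 M^2 z (1 - z). The factor 1 - z is
  the one in Euler's transformation, and z remains in front.\<close>

lemma \<psi>_hyp2F1:
  assumes q: "0 < q"
  shows "complex_of_real (\<psi> q) =
     complex_of_real (2 powr (1 - \<nu>) / Gamma \<nu> * sqrt (2 * pi) * M powr \<beta> * (pi / cos (pi * \<nu>)) * ((M - q) / (2 * M)))
     * hyp2F1 (complex_of_real (1/2 - \<nu>)) (complex_of_real (1/2 + \<nu>)) 2 (complex_of_real ((M - q) / (2 * M)))"
proof -
  define z where "z = (M - q) / (2 * M)"
  have \<nu>': "0 \<le> \<nu>" "\<nu> < 3/2" using \<nu> by auto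
  have z1: "z < 1" using q M_pos unfolding z_def by (simp add: field_simps)
  have z2: "1 - 2 * z = q / M" using M_pos unfolding z_def by (simp add: field_simps)
  have z3: "1 - z = (M + q) / (2 * M)" using M_pos unfolding z_def by (simp add: field_simps)
  define Y where "Y = (\<integral>t. exp (\<nu> * t) * (q / M + cosh t) powr (- (3/2)) \<partial>lborel)"
  have Yc: "cosh_integral \<nu> (complex_of_real z) = complex_of_real Y"
  proof -
    have "complex_of_real (exp (\<nu> * t)) * (complex_of_real (1 + cosh t) - 2 * complex_of_real z) powr (complex_of_real (- (3/2)))
       = complex_of_real (exp (\<nu> * t) * (q / M + cosh t) powr (- (3/2)))" for t
    proof -
      have "complex_of_real (1 + cosh t) - 2 * complex_of_real z = complex_of_real (q / M + cosh t)"
        unfolding z2[symmetric] by simp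
      moreover have "0 \<le> q / M + cosh t" using q M_pos by (simp add: cosh_real_nonneg)
      ultimately show ?thesis by (simp only: powr_of_real of_real_mult)
    qed
    then show ?thesis unfolding cosh_integral_def Y_def by (simp only: integral_complex_of_real)
  qed
  have JY: "J (3/2) q = M powr (- (3/2)) * Y"
  proof -
    have "(q + M * cosh t) powr (- (3/2)) = M powr (- (3/2)) * (q / M + cosh t) powr (- (3/2))" for t
    proof -
      have "q + M * cosh t = M * (q / M + cosh t)" using M_pos by (simp add: field_simps)
      moreover have "0 \<le> q / M + cosh t" using q M_pos by (simp add: cosh_real_nonneg)
      ultimately show ?thesis using M_pos by (simp only: powr_mult)
    qed
    then have "J (3/2) q = (\<integral>t. M powr (- (3/2)) * (exp (\<nu> * t) * (q / M + cosh t) powr (- (3/2))) \<partial>lborel)"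
      unfolding J_def by (intro Bochner_Integration.integral_cong) (simp_all add: mult_ac)
    then show ?thesis unfolding Y_def by simp
  qed
  have PY: "P q = (M / 2) powr \<nu> / Gamma \<nu> * Gamma (3/2) * (M powr (- (3/2)) * Y)"
    using J_aux(2)[OF q, of "3/2"] \<nu> unfolding P_def h0_def \<beta>_def JY by (simp add: algebra_simps)
  define b0 where "b0 = cosh_coeff \<nu> 0"
  define m where "m = \<nu>\<^sup>2 - 1 / 4"
  have m: "0 < m" unfolding m_def by (rule \<nu>_sq_pos)
  have G32: "Gamma (3/2 :: real) = sqrt pi / 2"
    using Gamma_plus1[of "1/2 :: real"] nonpos_Ints_nonpos[of "1/2 :: real"] Gamma_one_half_real by auto
  \<comment> \<open>The recursion shifts 3/2 to 1/2 and produces - m; the reflection formula then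
    gives pi / cos (pi \<nu>). This m cancels the denominator of the closed form and leaves the
    trigonometric factor of L.\<close>
  have b0_eq: "b0 = sqrt 2 * (- m * (pi / cos (pi * \<nu>)))"
  proof -
    have n: "1/2 + \<nu> \<notin> \<int>\<^sub>\<le>\<^sub>0" using nonpos_Ints_nonpos[of "1/2 + \<nu>"] \<nu> by auto
    have n2: "1/2 - \<nu> \<notin> \<int>\<^sub>\<le>\<^sub>0"
    proof
      assume "1/2 - \<nu> \<in> \<int>\<^sub>\<le>\<^sub>0"
      then have "1/2 - \<nu> \<in> \<int>" using nonpos_Ints_Int by blast
      then obtain k where k: "1/2 - \<nu> = of_int k" by (rule Ints_cases)
      with \<nu> have "of_int (-1) < (of_int k :: real)" "of_int k < (of_int 0 :: real)" by linarith+
      then show False unfolding of_int_less_iff by linarith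
    qed
    have g1: "Gamma (3/2 + \<nu>) = (1/2 + \<nu>) * Gamma (1/2 + \<nu>)"
    proof -
      have "1/2 + \<nu> + 1 = 3/2 + \<nu>" by simp
      with Gamma_plus1[OF n] show ?thesis by simp
    qed
    have g2: "Gamma (3/2 - \<nu>) = (1/2 - \<nu>) * Gamma (1/2 - \<nu>)"
    proof -
      have "1/2 - \<nu> + 1 = 3/2 - \<nu>" by simp
      with Gamma_plus1[OF n2] show ?thesis by simp
    qed
    have refl: "Gamma (1/2 + \<nu>) * Gamma (1/2 - \<nu>) = pi / cos (pi * \<nu>)"
    proof -
      have "Gamma (complex_of_real (1/2 + \<nu>)) * Gamma (1 - complex_of_real (1/2 + \<nu>)) = of_real pi / sin (of_real pi * complex_of_real (1/2 + \<nu>))"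
        by (rule Gamma_reflection_complex)
      moreover have "1 - complex_of_real (1/2 + \<nu>) = complex_of_real (1/2 - \<nu>)" by (simp add: complex_eq_iff)
      ultimately have "complex_of_real (Gamma (1/2 + \<nu>) * Gamma (1/2 - \<nu>)) = complex_of_real (pi / sin (pi * (1/2 + \<nu>)))"
        by (simp only: Gamma_complex_of_real of_real_mult of_real_divide sin_of_real flip: of_real_mult)
      then have "Gamma (1/2 + \<nu>) * Gamma (1/2 - \<nu>) = pi / sin (pi * (1/2 + \<nu>))" by (simp only: of_real_eq_iff)
      also have "sin (pi * (1/2 + \<nu>)) = cos (pi * \<nu>)" by (simp add: distrib_left sin_add)
      finally show ?thesis .
    qed
    have "b0 = sqrt 2 * ((1/2 + \<nu>) * (1/2 - \<nu>) * (Gamma (1/2 + \<nu>) * Gamma (1/2 - \<nu>)))"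
      unfolding b0_def cosh_coeff_0[OF \<nu>'] g1 g2 by (simp only: mult_ac)
    also have "(1/2 + \<nu>) * (1/2 - \<nu>) = - m" unfolding m_def by (simp add: algebra_simps power2_eq_square)
    finally show ?thesis unfolding refl .
  qed
  have b0: "b0 \<noteq> 0" unfolding b0_def using cosh_coeff_pos[OF \<nu>'] by simp
  have H: "hyp2F1 (complex_of_real (1/2 - \<nu>)) (complex_of_real (1/2 + \<nu>)) 2 (complex_of_real z) = complex_of_real ((1 - z) * Y / b0)"
    unfolding hyp2F1_eq[OF \<nu>' of_real_in_slit[OF z1]] Yc b0_def by simp
  define k where "k = pi / cos (pi * \<nu>)"
  have bk: "b0 = - (sqrt 2 * m * k)" using b0_eq unfolding k_def by simp
  have k: "k \<noteq> 0" using b0 unfolding bk by auto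
  have "\<psi> q = (q\<^sup>2 - M\<^sup>2) * ((M / 2) powr \<nu> / Gamma \<nu> * (sqrt pi / 2) * (M powr (- (3/2)) * Y)) / m"
    unfolding \<psi>_closed_form[OF q] PY G32 m_def by simp
  also have "\<dots> = 2 powr (1 - \<nu>) / Gamma \<nu> * sqrt (2 * pi) * M powr \<beta> * k * z * ((1 - z) * Y / b0)"
  proof -
    have p1: "(M / 2) powr \<nu> = M powr \<nu> * 2 powr (- \<nu>)" using M_pos by (simp add: powr_divide powr_minus_divide)
    have p2: "2 powr (1 - \<nu>) = 2 * 2 powr (- \<nu>)"
    proof -
      have "2 powr (1 - \<nu>) = 2 powr (1 + - \<nu>)" by simp
      also have "\<dots> = 2 powr 1 * 2 powr (- \<nu>)" by (rule powr_add)
      finally show ?thesis by simp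
    qed
    have p3: "M powr \<beta> = M\<^sup>2 * (M powr \<nu> * M powr (- (3/2)))"
    proof -
      have "M powr \<beta> = M powr (2 + (\<nu> + - (3/2)))" unfolding \<beta>_def by (rule arg_cong) simp
      also have "\<dots> = M powr 2 * (M powr \<nu> * M powr (- (3/2)))" by (simp only: powr_add)
      finally show ?thesis using M_pos by simp
    qed
    have zz: "M\<^sup>2 * (z * (1 - z)) = (M\<^sup>2 - q\<^sup>2) / 4"
      unfolding z3 unfolding z_def using M_pos by (simp add: field_simps power2_eq_square)
    have s: "sqrt (2 * pi) = sqrt 2 * sqrt pi" by (rule real_sqrt_mult)
    define A B where "A = M powr \<nu> * 2 powr (- \<nu>)" and "B = M powr (- (3/2))"
    have "2 powr (1 - \<nu>) / Gamma \<nu> * sqrt (2 * pi) * M powr \<beta> * k * z * ((1 - z) * Y / b0)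
      = 2 * A * B / Gamma \<nu> * (sqrt 2 * sqrt pi) * k * (M\<^sup>2 * (z * (1 - z))) * Y / b0"
      unfolding p2 p3 s A_def B_def by (simp add: mult_ac)
    also have "\<dots> = 2 * A * B / Gamma \<nu> * (sqrt 2 * sqrt pi) * k * ((M\<^sup>2 - q\<^sup>2) / 4) * Y / (- (sqrt 2 * m * k))"
      unfolding zz bk ..
    also have "\<dots> = (q\<^sup>2 - M\<^sup>2) * (A / Gamma \<nu> * (sqrt pi / 2) * (B * Y)) / m"
      using m k Gamma_\<nu>_pos by (simp add: field_simps)
    finally show ?thesis unfolding p1 A_def B_def by simp
  qed
  finally show ?thesis unfolding z_def[symmetric] H k_def by (simp only: of_real_mult)
qed

section \<open>The stable exponent as an integral against the Levy measure\<close>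

definition \<kappa> :: "real \<Rightarrow> real" where "\<kappa> q = Gamma (- \<beta>) * q powr \<beta>"

text \<open>Taylor's formula with integral remainder, e^(- x) - 1 + x = x^2 times the integral of (1
  - a) e^(- a x) over a in [0, 1], followed by Tonelli: the x-integral is a Gamma integral, the
  a-integral is Beta (\<beta> - 1) 2.\<close>

lemma stable_exponent_unit:
  "(\<integral>\<^sup>+x. ennreal (indicator {0<..} x * ((exp (- x) - 1 + x) * x powr (- 1 - \<beta>))) \<partial>lborel) = ennreal (Gamma (- \<beta>))"
proof -
  define f where "f x a = ennreal (indicator {0<..} x * (indicator {0..1} a * ((1 - a) * (x powr (2 - \<beta> - 1) * exp (- a * x)))))" for x a :: real
  have [measurable]: "case_prod f \<in> borel_measurable (lborel \<Otimes>\<^sub>M lborel)" unfolding f_def by measurable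
  have 1: "ennreal (indicator {0<..} x * ((exp (- x) - 1 + x) * x powr (- 1 - \<beta>))) = (\<integral>\<^sup>+a. f x a \<partial>lborel)" for x
  proof (cases "0 < x")
    case x: True
    have p: "x powr (2 - \<beta> - 1) = x powr (- 1 - \<beta>) * x\<^sup>2"
    proof -
      have "x powr (2 - \<beta> - 1) = x powr (- 1 - \<beta> + 2)" by (rule arg_cong) simp
      also have "\<dots> = x powr (- 1 - \<beta>) * x powr 2" by (rule powr_add)
      finally show ?thesis using x by simp
    qed
    have "(\<integral>\<^sup>+a. f x a \<partial>lborel) = (\<integral>\<^sup>+a. ennreal (x powr (- 1 - \<beta>)) * (ennreal ((1 - a) * (x\<^sup>2 * exp (- a * x))) * indicator {0..1} a) \<partial>lborel)"
      unfolding f_def p using x by (intro nn_integral_cong) (auto simp: indicator_def mult_ac simp flip: ennreal_mult')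
    also have "\<dots> = ennreal (x powr (- 1 - \<beta>)) * (\<integral>\<^sup>+a. ennreal ((1 - a) * (x\<^sup>2 * exp (- a * x))) * indicator {0..1} a \<partial>lborel)"
      by (rule nn_integral_cmult) measurable
    also have "(\<integral>\<^sup>+a. ennreal ((1 - a) * (x\<^sup>2 * exp (- a * x))) * indicator {0..1} a \<partial>lborel)
        = ennreal ((- (1 - 1) * x * exp (- 1 * x) + exp (- 1 * x)) - (- (1 - 0) * x * exp (- 0 * x) + exp (- 0 * x)))"
    proof (rule nn_integral_FTC_Icc)
      fix a :: real
      show "((\<lambda>a. - (1 - a) * x * exp (- a * x) + exp (- a * x)) has_real_derivative (1 - a) * (x\<^sup>2 * exp (- a * x))) (at a)"
        by (auto intro!: derivative_eq_intros simp: algebra_simps power2_eq_square)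
    qed auto
    also have "ennreal (x powr (- 1 - \<beta>)) * \<dots> = ennreal (x powr (- 1 - \<beta>) * (exp (- x) - 1 + x))"
      by (subst ennreal_mult'[symmetric]) (auto simp: algebra_simps)
    finally show ?thesis using x by (simp add: mult.commute)
  qed (simp add: f_def)
  have 2: "(\<integral>\<^sup>+x. f x a \<partial>lborel) = ennreal (Gamma (2 - \<beta>)) * ennreal (indicator {0..1} a * (a powr (\<beta> - 1 - 1) * (1 - a) powr (2 - 1)))" if "a \<noteq> 0" for a
  proof (cases "0 < a \<and> a \<le> 1")
    case a: True
    have "(\<integral>\<^sup>+x. f x a \<partial>lborel) = (\<integral>\<^sup>+x. ennreal (1 - a) * ennreal (indicator {0<..} x * (x powr (2 - \<beta> - 1) * exp (- a * x))) \<partial>lborel)"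
      unfolding f_def using a by (intro nn_integral_cong) (auto simp: indicator_def simp flip: ennreal_mult')
    also have "\<dots> = ennreal (1 - a) * (\<integral>\<^sup>+x. ennreal (indicator {0<..} x * (x powr (2 - \<beta> - 1) * exp (- a * x))) \<partial>lborel)"
      by (rule nn_integral_cmult) measurable
    also have "\<dots> = ennreal (1 - a) * ennreal (Gamma (2 - \<beta>) / a powr (2 - \<beta>))"
      using a \<beta> by (subst nn_integral_Gamma_rate) auto
    also have "\<dots> = ennreal ((1 - a) * (Gamma (2 - \<beta>) / a powr (2 - \<beta>)))" using a by (subst ennreal_mult') auto
    also have "(1 - a) * (Gamma (2 - \<beta>) / a powr (2 - \<beta>)) = Gamma (2 - \<beta>) * (a powr (\<beta> - 1 - 1) * (1 - a) powr (2 - 1))"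
    proof -
      have "a powr (\<beta> - 1 - 1) = a powr (- (2 - \<beta>))" by (rule arg_cong) simp
      also have "\<dots> = 1 / a powr (2 - \<beta>)" by (rule powr_minus_divide)
      finally have e: "a powr (\<beta> - 1 - 1) = 1 / a powr (2 - \<beta>)" .
      have "(1 - a) powr (2 - 1) = 1 - a" using a by (cases "a = 1") auto
      then show ?thesis unfolding e by simp
    qed
    also have "ennreal \<dots> = ennreal (Gamma (2 - \<beta>)) * ennreal (a powr (\<beta> - 1 - 1) * (1 - a) powr (2 - 1))"
      using \<beta> by (intro ennreal_mult') (auto intro!: less_imp_le Gamma_real_pos)
    finally show ?thesis using a by simp
  qed (use that in \<open>auto simp: f_def indicator_def\<close>)
  have B: "(\<integral>\<^sup>+a. ennreal (indicator {0..1} a * (a powr (\<beta> - 1 - 1) * (1 - a) powr (2 - 1))) \<partial>lborel) = ennreal (Beta (\<beta> - 1) 2)"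
  proof -
    have i: "set_integrable lborel {0..1} (\<lambda>a. a powr (\<beta> - 1 - 1) * (1 - a) powr (2 - 1))"
      by (rule integrable_Beta) (use \<beta> in auto)
    have hi: "((\<lambda>a. a powr (\<beta> - 1 - 1) * (1 - a) powr (2 - 1)) has_integral Beta (\<beta> - 1) 2) {0..1}"
      by (rule has_integral_Beta_real) (use \<beta> in auto)
    have "(LINT a:{0..1}|lborel. a powr (\<beta> - 1 - 1) * (1 - a) powr (2 - 1)) = Beta (\<beta> - 1) 2"
      using set_borel_integral_eq_integral(2)[OF i] integral_unique[OF hi] by simp
    then show ?thesis using nn_integral_eq_integral[OF i[unfolded set_integrable_def]]
      by (simp add: set_lebesgue_integral_def)
  qed
  have B2: "Gamma (2 - \<beta>) * Beta (\<beta> - 1) 2 = Gamma (- \<beta>)"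
  proof -
    have n: "\<beta> - 1 \<notin> \<int>\<^sub>\<le>\<^sub>0" "\<beta> \<notin> \<int>\<^sub>\<le>\<^sub>0" using nonpos_Ints_nonpos[of "\<beta> - 1"] nonpos_Ints_nonpos[of \<beta>] \<beta> by auto
    have "Gamma (\<beta> - 1 + 2) = \<beta> * ((\<beta> - 1) * Gamma (\<beta> - 1))"
      using Gamma_plus1[OF n(1)] Gamma_plus1[OF n(2)] by (simp add: add.commute)
    moreover have "Gamma (2 :: real) = 1" using Gamma_fact[of 1, where ?'a=real] by simp
    moreover have "0 < Gamma (\<beta> - 1)" using \<beta> by (intro Gamma_real_pos) auto
    ultimately have "Beta (\<beta> - 1) 2 = 1 / (\<beta> * (\<beta> - 1))" unfolding Beta_def by simp
    moreover have "\<beta> * (\<beta> - 1) = \<nu>\<^sup>2 - 1 / 4" unfolding \<beta>_def by (simp add: algebra_simps power2_eq_square)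
    ultimately show ?thesis unfolding Gamma_2\<beta> using \<nu>_sq_pos by simp
  qed
  have "(\<integral>\<^sup>+x. ennreal (indicator {0<..} x * ((exp (- x) - 1 + x) * x powr (- 1 - \<beta>))) \<partial>lborel) = (\<integral>\<^sup>+x. \<integral>\<^sup>+a. f x a \<partial>lborel \<partial>lborel)"
    unfolding 1 ..
  also have "\<dots> = (\<integral>\<^sup>+a. \<integral>\<^sup>+x. f x a \<partial>lborel \<partial>lborel)"
    by (rule lborel_pair.Fubini'[symmetric]) measurable
  also have "\<dots> = (\<integral>\<^sup>+a. ennreal (Gamma (2 - \<beta>)) * ennreal (indicator {0..1} a * (a powr (\<beta> - 1 - 1) * (1 - a) powr (2 - 1))) \<partial>lborel)"
    by (intro nn_integral_cong_AE AE_I[where N="{0}"]) (use 2 in auto)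
  also have "\<dots> = ennreal (Gamma (2 - \<beta>)) * ennreal (Beta (\<beta> - 1) 2)"
    unfolding B[symmetric] by (rule nn_integral_cmult) measurable
  also have "\<dots> = ennreal (Gamma (- \<beta>))"
    unfolding B2[symmetric] using \<beta> by (intro ennreal_mult'[symmetric]) (auto intro!: less_imp_le Gamma_real_pos)
  finally show ?thesis .
qed

lemma stable_exponent:
  assumes q: "0 < q"
  shows "has_bochner_integral lborel (\<lambda>x. indicator {0<..} x * ((exp (- q * x) - 1 + q * x) * x powr (- 1 - \<beta>))) (\<kappa> q)"
proof (rule has_bochner_integral_nn_integral)
  have k: "0 \<le> exp (- y) - 1 + y" for y :: real using exp_ge_add_one_self[of "- y"] by linarith
  show "AE x in lborel. 0 \<le> indicator {0<..} x * ((exp (- q * x) - 1 + q * x) * x powr (- 1 - \<beta>))"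
    using k[of "q * _"] by (intro AE_I2) auto
  show "0 \<le> \<kappa> q" unfolding \<kappa>_def using Gamma_\<beta>_pos by simp
  have "ennreal (Gamma (- \<beta>)) = ennreal q * (\<integral>\<^sup>+x. ennreal (indicator {0<..} (0 + q * x) * ((exp (- (0 + q * x)) - 1 + (0 + q * x)) * (0 + q * x) powr (- 1 - \<beta>))) \<partial>lborel)"
    unfolding stable_exponent_unit[symmetric] using q
    by (subst nn_integral_real_affine[where c=q and t=0]) auto
  also have "\<dots> = (\<integral>\<^sup>+x. ennreal q * ennreal (indicator {0<..} (0 + q * x) * ((exp (- (0 + q * x)) - 1 + (0 + q * x)) * (0 + q * x) powr (- 1 - \<beta>))) \<partial>lborel)"
    by (rule nn_integral_cmult[symmetric]) measurable
  also have "\<dots> = (\<integral>\<^sup>+x. ennreal (q powr (- \<beta>)) * ennreal (indicator {0<..} x * ((exp (- q * x) - 1 + q * x) * x powr (- 1 - \<beta>))) \<partial>lborel)"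
  proof (intro nn_integral_cong)
    fix x :: real
    show "ennreal q * ennreal (indicator {0<..} (0 + q * x) * ((exp (- (0 + q * x)) - 1 + (0 + q * x)) * (0 + q * x) powr (- 1 - \<beta>)))
      = ennreal (q powr (- \<beta>)) * ennreal (indicator {0<..} x * ((exp (- q * x) - 1 + q * x) * x powr (- 1 - \<beta>)))"
    proof (cases "0 < x")
      case x: True
      have "q powr (- \<beta>) = q powr (1 + (- 1 - \<beta>))" by simp
      also have "\<dots> = q * q powr (- 1 - \<beta>)" using q unfolding powr_add by simp
      finally have e: "q powr (- \<beta>) = q * q powr (- 1 - \<beta>)" .
      have "(0 + q * x) powr (- 1 - \<beta>) = q powr (- 1 - \<beta>) * x powr (- 1 - \<beta>)" using q x by (simp only: powr_mult add_0)
      then have eq: "q * ((exp (- (0 + q * x)) - 1 + (0 + q * x)) * (0 + q * x) powr (- 1 - \<beta>)) = q powr (- \<beta>) * ((exp (- q * x) - 1 + q * x) * x powr (- 1 - \<beta>))"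
        unfolding e by simp
      have L: "indicator {0<..} (0 + q * x) = (1::real)" and R: "indicator {0<..} x = (1::real)" using x q by auto
      show ?thesis
        unfolding L R mult_1_left ennreal_mult'[OF less_imp_le[OF q], symmetric] ennreal_mult'[OF powr_ge_zero, symmetric] eq ..
    qed (use q in \<open>simp add: zero_less_mult_iff\<close>)
  qed
  also have "\<dots> = ennreal (q powr (- \<beta>)) * (\<integral>\<^sup>+x. ennreal (indicator {0<..} x * ((exp (- q * x) - 1 + q * x) * x powr (- 1 - \<beta>))) \<partial>lborel)"
    by (rule nn_integral_cmult) measurable
  finally have *: "ennreal (Gamma (- \<beta>)) = \<dots>" .
  have "ennreal (\<kappa> q) = ennreal (q powr \<beta>) * ennreal (Gamma (- \<beta>))"
    unfolding \<kappa>_def by (subst ennreal_mult'[symmetric]) (auto simp: mult.commute)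
  also have "\<dots> = ennreal (q powr \<beta> * q powr (- \<beta>)) * (\<integral>\<^sup>+x. ennreal (indicator {0<..} x * ((exp (- q * x) - 1 + q * x) * x powr (- 1 - \<beta>))) \<partial>lborel)"
    unfolding * by (subst ennreal_mult') (auto simp: mult.assoc)
  also have "q powr \<beta> * q powr (- \<beta>) = 1" using q by (simp flip: powr_add)
  finally show "(\<integral>\<^sup>+x. ennreal (indicator {0<..} x * ((exp (- q * x) - 1 + q * x) * x powr (- 1 - \<beta>))) \<partial>lborel) = ennreal (\<kappa> q)" by simp
qed measurable

text \<open>The combination of q = 2 with twice q = 1 removes the compensating linear term and
  leaves a nonnegative function, (1 - e^(- x))^2. Its integral will be compared with the
  corresponding one-step means of the process.\<close>

lemma stable_second_difference:
  "has_bochner_integral lborel (\<lambda>x. indicator {0<..} x * ((1 - exp (- x))\<^sup>2 * x powr (- 1 - \<beta>))) (\<kappa> 2 - 2 * \<kappa> 1)"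
proof -
  have "has_bochner_integral lborel (\<lambda>x. indicator {0<..} x * ((exp (- 2 * x) - 1 + 2 * x) * x powr (- 1 - \<beta>))
      - 2 * (indicator {0<..} x * ((exp (- 1 * x) - 1 + 1 * x) * x powr (- 1 - \<beta>)))) (\<kappa> 2 - 2 * \<kappa> 1)"
    by (intro has_bochner_integral_diff has_bochner_integral_mult_right stable_exponent) auto
  also have "(\<lambda>x. indicator {0<..} x * ((exp (- 2 * x) - 1 + 2 * x) * x powr (- 1 - \<beta>))
      - 2 * (indicator {0<..} x * ((exp (- 1 * x) - 1 + 1 * x) * x powr (- 1 - \<beta>))))
    = (\<lambda>x. indicator {0<..} x * ((1 - exp (- x))\<^sup>2 * x powr (- 1 - \<beta>)))"
  proof
    fix x :: real
    have "exp (- 2 * x) = exp (- x) * exp (- x)" by (simp flip: exp_add)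
    then have "(exp (- 2 * x) - 1 + 2 * x) - 2 * (exp (- 1 * x) - 1 + 1 * x) = (1 - exp (- x))\<^sup>2"
      by (simp add: power2_eq_square algebra_simps)
    then have "(1 - exp (- x))\<^sup>2 * x powr (- 1 - \<beta>) = ((exp (- 2 * x) - 1 + 2 * x) - 2 * (exp (- 1 * x) - 1 + 1 * x)) * x powr (- 1 - \<beta>)"
      by simp
    then show "indicator {0<..} x * ((exp (- 2 * x) - 1 + 2 * x) * x powr (- 1 - \<beta>))
      - 2 * (indicator {0<..} x * ((exp (- 1 * x) - 1 + 1 * x) * x powr (- 1 - \<beta>))) = indicator {0<..} x * ((1 - exp (- x))\<^sup>2 * x powr (- 1 - \<beta>))"
      by (cases "0 < x") (simp_all add: algebra_simps)
  qed
  finally show ?thesis .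
qed

text \<open>\<psi> vanishes at M by the closed form and is unbounded, since q^\<beta> grows while
  \<open>A\<close> stays bounded on [M, infinity). Hence every argument s <= 0 of u has the form -
  \<psi> q.\<close>

lemma \<psi>_surj:
  assumes "0 \<le> y"
  shows "\<exists>q\<ge>M. \<psi> q = y"
proof -
  have \<psi>M: "\<psi> M = 0" using \<psi>_closed_form[OF M_pos] by simp
  have cont: "isCont \<psi> q" if "0 < q" for q
  proof -
    have "(A has_field_derivative - A1 q) (at q)"
      using laplace_has_derivative[OF ok_k0 that] unfolding A_def A1_def .
    then have "isCont A q" by (rule DERIV_isCont)
    then show ?thesis unfolding \<psi>_def using that by (intro continuous_intros) auto
  qed
  have lim: "LIM q at_top. \<kappa> q :> at_top"
  proof -
    have "0 < \<beta>" using \<beta> by simp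
    then have "LIM q at_top. q powr \<beta> :> at_top" by real_asymp
    then show ?thesis unfolding \<kappa>_def using Gamma_\<beta>_pos
      by (intro filterlim_tendsto_pos_mult_at_top[OF tendsto_const])
  qed
  define K where "K = C * Gamma (2 - \<beta>) * M powr (\<beta> - 2)"
  have "\<forall>\<^sub>F q in at_top. y + K \<le> \<kappa> q \<and> M \<le> q"
    using lim eventually_ge_at_top[of M] by (auto simp: filterlim_at_top eventually_conj_iff)
  then obtain q1 where q1: "y + K \<le> \<kappa> q1" "M \<le> q1" using eventually_happens' trivial_limit_at_top_linorder by blast
  have "A q1 \<le> C * Gamma (2 - \<beta>) * q1 powr (\<beta> - 2)"
    using A_bound[of q1] q1 M_pos by linarith
  also have "\<dots> \<le> K" unfolding K_def using C_pos \<beta> q1 M_pos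
    by (intro mult_left_mono powr_mono2') (auto intro!: mult_nonneg_nonneg less_imp_le Gamma_real_pos)
  finally have "y \<le> \<psi> q1" using q1 unfolding \<psi>_def \<kappa>_def by linarith
  then have "\<exists>q. M \<le> q \<and> q \<le> q1 \<and> \<psi> q = y"
    using q1 assms \<psi>M M_pos by (intro IVT) (auto intro!: cont)
  then show ?thesis by blast
qed

end

section \<open>Cadlag paths and their jumps\<close>

lemma cadlag_right: "cadlag f \<Longrightarrow> 0 \<le> t \<Longrightarrow> (f \<longlongrightarrow> f t) (at_right t)"
  unfolding cadlag_def by blast

lemma cadlag_left:
  assumes "cadlag f" "0 < t"
  shows "(f \<longlongrightarrow> f t - jump f t) (at_left t)"
proof -
  from assms obtain l where l: "(f \<longlongrightarrow> l) (at_left t)" unfolding cadlag_def by blast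
  then have "Lim (at_left t) f = l" by (intro tendsto_Lim) auto
  with l show ?thesis unfolding jump_def by simp
qed

lemma cadlag_sequentially_right:
  assumes "cadlag f" "0 \<le> t" "r \<longlonglongrightarrow> t" "\<And>n. t \<le> r n"
  shows "(\<lambda>n. f (r n)) \<longlonglongrightarrow> f t"
proof -
  have "continuous (at t within {t..}) f"
    using cadlag_right[OF assms(1,2)] by (simp add: continuous_within at_within_Ici_at_right)
  then show ?thesis using assms(3,4) unfolding continuous_within_sequentially comp_def by auto
qed

lemma cadlag_sequentially_left:
  assumes "cadlag f" "0 < t" "l \<longlonglongrightarrow> t" "\<And>n. l n < t"
  shows "(\<lambda>n. f (l n)) \<longlonglongrightarrow> f t - jump f t"
  by (rule filterlim_compose[OF cadlag_left[OF assms(1,2)]])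
     (use assms(3) less_imp_neq[OF assms(4)] assms(4) in \<open>auto simp: filterlim_at intro!: always_eventually\<close>)

text \<open>For t > 0 the index i of the dyadic interval (i / 2^n, (i + 1) / 2^n] containing t. The
  left end is excluded, so that it lies strictly before t and a jump at t falls into the increment
  over this cell.\<close>

definition cell :: "nat \<Rightarrow> real \<Rightarrow> nat" where "cell n t = nat (\<lceil>2 ^ n * t\<rceil> - 1)"

lemma cell_bounds:
  assumes "0 < t"
  shows "real (cell n t) / 2 ^ n < t" "t \<le> (real (cell n t) + 1) / 2 ^ n"
proof -
  have "0 < 2 ^ n * t" using assms by simp
  then have c: "real (cell n t) = of_int \<lceil>2 ^ n * t\<rceil> - 1" unfolding cell_def by simp
  have "of_int \<lceil>2 ^ n * t\<rceil> - 1 < 2 ^ n * t" "2 ^ n * t \<le> of_int \<lceil>2 ^ n * t\<rceil>" by linarith+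
  then show "real (cell n t) / 2 ^ n < t" "t \<le> (real (cell n t) + 1) / 2 ^ n" unfolding c by (auto simp: field_simps)
qed

lemma cell_unique:
  assumes "real i / 2 ^ n < t" "t \<le> (real i + 1) / 2 ^ n"
  shows "cell n t = i"
proof -
  have t: "0 < t" using assms(1) by (rule le_less_trans[rotated]) simp
  have "real i < real (cell n t) + 1" "real (cell n t) < real i + 1"
    using assms cell_bounds[OF t, of n] by (auto simp: field_simps)
  then show ?thesis by linarith
qed

lemma tendsto_inverse_2_power: "(\<lambda>n. 1 / 2 ^ n :: real) \<longlonglongrightarrow> 0"
  using LIMSEQ_inverse_realpow_zero[of 2] by (simp add: inverse_eq_divide)

lemma cell_limits:
  assumes "0 < t"
  shows "(\<lambda>n. real (cell n t) / 2 ^ n) \<longlonglongrightarrow> t" "(\<lambda>n. (real (cell n t) + 1) / 2 ^ n) \<longlonglongrightarrow> t"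
proof -
  have "t \<le> real (cell n t) / 2 ^ n + 1 / 2 ^ n" for n
    using cell_bounds(2)[OF assms, of n] by (simp only: add_divide_distrib)
  then have 1: "t - 1 / 2 ^ n \<le> real (cell n t) / 2 ^ n" for n by (simp only: diff_le_eq)
  have "(\<lambda>n. t - 1 / 2 ^ n) \<longlonglongrightarrow> t - 0" by (intro tendsto_diff tendsto_const tendsto_inverse_2_power)
  then have 0: "(\<lambda>n. t - 1 / 2 ^ n) \<longlonglongrightarrow> t" by simp
  show 2: "(\<lambda>n. real (cell n t) / 2 ^ n) \<longlonglongrightarrow> t"
    by (rule tendsto_sandwich[OF always_eventually always_eventually 0 tendsto_const])
       (use 1 less_imp_le[OF cell_bounds(1)[OF assms]] in blast)+
  have "(\<lambda>n. real (cell n t) / 2 ^ n + 1 / 2 ^ n) \<longlonglongrightarrow> t + 0" by (intro tendsto_add 2 tendsto_inverse_2_power)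
  then show "(\<lambda>n. (real (cell n t) + 1) / 2 ^ n) \<longlonglongrightarrow> t" by (simp add: add_divide_distrib)
qed

lemma grid_less_iff: "real a / 2 ^ n < real b / 2 ^ n \<longleftrightarrow> a < b"
  by (simp only: divide_less_cancel of_nat_less_iff) simp

definition incr :: "(real \<Rightarrow> real) \<Rightarrow> nat \<Rightarrow> nat \<Rightarrow> real" where
  "incr f n i = f ((real i + 1) / 2 ^ n) - f (real i / 2 ^ n)"

text \<open>The right ends approach t from times >= t and see the value, the left ends approach from
  times < t and see the left limit.\<close>

lemma incr_cell_tendsto:
  assumes "cadlag f" "0 < t"
  shows "(\<lambda>n. incr f n (cell n t)) \<longlonglongrightarrow> jump f t"
proof -
  have "(\<lambda>n. f ((real (cell n t) + 1) / 2 ^ n) - f (real (cell n t) / 2 ^ n)) \<longlonglongrightarrow> f t - (f t - jump f t)"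
    by (rule tendsto_diff[OF
          cadlag_sequentially_right[OF assms(1) less_imp_le[OF assms(2)] cell_limits(2)[OF assms(2)] cell_bounds(2)[OF assms(2)]]
          cadlag_sequentially_left[OF assms cell_limits(1)[OF assms(2)] cell_bounds(1)[OF assms(2)]]])
  then show ?thesis unfolding incr_def by simp
qed

text \<open>To the right of t the path stays within e / 2 of f t, to the left within e / 2 of the
  left limit. An interval straddling t adds the jump, which is why the first bound has 2 e and
  excludes a jump of size at least e; intervals on one side of t satisfy the second bound.\<close>

lemma cadlag_local_oscillation:
  assumes f: "cadlag f" and t: "0 \<le> t" and e: "0 < e"
  obtains \<delta> where "0 < \<delta>"
    "\<And>u v. 0 \<le> u \<Longrightarrow> u \<le> v \<Longrightarrow> t - \<delta> < u \<Longrightarrow> v < t + \<delta> \<Longrightarrow> \<not> (u < t \<and> t \<le> v \<and> e \<le> \<bar>jump f t\<bar>) \<Longrightarrow> \<bar>f v - f u\<bar> < 2 * e"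
    "\<And>u v. 0 \<le> u \<Longrightarrow> u \<le> v \<Longrightarrow> t - \<delta> < u \<Longrightarrow> v < t + \<delta> \<Longrightarrow> \<not> (u < t \<and> t \<le> v) \<Longrightarrow> \<bar>f v - f u\<bar> < e"
proof -
  have "\<forall>\<^sub>F s in at_right t. dist (f s) (f t) < e / 2"
    using cadlag_right[OF f t] e by (intro tendstoD) auto
  then obtain b1 where b1: "t < b1" "\<And>s. t < s \<Longrightarrow> s < b1 \<Longrightarrow> \<bar>f s - f t\<bar> < e / 2"
    unfolding eventually_at_right_field dist_real_def by blast
  then have R: "\<bar>f s - f t\<bar> < e / 2" if "t \<le> s" "s < b1" for s
    using that e by (cases "s = t") auto
  define l where "l = f t - jump f t"
  have "\<exists>b<t. \<forall>s. 0 \<le> s \<longrightarrow> b < s \<longrightarrow> s < t \<longrightarrow> \<bar>f s - l\<bar> < e / 2"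
  proof (cases "t = 0")
    case False
    then have "\<forall>\<^sub>F s in at_left t. dist (f s) l < e / 2"
      using cadlag_left[OF f, of t] t e unfolding l_def by (intro tendstoD) auto
    then show ?thesis unfolding eventually_at_left_field dist_real_def by blast
  qed (auto intro!: exI[of _ "-1"])
  then obtain b2 where b2: "b2 < t" and L: "\<And>s. 0 \<le> s \<Longrightarrow> b2 < s \<Longrightarrow> s < t \<Longrightarrow> \<bar>f s - l\<bar> < e / 2" by blast
  define \<delta> where "\<delta> = min (b1 - t) (t - b2)"
  have \<delta>: "\<delta> \<le> b1 - t" "\<delta> \<le> t - b2" "0 < \<delta>" using b1(1) b2 unfolding \<delta>_def by simp_all
  have 3: "\<bar>f v - f u\<bar> < e" if uv: "0 \<le> u" "u \<le> v" "t - \<delta> < u" "v < t + \<delta>" "\<not> (u < t \<and> t \<le> v)" for u v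
  proof (cases "v < t")
    case True
    have "\<bar>f u - l\<bar> < e / 2" by (rule L) (use True uv \<delta> in linarith)+
    moreover have "\<bar>f v - l\<bar> < e / 2" by (rule L) (use True uv \<delta> in linarith)+
    ultimately show ?thesis by linarith
  next
    case False
    then have "t \<le> u" using uv(5) by linarith
    then have "\<bar>f u - f t\<bar> < e / 2" by (rule R) (use uv \<delta> in linarith)
    moreover have "\<bar>f v - f t\<bar> < e / 2" by (rule R) (use \<open>t \<le> u\<close> uv \<delta> in linarith)+
    ultimately show ?thesis by linarith
  qed
  have 2: "\<bar>f v - f u\<bar> < 2 * e" if uv: "0 \<le> u" "u \<le> v" "t - \<delta> < u" "v < t + \<delta>" "\<not> (u < t \<and> t \<le> v \<and> e \<le> \<bar>jump f t\<bar>)" for u v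
  proof (cases "u < t \<and> t \<le> v")
    case True
    have "\<bar>f u - l\<bar> < e / 2" by (rule L) (use True uv(1-4) \<delta> in linarith)+
    moreover have "\<bar>f v - f t\<bar> < e / 2" by (rule R) (use True uv(1-4) \<delta> in linarith)+
    moreover have "\<bar>jump f t\<bar> < e" using True uv(5) by linarith
    moreover have "f t - l = jump f t" unfolding l_def by simp
    ultimately show ?thesis by linarith
  next
    case False
    from 3[OF uv(1-4) False] e show ?thesis by linarith
  qed
  from that[OF \<delta>(3) 2 3] show ?thesis .
qed

definition big_jumps :: "(real \<Rightarrow> real) \<Rightarrow> real \<Rightarrow> real \<Rightarrow> real set" where
  "big_jumps f e T = {t. 0 < t \<and> t \<le> T \<and> e \<le> \<bar>jump f t\<bar>}"

text \<open>Infinitely many large jumps would accumulate at some t. A jump close to t but different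
  from t lies on one side of t, where the oscillation is below e / 2.\<close>

lemma finite_big_jumps:
  assumes f: "cadlag f" and e: "0 < e"
  shows "finite (big_jumps f e T)"
proof (rule ccontr)
  assume inf: "infinite (big_jumps f e T)"
  have "big_jumps f e T \<subseteq> {0..T}" unfolding big_jumps_def by auto
  with inf obtain t where t: "t \<in> {0..T}" "t islimpt big_jumps f e T"
    using compact_Icc[of 0 T] unfolding compact_eq_Bolzano_Weierstrass by blast
  obtain \<delta> where \<delta>: "0 < \<delta>"
    "\<And>u v. 0 \<le> u \<Longrightarrow> u \<le> v \<Longrightarrow> t - \<delta> < u \<Longrightarrow> v < t + \<delta> \<Longrightarrow> \<not> (u < t \<and> t \<le> v) \<Longrightarrow> \<bar>f v - f u\<bar> < e / 2"
  proof -
    have "0 \<le> t" "0 < e / 2" using t e by auto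
    from cadlag_local_oscillation[OF f this] that show ?thesis by metis
  qed
  from t(2) \<delta>(1) obtain s where s: "s \<in> big_jumps f e T" "s \<noteq> t" "dist s t < \<delta>"
    unfolding islimpt_approachable by blast
  then have s0: "0 < s" "e \<le> \<bar>jump f s\<bar>" "\<bar>s - t\<bar> < \<delta>" unfolding big_jumps_def dist_real_def by auto
  have "((\<lambda>u. \<bar>f s - f u\<bar>) \<longlongrightarrow> \<bar>f s - (f s - jump f s)\<bar>) (at_left s)"
    by (intro tendsto_intros cadlag_left f s0)
  moreover have "\<forall>\<^sub>F u in at_left s. \<bar>f s - f u\<bar> \<le> e / 2"
  proof -
    \<comment> \<open>Points u between m and s lie on the same side of t as s and within distance
      \<delta> of t.\<close>
    define m where "m = Max {0, t - \<delta>, if t < s then t else 0}"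
    have "m < s" unfolding m_def using s0 by auto
    moreover have "\<bar>f s - f u\<bar> \<le> e / 2" if "m < u" "u < s" for u
      using \<delta>(2)[of u s] that s0 s(2) unfolding m_def by (auto split: if_splits)
    ultimately show ?thesis unfolding eventually_at_left_field by blast
  qed
  ultimately have "\<bar>f s - (f s - jump f s)\<bar> \<le> e / 2"
    by (rule tendsto_upperbound) simp
  with s0 e show False by simp
qed

text \<open>By compactness, bad intervals with lengths tending to 0 would have a subsequence
  shrinking to one point t, where the local bound already forbids them.\<close>

lemma cadlag_uniform_oscillation:
  assumes f: "cadlag f" and e: "0 < e"
  obtains \<delta> where "0 < \<delta>"
    "\<And>u v. 0 \<le> u \<Longrightarrow> u \<le> v \<Longrightarrow> v \<le> T \<Longrightarrow> v - u < \<delta> \<Longrightarrow> {u<..v} \<inter> big_jumps f e T = {} \<Longrightarrow> \<bar>f v - f u\<bar> < 2 * e"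
proof -
  have "\<exists>\<delta>>0. \<forall>u v. 0 \<le> u \<and> u \<le> v \<and> v \<le> T \<and> v - u < \<delta> \<and> {u<..v} \<inter> big_jumps f e T = {} \<longrightarrow> \<bar>f v - f u\<bar> < 2 * e"
  proof (rule ccontr)
    assume neg: "\<not> ?thesis"
    have "\<exists>u v. 0 \<le> u \<and> u \<le> v \<and> v \<le> T \<and> v - u < 1 / 2 ^ n \<and> {u<..v} \<inter> big_jumps f e T = {} \<and> \<not> \<bar>f v - f u\<bar> < 2 * e" for n :: nat
    proof -
      have "(0::real) < 1 / 2 ^ n" by simp
      with neg show ?thesis by blast
    qed
    then obtain u v where uv: "\<And>n::nat. 0 \<le> u n" "\<And>n. u n \<le> v n" "\<And>n. v n \<le> T" "\<And>n. v n - u n < 1 / 2 ^ n"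
      "\<And>n. {u n<..v n} \<inter> big_jumps f e T = {}" "\<And>n. \<not> \<bar>f (v n) - f (u n)\<bar> < 2 * e" by metis
    have "\<forall>n. u n \<in> {0..T}" using uv by (auto intro: order_trans)
    then obtain t r where tr: "t \<in> {0..T}" "strict_mono (r :: nat \<Rightarrow> nat)" "(u \<circ> r) \<longlonglongrightarrow> t"
      using seq_compactE[OF compact_imp_seq_compact[OF compact_Icc[of 0 T]], of u] by blast
    have vr: "(\<lambda>n. v (r n)) \<longlonglongrightarrow> t"
    proof -
      have d0: "(\<lambda>n. 1 / 2 ^ r n :: real) \<longlonglongrightarrow> 0"
        using LIMSEQ_subseq_LIMSEQ[OF tendsto_inverse_2_power tr(2)] by (simp add: comp_def)
      have "(\<lambda>n. v (r n) - u (r n)) \<longlonglongrightarrow> 0"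
        by (rule tendsto_sandwich[OF _ _ tendsto_const d0]) (use uv(2,4) in \<open>auto intro!: always_eventually less_imp_le\<close>)
      from tendsto_add[OF this tr(3)[unfolded comp_def]] show ?thesis by simp
    qed
    from tr(1) have "0 \<le> t" by simp
    from cadlag_local_oscillation[OF f this e] obtain \<delta> where \<delta>: "0 < \<delta>"
      "\<And>u v. 0 \<le> u \<Longrightarrow> u \<le> v \<Longrightarrow> t - \<delta> < u \<Longrightarrow> v < t + \<delta> \<Longrightarrow> \<not> (u < t \<and> t \<le> v \<and> e \<le> \<bar>jump f t\<bar>) \<Longrightarrow> \<bar>f v - f u\<bar> < 2 * e"
      by metis
    have "\<forall>\<^sub>F n in sequentially. t - \<delta> < u (r n)" "\<forall>\<^sub>F n in sequentially. v (r n) < t + \<delta>"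
      using order_tendstoD(1)[OF tr(3)[unfolded comp_def], of "t - \<delta>"] order_tendstoD(2)[OF vr, of "t + \<delta>"] \<delta>(1) by auto
    then have "\<forall>\<^sub>F n in sequentially. t - \<delta> < u (r n) \<and> v (r n) < t + \<delta>" by (rule eventually_conj)
    then obtain n where n: "t - \<delta> < u (r n)" "v (r n) < t + \<delta>"
      using eventually_happens' sequentially_bot by blast
    have "\<not> (u (r n) < t \<and> t \<le> v (r n) \<and> e \<le> \<bar>jump f t\<bar>)"
    proof
      assume a: "u (r n) < t \<and> t \<le> v (r n) \<and> e \<le> \<bar>jump f t\<bar>"
      then have "t \<in> {u (r n)<..v (r n)} \<inter> big_jumps f e T"
        unfolding big_jumps_def using uv(1)[of "r n"] tr(1) by auto
      with uv(5)[of "r n"] show False by blast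
    qed
    with \<delta>(2)[OF uv(1) uv(2) n] uv(6) show False by blast
  qed
  then show ?thesis using that by blast
qed

text \<open>On a fine grid each cell contains at most one large jump, and over the other cells the
  increment is below 2 e, where F vanishes. The sum over cells thus becomes a finite sum over jumps,
  in which each increment tends to its jump.\<close>

lemma grid_sum_tendsto:
  fixes F :: "real \<Rightarrow> real" and k :: "nat \<Rightarrow> nat"
  assumes f: "cadlag f" and e: "0 < e" and F0: "\<And>x. \<bar>x\<bar> < 2 * e \<Longrightarrow> F x = 0" and cont: "\<And>x. isCont F x"
    and T: "0 \<le> T" "\<And>n. T \<le> real (k n) / 2 ^ n" "(\<lambda>n. real (k n) / 2 ^ n) \<longlonglongrightarrow> T"
    and K: "\<And>n. real (k n) / 2 ^ n \<le> K"
  shows "(\<lambda>n. \<Sum>i<k n. F (incr f n i)) \<longlonglongrightarrow> (\<Sum>t\<in>big_jumps f e T. F (jump f t))"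
proof -
  \<comment> \<open>The grid may end later than T, though never after K, so jumps between T and K
    have to be kept under control as well.\<close>
  define B where "B = big_jumps f e K"
  have finB: "finite B" unfolding B_def by (rule finite_big_jumps[OF f e])
  have TK: "T \<le> K" using T(2)[of 0] K[of 0] by simp
  have sub: "big_jumps f e T = {t\<in>B. t \<le> T}" unfolding B_def big_jumps_def using TK by auto
  have pos: "0 < t" if "t \<in> B" for t using that unfolding B_def big_jumps_def by auto
  obtain \<delta> where \<delta>: "0 < \<delta>"
    "\<And>u v. 0 \<le> u \<Longrightarrow> u \<le> v \<Longrightarrow> v \<le> K \<Longrightarrow> v - u < \<delta> \<Longrightarrow> {u<..v} \<inter> B = {} \<Longrightarrow> \<bar>f v - f u\<bar> < 2 * e"
    using cadlag_uniform_oscillation[OF f e, of K] unfolding B_def by metis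
  have ev1: "\<forall>\<^sub>F n in sequentially. 1 / 2 ^ n < \<delta>"
    using order_tendstoD(2)[OF tendsto_inverse_2_power \<delta>(1)] by simp
  have ev2: "\<forall>\<^sub>F n in sequentially. inj_on (cell n) B"
  proof -
    have "\<forall>\<^sub>F n in sequentially. \<forall>p\<in>B \<times> B. fst p < snd p \<longrightarrow> cell n (fst p) \<noteq> cell n (snd p)"
    proof (intro eventually_ball_finite ballI)
      fix p assume p: "p \<in> B \<times> B"
      show "\<forall>\<^sub>F n in sequentially. fst p < snd p \<longrightarrow> cell n (fst p) \<noteq> cell n (snd p)"
      proof (cases "fst p < snd p")
        case True
        have "\<forall>\<^sub>F n in sequentially. fst p < real (cell n (snd p)) / 2 ^ n"
          using order_tendstoD(1)[OF cell_limits(1)[of "snd p"], of "fst p"] True pos p by auto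
        then show ?thesis
        proof eventually_elim
          case (elim n)
          then show ?case using cell_bounds(1)[of "fst p" n] pos p by auto
        qed
      qed simp
    qed (use finB in simp)
    then show ?thesis
    proof eventually_elim
      case (elim n)
      then have *: "cell n s \<noteq> cell n t" if "s \<in> B" "t \<in> B" "s < t" for s t using that by force
      then show ?case by (intro linorder_inj_onI) auto
    qed
  qed
  \<comment> \<open>A large jump after T drops out of the sum once the grid ends before it. A jump
    exactly at T is always counted, because the grid ends at or after T.\<close>
  have ev3: "\<forall>\<^sub>F n in sequentially. \<forall>t\<in>B. T < t \<longrightarrow> k n \<le> cell n t"
  proof (intro eventually_ball_finite finB ballI)
    fix t assume "t \<in> B"
    show "\<forall>\<^sub>F n in sequentially. T < t \<longrightarrow> k n \<le> cell n t"
    proof (cases "T < t")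
      case True
      from order_tendstoD(2)[OF T(3) True] have "\<forall>\<^sub>F n in sequentially. real (k n) / 2 ^ n < t" .
      then show ?thesis
      proof eventually_elim
        case (elim n)
        have "real (k n) / 2 ^ n < real (cell n t + 1) / 2 ^ n"
          using less_le_trans[OF elim cell_bounds(2)[OF pos[OF \<open>t \<in> B\<close>], of n]] by (simp only: of_nat_add of_nat_1)
        then have "k n < cell n t + 1" by (simp only: grid_less_iff)
        then show ?case by simp
      qed
    qed simp
  qed
  have "\<forall>\<^sub>F n in sequentially. (\<Sum>t\<in>big_jumps f e T. F (incr f n (cell n t))) = (\<Sum>i<k n. F (incr f n i))"
    using ev1 ev2 ev3
  proof eventually_elim
    case (elim n)
    have c1: "cell n t < k n" if "t \<in> big_jumps f e T" for t
    proof -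
      have "0 < t" "t \<le> T" using that unfolding big_jumps_def by auto
      have "real (cell n t) / 2 ^ n < t" by (rule cell_bounds(1)) fact
      also have "t \<le> T" by fact
      also have "T \<le> real (k n) / 2 ^ n" by (rule T(2))
      finally have "real (cell n t) / 2 ^ n < real (k n) / 2 ^ n" .
      then show ?thesis by (simp only: grid_less_iff)
    qed
    have "(\<Sum>i<k n. F (incr f n i)) = (\<Sum>i\<in>cell n ` big_jumps f e T. F (incr f n i))"
    proof (rule sum.mono_neutral_right)
      show "\<forall>i\<in>{..<k n} - cell n ` big_jumps f e T. F (incr f n i) = 0"
      proof
        fix i assume i: "i \<in> {..<k n} - cell n ` big_jumps f e T"
        then have le: "(real i + 1) / 2 ^ n \<le> real (k n) / 2 ^ n" by (intro divide_right_mono) auto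
        have "\<bar>f ((real i + 1) / 2 ^ n) - f (real i / 2 ^ n)\<bar> < 2 * e"
        proof (rule \<delta>(2))
          show "(real i + 1) / 2 ^ n - real i / 2 ^ n < \<delta>" using elim(1) by (simp add: diff_divide_distrib[symmetric])
          show "(real i + 1) / 2 ^ n \<le> K" by (rule order_trans[OF le K])
          show "{real i / 2 ^ n<..(real i + 1) / 2 ^ n} \<inter> B = {}"
          proof safe
            fix t assume t: "t \<in> {real i / 2 ^ n<..(real i + 1) / 2 ^ n}" "t \<in> B"
            then have c: "cell n t = i" by (intro cell_unique) auto
            show "t \<in> {}"
            proof (cases "t \<le> T")
              case True
              then have "t \<in> big_jumps f e T" unfolding sub using t(2) by simp
              then have "i \<in> cell n ` big_jumps f e T" unfolding c[symmetric] by (rule imageI)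
              with i show ?thesis by blast
            next
              case False
              with elim(3) t(2) have "k n \<le> i" unfolding c[symmetric] by force
              with i show ?thesis by simp
            qed
          qed
        qed (auto simp: divide_right_mono)
        then show "F (incr f n i) = 0" unfolding incr_def by (rule F0)
      qed
    qed (use c1 in auto)
    also have "\<dots> = (\<Sum>t\<in>big_jumps f e T. F (incr f n (cell n t)))"
      by (subst sum.reindex) (use elim(2) sub in \<open>auto intro: inj_on_subset\<close>)
    finally show ?case ..
  qed
  moreover have "(\<lambda>n. \<Sum>t\<in>big_jumps f e T. F (incr f n (cell n t))) \<longlonglongrightarrow> (\<Sum>t\<in>big_jumps f e T. F (jump f t))"
    by (intro tendsto_sum isCont_tendsto_compose[OF cont] incr_cell_tendsto f) (auto simp: big_jumps_def)
  ultimately show ?thesis by (rule Lim_transform_eventually[rotated])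
qed

text \<open>Continuous, zero for |x| <= 1 / m, one for |x| >= 2 / m. A function cut off in this way
  sees only finitely many jumps in bounded time and is restored as m increases.\<close>

definition cutoff :: "nat \<Rightarrow> real \<Rightarrow> real" where
  "cutoff m x = min 1 (max 0 (real m * \<bar>x\<bar> - 1))"

lemma cutoff_bounds: "0 \<le> cutoff m x" "cutoff m x \<le> 1"
  unfolding cutoff_def by auto

lemma cutoff_mono: "m \<le> m' \<Longrightarrow> cutoff m x \<le> cutoff m' x"
  unfolding cutoff_def using mult_right_mono[of "real m" "real m'" "\<bar>x\<bar>"] by (intro min.mono max.mono) auto

lemma cutoff_continuous [continuous_intros]: "isCont (cutoff m) x"
  unfolding cutoff_def by (intro continuous_intros)

lemma cutoff_zero: "\<bar>x\<bar> \<le> 1 / real m \<Longrightarrow> cutoff m x = 0"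
  unfolding cutoff_def by (cases "m = 0") (auto simp: field_simps)

lemma cutoff_eventually_one: "x \<noteq> 0 \<Longrightarrow> \<forall>\<^sub>F m in sequentially. cutoff m x = 1"
proof -
  assume x: "x \<noteq> 0"
  obtain M :: nat where "2 / \<bar>x\<bar> < real M" using reals_Archimedean2 by blast
  then have M: "2 < real M * \<bar>x\<bar>" using x by (simp add: pos_divide_less_eq)
  have "cutoff m x = 1" if "M \<le> m" for m
  proof -
    have "real M * \<bar>x\<bar> \<le> real m * \<bar>x\<bar>" using that by (intro mult_right_mono) auto
    with M have "1 \<le> real m * \<bar>x\<bar> - 1" by linarith
    then show ?thesis unfolding cutoff_def by linarith
  qed
  then show ?thesis by (rule eventually_sequentiallyI)
qed

text \<open>An extended nonnegative sum: it is defined whether or not it converges and obeys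
  monotone convergence in F and in S.\<close>

definition jump_sum :: "(real \<Rightarrow> real) \<Rightarrow> (real \<Rightarrow> real) \<Rightarrow> real set \<Rightarrow> ennreal" where
  "jump_sum F f S = (\<integral>\<^sup>+t. ennreal (F (jump f t)) \<partial>count_space S)"

lemma jump_sum_cutoff:
  assumes f: "cadlag f" and F: "\<And>x. 0 \<le> F x" and cont: "\<And>x. isCont F x"
    and T: "0 \<le> T" "\<And>n. T \<le> real (k n) / 2 ^ n" "(\<lambda>n. real (k n) / 2 ^ n) \<longlonglongrightarrow> T"
    and K: "\<And>n. real (k n) / 2 ^ n \<le> K"
  shows "jump_sum (\<lambda>x. cutoff m x * F x) f {0<..T} < \<infinity>"
    and "(\<lambda>n. \<Sum>i<k n. cutoff m (incr f n i) * F (incr f n i)) \<longlonglongrightarrow> enn2real (jump_sum (\<lambda>x. cutoff m x * F x) f {0<..T})"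
proof -
  \<comment> \<open>For m > 0 the condition |x| < 2 e is |x| < 1 / m, where the cutoff vanishes. For
    m = 0 the cutoff is identically zero and any positive e will do.\<close>
  define e where "e = (if m = 0 then 1 else 1 / (2 * real m))"
  have e: "0 < e" unfolding e_def by auto
  have z: "cutoff m x = 0" if "\<bar>x\<bar> < 2 * e" for x
    using that unfolding e_def by (cases "m = 0") (auto simp: cutoff_def[of 0] intro!: cutoff_zero)
  let ?B = "big_jumps f e T"
  have z': "cutoff m (jump f t) = 0" if "t \<in> {0<..T}" "t \<notin> ?B" for t
  proof (rule z)
    from that have "\<bar>jump f t\<bar> < e" unfolding big_jumps_def by auto
    then show "\<bar>jump f t\<bar> < 2 * e" using e by linarith
  qed
  have 1: "jump_sum (\<lambda>x. cutoff m x * F x) f {0<..T} = (\<Sum>t\<in>?B. ennreal (cutoff m (jump f t) * F (jump f t)))"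
    unfolding jump_sum_def
  proof (rule nn_integral_count_space'[OF finite_big_jumps[OF f e]])
    show "ennreal (cutoff m (jump f t) * F (jump f t)) = 0" if "t \<in> {0<..T}" "t \<notin> ?B" for t
      unfolding z'[OF that] by simp
    show "?B \<subseteq> {0<..T}" unfolding big_jumps_def by auto
  qed
  have 2: "(\<Sum>t\<in>?B. ennreal (cutoff m (jump f t) * F (jump f t))) = ennreal (\<Sum>t\<in>?B. cutoff m (jump f t) * F (jump f t))"
    by (rule sum_ennreal) (intro mult_nonneg_nonneg cutoff_bounds F)
  have *: "jump_sum (\<lambda>x. cutoff m x * F x) f {0<..T} = ennreal (\<Sum>t\<in>?B. cutoff m (jump f t) * F (jump f t))"
    by (rule trans[OF 1 2])
  show "jump_sum (\<lambda>x. cutoff m x * F x) f {0<..T} < \<infinity>" using * by (simp only: infinity_ennreal_def ennreal_less_top)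
  have "(\<lambda>n. \<Sum>i<k n. cutoff m (incr f n i) * F (incr f n i)) \<longlonglongrightarrow> (\<Sum>t\<in>?B. cutoff m (jump f t) * F (jump f t))"
    by (rule grid_sum_tendsto[OF f e _ _ T K, of "\<lambda>x. cutoff m x * F x"]) (auto simp: z intro!: continuous_intros cont)
  moreover
  have "0 \<le> (\<Sum>t\<in>?B. cutoff m (jump f t) * F (jump f t))"
    by (intro sum_nonneg mult_nonneg_nonneg cutoff_bounds F)
  then have "enn2real (jump_sum (\<lambda>x. cutoff m x * F x) f {0<..T}) = (\<Sum>t\<in>?B. cutoff m (jump f t) * F (jump f t))"
    using * by (simp only: enn2real_ennreal)
  ultimately show "(\<lambda>n. \<Sum>i<k n. cutoff m (incr f n i) * F (incr f n i)) \<longlonglongrightarrow> enn2real (jump_sum (\<lambda>x. cutoff m x * F x) f {0<..T})"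
    by (simp only:)
qed

lemma ennreal_cutoff_SUP:
  assumes F: "\<And>x. 0 \<le> F x" "F 0 = 0"
  shows "ennreal (F x) = (SUP m. ennreal (cutoff m x * F x))"
proof (cases "x = 0")
    case False
    have "(\<lambda>m. ennreal (cutoff m x * F x)) \<longlonglongrightarrow> ennreal (F x)"
      by (rule tendsto_eventually, rule eventually_mono[OF cutoff_eventually_one[OF False]]) simp
    moreover have "incseq (\<lambda>m. ennreal (cutoff m x * F x))"
      using cutoff_mono F by (intro incseq_SucI ennreal_leI mult_right_mono) auto
    ultimately show ?thesis using LIMSEQ_unique LIMSEQ_SUP by blast
  qed (use F in simp)

lemma jump_sum_SUP:
  assumes F: "\<And>x. 0 \<le> F x" "F 0 = 0"
  shows "jump_sum F f S = (SUP m. jump_sum (\<lambda>x. cutoff m x * F x) f S)"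
proof -
  have "jump_sum F f S = (\<integral>\<^sup>+t. (SUP m. ennreal (cutoff m (jump f t) * F (jump f t))) \<partial>count_space S)"
    unfolding jump_sum_def using ennreal_cutoff_SUP[of F, OF F] by simp
  also have "\<dots> = (SUP m. \<integral>\<^sup>+t. ennreal (cutoff m (jump f t) * F (jump f t)) \<partial>count_space S)"
    by (rule nn_integral_monotone_convergence_SUP)
       (auto intro!: incseq_SucI le_funI ennreal_leI mult_right_mono F cutoff_mono)
  finally show ?thesis unfolding jump_sum_def .
qed

lemma jump_sum_mono: "(\<And>t. t \<in> S \<Longrightarrow> F (jump f t) \<le> G (jump f t)) \<Longrightarrow> jump_sum F f S \<le> jump_sum G f S"
  unfolding jump_sum_def by (intro nn_integral_mono ennreal_leI) auto

section \<open>Small-time behaviour of the stable process\<close>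

lemma (in prob_space) indep_var_nn_integral:
  fixes f g :: "_ \<Rightarrow> ennreal"
  assumes ind: "indep_var S X T Y" and f: "f \<in> borel_measurable S" and g: "g \<in> borel_measurable T"
  shows "(\<integral>\<^sup>+w. f (X w) * g (Y w) \<partial>M) = (\<integral>\<^sup>+w. f (X w) \<partial>M) * (\<integral>\<^sup>+w. g (Y w) \<partial>M)"
proof -
  note D = ind[unfolded indep_var_distribution_eq]
  have X: "X \<in> measurable M S" and Y: "Y \<in> measurable M T" using D by auto
  interpret PX: prob_space "distr M S X" by (rule prob_space_distr) fact
  interpret PY: prob_space "distr M T Y" by (rule prob_space_distr) fact
  interpret P: pair_sigma_finite "distr M S X" "distr M T Y" ..
  have "(\<integral>\<^sup>+w. f (X w) * g (Y w) \<partial>M) = (\<integral>\<^sup>+p. f (fst p) * g (snd p) \<partial>distr M (S \<Otimes>\<^sub>M T) (\<lambda>x. (X x, Y x)))"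
    using X Y f g by (subst nn_integral_distr) auto
  also have "distr M (S \<Otimes>\<^sub>M T) (\<lambda>x. (X x, Y x)) = distr M S X \<Otimes>\<^sub>M distr M T Y" using D by simp
  also have "(\<integral>\<^sup>+p. f (fst p) * g (snd p) \<partial>(distr M S X \<Otimes>\<^sub>M distr M T Y)) = (\<integral>\<^sup>+x. \<integral>\<^sup>+y. f x * g y \<partial>distr M T Y \<partial>distr M S X)"
    using f g by (subst PY.nn_integral_fst[symmetric]) auto
  also have "\<dots> = (\<integral>\<^sup>+x. f x * (\<integral>\<^sup>+y. g y \<partial>distr M T Y) \<partial>distr M S X)"
    using g by (intro nn_integral_cong nn_integral_cmult) auto
  also have "\<dots> = (\<integral>\<^sup>+x. f x \<partial>distr M S X) * (\<integral>\<^sup>+y. g y \<partial>distr M T Y)"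
    using f by (intro nn_integral_multc) auto
  also have "\<dots> = (\<integral>\<^sup>+w. f (X w) \<partial>M) * (\<integral>\<^sup>+w. g (Y w) \<partial>M)"
    using X Y f g by (simp add: nn_integral_distr)
  finally show ?thesis .
qed

text \<open>No measurability is assumed. As a supremum over simple functions from below, the
  integral is superadditive in any case. This is what the definition of the Levy measure calls for,
  whose integrands count jumps and are not known to be measurable.\<close>

lemma nn_integral_superadd:
  "(\<integral>\<^sup>+x. f x \<partial>M) + (\<integral>\<^sup>+x. g x \<partial>M) \<le> (\<integral>\<^sup>+x. f x + g x \<partial>M)"
proof -
  let ?S = "\<lambda>f. {s. simple_function M s \<and> s \<le> f}"
  have ne: "?S h \<noteq> {}" for h :: "'a \<Rightarrow> ennreal" by (auto intro!: exI[of _ "\<lambda>_. 0"] simp: le_fun_def)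
  have "integral\<^sup>S M s + integral\<^sup>S M t \<le> (\<integral>\<^sup>+x. f x + g x \<partial>M)" if "s \<in> ?S f" "t \<in> ?S g" for s t
  proof -
    have "integral\<^sup>S M s + integral\<^sup>S M t = integral\<^sup>S M (\<lambda>x. s x + t x)"
      using that by (intro simple_integral_add[symmetric]) auto
    also have "\<dots> = (\<integral>\<^sup>+x. s x + t x \<partial>M)"
      using that by (intro nn_integral_eq_simple_integral[symmetric]) auto
    also have "\<dots> \<le> (\<integral>\<^sup>+x. f x + g x \<partial>M)"
      using that by (intro nn_integral_mono add_mono) (auto simp: le_fun_def)
    finally show ?thesis .
  qed
  then have "(SUP t\<in>?S g. integral\<^sup>S M s + integral\<^sup>S M t) \<le> (\<integral>\<^sup>+x. f x + g x \<partial>M)" if "s \<in> ?S f" for s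
    using that by (intro SUP_least) auto
  then have "integral\<^sup>S M s + (\<integral>\<^sup>+x. g x \<partial>M) \<le> (\<integral>\<^sup>+x. f x + g x \<partial>M)" if "s \<in> ?S f" for s
    using that ne[of g] unfolding nn_integral_def[of M g] by (simp add: ennreal_SUP_add_right)
  then have "(SUP s\<in>?S f. integral\<^sup>S M s + (\<integral>\<^sup>+x. g x \<partial>M)) \<le> (\<integral>\<^sup>+x. f x + g x \<partial>M)"
    by (intro SUP_least) auto
  then show ?thesis using ne[of f] unfolding nn_integral_def[of M f] by (simp add: ennreal_SUP_add_left)
qed

lemma nn_integral_supercmult:
  "c * (\<integral>\<^sup>+x. f x \<partial>M) \<le> (\<integral>\<^sup>+x. c * f x \<partial>M)"
proof -
  have "c * (\<integral>\<^sup>+x. f x \<partial>M) = (SUP s\<in>{s. simple_function M s \<and> s \<le> f}. c * integral\<^sup>S M s)"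
    unfolding nn_integral_def by (rule SUP_mult_left_ennreal)
  also have "\<dots> \<le> (\<integral>\<^sup>+x. c * f x \<partial>M)"
  proof (rule SUP_least)
    fix s assume s: "s \<in> {s. simple_function M s \<and> s \<le> f}"
    have "c * integral\<^sup>S M s = integral\<^sup>S M (\<lambda>x. c * s x)"
      using s by (intro simple_integral_mult[symmetric]) auto
    also have "\<dots> = (\<integral>\<^sup>+x. c * s x \<partial>M)"
      using s by (intro nn_integral_eq_simple_integral[symmetric]) auto
    also have "\<dots> \<le> (\<integral>\<^sup>+x. c * f x \<partial>M)"
      using s by (intro nn_integral_mono mult_left_mono) (auto simp: le_fun_def)
    finally show "c * integral\<^sup>S M s \<le> (\<integral>\<^sup>+x. c * f x \<partial>M)" .
  qed
  finally show ?thesis .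
qed

lemma nn_integral_super_sum:
  assumes "finite S"
  shows "(\<Sum>y\<in>S. c y * (\<integral>\<^sup>+x. f y x \<partial>M)) \<le> (\<integral>\<^sup>+x. (\<Sum>y\<in>S. c y * f y x) \<partial>M)"
  using assms
proof induction
  case (insert y S)
  then have "(\<Sum>y\<in>insert y S. c y * (\<integral>\<^sup>+x. f y x \<partial>M)) \<le> (\<integral>\<^sup>+x. c y * f y x \<partial>M) + (\<integral>\<^sup>+x. (\<Sum>y\<in>S. c y * f y x) \<partial>M)"
    by (simp add: add_mono nn_integral_supercmult)
  also have "\<dots> \<le> (\<integral>\<^sup>+x. c y * f y x + (\<Sum>y\<in>S. c y * f y x) \<partial>M)" by (rule nn_integral_superadd)
  finally show ?case using insert by simp
qed simp

lemma tendsto_scaled_exp_minus_one: "(\<lambda>n. 2 ^ n * (exp (c / 2 ^ n) - 1)) \<longlonglongrightarrow> (c :: real)"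
proof -
  have "((\<lambda>h. (exp (c * h) - 1) / h) \<longlongrightarrow> c) (at 0)"
  proof -
    have "((\<lambda>h. exp (c * h)) has_field_derivative exp (c * 0) * c) (at 0)"
      by (auto intro!: derivative_eq_intros)
    then show ?thesis by (simp add: has_field_derivative_iff)
  qed
  moreover have "filterlim (\<lambda>n. 1 / 2 ^ n :: real) (at 0) sequentially"
    unfolding filterlim_at using tendsto_inverse_2_power by simp
  ultimately have "(\<lambda>n. (exp (c * (1 / 2 ^ n)) - 1) / (1 / 2 ^ n)) \<longlonglongrightarrow> c"
    by (rule filterlim_compose)
  then show ?thesis by (simp add: mult.commute)
qed

text \<open>Squeeze by 1 - 1 / c <= ln c <= c - 1; both outer terms have the same scaled limit
  because c n tends to 1.\<close>

lemma tendsto_scaled_ln: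
  fixes c :: "nat \<Rightarrow> real"
  assumes c: "\<And>n. 0 < c n" and lim: "(\<lambda>n. 2 ^ n * (c n - 1)) \<longlonglongrightarrow> \<psi>"
  shows "(\<lambda>n. 2 ^ n * ln (c n)) \<longlonglongrightarrow> \<psi>"
proof (rule tendsto_sandwich[OF always_eventually always_eventually _ lim])
  have "(\<lambda>n. 2 ^ n * (c n - 1) * (1 / 2 ^ n)) \<longlonglongrightarrow> \<psi> * 0"
    by (rule tendsto_mult[OF lim tendsto_inverse_2_power])
  then have "(\<lambda>n. c n - 1 + 1) \<longlonglongrightarrow> 0 + 1" by (intro tendsto_add tendsto_const) simp
  then have c1: "c \<longlonglongrightarrow> 1" by simp
  show "(\<lambda>n. 2 ^ n * (c n - 1) / c n) \<longlonglongrightarrow> \<psi>"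
    using tendsto_divide[OF lim c1] by simp
  show "\<forall>n. 2 ^ n * ln (c n) \<le> 2 ^ n * (c n - 1)"
    using ln_le_minus_one[OF c] by (auto intro!: mult_left_mono)
  show "\<forall>n. 2 ^ n * (c n - 1) / c n \<le> 2 ^ n * ln (c n)"
  proof
    fix n
    have "ln (1 / c n) \<le> 1 / c n - 1" by (rule ln_le_minus_one) (use c in simp)
    then have "(c n - 1) / c n \<le> ln (c n)" using c[of n] by (simp add: ln_div diff_divide_distrib)
    then have "2 ^ n * ((c n - 1) / c n) \<le> 2 ^ n * ln (c n)" by (intro mult_left_mono) auto
    then show "2 ^ n * (c n - 1) / c n \<le> 2 ^ n * ln (c n)" by simp
  qed
qed

lemma isCont_borel: "(\<And>x::real. isCont F x) \<Longrightarrow> (F :: real \<Rightarrow> real) \<in> borel_measurable borel"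
  by (intro borel_measurable_continuous_onI continuous_at_imp_continuous_on) auto

text \<open>Comparable to \<open>min 1 x\<^sup>2\<close> for \<open>x \<ge> 0\<close>, and its expectation is explicit in the Laplace exponent;
  hence it serves as the dominating function in all small-time limits.\<close>

definition test_fun :: "real \<Rightarrow> real" where "test_fun x = (1 - exp (- x))\<^sup>2"

text \<open>\<open>second_difference\<close> evaluates the Levy measure on \<open>test_fun\<close>.
  The one-step means of \<open>test_fun\<close> follow from the Laplace exponent alone; that both
  give the same number means that no mass is lost in the small-time limits.\<close>

locale stable_levy =
  fixes \<beta> :: real and \<Omega> :: "'w measure" and X :: "real \<Rightarrow> 'w \<Rightarrow> real"
  assumes \<beta>: "1 < \<beta>" "\<beta> < 2"
    and stable: "spectrally_positive_stable \<beta> \<Omega> X"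
    and Gamma_pos: "0 < Gamma (- \<beta>)"
    and second_difference:
      "has_bochner_integral lborel (\<lambda>x. indicator {0<..} x * (test_fun x * x powr (- 1 - \<beta>)))
         (Gamma (- \<beta>) * 2 powr \<beta> - 2 * Gamma (- \<beta>))"
begin

definition \<kappa> :: "real \<Rightarrow> real" where "\<kappa> q = Gamma (- \<beta>) * q powr \<beta>"

definition NU :: "real measure" where
  "NU = density lborel (\<lambda>x. ennreal (indicator {0<..} x * x powr (- 1 - \<beta>)))"

abbreviation (input) path :: "'w \<Rightarrow> real \<Rightarrow> real" where "path w \<equiv> (\<lambda>t. X t w)"

lemma levy: "levy_process \<Omega> X" and levy_measure: "has_levy_measure \<Omega> X NU"
  and laplace_exponent: "\<And>t q. 0 \<le> t \<Longrightarrow> 0 \<le> q \<Longrightarrow> (\<integral>w. exp (- q * X t w) \<partial>\<Omega>) = exp (t * \<kappa> q)"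
  using stable unfolding spectrally_positive_stable_def NU_def \<kappa>_def by (auto simp: mult.assoc)

lemma \<kappa>_nonneg: "0 \<le> \<kappa> q"
  unfolding \<kappa>_def using Gamma_pos by simp

sublocale prob_space \<Omega>
  using levy unfolding levy_process_def by blast

lemma X_measurable [measurable]: "0 \<le> t \<Longrightarrow> X t \<in> borel_measurable \<Omega>"
  and X_0: "w \<in> space \<Omega> \<Longrightarrow> X 0 w = 0"
  and X_cadlag: "w \<in> space \<Omega> \<Longrightarrow> cadlag (path w)"
  and X_stationary: "0 \<le> s \<Longrightarrow> 0 \<le> h \<Longrightarrow> distr \<Omega> borel (\<lambda>w. X (s + h) w - X s w) = distr \<Omega> borel (X h)"
  using levy unfolding levy_process_def by auto

lemma X_indep:
  fixes t :: "nat \<Rightarrow> real"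
  assumes "0 \<le> t 0" "mono t"
  shows "indep_vars (\<lambda>_. borel) (\<lambda>i w. X (t (Suc i)) w - X (t i) w) {..<n}"
  using levy assms unfolding levy_process_def by blast

text \<open>A non-integrable function has Bochner integral 0, whereas the Laplace exponent
  prescribes a positive value.\<close>

lemma exp_X_integrable:
  assumes "0 \<le> t" "0 \<le> q"
  shows "integrable \<Omega> (\<lambda>w. exp (- q * X t w))"
proof (rule ccontr)
  assume "\<not> ?thesis"
  then have "(\<integral>w. exp (- q * X t w) \<partial>\<Omega>) = 0" by (rule not_integrable_integral_eq)
  with laplace_exponent[OF assms] show False by simp
qed

lemma incr_measurable [measurable]: "(\<lambda>w. incr (path w) n i) \<in> borel_measurable \<Omega>"
  unfolding incr_def by measurable

lemma incr_distr: "distr \<Omega> borel (\<lambda>w. incr (path w) n i) = distr \<Omega> borel (X (1 / 2 ^ n))"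
proof -
  have "(real i + 1) / 2 ^ n = real i / 2 ^ n + 1 / 2 ^ n" by (rule add_divide_distrib)
  then show ?thesis unfolding incr_def using X_stationary[of "real i / 2 ^ n" "1 / 2 ^ n"] by simp
qed

lemma incr_nn_integral:
  assumes [measurable]: "F \<in> borel_measurable borel"
  shows "(\<integral>\<^sup>+w. F (incr (path w) n i) \<partial>\<Omega>) = (\<integral>\<^sup>+w. F (X (1 / 2 ^ n) w) \<partial>\<Omega>)"
proof -
  have "(\<integral>\<^sup>+w. F (incr (path w) n i) \<partial>\<Omega>) = (\<integral>\<^sup>+x. F x \<partial>distr \<Omega> borel (\<lambda>w. incr (path w) n i))"
    by (subst nn_integral_distr) auto
  also have "\<dots> = (\<integral>\<^sup>+w. F (X (1 / 2 ^ n) w) \<partial>\<Omega>)"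
    unfolding incr_distr by (subst nn_integral_distr) auto
  finally show ?thesis .
qed

lemma incr_indep: "indep_vars (\<lambda>_. borel) (\<lambda>i w. incr (path w) n i) {..<N}"
proof -
  have "indep_vars (\<lambda>_. borel) (\<lambda>i w. X (real (Suc i) / 2 ^ n) w - X (real i / 2 ^ n) w) {..<N}"
    by (rule X_indep) (auto intro!: monoI divide_right_mono)
  moreover have "real (Suc i) / 2 ^ n = (real i + 1) / 2 ^ n" for i by (simp add: add.commute)
  ultimately show ?thesis unfolding incr_def by (simp only:)
qed

lemma X_grid: "w \<in> space \<Omega> \<Longrightarrow> X (real k / 2 ^ n) w = (\<Sum>i<k. incr (path w) n i)"
proof (induction k)
  case (Suc k)
  then show ?case by (simp add: incr_def add.commute)
qed (simp add: X_0)

lemma NU_AE_pos: "AE x in NU. 0 < x"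
  unfolding NU_def by (subst AE_density) (auto simp: indicator_def)

lemma sets_NU [measurable_cong, simp]: "sets NU = sets borel" and space_NU [simp]: "space NU = UNIV"
  unfolding NU_def by simp_all

lemma test_fun_nonneg: "0 \<le> test_fun x" and test_fun_0 [simp]: "test_fun 0 = 0" and test_fun_cont: "isCont test_fun x"
  unfolding test_fun_def[abs_def] by (auto intro!: continuous_intros)

lemma nn_integral_test_fun: "(\<integral>\<^sup>+x. ennreal (test_fun x) \<partial>NU) = ennreal (\<kappa> 2 - 2 * \<kappa> 1)"
proof -
  have m: "test_fun \<in> borel_measurable borel" by (intro borel_measurable_continuous_onI continuous_at_imp_continuous_on) (simp add: test_fun_cont)
  have "(\<integral>\<^sup>+x. ennreal (test_fun x) \<partial>NU) = (\<integral>\<^sup>+x. ennreal (indicator {0<..} x * x powr (- 1 - \<beta>)) * ennreal (test_fun x) \<partial>lborel)"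
    unfolding NU_def using m by (subst nn_integral_density) auto
  also have "\<dots> = (\<integral>\<^sup>+x. ennreal (indicator {0<..} x * (test_fun x * x powr (- 1 - \<beta>))) \<partial>lborel)"
    by (intro nn_integral_cong) (auto simp: indicator_def ennreal_mult'[symmetric] test_fun_nonneg mult.commute)
  also have "\<dots> = ennreal (\<kappa> 2 - 2 * \<kappa> 1)"
    using second_difference unfolding has_bochner_integral_iff \<kappa>_def
    by (subst nn_integral_eq_integral) (auto simp: test_fun_nonneg)
  finally show ?thesis .
qed

lemma jump_sum_cutoff_unit:
  assumes w: "w \<in> space \<Omega>" and F: "\<And>x. 0 \<le> F x" and cont: "\<And>x. isCont F x"
  shows "jump_sum (\<lambda>x. cutoff m x * F x) (path w) {0<..real K} < \<infinity>"
    "(\<lambda>n. \<Sum>i<K * 2 ^ n. cutoff m (incr (path w) n i) * F (incr (path w) n i)) \<longlonglongrightarrow> enn2real (jump_sum (\<lambda>x. cutoff m x * F x) (path w) {0<..real K})"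
  using jump_sum_cutoff[OF X_cadlag[OF w] F cont, of "real K" "\<lambda>n. K * 2 ^ n" "real K" m] by auto

lemma jump_sum_cutoff_le_liminf:
  assumes w: "w \<in> space \<Omega>" and F: "\<And>x. 0 \<le> F x" and cont: "\<And>x. isCont F x"
  shows "jump_sum (\<lambda>x. cutoff m x * F x) (path w) {0<..real K} \<le> liminf (\<lambda>n. (\<Sum>i<K * 2 ^ n. ennreal (F (incr (path w) n i))))"
proof -
  note J = jump_sum_cutoff_unit[OF w F cont, of m K]
  have "(\<lambda>n. ennreal (\<Sum>i<K * 2 ^ n. cutoff m (incr (path w) n i) * F (incr (path w) n i))) \<longlonglongrightarrow> ennreal (enn2real (jump_sum (\<lambda>x. cutoff m x * F x) (path w) {0<..real K}))"
    by (intro tendsto_ennrealI J(2))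
  then have "jump_sum (\<lambda>x. cutoff m x * F x) (path w) {0<..real K} = liminf (\<lambda>n. ennreal (\<Sum>i<K * 2 ^ n. cutoff m (incr (path w) n i) * F (incr (path w) n i)))"
    using J(1) by (subst lim_imp_Liminf) auto
  also have "\<dots> \<le> liminf (\<lambda>n. (\<Sum>i<K * 2 ^ n. ennreal (F (incr (path w) n i))))"
  proof (intro Liminf_mono always_eventually allI)
    fix n
    have "ennreal (\<Sum>i<K * 2 ^ n. cutoff m (incr (path w) n i) * F (incr (path w) n i)) \<le> ennreal (\<Sum>i<K * 2 ^ n. F (incr (path w) n i))"
      using cutoff_bounds F by (intro ennreal_leI sum_mono mult_left_le_one_le) auto
    also have "\<dots> = (\<Sum>i<K * 2 ^ n. ennreal (F (incr (path w) n i)))" by (rule sum_ennreal[symmetric]) (rule F)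
    finally show "ennreal (\<Sum>i<K * 2 ^ n. cutoff m (incr (path w) n i) * F (incr (path w) n i)) \<le> (\<Sum>i<K * 2 ^ n. ennreal (F (incr (path w) n i)))" .
  qed
  finally show ?thesis .
qed

lemma nn_integral_grid_sum:
  assumes [measurable]: "F \<in> borel_measurable borel"
  shows "(\<integral>\<^sup>+w. (\<Sum>i<K * 2 ^ n. ennreal (F (incr (path w) n i))) \<partial>\<Omega>) = of_nat K * (2 ^ n * (\<integral>\<^sup>+w. ennreal (F (X (1 / 2 ^ n) w)) \<partial>\<Omega>))"
proof -
  have "(\<integral>\<^sup>+w. (\<Sum>i<K * 2 ^ n. ennreal (F (incr (path w) n i))) \<partial>\<Omega>) = (\<Sum>i<K * 2 ^ n. (\<integral>\<^sup>+w. ennreal (F (incr (path w) n i)) \<partial>\<Omega>))"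
    by (rule nn_integral_sum) measurable
  also have "\<dots> = (\<Sum>i<K * 2 ^ n. (\<integral>\<^sup>+w. ennreal (F (X (1 / 2 ^ n) w)) \<partial>\<Omega>))"
    by (intro sum.cong refl incr_nn_integral) measurable
  finally show ?thesis by (simp add: mult.assoc)
qed

text \<open>Fatou applied to the grid sums: by stationarity, the mean of a sum over K 2^n cells is K
  2^n times a one-step mean.\<close>

lemma nn_integral_liminf_jump_sum:
  assumes F: "\<And>x. 0 \<le> F x" and cont: "\<And>x. isCont F x"
  shows "(\<integral>\<^sup>+w. jump_sum (\<lambda>x. cutoff m x * F x) (path w) {0<..real K} \<partial>\<Omega>)
     \<le> of_nat K * liminf (\<lambda>n. 2 ^ n * (\<integral>\<^sup>+w. ennreal (F (X (1 / 2 ^ n) w)) \<partial>\<Omega>))"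
proof -
  have [measurable]: "F \<in> borel_measurable borel" by (rule isCont_borel[OF cont])
  have "(\<integral>\<^sup>+w. jump_sum (\<lambda>x. cutoff m x * F x) (path w) {0<..real K} \<partial>\<Omega>)
     \<le> (\<integral>\<^sup>+w. liminf (\<lambda>n. (\<Sum>i<K * 2 ^ n. ennreal (F (incr (path w) n i)))) \<partial>\<Omega>)"
    by (intro nn_integral_mono jump_sum_cutoff_le_liminf F cont)
  also have "\<dots> \<le> liminf (\<lambda>n. (\<integral>\<^sup>+w. (\<Sum>i<K * 2 ^ n. ennreal (F (incr (path w) n i))) \<partial>\<Omega>))"
    by (rule nn_integral_liminf) measurable
  also have "\<dots> = liminf (\<lambda>n. of_nat K * (2 ^ n * (\<integral>\<^sup>+w. ennreal (F (X (1 / 2 ^ n) w)) \<partial>\<Omega>)))"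
    by (subst nn_integral_grid_sum) simp_all
  also have "\<dots> = of_nat K * liminf (\<lambda>n. 2 ^ n * (\<integral>\<^sup>+w. ennreal (F (X (1 / 2 ^ n) w)) \<partial>\<Omega>))"
    by (rule Liminf_compose_continuous_mono[where f="\<lambda>x. of_nat K * x"])
       (auto simp: of_nat_less_top intro!: ennreal_continuous_on_cmult mult_left_mono monoI continuous_on_id)
  finally show ?thesis .
qed

text \<open>One half of Campbell's formula. For a simple function below H the definition of the Levy
  measure applies level set by level set; the inequality is all that superadditivity
  permits.\<close>

lemma nn_integral_NU_le_jump_sum:
  assumes H0: "H 0 = 0" and F: "\<And>x. 0 \<le> H x" and [measurable]: "H \<in> borel_measurable borel"
  shows "(\<integral>\<^sup>+x. ennreal (H x) \<partial>NU) \<le> (\<integral>\<^sup>+w. jump_sum H (path w) {0<..1} \<partial>\<Omega>)"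
  unfolding nn_integral_def[of NU]
proof (rule SUP_least)
  fix s assume s: "s \<in> {s. simple_function NU s \<and> s \<le> (\<lambda>x. ennreal (H x))}"
  then have sf: "simple_function NU s" and le: "s x \<le> ennreal (H x)" for x by (auto simp: le_fun_def)
  have s0: "s 0 = 0" using le[of 0] H0 by simp
  have fin: "finite (range s)" using sf unfolding simple_function_def by simp
  have sm: "s -` {y} \<in> sets borel" for y
    using simple_functionD(2)[OF sf, of "{y}"] by simp
  have "integral\<^sup>S NU s = (\<Sum>y\<in>range s. y * emeasure NU (s -` {y}))"
    unfolding simple_integral_def by simp
  also have "\<dots> = (\<Sum>y\<in>range s. y * (\<integral>\<^sup>+w. emeasure (count_space UNIV) {t\<in>{0<..1}. jump (path w) t \<in> s -` {y}} \<partial>\<Omega>))"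
  proof (intro sum.cong refl)
    fix y assume "y \<in> range s"
    show "y * emeasure NU (s -` {y}) = y * (\<integral>\<^sup>+w. emeasure (count_space UNIV) {t\<in>{0<..1}. jump (path w) t \<in> s -` {y}} \<partial>\<Omega>)"
    \<comment> \<open>The Levy measure is tied to jump counts only for sets that avoid 0. The level
      set containing 0 is that of the value 0, and it contributes nothing.\<close>
    proof (cases "y = 0")
      case False
      then have "0 \<notin> s -` {y}" using s0 by auto
      then show ?thesis using levy_measure sm unfolding has_levy_measure_def by simp
    qed simp
  qed
  also have "\<dots> \<le> (\<integral>\<^sup>+w. (\<Sum>y\<in>range s. y * emeasure (count_space UNIV) {t\<in>{0<..1}. jump (path w) t \<in> s -` {y}}) \<partial>\<Omega>)"
    by (rule nn_integral_super_sum[OF fin])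
  also have "\<dots> \<le> (\<integral>\<^sup>+w. jump_sum H (path w) {0<..1} \<partial>\<Omega>)"
  proof (intro nn_integral_mono)
    fix w
    have "(\<Sum>y\<in>range s. y * emeasure (count_space UNIV) {t\<in>{0<..1}. jump (path w) t \<in> s -` {y}})
       = (\<Sum>y\<in>range s. y * (\<integral>\<^sup>+t. indicator {t\<in>{0<..1}. jump (path w) t \<in> s -` {y}} t \<partial>count_space {0<..1}))"
    proof (intro sum.cong refl arg_cong2[where f="(*)"])
      fix y
      show "emeasure (count_space UNIV) {t\<in>{0<..1}. jump (path w) t \<in> s -` {y}} = (\<integral>\<^sup>+t. indicator {t\<in>{0<..1}. jump (path w) t \<in> s -` {y}} t \<partial>count_space {0<..1})"
      proof -
        let ?A = "{t\<in>{0<..1}. jump (path w) t \<in> s -` {y}}"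
        have sub: "?A \<subseteq> {0<..1}" by auto
        have "emeasure (count_space UNIV) ?A = emeasure (count_space {0<..1}) ?A"
          unfolding emeasure_count_space[OF sub] emeasure_count_space[OF subset_UNIV] ..
        also have "\<dots> = (\<integral>\<^sup>+t. indicator ?A t \<partial>count_space {0<..1})"
          using sub by (intro nn_integral_indicator[symmetric]) simp
        finally show ?thesis .
      qed
    qed
    also have "\<dots> = (\<integral>\<^sup>+t. (\<Sum>y\<in>range s. y * indicator {t\<in>{0<..1}. jump (path w) t \<in> s -` {y}} t) \<partial>count_space {0<..1})"
      by (subst nn_integral_sum) (auto simp: nn_integral_cmult)
    also have "\<dots> \<le> jump_sum H (path w) {0<..1}"
      unfolding jump_sum_def
    proof (intro nn_integral_mono)
      fix t :: real assume t: "t \<in> space (count_space {0<..1})"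
      have "(\<Sum>y\<in>range s. y * indicator {t\<in>{0<..1}. jump (path w) t \<in> s -` {y}} t) = (\<Sum>y\<in>{s (jump (path w) t)}. y * 1)"
        using t fin by (intro sum.mono_neutral_cong_right) (auto simp: indicator_def)
      then show "(\<Sum>y\<in>range s. y * indicator {t\<in>{0<..1}. jump (path w) t \<in> s -` {y}} t) \<le> ennreal (H (jump (path w) t))"
        using le by simp
    qed
    finally show "(\<Sum>y\<in>range s. y * emeasure (count_space UNIV) {t\<in>{0<..1}. jump (path w) t \<in> s -` {y}}) \<le> jump_sum H (path w) {0<..1}" .
  qed
  finally show "integral\<^sup>S NU s \<le> (\<integral>\<^sup>+w. jump_sum H (path w) {0<..1} \<partial>\<Omega>)" .
qed

text \<open>Both inequalities combined for the functions cut off near 0, then monotone convergence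
  in the cutoff. This is the lower half of the small-time limit.\<close>

lemma nn_integral_NU_le_liminf:
  assumes F: "\<And>x. 0 \<le> F x" "F 0 = 0" and cont: "\<And>x. isCont F x"
  shows "(\<integral>\<^sup>+x. ennreal (F x) \<partial>NU) \<le> liminf (\<lambda>n. 2 ^ n * (\<integral>\<^sup>+w. ennreal (F (X (1 / 2 ^ n) w)) \<partial>\<Omega>))"
proof -
  let ?L = "liminf (\<lambda>n. 2 ^ n * (\<integral>\<^sup>+w. ennreal (F (X (1 / 2 ^ n) w)) \<partial>\<Omega>))"
  have Fm [measurable]: "F \<in> borel_measurable borel" by (rule isCont_borel[OF cont])
  have cm [measurable]: "cutoff m \<in> borel_measurable borel" for m
    by (rule isCont_borel) (rule cutoff_continuous)
  have 1: "(\<integral>\<^sup>+x. ennreal (cutoff m x * F x) \<partial>NU) \<le> ?L" for m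
  proof -
    have "(\<integral>\<^sup>+x. ennreal (cutoff m x * F x) \<partial>NU) \<le> (\<integral>\<^sup>+w. jump_sum (\<lambda>x. cutoff m x * F x) (path w) {0<..1} \<partial>\<Omega>)"
      by (rule nn_integral_NU_le_jump_sum) (auto simp: F cutoff_bounds)
    also have "\<dots> \<le> of_nat 1 * ?L" using nn_integral_liminf_jump_sum[OF F(1) cont, of m 1] by simp
    finally show ?thesis by simp
  qed
  have "(\<integral>\<^sup>+x. ennreal (F x) \<partial>NU) = (\<integral>\<^sup>+x. (SUP m. ennreal (cutoff m x * F x)) \<partial>NU)"
    using ennreal_cutoff_SUP[of F, OF F] by simp
  also have "\<dots> = (SUP m. \<integral>\<^sup>+x. ennreal (cutoff m x * F x) \<partial>NU)"
    by (rule nn_integral_monotone_convergence_SUP)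
       (auto intro!: incseq_SucI le_funI ennreal_leI mult_right_mono F cutoff_mono)
  also have "\<dots> \<le> ?L" by (intro SUP_least 1)
  finally show ?thesis .
qed

lemma test_fun_X:
  assumes "0 \<le> t"
  shows "integrable \<Omega> (\<lambda>w. test_fun (X t w))" "(\<integral>w. test_fun (X t w) \<partial>\<Omega>) = (exp (t * \<kappa> 2) - 1) - 2 * (exp (t * \<kappa> 1) - 1)"
proof -
  have e: "test_fun x = 1 - 2 * exp (- 1 * x) + exp (- 2 * x)" for x
  proof -
    have "exp (- 2 * x) = exp (- x) * exp (- x)" by (simp flip: exp_add)
    then show ?thesis unfolding test_fun_def by (simp add: power2_eq_square algebra_simps)
  qed
  note i = exp_X_integrable[OF assms, of 1] exp_X_integrable[OF assms, of 2]
  show "integrable \<Omega> (\<lambda>w. test_fun (X t w))" unfolding e using i by simp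
  show "(\<integral>w. test_fun (X t w) \<partial>\<Omega>) = (exp (t * \<kappa> 2) - 1) - 2 * (exp (t * \<kappa> 1) - 1)"
    unfolding e using i laplace_exponent[OF assms, of 1] laplace_exponent[OF assms, of 2] by (simp add: prob_space)
qed

text \<open>The limit is the derivative at time 0 of explicit exponentials and equals the integral
  of \<open>test_fun\<close> against \<open>NU\<close>.\<close>

lemma test_fun_limit: "(\<lambda>n. 2 ^ n * (\<integral>w. test_fun (X (1 / 2 ^ n) w) \<partial>\<Omega>)) \<longlonglongrightarrow> \<kappa> 2 - 2 * \<kappa> 1"
proof -
  have "(\<lambda>n. 2 ^ n * (exp (\<kappa> 2 / 2 ^ n) - 1) - 2 * (2 ^ n * (exp (\<kappa> 1 / 2 ^ n) - 1))) \<longlonglongrightarrow> \<kappa> 2 - 2 * \<kappa> 1"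
    by (intro tendsto_intros tendsto_scaled_exp_minus_one)
  also have "(\<lambda>n. 2 ^ n * (exp (\<kappa> 2 / 2 ^ n) - 1) - 2 * (2 ^ n * (exp (\<kappa> 1 / 2 ^ n) - 1))) = (\<lambda>n. 2 ^ n * (\<integral>w. test_fun (X (1 / 2 ^ n) w) \<partial>\<Omega>))"
    by (rule ext) (simp add: test_fun_X(2) algebra_simps)
  finally show ?thesis .
qed

lemma test_fun_measurable [measurable]: "test_fun \<in> borel_measurable borel"
  by (rule isCont_borel) (rule test_fun_cont)

lemma test_fun_NU: "integrable NU test_fun" "(\<integral>x. test_fun x \<partial>NU) = \<kappa> 2 - 2 * \<kappa> 1"
proof -
  have c: "0 \<le> \<kappa> 2 - 2 * \<kappa> 1"
    by (rule LIMSEQ_le_const[OF test_fun_limit]) (auto simp: test_fun_nonneg intro!: mult_nonneg_nonneg Bochner_Integration.integral_nonneg)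
  have "has_bochner_integral NU test_fun (\<kappa> 2 - 2 * \<kappa> 1)"
    by (rule has_bochner_integral_nn_integral) (use c nn_integral_test_fun test_fun_nonneg in auto)
  then show "integrable NU test_fun" "(\<integral>x. test_fun x \<partial>NU) = \<kappa> 2 - 2 * \<kappa> 1" by (auto simp: has_bochner_integral_iff)
qed

lemma dominated_integrable:
  assumes G: "\<And>x. 0 \<le> G x" "\<And>x. G x \<le> c * test_fun x" and cont: "\<And>x. isCont G x"
  shows "integrable NU G" "0 \<le> t \<Longrightarrow> integrable \<Omega> (\<lambda>w. G (X t w))"
proof -
  have m [measurable]: "G \<in> borel_measurable borel" by (rule isCont_borel) (rule cont)
  have b: "norm (G x) \<le> norm (c * test_fun x)" for x unfolding real_norm_def using G(1)[of x] G(2)[of x] by linarith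
  show "integrable NU G"
    by (rule Bochner_Integration.integrable_bound[where f="\<lambda>x. c * test_fun x"]) (rule integrable_mult_right[OF test_fun_NU(1)], simp, rule AE_I2, rule b)
  show "integrable \<Omega> (\<lambda>w. G (X t w))" if "0 \<le> t"
    by (rule Bochner_Integration.integrable_bound[where f="\<lambda>w. c * test_fun (X t w)"]) (rule integrable_mult_right[OF test_fun_X(1)[OF that]], use that in measurable, rule AE_I2, rule b)
qed

lemma scaled_lower_bound:
  assumes G: "\<And>x. 0 \<le> G x" "\<And>x. G x \<le> c * test_fun x" and cont: "\<And>x. isCont G x" and y: "y < (\<integral>x. G x \<partial>NU)"
  shows "\<forall>\<^sub>F n in sequentially. y < 2 ^ n * (\<integral>w. G (X (1 / 2 ^ n) w) \<partial>\<Omega>)"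
proof (cases "0 \<le> y")
  case True
  have G0: "G 0 = 0" using G(1)[of 0] G(2)[of 0] by simp
  note i = dominated_integrable[of G c, OF G cont]
  have "ennreal y < ennreal (\<integral>x. G x \<partial>NU)" using y True by (simp add: ennreal_lessI)
  also have "\<dots> = (\<integral>\<^sup>+x. ennreal (G x) \<partial>NU)" using i(1) G(1) by (intro nn_integral_eq_integral[symmetric]) auto
  also have "\<dots> \<le> liminf (\<lambda>n. 2 ^ n * (\<integral>\<^sup>+w. ennreal (G (X (1 / 2 ^ n) w)) \<partial>\<Omega>))"
    by (rule nn_integral_NU_le_liminf) (use G G0 cont in auto)
  finally have "\<forall>\<^sub>F n in sequentially. ennreal y < 2 ^ n * (\<integral>\<^sup>+w. ennreal (G (X (1 / 2 ^ n) w)) \<partial>\<Omega>)"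
    by (rule less_LiminfD)
  then show ?thesis
  proof eventually_elim
    case (elim n)
    have "(\<integral>\<^sup>+w. ennreal (G (X (1 / 2 ^ n) w)) \<partial>\<Omega>) = ennreal (\<integral>w. G (X (1 / 2 ^ n) w) \<partial>\<Omega>)"
      using i(2) G(1) by (intro nn_integral_eq_integral) auto
    moreover have "(2::ennreal) ^ n = ennreal (2 ^ n)" by (simp add: ennreal_power[symmetric])
    ultimately have "ennreal y < ennreal (2 ^ n * (\<integral>w. G (X (1 / 2 ^ n) w) \<partial>\<Omega>))"
      using elim by (simp add: ennreal_mult')
    then show ?case by (rule ennreal_less_iff[THEN iffD1, rotated]) (rule True)
  qed
next
  case False
  then have y0: "y < 0" by simp
  have "0 \<le> 2 ^ n * (\<integral>w. G (X (1 / 2 ^ n) w) \<partial>\<Omega>)" for n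
    by (rule mult_nonneg_nonneg, simp, rule Bochner_Integration.integral_nonneg, rule G)
  then have "y < 2 ^ n * (\<integral>w. G (X (1 / 2 ^ n) w) \<partial>\<Omega>)" for n
    by (rule less_le_trans[OF y0])
  then show ?thesis by simp
qed

text \<open>Fatou's bound for \<open>G\<close> and for \<open>c test_fun - G\<close> together with the exact limit for \<open>test_fun\<close> forces convergence.\<close>

lemma scaled_limit:
  assumes G: "\<And>x. 0 \<le> G x" "\<And>x. G x \<le> c * test_fun x" and cont: "\<And>x. isCont G x"
  shows "(\<lambda>n. 2 ^ n * (\<integral>w. G (X (1 / 2 ^ n) w) \<partial>\<Omega>)) \<longlonglongrightarrow> (\<integral>x. G x \<partial>NU)"
proof (rule order_tendstoI)
  fix y assume "y < (\<integral>x. G x \<partial>NU)"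
  then show "\<forall>\<^sub>F n in sequentially. y < 2 ^ n * (\<integral>w. G (X (1 / 2 ^ n) w) \<partial>\<Omega>)"
    by (rule scaled_lower_bound[of G c, OF G cont])
next
  fix y assume y: "(\<integral>x. G x \<partial>NU) < y"
  define H where "H x = c * test_fun x - G x" for x
  have H: "0 \<le> H x" "H x \<le> c * test_fun x" "isCont H x" for x
    unfolding H_def[abs_def] using G(1)[of x] G(2)[of x] by (auto intro!: continuous_intros cont test_fun_cont)
  note iG = dominated_integrable[of G c, OF G cont]
  define S where "S = c * (\<kappa> 2 - 2 * \<kappa> 1)"
  define e where "e = (y - (\<integral>x. G x \<partial>NU)) / 2"
  have e: "0 < e" using y unfolding e_def by simp
  have "(\<integral>x. H x \<partial>NU) = S - (\<integral>x. G x \<partial>NU)"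
    unfolding H_def S_def using iG test_fun_NU by simp
  then have "S - (\<integral>x. G x \<partial>NU) - e < (\<integral>x. H x \<partial>NU)" using e by simp
  from scaled_lower_bound[of H c, OF H this]
  have 1: "\<forall>\<^sub>F n in sequentially. S - (\<integral>x. G x \<partial>NU) - e < 2 ^ n * (\<integral>w. H (X (1 / 2 ^ n) w) \<partial>\<Omega>)" .
  have "(\<lambda>n. c * (2 ^ n * (\<integral>w. test_fun (X (1 / 2 ^ n) w) \<partial>\<Omega>))) \<longlonglongrightarrow> S"
    unfolding S_def by (intro tendsto_mult_left test_fun_limit)
  then have 2: "\<forall>\<^sub>F n in sequentially. c * (2 ^ n * (\<integral>w. test_fun (X (1 / 2 ^ n) w) \<partial>\<Omega>)) < S + e"
    by (rule order_tendstoD) (use e in simp)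
  from 1 2 show "\<forall>\<^sub>F n in sequentially. 2 ^ n * (\<integral>w. G (X (1 / 2 ^ n) w) \<partial>\<Omega>) < y"
  proof eventually_elim
    case (elim n)
    have "(\<integral>w. H (X (1 / 2 ^ n) w) \<partial>\<Omega>) = c * (\<integral>w. test_fun (X (1 / 2 ^ n) w) \<partial>\<Omega>) - (\<integral>w. G (X (1 / 2 ^ n) w) \<partial>\<Omega>)"
      unfolding H_def using iG(2)[of "1 / 2 ^ n"] test_fun_X(1)[of "1 / 2 ^ n"] by simp
    then have "2 ^ n * (\<integral>w. H (X (1 / 2 ^ n) w) \<partial>\<Omega>) = c * (2 ^ n * (\<integral>w. test_fun (X (1 / 2 ^ n) w) \<partial>\<Omega>)) - 2 ^ n * (\<integral>w. G (X (1 / 2 ^ n) w) \<partial>\<Omega>)"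
      by (simp add: right_diff_distrib)
    with elim have "2 ^ n * (\<integral>w. G (X (1 / 2 ^ n) w) \<partial>\<Omega>) < (\<integral>x. G x \<partial>NU) + 2 * e" by linarith
    moreover have "2 * e = y - (\<integral>x. G x \<partial>NU)" unfolding e_def by simp
    ultimately show ?case by linarith
  qed
qed

lemma jump_sum_cutoff_measurable:
  assumes F: "\<And>x. 0 \<le> F x" and cont: "\<And>x. isCont F x"
  shows "(\<lambda>w. jump_sum (\<lambda>x. cutoff m x * F x) (path w) {0<..real K}) \<in> borel_measurable \<Omega>"
proof -
  have [measurable]: "F \<in> borel_measurable borel" by (rule isCont_borel) (rule cont)
  have [measurable]: "cutoff m \<in> borel_measurable borel" by (rule isCont_borel) (rule cutoff_continuous)
  have "(\<lambda>w. ennreal (enn2real (jump_sum (\<lambda>x. cutoff m x * F x) (path w) {0<..real K}))) \<in> borel_measurable \<Omega>"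
    by (intro measurable_compose[OF _ measurable_ennreal] borel_measurable_LIMSEQ_real[OF jump_sum_cutoff_unit(2)[OF _ F cont]]) measurable
  also have "?this \<longleftrightarrow> ?thesis"
    by (intro measurable_cong) (use jump_sum_cutoff_unit(1)[OF _ F cont] in auto)
  finally show ?thesis .
qed

text \<open>\<open>test_fun\<close> restricted to negative arguments is still dominated by
  \<open>test_fun\<close>, and its integral against the Levy measure is 0. Its one-step means
  therefore vanish in the scaled limit, and with them the expected sum over the jumps.\<close>

lemma AE_no_negative_jump: "AE w in \<Omega>. \<forall>t>0. 0 \<le> jump (path w) t"
proof -
  define G where "G x = test_fun (min x 0)" for x
  have G: "0 \<le> G x" "G x \<le> 1 * test_fun x" "isCont G x" for x
  proof -
    show "0 \<le> G x" unfolding G_def by (rule test_fun_nonneg)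
    show "G x \<le> 1 * test_fun x" unfolding G_def using test_fun_nonneg[of x] by (cases "x \<le> 0") (simp_all add: min_def)
    have "isCont (\<lambda>x. min x 0) x" by (intro continuous_intros)
    then show "isCont G x" unfolding G_def[abs_def] by (rule isCont_o2) (rule test_fun_cont)
  qed
  have G0: "G 0 = 0" by (simp add: G_def)
  have "(\<integral>x. G x \<partial>NU) = (\<integral>x. 0 \<partial>NU)"
  proof (rule integral_cong_AE)
    show "G \<in> borel_measurable NU" using isCont_borel[of G, OF G(3)] by simp
    show "AE x in NU. G x = 0" using NU_AE_pos by eventually_elim (simp add: G_def)
  qed simp
  then have lim: "(\<lambda>n. 2 ^ n * (\<integral>w. G (X (1 / 2 ^ n) w) \<partial>\<Omega>)) \<longlonglongrightarrow> 0"
    using scaled_limit[of G 1, OF G] by simp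
  have e: "2 ^ n * (\<integral>\<^sup>+w. ennreal (G (X (1 / 2 ^ n) w)) \<partial>\<Omega>) = ennreal (2 ^ n * (\<integral>w. G (X (1 / 2 ^ n) w) \<partial>\<Omega>))" for n
  proof -
    have "(\<integral>\<^sup>+w. ennreal (G (X (1 / 2 ^ n) w)) \<partial>\<Omega>) = ennreal (\<integral>w. G (X (1 / 2 ^ n) w) \<partial>\<Omega>)"
      using dominated_integrable(2)[of G 1, OF G] G(1) by (intro nn_integral_eq_integral) auto
    moreover have "(2::ennreal) ^ n = ennreal (2 ^ n)" by (simp add: ennreal_power[symmetric])
    ultimately show ?thesis by (simp add: ennreal_mult')
  qed
  have "(\<lambda>n. 2 ^ n * (\<integral>\<^sup>+w. ennreal (G (X (1 / 2 ^ n) w)) \<partial>\<Omega>)) \<longlonglongrightarrow> 0"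
    unfolding e using tendsto_ennrealI[OF lim] by simp
  then have L: "liminf (\<lambda>n. 2 ^ n * (\<integral>\<^sup>+w. ennreal (G (X (1 / 2 ^ n) w)) \<partial>\<Omega>)) = 0"
    by (rule lim_imp_Liminf[rotated]) simp
  have "AE w in \<Omega>. jump_sum (\<lambda>x. cutoff m x * G x) (path w) {0<..real K} = 0" for m K
  proof -
    have "(\<integral>\<^sup>+w. jump_sum (\<lambda>x. cutoff m x * G x) (path w) {0<..real K} \<partial>\<Omega>) = 0"
      using nn_integral_liminf_jump_sum[of G m K, OF G(1) G(3)] unfolding L by simp
    then show ?thesis
      using nn_integral_0_iff_AE[OF jump_sum_cutoff_measurable[of G m K, OF G(1) G(3)]] by simp
  qed
  then have "AE w in \<Omega>. \<forall>m K. jump_sum (\<lambda>x. cutoff m x * G x) (path w) {0<..real K} = 0"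
    by (simp add: AE_all_countable)
  then show ?thesis
  proof eventually_elim
    case (elim w)
    show ?case
    proof (intro allI impI)
      fix t :: real assume t: "0 < t"
      obtain K :: nat where K: "t \<le> real K" using real_arch_simple by blast
      have "jump_sum G (path w) {0<..real K} = 0"
        unfolding jump_sum_SUP[of G, OF G(1) G0] using elim by simp
      then have "\<forall>s\<in>{0<..real K}. ennreal (G (jump (path w) s)) = 0"
        unfolding jump_sum_def by (simp add: nn_integral_0_iff_AE AE_count_space)
      then have "G (jump (path w) t) \<le> 0" using t K by (simp add: ennreal_eq_0_iff)
      with G(1)[of "jump (path w) t"] have "test_fun (min (jump (path w) t) 0) = 0" unfolding G_def by linarith
      then have "min (jump (path w) t) 0 = 0" unfolding test_fun_def by simp
      then show "0 \<le> jump (path w) t" by simp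
    qed
  qed
qed

end

text \<open>Uniform integrability by hand: truncating U n at R changes it by at most (U n)^2 / R,
  hence by at most B / R in the mean, and the truncated sequence converges by domination.\<close>

lemma (in prob_space) L1_tendsto_of_L2_bounded:
  fixes U :: "nat \<Rightarrow> 'a \<Rightarrow> real" and V :: "'a \<Rightarrow> real"
  assumes U: "\<And>n. U n \<in> borel_measurable M" "\<And>n w. w \<in> space M \<Longrightarrow> 0 \<le> U n w"
    and V: "V \<in> borel_measurable M" "AE w in M. 0 \<le> V w \<and> V w \<le> D"
    and lim: "AE w in M. (\<lambda>n. U n w) \<longlonglongrightarrow> V w"
    and sq: "\<And>n. integrable M (\<lambda>w. (U n w)\<^sup>2)" "\<And>n. (\<integral>w. (U n w)\<^sup>2 \<partial>M) \<le> B"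
  shows "(\<lambda>n. \<integral>w. \<bar>U n w - V w\<bar> \<partial>M) \<longlonglongrightarrow> 0"
    and "\<And>n. integrable M (\<lambda>w. \<bar>U n w - V w\<bar>)"
proof -
  note [measurable] = U(1) V(1)
  have "0 \<le> (\<integral>w. (U 0 w)\<^sup>2 \<partial>M)" by (rule Bochner_Integration.integral_nonneg) simp
  then have B0: "0 \<le> B" using sq(2)[of 0] by linarith
  have Ui: "integrable M (U n)" for n
  proof (rule Bochner_Integration.integrable_bound[where f="\<lambda>w. 1 + (U n w)\<^sup>2"])
    show "integrable M (\<lambda>w. 1 + (U n w)\<^sup>2)" by (intro Bochner_Integration.integrable_add integrable_const sq(1))
    have "norm x \<le> norm (1 + x\<^sup>2)" for x :: real
    proof -
      have "0 \<le> (\<bar>x\<bar> - 1)\<^sup>2" by simp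
      then have "2 * \<bar>x\<bar> \<le> 1 + x\<^sup>2" by (simp add: power2_eq_square algebra_simps abs_mult[symmetric])
      then show ?thesis using abs_ge_self[of "1 + x\<^sup>2"] abs_ge_zero[of x] unfolding real_norm_def by linarith
    qed
    then show "AE w in M. norm (U n w) \<le> norm (1 + (U n w)\<^sup>2)" by (intro AE_I2)
  qed simp
  have Vi: "integrable M V"
    by (rule integrable_const_bound[where B="\<bar>D\<bar>"]) (rule eventually_mono[OF V(2)], auto)
  show int: "integrable M (\<lambda>w. \<bar>U n w - V w\<bar>)" for n
    using Ui Vi by auto
  show "(\<lambda>n. \<integral>w. \<bar>U n w - V w\<bar> \<partial>M) \<longlonglongrightarrow> 0"
  proof (rule LIMSEQ_I)
    fix r :: real assume r: "0 < r"
    \<comment> \<open>Large enough that truncation leaves the limit V unchanged, as D <= R, and that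
      B / R < r.\<close>
    define R where "R = \<bar>D\<bar> + 1 + 2 * B / r"
    have "0 \<le> 2 * B / r" using B0 r by simp
    then have R: "0 < R" "D \<le> R" unfolding R_def by linarith+
    have BR: "B / R < r"
    proof -
      have "2 * B / r < R" unfolding R_def by simp
      then have "2 * B < R * r" using r by (simp add: pos_divide_less_eq)
      then have "B < r * R" using B0 by (simp add: mult.commute)
      then show ?thesis using R by (simp add: pos_divide_less_eq)
    qed
    have "(\<lambda>n. \<integral>w. \<bar>min (U n w) R - V w\<bar> \<partial>M) \<longlonglongrightarrow> (\<integral>w. 0 \<partial>M)"
    proof (rule integral_dominated_convergence[where w="\<lambda>_. R + \<bar>D\<bar>"])
      show "AE w in M. (\<lambda>n. \<bar>min (U n w) R - V w\<bar>) \<longlonglongrightarrow> 0"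
        using lim V(2)
      proof eventually_elim
        case (elim w)
        have "(\<lambda>n. \<bar>min (U n w) R - V w\<bar>) \<longlonglongrightarrow> \<bar>min (V w) R - V w\<bar>"
          by (intro tendsto_intros elim)
        then show ?case using elim R by (simp add: min_def)
      qed
      show "AE w in M. norm \<bar>min (U n w) R - V w\<bar> \<le> R + \<bar>D\<bar>" for n
        using V(2) AE_space
      proof eventually_elim
        case (elim w)
        then show ?case using U(2)[of w n] R by (auto simp: min_def abs_if)
      qed
    qed simp_all
    then have "\<forall>\<^sub>F n in sequentially. (\<integral>w. \<bar>min (U n w) R - V w\<bar> \<partial>M) < r - B / R"
      by (rule order_tendstoD(2)) (use BR in simp)
    then obtain n0 where n0: "\<And>n. n \<ge> n0 \<Longrightarrow> (\<integral>w. \<bar>min (U n w) R - V w\<bar> \<partial>M) < r - B / R"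
      unfolding eventually_sequentially by blast
    have "norm ((\<integral>w. \<bar>U n w - V w\<bar> \<partial>M) - 0) < r" if "n \<ge> n0" for n
    proof -
      have mi: "integrable M (\<lambda>w. \<bar>min (U n w) R - V w\<bar>)"
        using Ui Vi by (intro integrable_abs Bochner_Integration.integrable_diff integrable_min) auto
      have "(\<integral>w. \<bar>U n w - V w\<bar> \<partial>M) \<le> (\<integral>w. \<bar>min (U n w) R - V w\<bar> + (U n w)\<^sup>2 / R \<partial>M)"
      proof (intro integral_mono int Bochner_Integration.integrable_add mi integrable_divide sq(1))
        fix w assume w: "w \<in> space M"
        have "U n w - min (U n w) R \<le> (U n w)\<^sup>2 / R"
        proof (cases "U n w \<le> R")
          case False
          then have "U n w * R \<le> U n w * U n w" using U(2)[OF w, of n] by (intro mult_left_mono) auto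
          then have "U n w \<le> (U n w)\<^sup>2 / R" using R by (simp add: pos_le_divide_eq power2_eq_square)
          then show ?thesis using False R by simp
        qed (use R in simp)
        then show "\<bar>U n w - V w\<bar> \<le> \<bar>min (U n w) R - V w\<bar> + (U n w)\<^sup>2 / R" by linarith
      qed
      also have "\<dots> = (\<integral>w. \<bar>min (U n w) R - V w\<bar> \<partial>M) + (\<integral>w. (U n w)\<^sup>2 \<partial>M) / R"
        using mi sq(1)[of n] by simp
      also have "\<dots> < r - B / R + B / R"
        using n0[OF that] sq(2)[of n] R by (intro add_less_le_mono divide_right_mono) auto
      finally show ?thesis by simp
    qed
    then show "\<exists>n0. \<forall>n\<ge>n0. norm ((\<integral>w. \<bar>U n w - V w\<bar> \<partial>M) - 0) < r" by blast
  qed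
qed

section \<open>First passage and optional stopping\<close>

text \<open>The first grid index at which the path is below - s, capped at N. The cap makes it a
  bounded stopping time, so optional stopping can be proved by induction on N.\<close>

definition stop_index :: "real \<Rightarrow> nat \<Rightarrow> nat \<Rightarrow> (real \<Rightarrow> real) \<Rightarrow> nat" where
  "stop_index s n N f = (LEAST k. N \<le> k \<or> f (real k / 2 ^ n) < - s)"

lemma stop_index_le: "stop_index s n N f \<le> N"
  unfolding stop_index_def by (rule Least_le) simp

lemma stop_index_cases: "N \<le> stop_index s n N f \<or> f (real (stop_index s n N f) / 2 ^ n) < - s"
  unfolding stop_index_def by (rule LeastI[of _ N]) simp

lemma stop_index_le_hit: "f (real k / 2 ^ n) < - s \<Longrightarrow> stop_index s n N f \<le> k"
  unfolding stop_index_def by (rule Least_le) simp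

text \<open>Raising the cap by one matters only on the event that no grid point up to index N lies
  below - s, an event of the first N increments.\<close>

lemma stop_index_Suc:
  "stop_index s n (Suc N) f = (if \<forall>k\<le>N. - s \<le> f (real k / 2 ^ n) then Suc N else stop_index s n N f)"
proof (cases "\<forall>k\<le>N. - s \<le> f (real k / 2 ^ n)")
  case True
  have "\<not> stop_index s n (Suc N) f \<le> N" using stop_index_cases[of "Suc N" s n f] True by force
  then show ?thesis using stop_index_le[of s n "Suc N" f] True by simp
next
  case False
  then obtain k where k: "k \<le> N" "f (real k / 2 ^ n) < - s" by (auto simp: not_le)
  have "stop_index s n (Suc N) f = stop_index s n N f"
  proof (rule antisym)
    show "stop_index s n (Suc N) f \<le> stop_index s n N f"
    proof (cases "N \<le> stop_index s n N f")
      case True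
      then show ?thesis using stop_index_le_hit[of f k n s "Suc N"] k by simp
    next
      case False
      then show ?thesis using stop_index_cases[of N s n f] stop_index_le_hit by blast
    qed
    show "stop_index s n N f \<le> stop_index s n (Suc N) f"
    proof (cases "Suc N \<le> stop_index s n (Suc N) f")
      case True then show ?thesis using stop_index_le[of s n N f] by linarith
    next
      case False
      then show ?thesis using stop_index_cases[of "Suc N" s n f] stop_index_le_hit by blast
    qed
  qed
  with False show ?thesis by auto
qed

lemma stop_index_N: "\<forall>k<N. - s \<le> f (real k / 2 ^ n) \<Longrightarrow> stop_index s n N f = N"
  using stop_index_cases[of N s n f] stop_index_le[of s n N f] by (metis antisym_conv2 not_le)

context stable_levy
begin

lemma stop_index_measurable [measurable]:
  "(\<lambda>w. stop_index s n N (path w)) \<in> measurable \<Omega> (count_space UNIV)"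
  unfolding stop_index_def by measurable

lemma grid_independence:
  fixes f :: "(nat \<Rightarrow> real) \<Rightarrow> ennreal" and g :: "(nat \<Rightarrow> real) \<Rightarrow> ennreal"
  assumes f: "f \<in> borel_measurable (PiM {..<k} (\<lambda>_. borel))" and g: "g \<in> borel_measurable (PiM {k..<N} (\<lambda>_. borel))" and k: "k \<le> N"
  shows "(\<integral>\<^sup>+w. f (\<lambda>i\<in>{..<k}. incr (path w) n i) * g (\<lambda>i\<in>{k..<N}. incr (path w) n i) \<partial>\<Omega>)
    = (\<integral>\<^sup>+w. f (\<lambda>i\<in>{..<k}. incr (path w) n i) \<partial>\<Omega>) * (\<integral>\<^sup>+w. g (\<lambda>i\<in>{k..<N}. incr (path w) n i) \<partial>\<Omega>)"
proof (rule indep_var_nn_integral[OF _ f g])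
  show "indep_var (Pi\<^sub>M {..<k} (\<lambda>_. borel)) (\<lambda>x. \<lambda>i\<in>{..<k}. incr (path x) n i) (Pi\<^sub>M {k..<N} (\<lambda>_. borel)) (\<lambda>x. \<lambda>i\<in>{k..<N}. incr (path x) n i)"
    by (rule indep_var_restrict[OF incr_indep[of n N]]) (use k in auto)
qed

text \<open>Induction on the cap. On the event \<open>E\<close> that the walk has not stopped up to
  index N, one more factor enters; it depends on the increment with index N only, is independent of
  \<open>E\<close> and of the earlier factors, and has mean 1.\<close>

lemma optional_stopping:
  fixes wt :: "real \<Rightarrow> real"
  assumes [measurable]: "wt \<in> borel_measurable borel" and wt: "\<And>x. 0 \<le> wt x"
    and mean: "(\<integral>\<^sup>+w. ennreal (wt (X (1 / 2 ^ n) w)) \<partial>\<Omega>) = 1"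
  shows "(\<integral>\<^sup>+w. ennreal (\<Prod>i<stop_index s n N (path w). wt (incr (path w) n i)) \<partial>\<Omega>) = 1"
proof (induction N)
  case 0
  have "stop_index s n 0 f = 0" for f using stop_index_le[of s n 0 f] by simp
  then show ?case by (simp add: emeasure_space_1)
next
  case (Suc N)
  define E where "E w \<longleftrightarrow> (\<forall>k\<le>N. - s \<le> X (real k / 2 ^ n) w)" for w
  define W where "W w k = ennreal (\<Prod>i<k. wt (incr (path w) n i))" for w k
  have W_Suc: "W w (Suc k) = W w k * ennreal (wt (incr (path w) n k))" for w k
    unfolding W_def using wt by (simp add: ennreal_mult prod_nonneg)
  have [measurable]: "(\<lambda>w. W w k) \<in> borel_measurable \<Omega>" for k unfolding W_def by measurable
  have [measurable]: "Measurable.pred \<Omega> E" unfolding E_def by measurable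
  have [measurable]: "(\<lambda>w. W w (stop_index s n N (path w))) \<in> borel_measurable \<Omega>" for N
    by (rule measurable_compose_countable[where f="\<lambda>k w. W w k"]) measurable
  define f where "f v = (if \<forall>k\<le>N. - s \<le> (\<Sum>i<k. v i) then ennreal (\<Prod>i<N. wt (v i)) else 0)" for v :: "nat \<Rightarrow> real"
  define g where "g v = ennreal (wt (v N))" for v :: "nat \<Rightarrow> real"
  have comp: "(\<lambda>v. v i) \<in> borel_measurable (PiM {..<N} (\<lambda>_. borel :: real measure))" if "i < N" for i
    using measurable_component_singleton[of i "{..<N}" "\<lambda>_. borel :: real measure"] that by simp
  have fm: "f \<in> borel_measurable (PiM {..<N} (\<lambda>_. borel))"
  proof -
    have [measurable]: "(\<lambda>v. \<Sum>i<k. v i) \<in> borel_measurable (PiM {..<N} (\<lambda>_. borel :: real measure))" if "k \<le> N" for k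
      by (rule borel_measurable_sum) (use comp that in auto)
    have [measurable]: "(\<lambda>v. \<Prod>i<N. wt (v i)) \<in> borel_measurable (PiM {..<N} (\<lambda>_. borel :: real measure))"
      by (rule borel_measurable_prod) (use comp in \<open>auto intro: measurable_compose[OF _ assms(1)]\<close>)
    have "Measurable.pred (PiM {..<N} (\<lambda>_. borel :: real measure)) (\<lambda>v. \<forall>k\<in>{..N}. - s \<le> (\<Sum>i<k. v i))"
      by (rule pred_intros_finite) auto
    then have [measurable]: "Measurable.pred (PiM {..<N} (\<lambda>_. borel :: real measure)) (\<lambda>v. \<forall>k\<le>N. - s \<le> (\<Sum>i<k. v i))"
      by (simp add: Ball_def)
    show ?thesis unfolding f_def by measurable
  qed
  have gm: "g \<in> borel_measurable (PiM {N..<Suc N} (\<lambda>_. borel))"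
    unfolding g_def using measurable_component_singleton[of N "{N..<Suc N}" "\<lambda>_. borel :: real measure"]
    by (auto intro: measurable_compose[OF _ assms(1)])
  have f_eq: "f (\<lambda>i\<in>{..<N}. incr (path w) n i) = (if E w then W w N else 0)" if "w \<in> space \<Omega>" for w
    unfolding f_def E_def W_def using X_grid[OF that] by (auto intro!: arg_cong[of _ _ ennreal] prod.cong simp: not_le)
  have g_eq: "g (\<lambda>i\<in>{N..<Suc N}. incr (path w) n i) = ennreal (wt (incr (path w) n N))" for w
    unfolding g_def by simp
  have step: "(\<integral>\<^sup>+w. (if E w then W w (Suc N) else 0) \<partial>\<Omega>) = (\<integral>\<^sup>+w. (if E w then W w N else 0) \<partial>\<Omega>)"
  proof -
    have "(\<integral>\<^sup>+w. (if E w then W w (Suc N) else 0) \<partial>\<Omega>) = (\<integral>\<^sup>+w. f (\<lambda>i\<in>{..<N}. incr (path w) n i) * g (\<lambda>i\<in>{N..<Suc N}. incr (path w) n i) \<partial>\<Omega>)"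
      unfolding g_eq by (intro nn_integral_cong) (simp add: f_eq W_Suc)
    also have "\<dots> = (\<integral>\<^sup>+w. f (\<lambda>i\<in>{..<N}. incr (path w) n i) \<partial>\<Omega>) * (\<integral>\<^sup>+w. g (\<lambda>i\<in>{N..<Suc N}. incr (path w) n i) \<partial>\<Omega>)"
      by (rule grid_independence[OF fm gm]) simp
    also have "(\<integral>\<^sup>+w. g (\<lambda>i\<in>{N..<Suc N}. incr (path w) n i) \<partial>\<Omega>) = 1"
      unfolding g_eq using incr_nn_integral[of "\<lambda>x. ennreal (wt x)" n N] mean by simp
    also have "(\<integral>\<^sup>+w. f (\<lambda>i\<in>{..<N}. incr (path w) n i) \<partial>\<Omega>) = (\<integral>\<^sup>+w. (if E w then W w N else 0) \<partial>\<Omega>)"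
      by (intro nn_integral_cong f_eq)
    finally show ?thesis by simp
  qed
  have EN: "stop_index s n N (path w) = N" if "E w" for w
    by (rule stop_index_N) (use that in \<open>auto simp: E_def\<close>)
  have ES: "stop_index s n (Suc N) (path w) = (if E w then Suc N else stop_index s n N (path w))" for w
    unfolding stop_index_Suc E_def ..
  have "(\<integral>\<^sup>+w. W w (stop_index s n (Suc N) (path w)) \<partial>\<Omega>)
     = (\<integral>\<^sup>+w. (if E w then W w (Suc N) else 0) + (if E w then 0 else W w (stop_index s n N (path w))) \<partial>\<Omega>)"
    unfolding ES by (intro nn_integral_cong) simp
  also have "\<dots> = (\<integral>\<^sup>+w. (if E w then W w (Suc N) else 0) \<partial>\<Omega>) + (\<integral>\<^sup>+w. (if E w then 0 else W w (stop_index s n N (path w))) \<partial>\<Omega>)"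
    by (rule nn_integral_add) measurable
  also have "\<dots> = (\<integral>\<^sup>+w. (if E w then W w N else 0) + (if E w then 0 else W w (stop_index s n N (path w))) \<partial>\<Omega>)"
    unfolding step by (rule nn_integral_add[symmetric]) measurable
  also have "\<dots> = (\<integral>\<^sup>+w. W w (stop_index s n N (path w)) \<partial>\<Omega>)"
    using EN by (intro nn_integral_cong) simp
  also have "\<dots> = 1" using Suc.IH unfolding W_def .
  finally show ?case unfolding W_def .
qed

end

text \<open>First passage below - s, capped at K. Putting K into the set both imposes the cap and
  keeps the infimum away from the empty set.\<close>

definition passage :: "real \<Rightarrow> real \<Rightarrow> (real \<Rightarrow> real) \<Rightarrow> real" where
  "passage s K f = Inf ({t. 0 \<le> t \<and> f t < - s} \<union> {K})"

lemma passage_bounds: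
  assumes "0 \<le> K"
  shows "0 \<le> passage s K f" "passage s K f \<le> K" "\<And>t. 0 \<le> t \<Longrightarrow> f t < - s \<Longrightarrow> passage s K f \<le> t"
proof -
  have bdd: "bdd_below ({t. 0 \<le> t \<and> f t < - s} \<union> {K})" using assms by (intro bdd_belowI[of _ 0]) auto
  show "0 \<le> passage s K f" unfolding passage_def using assms by (intro cInf_greatest) auto
  show "passage s K f \<le> K" unfolding passage_def by (rule cInf_lower[OF _ bdd]) simp
  show "passage s K f \<le> t" if "0 \<le> t" "f t < - s" for t
    unfolding passage_def by (rule cInf_lower[OF _ bdd]) (use that in simp)
qed

lemma passage_le_stop_index: "passage s (real K) f \<le> real (stop_index s n (K * 2 ^ n) f) / 2 ^ n"
proof (cases "K * 2 ^ n \<le> stop_index s n (K * 2 ^ n) f")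
  case True
  then have "stop_index s n (K * 2 ^ n) f = K * 2 ^ n" using stop_index_le[of s n "K * 2 ^ n" f] by simp
  then show ?thesis using passage_bounds(2)[of "real K" s f] by simp
next
  case False
  then have "f (real (stop_index s n (K * 2 ^ n) f) / 2 ^ n) < - s"
    using stop_index_cases[of "K * 2 ^ n" s n f] by blast
  then show ?thesis by (intro passage_bounds) auto
qed

lemma stop_index_le_K: "real (stop_index s n (K * 2 ^ n) f) / 2 ^ n \<le> real K"
proof -
  have "real (stop_index s n (K * 2 ^ n) f) \<le> real (K * 2 ^ n)"
    using stop_index_le[of s n "K * 2 ^ n" f] by (simp only: of_nat_le_iff)
  then have "real (stop_index s n (K * 2 ^ n) f) / 2 ^ n \<le> real (K * 2 ^ n) / 2 ^ n" by (intro divide_right_mono) auto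
  then show ?thesis by simp
qed

text \<open>By right continuity a path that is below - s at time t stays there for a while, so a
  fine enough grid detects the passage soon after t.\<close>

lemma stop_index_tendsto:
  assumes f: "cadlag f"
  shows "(\<lambda>n. real (stop_index s n (K * 2 ^ n) f) / 2 ^ n) \<longlonglongrightarrow> passage s (real K) f"
proof (rule order_tendstoI)
  fix y assume "y < passage s (real K) f"
  then show "\<forall>\<^sub>F n in sequentially. y < real (stop_index s n (K * 2 ^ n) f) / 2 ^ n"
    using less_le_trans[OF _ passage_le_stop_index] by (intro always_eventually allI) blast
next
  fix y assume y: "passage s (real K) f < y"
  show "\<forall>\<^sub>F n in sequentially. real (stop_index s n (K * 2 ^ n) f) / 2 ^ n < y"
  proof (cases "real K < y")
    case True
    then show ?thesis using le_less_trans[OF stop_index_le_K] by (intro always_eventually allI) blast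
  next
    case False
    from cInf_lessD[OF _ y[unfolded passage_def]]
    obtain t where t: "t \<in> {t. 0 \<le> t \<and> f t < - s} \<union> {real K}" "t < y" by blast
    with False have t0: "0 \<le> t" "f t < - s" by auto
    have "\<forall>\<^sub>F u in at_right t. f u < - s"
      by (rule order_tendstoD(2)[OF cadlag_right[OF f t0(1)] t0(2)])
    then obtain b where b: "t < b" "\<And>u. t < u \<Longrightarrow> u < b \<Longrightarrow> f u < - s" unfolding eventually_at_right_field by blast
    define y' where "y' = (min b y + t) / 2"
    have y': "t < y'" "y' < b" "y' < y" using b(1) t(2) unfolding y'_def by auto
    then have y'0: "0 < y'" using t0 by simp
    have "\<forall>\<^sub>F n in sequentially. t < real (cell n y') / 2 ^ n"
      by (rule order_tendstoD(1)[OF cell_limits(1)[OF y'0] y'(1)])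
    then show ?thesis
    proof eventually_elim
      case (elim n)
      have lt: "real (cell n y') / 2 ^ n < y'" by (rule cell_bounds(1)[OF y'0])
      then have "f (real (cell n y') / 2 ^ n) < - s" using elim y' by (intro b(2)) linarith+
      then have "stop_index s n (K * 2 ^ n) f \<le> cell n y'" by (rule stop_index_le_hit)
      then have "real (stop_index s n (K * 2 ^ n) f) / 2 ^ n \<le> real (cell n y') / 2 ^ n" by (intro divide_right_mono) auto
      also have "\<dots> < y" using lt y' by linarith
      finally show ?case .
    qed
  qed
qed

text \<open>At the passage time itself the left limit is at least - s, and without downward jumps
  the value is at least the left limit.\<close>

lemma passage_ge:
  assumes f: "cadlag f" and f0: "f 0 = 0" and pos: "\<forall>t>0. 0 \<le> jump f t" and s: "0 \<le> s" and K: "0 \<le> K"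
    and t: "0 \<le> t" "t \<le> passage s K f"
  shows "- s \<le> f t"
proof (cases "t < passage s K f")
  case True
  then show ?thesis using passage_bounds(3)[OF K t(1), of f s] by (meson leI leD)
next
  case False
  with t have tp: "t = passage s K f" by simp
  show ?thesis
  proof (cases "t = 0")
    case False
    with t have t0: "0 < t" by simp
    have "- s \<le> f t - jump f t"
    proof (rule tendsto_lowerbound[OF cadlag_left[OF f t0]])
      have "- s \<le> f u" if "0 < u" "u < t" for u
        using passage_bounds(3)[OF K, of u f s] that tp by (meson leI leD less_imp_le)
      then show "\<forall>\<^sub>F u in at_left t. - s \<le> f u"
        unfolding eventually_at_left_field using t0 by blast
    qed simp
    then show ?thesis using pos t0 by force
  qed (use f0 s in simp)
qed

text \<open>The path creeps downwards: the value - s is attained exactly. Were it larger, right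
  continuity would postpone the passage.\<close>

lemma passage_eq:
  assumes f: "cadlag f" and f0: "f 0 = 0" and pos: "\<forall>t>0. 0 \<le> jump f t" and s: "0 \<le> s" and K: "passage s K f < K" "0 \<le> K"
  shows "f (passage s K f) = - s"
proof (rule antisym)
  define T where "T = passage s K f"
  have T0: "0 \<le> T" unfolding T_def by (rule passage_bounds) fact
  show "- s \<le> f (passage s K f)" by (rule passage_ge[OF f f0 pos s K(2) passage_bounds(1)[OF K(2)]]) simp
  show "f (passage s K f) \<le> - s"
  proof (rule ccontr)
    assume "\<not> ?thesis"
    then have gt: "- s < f T" unfolding T_def by simp
    have "\<forall>\<^sub>F u in at_right T. - s < f u"
      by (rule order_tendstoD(1)[OF cadlag_right[OF f T0] gt])
    then obtain b where b: "T < b" "\<And>u. T < u \<Longrightarrow> u < b \<Longrightarrow> - s < f u" unfolding eventually_at_right_field by blast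
    have m: "T < min b K" using b K unfolding T_def by simp
    from cInf_lessD[OF _ m[unfolded T_def passage_def]]
    obtain t where t: "t \<in> {t. 0 \<le> t \<and> f t < - s} \<union> {K}" "t < min b K" by blast
    then have t0: "0 \<le> t" "f t < - s" by auto
    have "T \<le> t" unfolding T_def by (rule passage_bounds(3)[of K t f s, OF K(2) t0])
    with gt b(2)[of t] t t0 show False by (cases "T = t") auto
  qed
qed

section \<open>Weighting the jumps\<close>

definition exp_neg :: "ennreal \<Rightarrow> real" where
  "exp_neg y = (if y = \<top> then 0 else exp (- enn2real y))"

lemma exp_neg_ennreal: "0 \<le> r \<Longrightarrow> exp_neg (ennreal r) = exp (- r)"
  unfolding exp_neg_def by simp

lemma exp_neg_top [simp]: "exp_neg \<top> = 0"
  unfolding exp_neg_def by simp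

lemma exp_neg_bounds: "0 \<le> exp_neg y" "exp_neg y \<le> 1"
  unfolding exp_neg_def by auto

lemma exp_neg_measurable [measurable]: "exp_neg \<in> borel_measurable borel"
  unfolding exp_neg_def by measurable

lemma exp_neg_add: "exp_neg (x + y) = exp_neg x * exp_neg y"
  unfolding exp_neg_def by (auto simp: enn2real_plus less_top exp_add[symmetric])

lemma exp_neg_SUP_tendsto:
  assumes "incseq y"
  shows "(\<lambda>m. exp_neg (y m)) \<longlonglongrightarrow> exp_neg (SUP m. y m)"
proof (cases "(SUP m. y m) = \<top>")
  case True
  have lim: "y \<longlonglongrightarrow> \<top>" using LIMSEQ_SUP[OF assms] unfolding True .
  have "(\<lambda>m. exp_neg (y m)) \<longlonglongrightarrow> 0"
  proof (rule LIMSEQ_I)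
    fix r :: real assume r: "0 < r"
    define b where "b = \<bar>ln r\<bar> + 1"
    have "\<forall>\<^sub>F m in sequentially. ennreal b < y m" by (rule order_tendstoD(1)[OF lim]) simp
    then obtain n0 where n0: "\<And>m. m \<ge> n0 \<Longrightarrow> ennreal b < y m" unfolding eventually_sequentially by blast
    have "norm (exp_neg (y m) - 0) < r" if "m \<ge> n0" for m
    proof (cases "y m = \<top>")
      case False
      then obtain x where x: "0 \<le> x" "y m = ennreal x" by (cases "y m") auto
      have "0 \<le> b" unfolding b_def by simp
      then have "b < x" using n0[OF that] x by (simp add: ennreal_less_iff)
      then have "- x < ln r" unfolding b_def by linarith
      then have "exp (- x) < r" using r by (metis exp_less_mono exp_ln)
      then show ?thesis using x by (simp add: exp_neg_ennreal)
    qed (use r in simp)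
    then show "\<exists>n0. \<forall>m\<ge>n0. norm (exp_neg (y m) - 0) < r" by blast
  qed
  then show ?thesis unfolding True by simp
next
  case False
  define S where "S = (SUP m. y m)"
  have S: "S \<noteq> \<top>" using False unfolding S_def .
  have le: "y m \<le> S" for m unfolding S_def by (rule SUP_upper) simp
  have nt: "y m \<noteq> \<top>" for m
  proof
    assume "y m = \<top>"
    with le[of m] have "\<top> \<le> S" by simp
    with S show False by (simp add: top_unique)
  qed
  have "y \<longlonglongrightarrow> S" unfolding S_def by (rule LIMSEQ_SUP[OF assms])
  moreover have "S = ennreal (enn2real S)" using S by (simp add: less_top)
  ultimately have "y \<longlonglongrightarrow> ennreal (enn2real S)" by simp
  from tendsto_enn2real[OF this enn2real_nonneg] have "(\<lambda>m. enn2real (y m)) \<longlonglongrightarrow> enn2real S" .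
  then have "(\<lambda>m. exp (- enn2real (y m))) \<longlonglongrightarrow> exp (- enn2real S)" by (intro tendsto_exp tendsto_minus)
  then have "(\<lambda>m. exp_neg (y m)) \<longlonglongrightarrow> exp_neg S" unfolding exp_neg_def using nt S by simp
  then show ?thesis unfolding S_def .
qed

lemma test_fun_lower_bound:
  assumes "0 \<le> x" "x \<le> 1"
  shows "x\<^sup>2 \<le> exp 2 * test_fun x"
proof -
  have "1 + x \<le> exp x" by (rule exp_ge_add_one_self)
  then have "x \<le> exp x * (1 - exp (- x))" by (simp add: algebra_simps flip: exp_add)
  also have "\<dots> \<le> exp 1 * (1 - exp (- x))" using assms by (intro mult_right_mono) auto
  finally have "x \<le> exp 1 * (1 - exp (- x))" .
  then have "x\<^sup>2 \<le> (exp 1 * (1 - exp (- x)))\<^sup>2" using assms by (intro power_mono) auto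
  also have "\<dots> = exp 2 * test_fun x" unfolding test_fun_def power_mult_distrib by (simp add: power2_eq_square flip: exp_add)
  finally show ?thesis .
qed

text \<open>F is the negative logarithm of the weight of a jump. The instance F = 0 is used as well,
  to show that every level is hit. The quadratic bound concerns 1 - exp (- F), since F itself may
  grow without bound at large jumps.\<close>

locale weighted_levy = stable_levy \<beta> \<Omega> X
  for \<beta> :: real and \<Omega> :: "'w measure" and X :: "real \<Rightarrow> 'w \<Rightarrow> real" +
  fixes F :: "real \<Rightarrow> real" and C :: real
  assumes F_cont: "\<And>x. isCont F x" and F_nonneg: "\<And>x. 0 \<le> F x" and F_nonpos: "\<And>x. x \<le> 0 \<Longrightarrow> F x = 0"
    and F_quadratic: "\<And>x. 1 - exp (- F x) \<le> C * x\<^sup>2" and C_pos: "0 < C"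
begin

definition \<phi> :: "real \<Rightarrow> real" where "\<phi> x = 1 - exp (- F x)"

definition \<psi> :: "real \<Rightarrow> real" where "\<psi> q = \<kappa> q - (\<integral>x. exp (- q * x) * \<phi> x \<partial>NU)"

lemma F_measurable [measurable]: "F \<in> borel_measurable borel"
  by (rule isCont_borel) (rule F_cont)

lemma \<phi>_bounds: "0 \<le> \<phi> x" "\<phi> x \<le> 1" "x \<le> 0 \<Longrightarrow> \<phi> x = 0"
  unfolding \<phi>_def using F_nonneg[of x] F_nonpos[of x] by auto

lemma \<phi>_cont: "isCont \<phi> x"
  unfolding \<phi>_def[abs_def] by (intro continuous_intros F_cont)

text \<open>The first summand handles 0 < x <= 1, where x^2 is at most e^2 \<open>test_fun\<close>
  x; the second handles x > 1, where \<open>test_fun\<close> x is at least (1 - 1/e)^2.\<close>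

definition c1 :: real where "c1 = C * exp 2 + 1 / (1 - exp (- 1))\<^sup>2"

lemma \<phi>_test_fun: "\<phi> x \<le> c1 * test_fun x"
proof -
  have e: "0 < (1 - exp (- 1) :: real)" by simp
  consider "x \<le> 0" | "0 < x" "x \<le> 1" | "1 < x" by linarith
  then show ?thesis
  proof cases
    case 1
    have "0 \<le> c1" unfolding c1_def using C_pos by simp
    then show ?thesis using \<phi>_bounds(3)[OF 1] test_fun_nonneg[of x] by simp
  next
    case 2
    have "\<phi> x \<le> C * x\<^sup>2" unfolding \<phi>_def by (rule F_quadratic)
    also have "\<dots> \<le> C * (exp 2 * test_fun x)" using test_fun_lower_bound[of x] 2 C_pos by (intro mult_left_mono) auto
    also have "\<dots> = C * exp 2 * test_fun x" by simp
    also have "\<dots> \<le> c1 * test_fun x" unfolding c1_def using test_fun_nonneg[of x] by (intro mult_right_mono) auto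
    finally show ?thesis .
  next
    case 3
    have "(1 - exp (- 1))\<^sup>2 \<le> test_fun x" unfolding test_fun_def using 3 by (intro power_mono) auto
    then have "1 \<le> 1 / (1 - exp (- 1))\<^sup>2 * test_fun x" using e by (simp add: field_simps)
    also have "\<dots> \<le> c1 * test_fun x" unfolding c1_def using test_fun_nonneg[of x] C_pos by (intro mult_right_mono) auto
    finally show ?thesis using \<phi>_bounds(2)[of x] by linarith
  qed
qed

definition tilted :: "real \<Rightarrow> real \<Rightarrow> real" where "tilted q x = exp (- q * x) * \<phi> x"

lemma tilted:
  assumes "0 \<le> q"
  shows "0 \<le> tilted q x" "tilted q x \<le> c1 * test_fun x" "isCont (tilted q) x"
proof -
  show "0 \<le> tilted q x" unfolding tilted_def using \<phi>_bounds(1)[of x] by simp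
  have "tilted q x \<le> \<phi> x"
  proof (cases "x \<le> 0")
    case False
    then show ?thesis unfolding tilted_def using assms \<phi>_bounds(1)[of x] by (intro mult_left_le_one_le) auto
  qed (simp add: tilted_def \<phi>_bounds)
  then show "tilted q x \<le> c1 * test_fun x" using \<phi>_test_fun[of x] by linarith
  show "isCont (tilted q) x" unfolding tilted_def[abs_def] by (intro continuous_intros \<phi>_cont)
qed

text \<open>The mean of the weight of one grid cell; division by it makes the weights mean one. It
  behaves like exp (\<psi> q / 2^n), which is how \<psi> enters the stopped identity.\<close>

definition tilt_norm :: "real \<Rightarrow> nat \<Rightarrow> real" where
  "tilt_norm q n = (\<integral>w. exp (- q * X (1 / 2 ^ n) w) * exp (- F (X (1 / 2 ^ n) w)) \<partial>\<Omega>)"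

lemma weighted_exp_integrable:
  assumes "0 \<le> q" "0 \<le> t"
  shows "integrable \<Omega> (\<lambda>w. exp (- q * X t w) * exp (- F (X t w)))"
proof (rule Bochner_Integration.integrable_bound[OF exp_X_integrable[OF assms(2,1)]])
  have [measurable]: "X t \<in> borel_measurable \<Omega>" by (rule X_measurable) fact
  show "(\<lambda>w. exp (- q * X t w) * exp (- F (X t w))) \<in> borel_measurable \<Omega>" by measurable
  show "AE w in \<Omega>. norm (exp (- q * X t w) * exp (- F (X t w))) \<le> norm (exp (- q * X t w))"
    using F_nonneg by (intro AE_I2) simp
qed

lemma tilt_norm_eq:
  assumes "0 \<le> q"
  shows "tilt_norm q n = exp (\<kappa> q / 2 ^ n) - (\<integral>w. tilted q (X (1 / 2 ^ n) w) \<partial>\<Omega>)"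
proof -
  have "(\<integral>w. exp (- q * X (1 / 2 ^ n) w) - tilted q (X (1 / 2 ^ n) w) \<partial>\<Omega>) = exp (\<kappa> q / 2 ^ n) - (\<integral>w. tilted q (X (1 / 2 ^ n) w) \<partial>\<Omega>)"
    using exp_X_integrable[of "1 / 2 ^ n" q] dominated_integrable(2)[of "tilted q" c1 "1 / 2 ^ n", OF tilted[OF assms]]
      laplace_exponent[of "1 / 2 ^ n" q] assms by (subst Bochner_Integration.integral_diff) auto
  then show ?thesis unfolding tilt_norm_def tilted_def \<phi>_def by (simp add: right_diff_distrib)
qed

lemma tilt_norm_pos: "0 \<le> q \<Longrightarrow> 0 < tilt_norm q n"
proof -
  assume q: "0 \<le> q"
  have i: "integrable \<Omega> (\<lambda>w. exp (- q * X (1 / 2 ^ n) w) * exp (- F (X (1 / 2 ^ n) w)))"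
    by (rule weighted_exp_integrable[OF q]) simp
  have "tilt_norm q n \<noteq> 0"
  proof
    assume "tilt_norm q n = 0"
    then have "AE w in \<Omega>. exp (- q * X (1 / 2 ^ n) w) * exp (- F (X (1 / 2 ^ n) w)) = 0"
      unfolding tilt_norm_def using integral_nonneg_eq_0_iff_AE[OF i] by simp
    then show False by simp
  qed
  moreover have "0 \<le> tilt_norm q n" unfolding tilt_norm_def by (rule Bochner_Integration.integral_nonneg) simp
  ultimately show ?thesis by simp
qed

lemma tilt_norm_limit:
  assumes "0 \<le> q"
  shows "(\<lambda>n. 2 ^ n * ln (tilt_norm q n)) \<longlonglongrightarrow> \<psi> q"
proof (rule tendsto_scaled_ln[OF tilt_norm_pos[OF assms]])
  have "(\<lambda>n. 2 ^ n * (exp (\<kappa> q / 2 ^ n) - 1) - 2 ^ n * (\<integral>w. tilted q (X (1 / 2 ^ n) w) \<partial>\<Omega>)) \<longlonglongrightarrow> \<kappa> q - (\<integral>x. tilted q x \<partial>NU)"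
    by (intro tendsto_diff tendsto_scaled_exp_minus_one scaled_limit[of "tilted q" c1, OF tilted[OF assms]])
  also have "(\<lambda>n. 2 ^ n * (exp (\<kappa> q / 2 ^ n) - 1) - 2 ^ n * (\<integral>w. tilted q (X (1 / 2 ^ n) w) \<partial>\<Omega>)) = (\<lambda>n. 2 ^ n * (tilt_norm q n - 1))"
    by (rule ext) (simp add: tilt_norm_eq[OF assms] algebra_simps)
  finally show "(\<lambda>n. 2 ^ n * (tilt_norm q n - 1)) \<longlonglongrightarrow> \<psi> q" unfolding \<psi>_def tilted_def .
qed

definition cut_rest :: "nat \<Rightarrow> real \<Rightarrow> real" where "cut_rest m x = (1 - cutoff m x) * F x"

lemma cut_rest_cont: "isCont (cut_rest m) x"
  unfolding cut_rest_def[abs_def] by (intro continuous_intros F_cont)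

lemma cut_rest_nonneg: "0 \<le> cut_rest m x"
  unfolding cut_rest_def using cutoff_bounds[of m x] F_nonneg[of x] by simp

text \<open>For m >= 2 + 8 C the remainder lives on 0 < x < 2 / m. There x <= 1 and C x^2 <= 1/2, so
  that \<phi> x <= 1/2 and F x = - ln (1 - \<phi> x) <= 2 \<phi> x. Only this part of F near 0 is
  dominated by \<open>test_fun\<close>.\<close>

lemma cut_rest_test_fun:
  assumes m: "2 + 8 * C \<le> real m"
  shows "cut_rest m x \<le> (2 * C * exp 2) * test_fun x"
proof (cases "0 < x \<and> x < 2 / real m")
  case False
  then have "x \<le> 0 \<or> cutoff m x = 1"
  proof (cases "x \<le> 0")
    case F: False
    then have "2 / real m \<le> x" using False by auto
    then have "2 \<le> real m * x" using m C_pos by (simp add: divide_le_eq mult.commute split: if_splits)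
    then show ?thesis unfolding cutoff_def by linarith
  qed simp
  then have "cut_rest m x = 0" unfolding cut_rest_def using F_nonpos[of x] by auto
  then show ?thesis using test_fun_nonneg[of x] C_pos by simp
next
  case x: True
  have m0: "2 \<le> real m" "8 * C \<le> real m" using m C_pos by auto
  have "x * real m < 2" using x m0 by (simp add: pos_less_divide_eq)
  have x1: "x \<le> 1"
  proof (rule ccontr)
    assume "\<not> x \<le> 1"
    then have "1 * real m \<le> x * real m" using m0 by (intro mult_right_mono) auto
    with \<open>x * real m < 2\<close> m0 show False by linarith
  qed
  have "C * x\<^sup>2 \<le> 1 / 2"
  proof -
    have "8 * C * x \<le> real m * x" using m0 x by (intro mult_right_mono) auto
    moreover have "real m * x < 2" using \<open>x * real m < 2\<close> by (simp only: mult.commute)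
    ultimately have "8 * C * x < 2" by (rule le_less_trans)
    then have "C * x * x \<le> 1 / 4 * 1" using x x1 C_pos by (intro mult_mono) auto
    then show ?thesis by (simp add: power2_eq_square)
  qed
  then have half: "\<phi> x \<le> 1 / 2" using F_quadratic[of x] unfolding \<phi>_def by linarith
  have "F x \<le> 2 * \<phi> x"
  proof -
    have p: "0 < 1 - \<phi> x" using half by linarith
    have "F x = ln (1 / (1 - \<phi> x))" unfolding \<phi>_def by (simp add: ln_div)
    also have "\<dots> \<le> 1 / (1 - \<phi> x) - 1" by (rule ln_le_minus_one) (use p in simp)
    also have "\<dots> = \<phi> x / (1 - \<phi> x)" using p by (simp add: field_simps)
    also have "\<dots> \<le> \<phi> x / (1 / 2)" using half \<phi>_bounds(1)[of x] by (intro divide_left_mono) auto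
    finally show ?thesis by simp
  qed
  also have "\<dots> \<le> 2 * (C * x\<^sup>2)" unfolding \<phi>_def by (intro mult_left_mono F_quadratic) simp
  also have "\<dots> \<le> 2 * (C * (exp 2 * test_fun x))"
    using test_fun_lower_bound[of x] x x1 C_pos by (intro mult_left_mono) auto
  finally have "F x \<le> (2 * C * exp 2) * test_fun x" by simp
  moreover have "cut_rest m x \<le> F x" unfolding cut_rest_def using cutoff_bounds[of m x] F_nonneg[of x] by (intro mult_left_le_one_le) auto
  ultimately show ?thesis by linarith
qed

lemma cut_rest_tendsto: "(\<lambda>m. \<integral>x. cut_rest m x \<partial>NU) \<longlonglongrightarrow> 0"
proof -
  obtain m0 :: nat where m0: "2 + 8 * C \<le> real m0" using real_arch_simple by blast
  have [measurable]: "cut_rest m \<in> borel_measurable borel" for m by (rule isCont_borel) (rule cut_rest_cont)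
  have "(\<lambda>m. \<integral>x. cut_rest (m + m0) x \<partial>NU) \<longlonglongrightarrow> (\<integral>x. 0 \<partial>NU)"
  proof (rule integral_dominated_convergence[where w="\<lambda>x. (2 * C * exp 2) * test_fun x"])
    show "integrable NU (\<lambda>x. (2 * C * exp 2) * test_fun x)" by (rule integrable_mult_right[OF test_fun_NU(1)])
    show "AE x in NU. (\<lambda>m. cut_rest (m + m0) x) \<longlonglongrightarrow> 0"
    proof (intro AE_I2)
      fix x
      have "(\<lambda>m. cut_rest m x) \<longlonglongrightarrow> 0"
      proof (cases "x = 0")
        case False
        show ?thesis
          by (rule tendsto_eventually, rule eventually_mono[OF cutoff_eventually_one[OF False]]) (simp add: cut_rest_def)
      qed (simp add: cut_rest_def F_nonpos)
      then show "(\<lambda>m. cut_rest (m + m0) x) \<longlonglongrightarrow> 0" by (rule LIMSEQ_ignore_initial_segment)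
    qed
    show "AE x in NU. norm (cut_rest (m + m0) x) \<le> (2 * C * exp 2) * test_fun x" for m
      using cut_rest_test_fun[of "m + m0"] m0 cut_rest_nonneg by (intro AE_I2) simp
  qed measurable
  then show ?thesis by (simp add: LIMSEQ_offset[of _ m0])
qed

end

locale stopped_levy = weighted_levy \<beta> \<Omega> X F C
  for \<beta> :: real and \<Omega> :: "'w measure" and X :: "real \<Rightarrow> 'w \<Rightarrow> real" and F C +
  fixes q s :: real and K :: nat
  assumes q: "0 < q" and s: "0 \<le> s"
begin

text \<open>\<open>U n\<close>, \<open>V n\<close>, \<open>A n\<close> are the three factors of the martingale stopped on the dyadic grid of mesh
  \<open>2 ^ - n\<close>, and \<open>Ul\<close>, \<open>Vl\<close>, \<open>Al\<close> are their limits. The product of jump weights converges only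
  after the small jumps have been cut off, which gives \<open>Am m n\<close> and its limit \<open>Aml m\<close>.\<close>

definition kn :: "nat \<Rightarrow> 'w \<Rightarrow> nat" where "kn n w = stop_index s n (K * 2 ^ n) (path w)"
definition \<tau> :: "'w \<Rightarrow> real" where "\<tau> w = passage s (real K) (path w)"

lemma \<tau>_bounds: "0 \<le> \<tau> w" "\<tau> w \<le> real K"
  unfolding \<tau>_def by (simp_all add: passage_bounds)

lemma kn_facts:
  shows "\<tau> w \<le> real (kn n w) / 2 ^ n" "real (kn n w) / 2 ^ n \<le> real K" "kn n w \<le> K * 2 ^ n"
    and "w \<in> space \<Omega> \<Longrightarrow> (\<lambda>n. real (kn n w) / 2 ^ n) \<longlonglongrightarrow> \<tau> w"
  unfolding \<tau>_def kn_def by (rule passage_le_stop_index stop_index_le_K stop_index_le stop_index_tendsto X_cadlag | assumption)+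

lemma kn_measurable [measurable]: "kn n \<in> measurable \<Omega> (count_space UNIV)"
  unfolding kn_def by (rule stop_index_measurable)

lemma \<tau>_measurable [measurable]: "\<tau> \<in> borel_measurable \<Omega>"
  by (rule borel_measurable_LIMSEQ_real[OF kn_facts(4)]) measurable

lemma kn_compose:
  assumes "\<And>k. (\<lambda>w. h k w) \<in> borel_measurable \<Omega>"
  shows "(\<lambda>w. (h (kn n w) w :: real)) \<in> borel_measurable \<Omega>"
  by (rule measurable_compose_countable[where f=h, OF assms kn_measurable])

definition U :: "nat \<Rightarrow> 'w \<Rightarrow> real" where "U n w = exp (- q * X (real (kn n w) / 2 ^ n) w)"
definition Ul :: "'w \<Rightarrow> real" where "Ul w = exp (- q * X (\<tau> w) w)"
definition V :: "nat \<Rightarrow> 'w \<Rightarrow> real" where "V n w = exp (- (real (kn n w) / 2 ^ n) * (2 ^ n * ln (tilt_norm q n)))"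
definition Vl :: "'w \<Rightarrow> real" where "Vl w = exp (- \<tau> w * \<psi> q)"
definition A :: "nat \<Rightarrow> 'w \<Rightarrow> real" where "A n w = exp (- (\<Sum>i<kn n w. F (incr (path w) n i)))"
definition Al :: "'w \<Rightarrow> real" where "Al w = exp_neg (jump_sum F (path w) {0<..\<tau> w})"
definition Am :: "nat \<Rightarrow> nat \<Rightarrow> 'w \<Rightarrow> real" where "Am m n w = exp (- (\<Sum>i<kn n w. cutoff m (incr (path w) n i) * F (incr (path w) n i)))"
definition Aml :: "nat \<Rightarrow> 'w \<Rightarrow> real" where "Aml m w = exp_neg (jump_sum (\<lambda>x. cutoff m x * F x) (path w) {0<..\<tau> w})"

lemma cutoff_measurable [measurable]: "cutoff m \<in> borel_measurable borel"
  by (rule isCont_borel) (rule cutoff_continuous)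

lemma UVA_measurable [measurable]:
  "U n \<in> borel_measurable \<Omega>" "V n \<in> borel_measurable \<Omega>" "A n \<in> borel_measurable \<Omega>" "Am m n \<in> borel_measurable \<Omega>"
  unfolding U_def V_def A_def Am_def by (rule kn_compose, measurable)+

lemma U_lim: "w \<in> space \<Omega> \<Longrightarrow> (\<lambda>n. U n w) \<longlonglongrightarrow> Ul w"
  unfolding U_def Ul_def
  by (intro tendsto_intros cadlag_sequentially_right[OF X_cadlag \<tau>_bounds(1) kn_facts(4) kn_facts(1)])

lemma V_lim: "w \<in> space \<Omega> \<Longrightarrow> (\<lambda>n. V n w) \<longlonglongrightarrow> Vl w"
  unfolding V_def Vl_def by (intro tendsto_intros kn_facts(4) tilt_norm_limit less_imp_le[OF q])

lemma Am_lim: "w \<in> space \<Omega> \<Longrightarrow> (\<lambda>n. Am m n w) \<longlonglongrightarrow> Aml m w"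
proof -
  assume w: "w \<in> space \<Omega>"
  note J = jump_sum_cutoff[OF X_cadlag[OF w] F_nonneg F_cont \<tau>_bounds(1) kn_facts(1) kn_facts(4)[OF w] kn_facts(2), of m]
  have "exp_neg (jump_sum (\<lambda>x. cutoff m x * F x) (path w) {0<..\<tau> w}) = exp (- enn2real (jump_sum (\<lambda>x. cutoff m x * F x) (path w) {0<..\<tau> w}))"
    using J(1) unfolding exp_neg_def by auto
  then show ?thesis unfolding Am_def Aml_def using J(2) by (simp add: tendsto_exp tendsto_minus)
qed

lemma Aml_lim: "(\<lambda>m. Aml m w) \<longlonglongrightarrow> Al w"
proof -
  have "incseq (\<lambda>m. jump_sum (\<lambda>x. cutoff m x * F x) (path w) {0<..\<tau> w})"
    by (intro incseq_SucI jump_sum_mono mult_right_mono cutoff_mono F_nonneg) simp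
  from exp_neg_SUP_tendsto[OF this] show ?thesis
    unfolding Aml_def Al_def jump_sum_SUP[of F, OF F_nonneg F_nonpos[OF order_refl]] .
qed

lemma limit_measurable [measurable]:
  "Ul \<in> borel_measurable \<Omega>" "Vl \<in> borel_measurable \<Omega>" "Aml m \<in> borel_measurable \<Omega>" "Al \<in> borel_measurable \<Omega>"
proof -
  show "Ul \<in> borel_measurable \<Omega>" by (rule borel_measurable_LIMSEQ_real[OF U_lim]) measurable
  show "Vl \<in> borel_measurable \<Omega>" by (rule borel_measurable_LIMSEQ_real[OF V_lim]) measurable
  show 1: "Aml m \<in> borel_measurable \<Omega>" for m by (rule borel_measurable_LIMSEQ_real[OF Am_lim]) measurable
  show "Al \<in> borel_measurable \<Omega>" by (rule borel_measurable_LIMSEQ_real[OF Aml_lim]) (rule 1)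
qed

lemma A_bounds:
  "0 \<le> A n w" "A n w \<le> 1" "0 \<le> Am m n w" "Am m n w \<le> 1" "0 \<le> Al w" "Al w \<le> 1" "0 \<le> Aml m w" "Aml m w \<le> 1"
proof -
  have "0 \<le> (\<Sum>i<kn n w. F (incr (path w) n i))" by (intro sum_nonneg F_nonneg)
  then show "0 \<le> A n w" "A n w \<le> 1" unfolding A_def by auto
  have "0 \<le> (\<Sum>i<kn n w. cutoff m (incr (path w) n i) * F (incr (path w) n i))" by (intro sum_nonneg mult_nonneg_nonneg F_nonneg cutoff_bounds)
  then show "0 \<le> Am m n w" "Am m n w \<le> 1" unfolding Am_def by auto
qed (auto simp: Al_def Aml_def exp_neg_bounds)

text \<open>For 0 <= b <= a the difference of e^(- b) and e^(- a) is at most a - b. Extending the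
  sum beyond the stopping index to all K 2^n cells makes its mean a multiple of a one-step
  mean.\<close>

lemma A_diff_bound: "\<bar>A n w - Am m n w\<bar> \<le> (\<Sum>i<K * 2 ^ n. cut_rest m (incr (path w) n i))"
proof -
  define a b where "a = (\<Sum>i<kn n w. F (incr (path w) n i))" and "b = (\<Sum>i<kn n w. cutoff m (incr (path w) n i) * F (incr (path w) n i))"
  have ab: "a - b = (\<Sum>i<kn n w. cut_rest m (incr (path w) n i))"
    unfolding a_def b_def cut_rest_def by (simp add: sum_subtractf[symmetric] algebra_simps)
  have ab0: "0 \<le> a - b" unfolding ab by (intro sum_nonneg cut_rest_nonneg)
  have b0: "0 \<le> b" unfolding b_def by (intro sum_nonneg mult_nonneg_nonneg F_nonneg cutoff_bounds)
  define E where "E = exp (- (a - b))"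
  have e: "exp (- a) = exp (- b) * E" unfolding E_def by (simp flip: exp_add)
  have E: "E \<le> 1" "1 - E \<le> a - b" using ab0 exp_ge_add_one_self[of "- (a - b)"] unfolding E_def by (simp, linarith)
  have "exp (- a) - exp (- b) = - (exp (- b) * (1 - E))" unfolding e by (simp add: algebra_simps)
  then have "\<bar>exp (- a) - exp (- b)\<bar> = exp (- b) * (1 - E)" using E(1) by (simp add: abs_mult)
  also have "\<dots> \<le> 1 * (a - b)" using b0 E by (intro mult_mono) auto
  also have "\<dots> \<le> (\<Sum>i<K * 2 ^ n. cut_rest m (incr (path w) n i))"
    unfolding mult_1 ab using kn_facts(3)[of n w] by (intro sum_mono2) (auto simp: cut_rest_nonneg)
  finally show ?thesis unfolding A_def Am_def a_def b_def .
qed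

lemma bounded_integrable: "h \<in> borel_measurable \<Omega> \<Longrightarrow> (\<And>w. \<bar>h w\<bar> \<le> B) \<Longrightarrow> integrable \<Omega> (h :: 'w \<Rightarrow> real)"
  by (rule integrable_const_bound[where B=B]) (rule AE_I2, simp, assumption)

lemma abs_diff_le_1: "0 \<le> x \<Longrightarrow> x \<le> 1 \<Longrightarrow> 0 \<le> y \<Longrightarrow> y \<le> 1 \<Longrightarrow> \<bar>x - y\<bar> \<le> (1::real)"
  by linarith

text \<open>Three errors: grid sum against cut-off grid sum, whose mean is controlled by a
  small-time limit; cut-off grid sum against cut-off jump sum, by convergence along the path; and
  removal of the cutoff from the jump sum. The cutoff level m is fixed before the mesh.\<close>

lemma A_L1: "(\<lambda>n. \<integral>w. \<bar>A n w - Al w\<bar> \<partial>\<Omega>) \<longlonglongrightarrow> 0"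
proof (rule LIMSEQ_I)
  fix r :: real assume r: "0 < r"
  have lim1: "(\<lambda>m. \<integral>w. \<bar>Aml m w - Al w\<bar> \<partial>\<Omega>) \<longlonglongrightarrow> (\<integral>w. 0 \<partial>\<Omega>)"
  proof (rule integral_dominated_convergence[where w="\<lambda>_. 1"])
    show "AE w in \<Omega>. (\<lambda>m. \<bar>Aml m w - Al w\<bar>) \<longlonglongrightarrow> 0"
      using Aml_lim by (intro AE_I2 tendsto_rabs_zero LIM_zero)
    show "AE w in \<Omega>. norm \<bar>Aml m w - Al w\<bar> \<le> 1" for m
      unfolding real_norm_def abs_abs by (intro AE_I2 abs_diff_le_1 A_bounds)
  qed auto
  have "(\<lambda>m. real K * (\<integral>x. cut_rest m x \<partial>NU)) \<longlonglongrightarrow> real K * 0" by (intro tendsto_mult_left cut_rest_tendsto)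
  then have e1: "\<forall>\<^sub>F m in sequentially. real K * (\<integral>x. cut_rest m x \<partial>NU) < r / 4" by (rule order_tendstoD) (use r in simp)
  have e2: "\<forall>\<^sub>F m in sequentially. (\<integral>w. \<bar>Aml m w - Al w\<bar> \<partial>\<Omega>) < r / 4"
    by (rule order_tendstoD(2)[OF lim1]) (use r in simp)
  have e3: "\<forall>\<^sub>F m in sequentially. 2 + 8 * C \<le> real m"
    using eventually_ge_at_top[of "nat \<lceil>2 + 8 * C\<rceil>"] by eventually_elim linarith
  from eventually_happens'[OF sequentially_bot eventually_conj[OF e1 eventually_conj[OF e2 e3]]]
  obtain m where m: "real K * (\<integral>x. cut_rest m x \<partial>NU) < r / 4" "(\<integral>w. \<bar>Aml m w - Al w\<bar> \<partial>\<Omega>) < r / 4" "2 + 8 * C \<le> real m"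
    by blast
  have lim2: "(\<lambda>n. \<integral>w. \<bar>Am m n w - Aml m w\<bar> \<partial>\<Omega>) \<longlonglongrightarrow> (\<integral>w. 0 \<partial>\<Omega>)"
  proof (rule integral_dominated_convergence[where w="\<lambda>_. 1"])
    show "AE w in \<Omega>. (\<lambda>n. \<bar>Am m n w - Aml m w\<bar>) \<longlonglongrightarrow> 0"
      using Am_lim by (intro AE_I2 tendsto_rabs_zero LIM_zero)
    show "AE w in \<Omega>. norm \<bar>Am m n w - Aml m w\<bar> \<le> 1" for n
      unfolding real_norm_def abs_abs by (intro AE_I2 abs_diff_le_1 A_bounds)
  qed auto
  note R = cut_rest_nonneg cut_rest_test_fun[OF m(3)] cut_rest_cont
  have "(\<lambda>n. real K * (2 ^ n * (\<integral>w. cut_rest m (X (1 / 2 ^ n) w) \<partial>\<Omega>))) \<longlonglongrightarrow> real K * (\<integral>x. cut_rest m x \<partial>NU)"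
    by (intro tendsto_mult_left scaled_limit[of "cut_rest m" "2 * C * exp 2", OF R])
  then have e4: "\<forall>\<^sub>F n in sequentially. real K * (2 ^ n * (\<integral>w. cut_rest m (X (1 / 2 ^ n) w) \<partial>\<Omega>)) < r / 4"
    by (rule order_tendstoD) (rule m(1))
  have e5: "\<forall>\<^sub>F n in sequentially. (\<integral>w. \<bar>Am m n w - Aml m w\<bar> \<partial>\<Omega>) < r / 4"
    by (rule order_tendstoD(2)[OF lim2]) (use r in simp)
  from eventually_conj[OF e4 e5]
  obtain n0 where n0: "\<And>n. n \<ge> n0 \<Longrightarrow> real K * (2 ^ n * (\<integral>w. cut_rest m (X (1 / 2 ^ n) w) \<partial>\<Omega>)) < r / 4 \<and> (\<integral>w. \<bar>Am m n w - Aml m w\<bar> \<partial>\<Omega>) < r / 4"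
    unfolding eventually_sequentially by blast
  have cut_rest_meas [measurable]: "cut_rest m \<in> borel_measurable borel" by (rule isCont_borel) (rule cut_rest_cont)
  have Ri: "integrable \<Omega> (\<lambda>w. cut_rest m (incr (path w) n i))" "(\<integral>w. cut_rest m (incr (path w) n i) \<partial>\<Omega>) = (\<integral>w. cut_rest m (X (1 / 2 ^ n) w) \<partial>\<Omega>)" for n i
  proof -
    have Xm: "X (1 / 2 ^ n) \<in> borel_measurable \<Omega>" by (rule X_measurable) simp
    have 1: "integrable \<Omega> (\<lambda>w. cut_rest m (X (1 / 2 ^ n) w))"
      by (rule dominated_integrable(2)[of "cut_rest m" "2 * C * exp 2", OF R]) simp
    then have "integrable (distr \<Omega> borel (X (1 / 2 ^ n))) (cut_rest m)" using Xm by (subst integrable_distr_eq) auto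
    then have "integrable (distr \<Omega> borel (\<lambda>w. incr (path w) n i)) (cut_rest m)" unfolding incr_distr .
    then show "integrable \<Omega> (\<lambda>w. cut_rest m (incr (path w) n i))" by (subst (asm) integrable_distr_eq) auto
    have "(\<integral>w. cut_rest m (incr (path w) n i) \<partial>\<Omega>) = (\<integral>x. cut_rest m x \<partial>distr \<Omega> borel (\<lambda>w. incr (path w) n i))"
      by (subst integral_distr) auto
    also have "\<dots> = (\<integral>w. cut_rest m (X (1 / 2 ^ n) w) \<partial>\<Omega>)" unfolding incr_distr using Xm by (subst integral_distr) auto
    finally show "(\<integral>w. cut_rest m (incr (path w) n i) \<partial>\<Omega>) = (\<integral>w. cut_rest m (X (1 / 2 ^ n) w) \<partial>\<Omega>)" .
  qed
  have "norm ((\<integral>w. \<bar>A n w - Al w\<bar> \<partial>\<Omega>) - 0) < r" if n: "n \<ge> n0" for n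
  proof -
    have i1: "integrable \<Omega> (\<lambda>w. \<bar>A n w - Al w\<bar>)" by (rule bounded_integrable[where B=1]) (auto intro!: abs_diff_le_1 A_bounds)
    have i2: "integrable \<Omega> (\<lambda>w. \<bar>Am m n w - Aml m w\<bar>)" by (rule bounded_integrable[where B=1]) (auto intro!: abs_diff_le_1 A_bounds)
    have i3: "integrable \<Omega> (\<lambda>w. \<bar>Aml m w - Al w\<bar>)" by (rule bounded_integrable[where B=1]) (auto intro!: abs_diff_le_1 A_bounds)
    have i4: "integrable \<Omega> (\<lambda>w. \<Sum>i<K * 2 ^ n. cut_rest m (incr (path w) n i))" by (intro Bochner_Integration.integrable_sum Ri)
    have "(\<integral>w. \<bar>A n w - Al w\<bar> \<partial>\<Omega>) \<le> (\<integral>w. (\<Sum>i<K * 2 ^ n. cut_rest m (incr (path w) n i)) + (\<bar>Am m n w - Aml m w\<bar> + \<bar>Aml m w - Al w\<bar>) \<partial>\<Omega>)"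
    proof (intro integral_mono i1 Bochner_Integration.integrable_add i2 i3 i4)
      fix w
      show "\<bar>A n w - Al w\<bar> \<le> (\<Sum>i<K * 2 ^ n. cut_rest m (incr (path w) n i)) + (\<bar>Am m n w - Aml m w\<bar> + \<bar>Aml m w - Al w\<bar>)"
        using A_diff_bound[of n w m] by linarith
    qed
    also have "\<dots> = (\<integral>w. (\<Sum>i<K * 2 ^ n. cut_rest m (incr (path w) n i)) \<partial>\<Omega>) + ((\<integral>w. \<bar>Am m n w - Aml m w\<bar> \<partial>\<Omega>) + (\<integral>w. \<bar>Aml m w - Al w\<bar> \<partial>\<Omega>))"
      by (simp only: Bochner_Integration.integral_add[OF i4 Bochner_Integration.integrable_add[OF i2 i3]] Bochner_Integration.integral_add[OF i2 i3])
    also have "(\<integral>w. (\<Sum>i<K * 2 ^ n. cut_rest m (incr (path w) n i)) \<partial>\<Omega>) = real K * (2 ^ n * (\<integral>w. cut_rest m (X (1 / 2 ^ n) w) \<partial>\<Omega>))"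
      by (subst Bochner_Integration.integral_sum[OF Ri(1)]) (simp add: Ri(2))
    finally have "(\<integral>w. \<bar>A n w - Al w\<bar> \<partial>\<Omega>) < r" using n0[OF n] m(2) r by linarith
    moreover have "0 \<le> (\<integral>w. \<bar>A n w - Al w\<bar> \<partial>\<Omega>)" by (rule Bochner_Integration.integral_nonneg) simp
    ultimately show ?thesis by simp
  qed
  then show "\<exists>n0. \<forall>n\<ge>n0. norm ((\<integral>w. \<bar>A n w - Al w\<bar> \<partial>\<Omega>) - 0) < r" by blast
qed

lemma X_kn: "w \<in> space \<Omega> \<Longrightarrow> X (real (kn n w) / 2 ^ n) w = (\<Sum>i<kn n w. incr (path w) n i)"
  by (rule X_grid)

text \<open>Optional stopping for the mean-one weights e^(- q x) e^(- F x) /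
  \<open>tilt_norm\<close> q n. The increments in the exponent add up to the value of the path, and
  the normalising constants add up to V.\<close>

lemma stop_mean: "(\<integral>\<^sup>+w. ennreal (U n w * V n w * A n w) \<partial>\<Omega>) = 1"
proof -
  define c where "c = tilt_norm q n"
  have c: "0 < c" unfolding c_def by (rule tilt_norm_pos) (use q in simp)
  define wt where "wt x = exp (- q * x) * exp (- F x) / c" for x
  have [measurable]: "wt \<in> borel_measurable borel" unfolding wt_def by measurable
  have i: "integrable \<Omega> (\<lambda>w. wt (X (1 / 2 ^ n) w))"
    unfolding wt_def by (intro integrable_divide weighted_exp_integrable) (use q in auto)
  have "(\<integral>\<^sup>+w. ennreal (wt (X (1 / 2 ^ n) w)) \<partial>\<Omega>) = ennreal (\<integral>w. wt (X (1 / 2 ^ n) w) \<partial>\<Omega>)"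
    by (rule nn_integral_eq_integral[OF i]) (use c in \<open>simp add: wt_def\<close>)
  also have "(\<integral>w. wt (X (1 / 2 ^ n) w) \<partial>\<Omega>) = 1"
    unfolding wt_def using c by (simp add: c_def tilt_norm_def)
  finally have mean: "(\<integral>\<^sup>+w. ennreal (wt (X (1 / 2 ^ n) w)) \<partial>\<Omega>) = 1" by simp
  have "(\<Prod>i<kn n w. wt (incr (path w) n i)) = U n w * V n w * A n w" if wt: "w \<in> space \<Omega>" for w
  proof -
    define k where "k = kn n w"
    have "(\<Prod>i<k. wt (incr (path w) n i)) = (\<Prod>i<k. exp (- q * incr (path w) n i)) * (\<Prod>i<k. exp (- F (incr (path w) n i))) / c ^ k"
      unfolding wt_def by (simp add: prod.distrib prod_dividef)
    also have "(\<Prod>i<k. exp (- q * incr (path w) n i)) = exp (- q * (\<Sum>i<k. incr (path w) n i))"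
      by (simp add: exp_sum sum_distrib_left)
    also have "(\<Prod>i<k. exp (- F (incr (path w) n i))) = exp (- (\<Sum>i<k. F (incr (path w) n i)))"
      by (simp add: exp_sum flip: sum_negf)
    also have "(\<Sum>i<k. incr (path w) n i) = X (real k / 2 ^ n) w" unfolding k_def by (rule X_kn[OF wt, symmetric])
    finally have 1: "(\<Prod>i<k. wt (incr (path w) n i)) = U n w * A n w / c ^ k" unfolding U_def A_def k_def .
    have "V n w = exp (- (real k * ln c))" unfolding V_def k_def c_def by simp
    also have "\<dots> = 1 / c ^ k" using c by (simp add: exp_minus exp_of_nat_mult inverse_eq_divide)
    finally show ?thesis using 1 unfolding k_def by simp
  qed
  then have "(\<integral>\<^sup>+w. ennreal (U n w * V n w * A n w) \<partial>\<Omega>) = (\<integral>\<^sup>+w. ennreal (\<Prod>i<kn n w. wt (incr (path w) n i)) \<partial>\<Omega>)"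
    by (intro nn_integral_cong) simp
  also have "\<dots> = 1" unfolding kn_def
    by (rule optional_stopping[of wt]) (use c mean in \<open>auto simp: wt_def\<close>)
  finally show ?thesis .
qed

text \<open>Optional stopping again, now with tilt 2 q and no jump weight. The normalisation left
  over is exp (\<kappa> (2 q) times the stopping time), and the time is at most K.\<close>

lemma U_square:
  "integrable \<Omega> (\<lambda>w. (U n w)\<^sup>2)" "(\<integral>w. (U n w)\<^sup>2 \<partial>\<Omega>) \<le> exp (\<kappa> (2 * q) * real K)"
proof -
  define a where "a = \<kappa> (2 * q)"
  have a: "0 \<le> a" unfolding a_def by (rule \<kappa>_nonneg)
  define wt where "wt x = exp (- (2 * q) * x) / exp (a / 2 ^ n)" for x
  have [measurable]: "wt \<in> borel_measurable borel" unfolding wt_def by measurable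
  have i: "integrable \<Omega> (\<lambda>w. wt (X (1 / 2 ^ n) w))"
    unfolding wt_def by (intro integrable_divide exp_X_integrable) (use q in auto)
  have "(\<integral>\<^sup>+w. ennreal (wt (X (1 / 2 ^ n) w)) \<partial>\<Omega>) = ennreal (\<integral>w. wt (X (1 / 2 ^ n) w) \<partial>\<Omega>)"
    by (rule nn_integral_eq_integral[OF i]) (simp add: wt_def)
  also have "(\<integral>w. wt (X (1 / 2 ^ n) w) \<partial>\<Omega>) = 1"
    using laplace_exponent[of "1 / 2 ^ n" "2 * q"] q unfolding wt_def a_def by simp
  finally have mean: "(\<integral>\<^sup>+w. ennreal (wt (X (1 / 2 ^ n) w)) \<partial>\<Omega>) = 1" by simp
  have le: "(U n w)\<^sup>2 \<le> exp (a * real K) * (\<Prod>i<kn n w. wt (incr (path w) n i))" if wt: "w \<in> space \<Omega>" for w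
  proof -
    define k where "k = kn n w"
    have "(\<Prod>i<k. wt (incr (path w) n i)) = (\<Prod>i<k. exp (- (2 * q) * incr (path w) n i)) / exp (a / 2 ^ n) ^ k"
      unfolding wt_def by (simp add: prod_dividef)
    also have "(\<Prod>i<k. exp (- (2 * q) * incr (path w) n i)) = exp (- (2 * q) * (\<Sum>i<k. incr (path w) n i))"
      by (simp add: exp_sum sum_distrib_left)
    also have "(\<Sum>i<k. incr (path w) n i) = X (real k / 2 ^ n) w" unfolding k_def by (rule X_kn[OF wt, symmetric])
    also have "exp (- (2 * q) * X (real k / 2 ^ n) w) = (U n w)\<^sup>2"
      unfolding U_def k_def by (simp add: power2_eq_square flip: exp_add)
    also have "exp (a / 2 ^ n) ^ k = exp (real k * (a / 2 ^ n))" by (rule exp_of_nat_mult[symmetric])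
    finally have e: "(\<Prod>i<k. wt (incr (path w) n i)) = (U n w)\<^sup>2 / exp (real k * (a / 2 ^ n))" .
    have "real k * (a / 2 ^ n) = a * (real k / 2 ^ n)" by simp
    also have "\<dots> \<le> a * real K" unfolding k_def by (intro mult_left_mono kn_facts a)
    finally have "(U n w)\<^sup>2 * exp (real k * (a / 2 ^ n)) \<le> (U n w)\<^sup>2 * exp (a * real K)" by (intro mult_left_mono) auto
    then have "(U n w)\<^sup>2 \<le> exp (a * real K) * ((U n w)\<^sup>2 / exp (real k * (a / 2 ^ n)))"
      by (simp add: field_simps)
    then show ?thesis using e unfolding k_def by simp
  qed
  have prod_meas: "(\<lambda>w. \<Prod>i<kn n w. wt (incr (path w) n i)) \<in> borel_measurable \<Omega>" by (rule kn_compose) measurable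
  have "(\<integral>\<^sup>+w. ennreal ((U n w)\<^sup>2) \<partial>\<Omega>) \<le> (\<integral>\<^sup>+w. ennreal (exp (a * real K)) * ennreal (\<Prod>i<kn n w. wt (incr (path w) n i)) \<partial>\<Omega>)"
    by (intro nn_integral_mono) (simp add: ennreal_mult'[symmetric] le ennreal_leI)
  also have "\<dots> = ennreal (exp (a * real K)) * (\<integral>\<^sup>+w. ennreal (\<Prod>i<kn n w. wt (incr (path w) n i)) \<partial>\<Omega>)"
    using prod_meas by (intro nn_integral_cmult) auto
  also have "(\<integral>\<^sup>+w. ennreal (\<Prod>i<kn n w. wt (incr (path w) n i)) \<partial>\<Omega>) = 1" unfolding kn_def
    by (rule optional_stopping[of wt]) (use mean in \<open>auto simp: wt_def\<close>)
  finally have fin: "(\<integral>\<^sup>+w. ennreal ((U n w)\<^sup>2) \<partial>\<Omega>) \<le> ennreal (exp (a * real K))" by simp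
  show int: "integrable \<Omega> (\<lambda>w. (U n w)\<^sup>2)"
    by (rule integrableI_nonneg) (use le_less_trans[OF fin] in auto)
  have "ennreal (\<integral>w. (U n w)\<^sup>2 \<partial>\<Omega>) \<le> ennreal (exp (a * real K))"
    using fin nn_integral_eq_integral[OF int] by simp
  then show "(\<integral>w. (U n w)\<^sup>2 \<partial>\<Omega>) \<le> exp (\<kappa> (2 * q) * real K)" unfolding a_def by simp
qed

text \<open>Up to the passage time the path is at least - s, hence the deterministic bound in the
  limit. On the grid the stopped value may lie below - s by an uncontrolled amount; this is the
  reason for the second-moment bound on U.\<close>

lemma Ul_bounds: "AE w in \<Omega>. 0 \<le> Ul w \<and> Ul w \<le> exp (q * s)"
  using AE_no_negative_jump AE_space
proof eventually_elim
  case (elim w)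
  have "- s \<le> X (\<tau> w) w"
    by (rule passage_ge[OF X_cadlag[OF elim(2)] X_0[OF elim(2)] elim(1) s of_nat_0_le_iff[of K] \<tau>_bounds(1)])
       (simp add: \<tau>_def)
  then have "q * - s \<le> q * X (\<tau> w) w" using q by (intro mult_left_mono) auto
  then show ?case unfolding Ul_def by simp
qed

lemma U_L1: "(\<lambda>n. \<integral>w. \<bar>U n w - Ul w\<bar> \<partial>\<Omega>) \<longlonglongrightarrow> 0" "integrable \<Omega> (\<lambda>w. \<bar>U n w - Ul w\<bar>)"
proof -
  have U0: "0 \<le> U n w" for n w unfolding U_def by simp
  have lim: "AE w in \<Omega>. (\<lambda>n. U n w) \<longlonglongrightarrow> Ul w" using U_lim by (rule AE_I2)
  note L = L1_tendsto_of_L2_bounded[of U Ul, OF UVA_measurable(1) U0 limit_measurable(1) Ul_bounds lim U_square]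
  show "(\<lambda>n. \<integral>w. \<bar>U n w - Ul w\<bar> \<partial>\<Omega>) \<longlonglongrightarrow> 0" by (rule L(1))
  show "integrable \<Omega> (\<lambda>w. \<bar>U n w - Ul w\<bar>)" by (rule L(2))
qed

lemma V_bound: "\<exists>B>0. \<forall>n w. V n w \<le> B \<and> Vl w \<le> B"
proof -
  have "Bseq (\<lambda>n. 2 ^ n * ln (tilt_norm q n))"
    by (rule convergent_imp_Bseq) (use tilt_norm_limit[OF less_imp_le[OF q]] in \<open>auto simp: convergent_def\<close>)
  then obtain b where b: "0 < b" "\<And>n. \<bar>2 ^ n * ln (tilt_norm q n)\<bar> \<le> b" unfolding Bseq_def by auto
  define B where "B = exp (real K * (b + \<bar>\<psi> q\<bar>))"
  have key: "exp (- t * y) \<le> B" if "0 \<le> t" "t \<le> real K" "\<bar>y\<bar> \<le> b + \<bar>\<psi> q\<bar>" for t y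
  proof -
    have "- t * y \<le> t * \<bar>y\<bar>" using that(1) abs_ge_minus_self[of y] mult_left_mono[of "- y" "\<bar>y\<bar>" t] by simp
    also have "\<dots> \<le> real K * (b + \<bar>\<psi> q\<bar>)" using that by (intro mult_mono) auto
    finally show ?thesis unfolding B_def by simp
  qed
  have "V n w \<le> B" for n w
    unfolding V_def by (rule key) (use kn_facts(2)[of n w] b(2)[of n] in auto)
  moreover have "Vl w \<le> B" for w
    unfolding Vl_def by (rule key) (use \<tau>_bounds[of w] b(1) in auto)
  moreover have "0 < B" unfolding B_def by simp
  ultimately show ?thesis by blast
qed

text \<open>The mean 1 passes to the limit because each factor converges in L1. The replacement
  order is U, then V, then A: the difference of U meets only V and A, while the later differences
  meet the bounded limit \<open>Ul\<close> instead of U.\<close>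

theorem stopped_identity: "(\<integral>w. Ul w * Vl w * Al w \<partial>\<Omega>) = 1"
proof -
  from V_bound obtain B where B: "0 < B" "\<And>n w. V n w \<le> B" "\<And>w. Vl w \<le> B" by blast
  define D where "D = exp (q * s)"
  have D: "0 < D" unfolding D_def by simp
  have nn: "0 \<le> U n w" "0 \<le> Ul w" "0 \<le> V n w" "0 \<le> Vl w" for n w
    unfolding U_def Ul_def V_def Vl_def by auto
  have V_L1: "(\<lambda>n. \<integral>w. \<bar>V n w - Vl w\<bar> \<partial>\<Omega>) \<longlonglongrightarrow> (\<integral>w. 0 \<partial>\<Omega>)"
  proof (rule integral_dominated_convergence[where w="\<lambda>_. B"])
    show "AE w in \<Omega>. (\<lambda>n. \<bar>V n w - Vl w\<bar>) \<longlonglongrightarrow> 0"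
      using V_lim by (intro AE_I2 tendsto_rabs_zero LIM_zero)
    show "AE w in \<Omega>. norm \<bar>V n w - Vl w\<bar> \<le> B" for n
    proof (intro AE_I2)
      fix w show "norm \<bar>V n w - Vl w\<bar> \<le> B"
        using B(2)[of n w] B(3)[of w] nn(3)[of n w] nn(4)[of w] unfolding real_norm_def abs_abs by linarith
    qed
  qed auto
  have iV: "integrable \<Omega> (\<lambda>w. \<bar>V n w - Vl w\<bar>)" for n
  proof (rule bounded_integrable[where B=B])
    fix w show "\<bar>\<bar>V n w - Vl w\<bar>\<bar> \<le> B"
        using B(2)[of n w] B(3)[of w] nn(3)[of n w] nn(4)[of w] by linarith
  qed measurable
  have iA: "integrable \<Omega> (\<lambda>w. \<bar>A n w - Al w\<bar>)" for n
    by (rule bounded_integrable[where B=1]) (auto intro!: abs_diff_le_1 A_bounds)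
  define E where "E n w = B * \<bar>U n w - Ul w\<bar> + (D * \<bar>V n w - Vl w\<bar> + D * B * \<bar>A n w - Al w\<bar>)" for n w
  have iE: "integrable \<Omega> (E n)" for n
    unfolding E_def by (intro Bochner_Integration.integrable_add integrable_mult_right U_L1 iV iA)
  have "(\<lambda>n. B * (\<integral>w. \<bar>U n w - Ul w\<bar> \<partial>\<Omega>) + (D * (\<integral>w. \<bar>V n w - Vl w\<bar> \<partial>\<Omega>) + D * B * (\<integral>w. \<bar>A n w - Al w\<bar> \<partial>\<Omega>))) \<longlonglongrightarrow> B * 0 + (D * (\<integral>w. 0 \<partial>\<Omega>) + D * B * 0)"
    by (intro tendsto_add tendsto_mult_left U_L1(1) V_L1 A_L1)
  also have "(\<lambda>n. B * (\<integral>w. \<bar>U n w - Ul w\<bar> \<partial>\<Omega>) + (D * (\<integral>w. \<bar>V n w - Vl w\<bar> \<partial>\<Omega>) + D * B * (\<integral>w. \<bar>A n w - Al w\<bar> \<partial>\<Omega>))) = (\<lambda>n. \<integral>w. E n w \<partial>\<Omega>)"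
    unfolding E_def using U_L1(2) iV iA by (intro ext) simp
  finally have limE: "(\<lambda>n. \<integral>w. E n w \<partial>\<Omega>) \<longlonglongrightarrow> 0" by simp
  have iUVA: "integrable \<Omega> (\<lambda>w. U n w * V n w * A n w)" "(\<integral>w. U n w * V n w * A n w \<partial>\<Omega>) = 1" for n
  proof -
    have "has_bochner_integral \<Omega> (\<lambda>w. U n w * V n w * A n w) 1"
      by (rule has_bochner_integral_nn_integral) (use stop_mean[of n] nn A_bounds in auto)
    then show "integrable \<Omega> (\<lambda>w. U n w * V n w * A n w)" "(\<integral>w. U n w * V n w * A n w \<partial>\<Omega>) = 1"
      by (auto simp: has_bochner_integral_iff)
  qed
  have iL: "integrable \<Omega> (\<lambda>w. Ul w * Vl w * Al w)"
  proof (rule integrable_const_bound[where B="D * B * 1"])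
    show "AE w in \<Omega>. norm (Ul w * Vl w * Al w) \<le> D * B * 1"
      using Ul_bounds
    proof eventually_elim
      case (elim w)
      have "Ul w * Vl w * Al w \<le> D * B * 1"
        using elim nn(4)[of w] B(1) B(3)[of w] A_bounds(5,6)[of w] D unfolding D_def[symmetric]
        by (intro mult_mono) auto
      moreover have "0 \<le> Ul w * Vl w * Al w" using nn A_bounds by (intro mult_nonneg_nonneg)
      ultimately show ?case by simp
    qed
  qed measurable
  have "\<bar>1 - (\<integral>w. Ul w * Vl w * Al w \<partial>\<Omega>)\<bar> \<le> (\<integral>w. E n w \<partial>\<Omega>)" for n
  proof -
    have "\<bar>1 - (\<integral>w. Ul w * Vl w * Al w \<partial>\<Omega>)\<bar> = \<bar>\<integral>w. U n w * V n w * A n w - Ul w * Vl w * Al w \<partial>\<Omega>\<bar>"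
      using Bochner_Integration.integral_diff[OF iUVA(1)[of n] iL] iUVA(2)[of n] by simp
    also have "\<dots> \<le> (\<integral>w. \<bar>U n w * V n w * A n w - Ul w * Vl w * Al w\<bar> \<partial>\<Omega>)" by (rule integral_abs_bound)
    also have "\<dots> \<le> (\<integral>w. E n w \<partial>\<Omega>)"
    proof (rule integral_mono_AE)
      show "integrable \<Omega> (\<lambda>w. \<bar>U n w * V n w * A n w - Ul w * Vl w * Al w\<bar>)"
        by (intro integrable_abs Bochner_Integration.integrable_diff iUVA iL)
      show "AE w in \<Omega>. \<bar>U n w * V n w * A n w - Ul w * Vl w * Al w\<bar> \<le> E n w"
        using Ul_bounds
      proof eventually_elim
        case (elim w)
        define u u' v v' a a' where "u = U n w" "u' = Ul w" "v = V n w" "v' = Vl w" "a = A n w" "a' = Al w"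
        note d = this
        have f: "0 \<le> u'" "u' \<le> D" "0 \<le> v" "v \<le> B" "0 \<le> v'" "v' \<le> B" "0 \<le> a" "a \<le> 1"
          using elim nn B A_bounds unfolding d D_def by auto
        have "u * v * a - u' * v' * a' = (v * a) * (u - u') + (u' * a) * (v - v') + (u' * v') * (a - a')"
          by (simp add: algebra_simps)
        then have "\<bar>u * v * a - u' * v' * a'\<bar> \<le> \<bar>(v * a) * (u - u')\<bar> + \<bar>(u' * a) * (v - v')\<bar> + \<bar>(u' * v') * (a - a')\<bar>"
          by linarith
        also have "\<bar>(v * a) * (u - u')\<bar> = (v * a) * \<bar>u - u'\<bar>" using f by (simp add: abs_mult)
        also have "\<bar>(u' * a) * (v - v')\<bar> = (u' * a) * \<bar>v - v'\<bar>" using f by (simp add: abs_mult)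
        also have "\<bar>(u' * v') * (a - a')\<bar> = (u' * v') * \<bar>a - a'\<bar>" using f by (simp add: abs_mult)
        also have "(v * a) * \<bar>u - u'\<bar> \<le> (B * 1) * \<bar>u - u'\<bar>" using f by (intro mult_right_mono mult_mono) auto
        also have "(u' * a) * \<bar>v - v'\<bar> \<le> (D * 1) * \<bar>v - v'\<bar>" using f D by (intro mult_right_mono mult_mono) auto
        also have "(u' * v') * \<bar>a - a'\<bar> \<le> (D * B) * \<bar>a - a'\<bar>" using f D by (intro mult_right_mono mult_mono) auto
        finally show ?case unfolding E_def d by simp
      qed
    qed (rule iE)
    finally show ?thesis .
  qed
  then have "\<bar>1 - (\<integral>w. Ul w * Vl w * Al w \<partial>\<Omega>)\<bar> \<le> 0"
    by (intro LIMSEQ_le_const[OF limE]) auto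
  then show ?thesis by simp
qed

end

section \<open>Removing the time cap: inverse local time\<close>

lemma cadlag_bounded_below:
  assumes f: "cadlag f" and T: "0 \<le> T"
  shows "\<exists>B. \<forall>t\<in>{0..T}. B \<le> f t"
proof -
  have loc: "\<exists>a b B. a < t \<and> t < b \<and> (\<forall>u. a < u \<and> u < b \<and> 0 \<le> u \<longrightarrow> B \<le> f u)" if t: "0 \<le> t" for t
  proof -
    have "\<forall>\<^sub>F u in at_right t. f t - 1 < f u" by (rule order_tendstoD(1)[OF cadlag_right[OF f t]]) simp
    then obtain b where b: "t < b" "\<And>u. t < u \<Longrightarrow> u < b \<Longrightarrow> f t - 1 < f u" unfolding eventually_at_right_field by blast
    show ?thesis
    proof (cases "t = 0")
      case True
      have "f t - 1 \<le> f u" if "u < b" "0 \<le> u" for u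
        using b(2)[of u] that True by (cases "u = 0") auto
      then show ?thesis using b(1) True by (intro exI[of _ "-1"] exI[of _ b] exI[of _ "f t - 1"]) auto
    next
      case False
      with t have t0: "0 < t" by simp
      define l where "l = f t - jump f t"
      have "\<forall>\<^sub>F u in at_left t. l - 1 < f u"
        unfolding l_def by (rule order_tendstoD(1)[OF cadlag_left[OF f t0]]) simp
      then obtain a where a: "a < t" "\<And>u. a < u \<Longrightarrow> u < t \<Longrightarrow> l - 1 < f u" unfolding eventually_at_left_field by blast
      have "min (l - 1) (f t - 1) \<le> f u" if "a < u" "u < b" for u
        using b(2)[of u] a(2)[of u] that by (cases u t rule: linorder_cases) auto
      then show ?thesis using a(1) b(1) by blast
    qed
  qed
  have "\<exists>a b B. a < t \<and> t < b \<and> (\<forall>u. a < u \<and> u < b \<and> 0 \<le> u \<longrightarrow> B \<le> f u)" if "t \<in> {0..T}" for t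
    using loc that by simp
  then obtain a b B where abB: "\<And>t. t \<in> {0..T} \<Longrightarrow> a t < t \<and> t < b t \<and> (\<forall>u. a t < u \<and> u < b t \<and> 0 \<le> u \<longrightarrow> B t \<le> f u)"
    by metis
  have "{0..T} \<subseteq> (\<Union>t\<in>{0..T}. {a t<..<b t})" using abB by fastforce
  from compactE_image[OF compact_Icc _ this]
  obtain C where C: "C \<subseteq> {0..T}" "finite C" "{0..T} \<subseteq> (\<Union>t\<in>C. {a t<..<b t})" by (metis open_greaterThanLessThan)
  have "Min (B ` C) \<le> f u" if u: "u \<in> {0..T}" for u
  proof -
    from C(3) u obtain t where t: "t \<in> C" "a t < u" "u < b t" by auto
    have "Min (B ` C) \<le> B t" using t(1) C(2) by simp
    also have "\<dots> \<le> f u" using abB[of t] t u C(1) by auto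
    finally show ?thesis .
  qed
  then show ?thesis by blast
qed

text \<open>The real-valued infimum has its intended meaning because cadlag paths are bounded below
  on compact intervals.\<close>

lemma running_inf_less_iff:
  assumes f: "cadlag f" and t: "0 \<le> t"
  shows "running_inf f t < c \<longleftrightarrow> (\<exists>r\<in>{0..t}. f r < c)"
proof -
  have "bdd_below (f ` {0..t})"
    using cadlag_bounded_below[OF f t] by (auto intro: bdd_belowI)
  then show ?thesis unfolding running_inf_def using t by (subst cInf_less_iff) auto
qed

lemma passage_eq_inverse_local_time:
  assumes f: "cadlag f" and t: "0 \<le> t" "f t < - s" "t \<le> K"
  shows "passage s K f = inverse_local_time f s"
proof -
  have K: "0 \<le> K" using t by simp
  have "0 \<le> t \<and> s < - running_inf f t \<longleftrightarrow> (\<exists>r\<in>{0..t}. f r < - s)" for t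
  proof (cases "0 \<le> t")
    case True
    then show ?thesis using running_inf_less_iff[OF f True, of "- s"] by (simp add: less_minus_iff)
  qed auto
  then have eq: "{t. 0 \<le> t \<and> s < - running_inf f t} = {t. \<exists>r\<in>{0..t}. f r < - s}" by simp
  have ne: "t \<in> {t. \<exists>r\<in>{0..t}. f r < - s}" using t by auto
  have bdd: "bdd_below {t. \<exists>r\<in>{0..t}. f r < - s}" by (rule bdd_belowI[of _ 0]) auto
  show ?thesis unfolding inverse_local_time_def eq
  proof (rule antisym)
    show "passage s K f \<le> Inf {t. \<exists>r\<in>{0..t}. f r < - s}"
    proof (rule cInf_greatest)
      show "{t. \<exists>r\<in>{0..t}. f r < - s} \<noteq> {}" using ne by blast
      fix x assume "x \<in> {t. \<exists>r\<in>{0..t}. f r < - s}"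
      then obtain r where r: "0 \<le> r" "r \<le> x" "f r < - s" by auto
      show "passage s K f \<le> x" using passage_bounds(3)[of K r f s, OF K r(1,3)] r(2) by simp
    qed
    show "Inf {t. \<exists>r\<in>{0..t}. f r < - s} \<le> passage s K f"
      unfolding passage_def
    proof (rule cInf_greatest)
      fix x assume "x \<in> {t. 0 \<le> t \<and> f t < - s} \<union> {K}"
      then consider "x = K" | "0 \<le> x" "f x < - s" by blast
      then have "\<exists>y\<le>x. y \<in> {t. \<exists>r\<in>{0..t}. f r < - s}"
      proof cases
        case 1 then show ?thesis using t ne by blast
      next
        case 2 then have "x \<in> {t. \<exists>r\<in>{0..t}. f r < - s}" by auto
        then show ?thesis by blast
      qed
      then show "Inf {t. \<exists>r\<in>{0..t}. f r < - s} \<le> x" using cInf_lower[OF _ bdd] by force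
    qed simp
  qed
qed

definition hits :: "real \<Rightarrow> (real \<Rightarrow> real) \<Rightarrow> bool" where
  "hits s f \<longleftrightarrow> (\<exists>t\<ge>0. f t < - s)"

lemma passage_not_hits: "\<not> hits s f \<Longrightarrow> passage s K f = K"
proof -
  assume "\<not> hits s f"
  then have "{t. 0 \<le> t \<and> f t < - s} = {}" unfolding hits_def by blast
  then show "passage s K f = K" unfolding passage_def by (simp only: Un_empty_left cInf_singleton)
qed

lemma passage_eventually:
  assumes f: "cadlag f" and h: "hits s f"
  shows "\<forall>\<^sub>F K in sequentially. passage s (real K) f = inverse_local_time f s \<and> passage s (real K) f < real K"
proof -
  obtain t where t: "0 \<le> t" "f t < - s" using h unfolding hits_def by blast
  have "\<forall>\<^sub>F K in sequentially. t < real K" using filterlim_real_sequentially unfolding filterlim_at_top_dense by blast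
  then show ?thesis
  proof eventually_elim
    case (elim K)
    have "passage s (real K) f \<le> t" by (rule passage_bounds(3)) (use t in auto)
    then show ?case using passage_eq_inverse_local_time[OF f t, of "real K"] elim by simp
  qed
qed

context weighted_levy
begin

text \<open>Paths that never go below - s get weight 0. This is the limit of exp (- K \<psi> q) as
  the cap K grows, provided \<psi> q > 0.\<close>

definition passage_weight :: "real \<Rightarrow> real \<Rightarrow> 'w \<Rightarrow> real" where
  "passage_weight q s w = (if hits s (path w) then
     exp (- inverse_local_time (path w) s * \<psi> q) * exp_neg (jump_sum F (path w) {0<..inverse_local_time (path w) s}) else 0)"

lemma passage_weight_measurable [measurable]: "passage_weight q s \<in> borel_measurable \<Omega>" if q: "0 < q" and s: "0 \<le> s"
proof (rule borel_measurable_LIMSEQ_real)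
  interpret S: stopped_levy \<beta> \<Omega> X F C q s K for K :: nat
    by unfold_locales fact+
  show "(\<lambda>w. if S.\<tau> K w < real K then S.Vl K w * S.Al K w else 0) \<in> borel_measurable \<Omega>" for K by measurable
  show "(\<lambda>K. if S.\<tau> K w < real K then S.Vl K w * S.Al K w else 0) \<longlonglongrightarrow> passage_weight q s w" if w: "w \<in> space \<Omega>" for w
  proof (cases "hits s (path w)")
    case True
    show ?thesis
    proof (rule tendsto_eventually)
      show "\<forall>\<^sub>F K in sequentially. (if S.\<tau> K w < real K then S.Vl K w * S.Al K w else 0) = passage_weight q s w"
        using passage_eventually[OF X_cadlag[OF w(1)] True]
      proof eventually_elim
        case (elim K)
        then have e: "S.\<tau> K w = inverse_local_time (path w) s" and l: "S.\<tau> K w < real K" unfolding S.\<tau>_def by auto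
        show ?case using True l unfolding passage_weight_def S.Vl_def S.Al_def e by simp
      qed
    qed
  next
    case False
    then have "S.\<tau> K w = real K" for K unfolding S.\<tau>_def by (rule passage_not_hits)
    then show ?thesis using False unfolding passage_weight_def by simp
  qed
qed

text \<open>Let the cap K tend to infinity; \<psi> q >= 0 gives the dominating constant exp (q s).
  Without a hit the path stays above - s and the factor exp (- K \<psi> q) must vanish, which
  explains the disjunction. Its first case, applied with F = 0, yields the almost sure hitting that
  its second case asks for when \<psi> q = 0.\<close>

lemma passage_identity:
  assumes q: "0 < q" and s: "0 \<le> s" and \<psi>: "0 \<le> \<psi> q" and hit: "0 < \<psi> q \<or> (AE w in \<Omega>. hits s (path w))"
  shows "(\<integral>w. exp (q * s) * passage_weight q s w \<partial>\<Omega>) = 1"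
proof -
  interpret S: stopped_levy \<beta> \<Omega> X F C q s K for K :: nat
    by unfold_locales fact+
  define G where "G K w = S.Ul K w * S.Vl K w * S.Al K w" for K w
  have G1: "(\<integral>w. G K w \<partial>\<Omega>) = 1" for K unfolding G_def by (rule S.stopped_identity)
  have Gm [measurable]: "G K \<in> borel_measurable \<Omega>" for K unfolding G_def by measurable
  define Z where "Z w = (if hits s (path w) then exp (- q * X (inverse_local_time (path w) s) w) * passage_weight q s w else 0)" for w
  have GZ: "\<forall>\<^sub>F K in sequentially. G K w = Z w \<and> S.\<tau> K w < real K" if w: "w \<in> space \<Omega>" "hits s (path w)" for w
    using passage_eventually[OF X_cadlag[OF w(1)] w(2)]
  proof eventually_elim
    case (elim K)
    then have e: "S.\<tau> K w = inverse_local_time (path w) s" and l: "S.\<tau> K w < real K" unfolding S.\<tau>_def by auto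
    show ?case using w(2) l unfolding G_def Z_def passage_weight_def S.Ul_def S.Vl_def S.Al_def e by simp
  qed
  have Zm [measurable]: "Z \<in> borel_measurable \<Omega>"
  proof (rule borel_measurable_LIMSEQ_real)
    show "(\<lambda>w. if S.\<tau> K w < real K then G K w else 0) \<in> borel_measurable \<Omega>" for K by measurable
    show "(\<lambda>K. if S.\<tau> K w < real K then G K w else 0) \<longlonglongrightarrow> Z w" if w: "w \<in> space \<Omega>" for w
    proof (cases "hits s (path w)")
      case True
      show ?thesis by (rule tendsto_eventually) (use GZ[OF w True] in eventually_elim, simp)
    next
      case False
      then have "S.\<tau> K w = real K" for K unfolding S.\<tau>_def by (rule passage_not_hits)
      then show ?thesis using False unfolding Z_def by simp
    qed
  qed
  have "(\<lambda>K. \<integral>w. G K w \<partial>\<Omega>) \<longlonglongrightarrow> (\<integral>w. Z w \<partial>\<Omega>)"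
  proof (rule integral_dominated_convergence[where w="\<lambda>_. exp (q * s)"])
    show "AE w in \<Omega>. norm (G K w) \<le> exp (q * s)" for K
      using S.Ul_bounds[of K]
    proof eventually_elim
      case (elim w)
      have V: "0 \<le> S.Vl K w" "S.Vl K w \<le> 1" unfolding S.Vl_def using \<psi> S.\<tau>_bounds(1)[of K w] by auto
      have "G K w \<le> exp (q * s) * 1 * 1" unfolding G_def
        using elim V S.A_bounds(5,6)[of K w] by (intro mult_mono) auto
      moreover have "0 \<le> G K w" unfolding G_def using elim V S.A_bounds(5)[of K w] by (intro mult_nonneg_nonneg) auto
      ultimately show ?case by simp
    qed
    have "AE w in \<Omega>. hits s (path w) \<or> 0 < \<psi> q" using hit
    proof
      assume "AE w in \<Omega>. hits s (path w)" then show ?thesis by eventually_elim simp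
    qed simp
    then show "AE w in \<Omega>. (\<lambda>K. G K w) \<longlonglongrightarrow> Z w" using AE_space
    proof eventually_elim
      case (elim w)
      show ?case
      proof (cases "hits s (path w)")
        case True
        show ?thesis by (rule tendsto_eventually) (use GZ[OF elim(2) True] in eventually_elim, simp)
      next
        case False
        with elim have \<psi>0: "0 < \<psi> q" by blast
        have \<tau>: "S.\<tau> K w = real K" for K unfolding S.\<tau>_def by (rule passage_not_hits) fact
        have V0: "(\<lambda>K. S.Vl K w) \<longlonglongrightarrow> 0"
        proof -
          have "filterlim (\<lambda>K. - real K * \<psi> q) at_bot sequentially"
            using \<psi>0 filterlim_real_sequentially by (simp add: filterlim_uminus_at_bot filterlim_at_top_mult_tendsto_pos[OF tendsto_const])
          then show ?thesis unfolding S.Vl_def \<tau> by (rule filterlim_compose[OF exp_at_bot])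
        qed
        have U: "0 \<le> S.Ul K w" "S.Ul K w \<le> exp (q * s)" for K
        proof -
          have "- s \<le> X (real K) w" using False unfolding hits_def by (metis not_le of_nat_0_le_iff)
          then have "q * - s \<le> q * X (real K) w" using q by (intro mult_left_mono) auto
          then show "0 \<le> S.Ul K w" "S.Ul K w \<le> exp (q * s)" unfolding S.Ul_def \<tau> by auto
        qed
        have "(\<lambda>K. G K w) \<longlonglongrightarrow> 0"
        proof (rule tendsto_sandwich[OF _ _ tendsto_const])
          show "\<forall>\<^sub>F K in sequentially. 0 \<le> G K w"
            unfolding G_def S.Vl_def using U(1) S.A_bounds(5) by (intro always_eventually allI mult_nonneg_nonneg) auto
          have "G K w \<le> exp (q * s) * S.Vl K w * 1" for K
            unfolding G_def S.Vl_def using U S.A_bounds(5,6)[of K w] by (intro mult_mono) auto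
          then show "\<forall>\<^sub>F K in sequentially. G K w \<le> exp (q * s) * S.Vl K w" by simp
          show "(\<lambda>K. exp (q * s) * S.Vl K w) \<longlonglongrightarrow> 0" using tendsto_mult_left[OF V0, of "exp (q * s)"] by simp
        qed
        then show ?thesis using False unfolding Z_def by simp
      qed
    qed
  qed auto
  then have Z1: "(\<integral>w. Z w \<partial>\<Omega>) = 1" unfolding G1 by (simp add: LIMSEQ_const_iff)
  have "AE w in \<Omega>. Z w = exp (q * s) * passage_weight q s w"
    using AE_no_negative_jump AE_space
  proof eventually_elim
    case (elim w)
    show ?case
    proof (cases "hits s (path w)")
      case True
      from eventually_happens'[OF sequentially_bot passage_eventually[OF X_cadlag[OF elim(2)] True]]
      obtain K where K: "passage s (real K) (path w) = inverse_local_time (path w) s" "passage s (real K) (path w) < real K" by blast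
      have "path w (passage s (real K) (path w)) = - s"
        by (rule passage_eq[OF X_cadlag[OF elim(2)] X_0[OF elim(2)] elim(1) s K(2)]) simp
      then show ?thesis unfolding Z_def K(1) using True by simp
    qed (simp add: Z_def passage_weight_def)
  qed
  then have "(\<integral>w. Z w \<partial>\<Omega>) = (\<integral>w. exp (q * s) * passage_weight q s w \<partial>\<Omega>)"
    using passage_weight_measurable[OF q s] by (intro integral_cong_AE) auto
  with Z1 show ?thesis by simp
qed

end

context stable_levy
begin

text \<open>For F = 0 the passage identity reads E (exp (- \<kappa> q T); hit) = exp (- q s). As q
  tends to 0 the probability of a hit is seen to be 1. For s = 0 the expectation is 1, which forces
  T = 0: the path enters the negative half line at once.\<close>

lemma AE_hits:
  assumes s: "0 \<le> s"
  shows "AE w in \<Omega>. hits s (path w)" and "AE w in \<Omega>. inverse_local_time (path w) 0 = 0"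
proof -
  interpret W: weighted_levy \<beta> \<Omega> X "\<lambda>_. 0" 1 by unfold_locales auto
  have [simp]: "jump_sum (\<lambda>_. 0) f S = 0" for f S unfolding jump_sum_def by simp
  have \<psi>: "W.\<psi> q = \<kappa> q" for q unfolding W.\<psi>_def W.\<phi>_def by simp
  have \<kappa>: "0 < \<kappa> q" if "0 < q" for q unfolding \<kappa>_def using Gamma_pos that by simp
  have w: "W.passage_weight q s w = (if hits s (path w) then exp (- inverse_local_time (path w) s * \<kappa> q) else 0)" for q s w
    unfolding W.passage_weight_def \<psi> using exp_neg_ennreal[of 0] by simp
  have id: "(\<integral>w. W.passage_weight q s w \<partial>\<Omega>) = exp (- q * s)" if "0 < q" "0 \<le> s" for q s
  proof -
    have "exp (q * s) * (\<integral>w. W.passage_weight q s w \<partial>\<Omega>) = 1"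
      using W.passage_identity[OF that] \<kappa>[OF that(1)] unfolding \<psi> by simp
    then show ?thesis by (simp add: exp_minus field_simps)
  qed
  have ilt: "0 \<le> inverse_local_time (path w) s" if "w \<in> space \<Omega>" "hits s (path w)" for w s
  proof -
    from eventually_happens'[OF sequentially_bot passage_eventually[OF X_cadlag[OF that(1)] that(2)]]
    obtain K where K: "passage s (real K) (path w) = inverse_local_time (path w) s" by blast
    show ?thesis using passage_bounds(1)[of "real K" s "path w"] K by simp
  qed
  have hm: "Measurable.pred \<Omega> (\<lambda>w. hits s (path w))" if "0 \<le> s" for s
  proof -
    have "Measurable.pred \<Omega> (\<lambda>w. W.passage_weight 1 s w \<noteq> 0)"
      using W.passage_weight_measurable[of 1 s] that by measurable
    also have "(\<lambda>w. W.passage_weight 1 s w \<noteq> 0) = (\<lambda>w. hits s (path w))" unfolding w by auto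
    finally show ?thesis .
  qed
  show H: "AE w in \<Omega>. hits s (path w)"
  proof -
    have le: "exp (- q * s) \<le> prob {w \<in> space \<Omega>. hits s (path w)}" if q: "0 < q" for q
    proof -
      have "exp (- q * s) = (\<integral>w. W.passage_weight q s w \<partial>\<Omega>)" by (rule id[OF q s, symmetric])
      also have "\<dots> \<le> (\<integral>w. indicator {w \<in> space \<Omega>. hits s (path w)} w \<partial>\<Omega>)"
      proof (rule integral_mono_AE')
        show "integrable \<Omega> (\<lambda>w. indicator {w \<in> space \<Omega>. hits s (path w)} w :: real)"
          using hm[OF s] by (intro integrable_real_indicator) (auto simp: less_top[symmetric])
        show "AE w in \<Omega>. W.passage_weight q s w \<le> indicator {w \<in> space \<Omega>. hits s (path w)} w"
          using \<kappa>[OF q] ilt[of _ s] by (intro AE_I2) (simp add: w indicator_def)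
      qed auto
      also have "\<dots> = prob {w \<in> space \<Omega>. hits s (path w)}" by (auto intro!: arg_cong[of _ _ prob])
      finally show ?thesis .
    qed
    have lim: "((\<lambda>q. exp (- q * s)) \<longlongrightarrow> exp (- 0 * s)) (at_right 0)" by (intro tendsto_intros)
    have "exp (- 0 * s) \<le> prob {w \<in> space \<Omega>. hits s (path w)}"
      by (rule tendsto_upperbound[OF lim]) (use le in \<open>auto simp: eventually_at_right_less intro: eventually_at_rightI[of 0 1]\<close>)
    then have "prob {w \<in> space \<Omega>. hits s (path w)} = 1" using prob_le_1[of "{w \<in> space \<Omega>. hits s (path w)}"] by simp
    then show ?thesis using hm[OF s] by (subst prob_Collect_eq_1[symmetric]) auto
  qed
  show "AE w in \<Omega>. inverse_local_time (path w) 0 = 0"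
  proof -
    have b: "AE w in \<Omega>. 0 \<le> 1 - W.passage_weight 1 0 w"
      using ilt[of _ 0] \<kappa>[of 1] by (intro AE_I2) (simp add: w)
    have i: "integrable \<Omega> (W.passage_weight 1 0)"
      using id[of 1 0] not_integrable_integral_eq[of \<Omega> "W.passage_weight 1 0"] by force
    have "(\<integral>w. 1 - W.passage_weight 1 0 w \<partial>\<Omega>) = 0" using id[of 1 0] i by (simp add: prob_space)
    then have "AE w in \<Omega>. 1 - W.passage_weight 1 0 w = 0"
      using integral_nonneg_eq_0_iff_AE[OF _ b] i by simp
    then show ?thesis by eventually_elim (use \<kappa>[of 1] in \<open>simp add: w split: if_splits\<close>)
  qed
qed

end

context weighted_levy
begin

lemma passage_weight_integral:
  assumes q: "0 < q" and s: "0 \<le> s" and \<psi>: "0 \<le> \<psi> q"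
  shows "(\<integral>w. passage_weight q s w \<partial>\<Omega>) = exp (- q * s)"
proof -
  have "exp (q * s) * (\<integral>w. passage_weight q s w \<partial>\<Omega>) = 1"
    using passage_identity[OF q s \<psi> disjI2[OF AE_hits(1)[OF s]]] by simp
  then show ?thesis by (simp add: exp_minus field_simps)
qed

end

section \<open>Time spent at the running infimum\<close>

text \<open>Lindley's recursion: the random walk with steps d minus its running minimum.\<close>

primrec reflected :: "(nat \<Rightarrow> real) \<Rightarrow> nat \<Rightarrow> real" where
  "reflected d 0 = 0"
| "reflected d (Suc j) = max 0 (reflected d j + d j)"

lemma reflected_cong: "(\<And>i. i < j \<Longrightarrow> d i = d' i) \<Longrightarrow> reflected d j = reflected d' j"
  by (induction j) auto

lemma reflected_nonneg: "0 \<le> reflected d j"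
  by (cases j) auto

lemma reflected_attained: "\<exists>i\<le>j. reflected d j = (\<Sum>k<j. d k) - (\<Sum>k<i. d k)"
proof (induction j)
  case (Suc j)
  show ?case
  proof (cases "0 \<le> reflected d j + d j")
    case True
    obtain i where "i \<le> j" "reflected d j = (\<Sum>k<j. d k) - (\<Sum>k<i. d k)" using Suc.IH by blast
    then show ?thesis using True by (intro exI[of _ i]) simp
  qed (auto intro!: exI[of _ "Suc j"])
qed simp

text \<open>The reflected walk is the path at the grid point just after r minus the path at some
  earlier grid point. The former is close to f r by right continuity; the latter is at least f r, or
  close to f r if it lies after r.\<close>

lemma reflected_incr_tendsto:
  assumes f: "cadlag f" and r: "0 < r" "\<And>u. 0 \<le> u \<Longrightarrow> u \<le> r \<Longrightarrow> f r \<le> f u"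
  shows "(\<lambda>n. reflected (incr f n) (Suc (cell n r))) \<longlonglongrightarrow> 0"
proof (rule LIMSEQ_I)
  fix e :: real assume e: "0 < e"
  have r0: "0 \<le> r" using r by simp
  have "\<forall>\<^sub>F u in at_right r. \<bar>f u - f r\<bar> < e / 2"
    using tendstoD[OF cadlag_right[OF f r0], of "e / 2"] e by (simp add: dist_real_def)
  then obtain b where b: "r < b" "\<And>u. r < u \<Longrightarrow> u < b \<Longrightarrow> \<bar>f u - f r\<bar> < e / 2" unfolding eventually_at_right_field by blast
  have b': "\<bar>f u - f r\<bar> < e / 2" if "r \<le> u" "u < b" for u
    using b(2)[of u] that e by (cases "u = r") auto
  have "\<forall>\<^sub>F n in sequentially. (real (cell n r) + 1) / 2 ^ n < b"
    by (rule order_tendstoD(2)[OF cell_limits(2)[OF r(1)] b(1)])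
  then have "\<forall>\<^sub>F n in sequentially. norm (reflected (incr f n) (Suc (cell n r)) - 0) < e"
  proof eventually_elim
    case (elim n)
    define j where "j = Suc (cell n r)"
    have j: "real j / 2 ^ n = (real (cell n r) + 1) / 2 ^ n" unfolding j_def by (simp add: add.commute)
    have jr: "r \<le> real j / 2 ^ n" unfolding j by (rule cell_bounds(2)[OF r(1)])
    have S: "(\<Sum>k<i. incr f n k) = f (real i / 2 ^ n) - f 0" for i
      by (induction i) (simp_all add: incr_def add.commute)
    obtain i where i: "i \<le> j" "reflected (incr f n) j = f (real j / 2 ^ n) - f (real i / 2 ^ n)"
      using reflected_attained[of j "incr f n"] unfolding S by auto
    have fj: "f (real j / 2 ^ n) < f r + e / 2" using b'[OF jr] elim unfolding j by linarith
    have ij: "real i / 2 ^ n \<le> real j / 2 ^ n" using i(1) by (intro divide_right_mono) auto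
    have i0: "0 \<le> real i / 2 ^ n" by simp
    have "f r - e / 2 < f (real i / 2 ^ n)"
    proof (cases "real i / 2 ^ n \<le> r")
      case True
      then show ?thesis using r(2)[OF i0 True] e by linarith
    next
      case False
      then show ?thesis using b'[of "real i / 2 ^ n"] ij elim j by linarith
    qed
    with i fj have "reflected (incr f n) j < e" by linarith
    then show ?case using reflected_nonneg[of "incr f n" j] unfolding j_def by simp
  qed
  then show "\<exists>no. \<forall>n\<ge>no. norm (reflected (incr f n) (Suc (cell n r)) - 0) < e" unfolding eventually_sequentially .
qed

text \<open>Summed over the grid, exp (q y) - 1 alone admits only a bound of order \<kappa> q, which
  is too weak. Here the first term has total mean of order q, the second has a freely small
  coefficient, and the third vanishes in the mean as the mesh shrinks.\<close>

lemma exp_overshoot_bound: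
  fixes q \<epsilon> :: real
  assumes q: "0 < q" and \<epsilon>: "0 < \<epsilon>"
  shows "\<exists>C\<ge>0. \<forall>y\<ge>0 :: real. exp (q * y) - 1 \<le> exp 1 * q * (exp y - 1) + \<epsilon> * (exp (2 * q * y) - 1) + C * (exp y - 1)\<^sup>2"
proof -
  define d where "d = exp (1 / q) - 1"
  have d: "0 < d" unfolding d_def using q by simp
  define C where "C = 1 / (4 * \<epsilon>) / d\<^sup>2"
  have C: "0 \<le> C" unfolding C_def using \<epsilon> by simp
  have "exp (q * y) - 1 \<le> exp 1 * q * (exp y - 1) + \<epsilon> * (exp (2 * q * y) - 1) + C * (exp y - 1)\<^sup>2" if y: "0 \<le> y" for y
  proof (cases "q * y \<le> 1")
    case True
    define z where "z = q * y"
    have z: "0 \<le> z" "z \<le> 1" unfolding z_def using True q y by auto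
    have "1 - z \<le> exp (- z)" using exp_ge_add_one_self[of "- z"] by simp
    then have "(1 - z) * exp z \<le> exp (- z) * exp z" by (intro mult_right_mono) auto
    then have "exp z - 1 \<le> z * exp z" by (simp add: algebra_simps flip: exp_add)
    also have "\<dots> \<le> z * exp 1" using z by (intro mult_left_mono) auto
    also have "\<dots> = exp 1 * q * y" unfolding z_def by simp
    also have "\<dots> \<le> exp 1 * q * (exp y - 1)"
    proof (rule mult_left_mono)
      show "y \<le> exp y - 1" using exp_ge_add_one_self[of y] by linarith
    qed (use q in simp)
    finally have 1: "exp (q * y) - 1 \<le> exp 1 * q * (exp y - 1)" unfolding z_def .
    have 2: "0 \<le> \<epsilon> * (exp (2 * q * y) - 1)" using \<epsilon> q y by simp
    have 3: "0 \<le> C * (exp y - 1)\<^sup>2" using C by simp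
    from 1 2 3 show ?thesis by linarith
  next
    case False
    define a where "a = exp (q * y) - 1"
    have a: "0 \<le> a" unfolding a_def using q y by simp
    have e2: "exp (2 * q * y) = exp (q * y) * exp (q * y)" by (simp flip: exp_add)
    have "a\<^sup>2 + 2 * a = exp (2 * q * y) - 1" unfolding e2 a_def by (simp add: power2_eq_square algebra_simps)
    then have a2: "a\<^sup>2 \<le> exp (2 * q * y) - 1" using a by linarith
    \<comment> \<open>Completing the square gives a <= \<epsilon> a^2 + 1 / (4 \<epsilon>). In this
      case y >= 1 / q, so the constant is absorbed by C (e^y - 1)^2.\<close>
    have "0 \<le> (2 * \<epsilon> * a - 1)\<^sup>2" by simp
    then have "4 * \<epsilon> * a \<le> 4 * \<epsilon> * (\<epsilon> * a\<^sup>2) + 1" by (simp add: power2_eq_square algebra_simps)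
    then have "a \<le> (4 * \<epsilon> * (\<epsilon> * a\<^sup>2) + 1) / (4 * \<epsilon>)" using \<epsilon> by (simp add: pos_le_divide_eq mult.commute)
    also have "\<dots> = \<epsilon> * a\<^sup>2 + 1 / (4 * \<epsilon>)" using \<epsilon> by (simp add: add_divide_distrib)
    also have "\<epsilon> * a\<^sup>2 \<le> \<epsilon> * (exp (2 * q * y) - 1)" using a2 \<epsilon> by (intro mult_left_mono) auto
    finally have 1: "a \<le> \<epsilon> * (exp (2 * q * y) - 1) + 1 / (4 * \<epsilon>)" by simp
    have "1 / q \<le> y" using False q by (simp add: pos_divide_le_eq mult.commute)
    then have "d\<^sup>2 \<le> (exp y - 1)\<^sup>2" unfolding d_def using q by (intro power_mono) auto
    then have "C * d\<^sup>2 \<le> C * (exp y - 1)\<^sup>2" using C by (intro mult_left_mono)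
    moreover have "C * d\<^sup>2 = 1 / (4 * \<epsilon>)" unfolding C_def using d by simp
    ultimately have 2: "1 / (4 * \<epsilon>) \<le> C * (exp y - 1)\<^sup>2" by simp
    have 3: "0 \<le> exp 1 * q * (exp y - 1)" using q y by simp
    from 1 2 3 show ?thesis unfolding a_def by linarith
  qed
  with C show ?thesis by blast
qed

context stable_levy
begin

text \<open>A discrete form of the Kella--Whitt martingale of the reflected process: it bounds the mean of the integral of
  \<open>exp (- q Z)\<close> by \<open>O(q) / \<kappa> q\<close>, which vanishes as \<open>q\<close> grows because \<open>\<beta> > 1\<close>.\<close>

definition Z :: "nat \<Rightarrow> nat \<Rightarrow> 'w \<Rightarrow> real" where "Z n j w = reflected (incr (path w) n) j"

text \<open>It satisfies Z (Suc j) = Z j + increment + overshoot, so it is the increment of the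
  local time at 0 of the discrete reflected process.\<close>

definition overshoot :: "nat \<Rightarrow> nat \<Rightarrow> 'w \<Rightarrow> real" where
  "overshoot n j w = max 0 (- (Z n j w + incr (path w) n j))"

lemma Z_measurable [measurable]: "Z n j \<in> borel_measurable \<Omega>"
  unfolding Z_def[abs_def] by (induction j) simp_all

definition mean_exp :: "real \<Rightarrow> nat \<Rightarrow> nat \<Rightarrow> real" where "mean_exp q n j = (\<integral>w. exp (- q * Z n j w) \<partial>\<Omega>)"

lemma exp_Z:
  assumes "0 \<le> q"
  shows "integrable \<Omega> (\<lambda>w. exp (- q * Z n j w))" "0 \<le> mean_exp q n j" "mean_exp q n j \<le> 1" "mean_exp q n 0 = 1"
proof -
  have b: "exp (- q * Z n j w) \<le> 1" for w using assms reflected_nonneg[of "incr (path w) n" j] unfolding Z_def by simp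
  show i: "integrable \<Omega> (\<lambda>w. exp (- q * Z n j w))" by (rule integrable_const_bound[where B=1]) (use b in auto)
  show "0 \<le> mean_exp q n j" unfolding mean_exp_def by (rule Bochner_Integration.integral_nonneg) simp
  have "mean_exp q n j \<le> (\<integral>w. 1 \<partial>\<Omega>)" unfolding mean_exp_def by (rule integral_mono[OF i]) (use b in auto)
  then show "mean_exp q n j \<le> 1" by (simp add: prob_space)
  show "mean_exp q n 0 = 1" unfolding mean_exp_def Z_def by (simp add: prob_space)
qed

text \<open>Either the overshoot or Z (Suc j) is 0, hence exp (- q (Z j + increment)) = exp (- q Z
  (Suc j)) + (exp (q overshoot) - 1). The mean of the left side factorises, since Z j depends on
  earlier increments only.\<close>

lemma overshoot_step:
  assumes q: "0 \<le> q"
  shows "integrable \<Omega> (\<lambda>w. exp (q * overshoot n j w) - 1)"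
    and "mean_exp q n (Suc j) + (\<integral>w. exp (q * overshoot n j w) - 1 \<partial>\<Omega>) = exp (\<kappa> q / 2 ^ n) * mean_exp q n j"
proof -
  define P where "P w = exp (- q * Z n j w) * exp (- q * incr (path w) n j)" for w
  have eq: "exp (q * overshoot n j w) - 1 = P w - exp (- q * Z n (Suc j) w)" for w
    unfolding P_def overshoot_def Z_def by (auto simp: max_def algebra_simps simp flip: exp_add)
  define f where "f v = ennreal (exp (- q * reflected v j))" for v :: "nat \<Rightarrow> real"
  define g where "g v = ennreal (exp (- q * v j))" for v :: "nat \<Rightarrow> real"
  have fm: "f \<in> borel_measurable (PiM {..<j} (\<lambda>_. borel))"
  proof -
    have [measurable]: "(\<lambda>v. reflected v i) \<in> borel_measurable (PiM {..<j} (\<lambda>_. borel :: real measure))" if "i \<le> j" for i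
      using that
    proof (induction i)
      case (Suc i)
      then have "(\<lambda>v. v i) \<in> borel_measurable (PiM {..<j} (\<lambda>_. borel :: real measure))"
        using measurable_component_singleton[of i "{..<j}" "\<lambda>_. borel :: real measure"] by simp
      with Suc show ?case by simp
    qed simp
    show ?thesis unfolding f_def by measurable
  qed
  have gm: "g \<in> borel_measurable (PiM {j..<Suc j} (\<lambda>_. borel))"
    unfolding g_def using measurable_component_singleton[of j "{j..<Suc j}" "\<lambda>_. borel :: real measure"]
    by simp
  have feq: "f (\<lambda>i\<in>{..<j}. incr (path w) n i) = ennreal (exp (- q * Z n j w))" for w
    unfolding f_def Z_def by (intro arg_cong[of _ _ "\<lambda>x. ennreal (exp (- q * x))"] reflected_cong) simp
  have geq: "g (\<lambda>i\<in>{j..<Suc j}. incr (path w) n i) = ennreal (exp (- q * incr (path w) n j))" for w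
    unfolding g_def by simp
  have "(\<integral>\<^sup>+w. ennreal (P w) \<partial>\<Omega>) = (\<integral>\<^sup>+w. f (\<lambda>i\<in>{..<j}. incr (path w) n i) * g (\<lambda>i\<in>{j..<Suc j}. incr (path w) n i) \<partial>\<Omega>)"
    unfolding feq geq P_def by (simp add: ennreal_mult)
  also have "\<dots> = (\<integral>\<^sup>+w. f (\<lambda>i\<in>{..<j}. incr (path w) n i) \<partial>\<Omega>) * (\<integral>\<^sup>+w. g (\<lambda>i\<in>{j..<Suc j}. incr (path w) n i) \<partial>\<Omega>)"
    by (rule grid_independence[OF fm gm]) simp
  also have "(\<integral>\<^sup>+w. f (\<lambda>i\<in>{..<j}. incr (path w) n i) \<partial>\<Omega>) = ennreal (mean_exp q n j)"
    unfolding feq mean_exp_def by (rule nn_integral_eq_integral[OF exp_Z(1)[OF q]]) simp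
  also have "(\<integral>\<^sup>+w. g (\<lambda>i\<in>{j..<Suc j}. incr (path w) n i) \<partial>\<Omega>) = ennreal (exp (\<kappa> q / 2 ^ n))"
  proof -
    have "(\<integral>\<^sup>+w. g (\<lambda>i\<in>{j..<Suc j}. incr (path w) n i) \<partial>\<Omega>) = (\<integral>\<^sup>+w. ennreal (exp (- q * X (1 / 2 ^ n) w)) \<partial>\<Omega>)"
      unfolding geq using incr_nn_integral[of "\<lambda>x. ennreal (exp (- q * x))" n j] by simp
    also have "\<dots> = ennreal (\<integral>w. exp (- q * X (1 / 2 ^ n) w) \<partial>\<Omega>)"
      by (rule nn_integral_eq_integral) (use exp_X_integrable[of "1 / 2 ^ n" q] q in auto)
    also have "(\<integral>w. exp (- q * X (1 / 2 ^ n) w) \<partial>\<Omega>) = exp (\<kappa> q / 2 ^ n)"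
      using laplace_exponent[of "1 / 2 ^ n" q] q by simp
    finally show ?thesis .
  qed
  finally have P: "(\<integral>\<^sup>+w. ennreal (P w) \<partial>\<Omega>) = ennreal (exp (\<kappa> q / 2 ^ n) * mean_exp q n j)"
    using exp_Z(2)[OF q] by (simp add: ennreal_mult' mult.commute)
  have [measurable]: "P \<in> borel_measurable \<Omega>" unfolding P_def[abs_def] by measurable
  have "has_bochner_integral \<Omega> P (exp (\<kappa> q / 2 ^ n) * mean_exp q n j)"
    by (rule has_bochner_integral_nn_integral) (use P exp_Z(2)[OF q] in \<open>auto\<close>, simp add: P_def)
  then have Pi: "integrable \<Omega> P" "(\<integral>w. P w \<partial>\<Omega>) = exp (\<kappa> q / 2 ^ n) * mean_exp q n j"
    by (auto simp: has_bochner_integral_iff)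
  show "integrable \<Omega> (\<lambda>w. exp (q * overshoot n j w) - 1)"
    unfolding eq by (intro Bochner_Integration.integrable_diff Pi(1) exp_Z(1)[OF q])
  show "mean_exp q n (Suc j) + (\<integral>w. exp (q * overshoot n j w) - 1 \<partial>\<Omega>) = exp (\<kappa> q / 2 ^ n) * mean_exp q n j"
    unfolding eq using Bochner_Integration.integral_diff[OF Pi(1) exp_Z(1)[OF q, of n "Suc j"]] Pi(2) by (simp add: mean_exp_def)
qed

lemma overshoot_sum:
  assumes q: "0 \<le> q"
  shows "(\<Sum>j<N. \<integral>w. exp (q * overshoot n j w) - 1 \<partial>\<Omega>) + mean_exp q n N = 1 + (exp (\<kappa> q / 2 ^ n) - 1) * (\<Sum>j<N. mean_exp q n j)"
proof (induction N)
  case (Suc N)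
  then show ?case using overshoot_step(2)[OF q, of n N] by (simp add: algebra_simps)
qed (simp add: exp_Z(4)[OF q])

lemma overshoot_sum_le:
  assumes q: "0 \<le> q"
  shows "(\<Sum>j<N. \<integral>w. exp (q * overshoot n j w) - 1 \<partial>\<Omega>) \<le> 1 + (exp (\<kappa> q / 2 ^ n) - 1) * real N"
proof -
  have "(\<Sum>j<N. mean_exp q n j) \<le> (\<Sum>j<N. 1)" by (intro sum_mono exp_Z(3) q)
  then have "(exp (\<kappa> q / 2 ^ n) - 1) * (\<Sum>j<N. mean_exp q n j) \<le> (exp (\<kappa> q / 2 ^ n) - 1) * real N"
    using \<kappa>_nonneg[of q] by (intro mult_left_mono) auto
  then show ?thesis using overshoot_sum[OF q, of n N] exp_Z(2)[OF q, of n N] by linarith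
qed

text \<open>Equal to (exp y - 1)^2 with y the size of a downward increment, which is the third term
  of the overshoot bound. It is small in the mean because the Levy measure charges only positive
  jumps.\<close>

definition negative_part :: "real \<Rightarrow> real" where "negative_part x = test_fun (min x 0)"

lemma negative_part_limit:
  shows "(\<lambda>n. 2 ^ n * (\<integral>w. negative_part (X (1 / 2 ^ n) w) \<partial>\<Omega>)) \<longlonglongrightarrow> 0"
    and "0 \<le> t \<Longrightarrow> integrable \<Omega> (\<lambda>w. negative_part (X t w))"
proof -
  have b: "0 \<le> negative_part x" "negative_part x \<le> 1 * test_fun x" "isCont negative_part x" for x
  proof -
    show "0 \<le> negative_part x" "negative_part x \<le> 1 * test_fun x"
      unfolding negative_part_def using test_fun_nonneg[of x] test_fun_nonneg[of "min x 0"] by (auto simp: min_def)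
    show "isCont negative_part x" unfolding negative_part_def[abs_def] test_fun_def by (intro continuous_intros)
  qed
  have "(\<integral>x. negative_part x \<partial>NU) = 0"
    using NU_AE_pos by (intro integral_eq_zero_AE) (auto elim!: eventually_mono simp: negative_part_def)
  then show "(\<lambda>n. 2 ^ n * (\<integral>w. negative_part (X (1 / 2 ^ n) w) \<partial>\<Omega>)) \<longlonglongrightarrow> 0"
    using scaled_limit[of negative_part 1, OF b] by simp
  show "integrable \<Omega> (\<lambda>w. negative_part (X t w))" if "0 \<le> t"
    by (rule dominated_integrable(2)[of negative_part 1, OF b that])
qed

lemma negative_part_incr:
  "integrable \<Omega> (\<lambda>w. negative_part (incr (path w) n i))"
  "(\<integral>w. negative_part (incr (path w) n i) \<partial>\<Omega>) = (\<integral>w. negative_part (X (1 / 2 ^ n) w) \<partial>\<Omega>)"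
proof -
  have [measurable]: "negative_part \<in> borel_measurable borel" unfolding negative_part_def[abs_def] by measurable
  have t: "0 \<le> (1 / 2 ^ n :: real)" by simp
  show "(\<integral>w. negative_part (incr (path w) n i) \<partial>\<Omega>) = (\<integral>w. negative_part (X (1 / 2 ^ n) w) \<partial>\<Omega>)"
    using arg_cong[OF incr_distr[of n i], of "\<lambda>M. integral\<^sup>L M negative_part"] by (simp add: integral_distr)
  have "integrable (distr \<Omega> borel (X (1 / 2 ^ n))) negative_part"
    using negative_part_limit(2)[OF t] by (simp add: integrable_distr_eq)
  then show "integrable \<Omega> (\<lambda>w. negative_part (incr (path w) n i))"
    unfolding incr_distr[of n i, symmetric] by (simp add: integrable_distr_eq)
qed

text \<open>The overshoot identity at q bounds the sum of means by the total overshoot term divided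
  by exp (\<kappa> q / 2^n) - 1. The same identity at 1 and at 2 q then bounds that total through
  \<open>exp_overshoot_bound\<close>.\<close>

lemma mean_exp_sum_bound:
  fixes K :: nat
  assumes q: "0 < q"
  defines "b \<equiv> (exp 1 * q * (1 + \<kappa> 1 * real K) + 1) / \<kappa> q"
  shows "liminf (\<lambda>n. ennreal ((\<Sum>j<K * 2 ^ n + 1. mean_exp q n j) / 2 ^ n)) \<le> ennreal b"
proof -
  have \<kappa>q: "0 < \<kappa> q" unfolding \<kappa>_def using Gamma_pos q by simp
  \<comment> \<open>Chosen so that the second term of the overshoot bound contributes exactly 1 in
    the limit, the last summand in the numerator of b.\<close>
  define \<epsilon> where "\<epsilon> = 1 / (1 + \<kappa> (2 * q) * real K)"
  have den: "0 < 1 + \<kappa> (2 * q) * real K" using \<kappa>_nonneg[of "2 * q"] by (intro add_pos_nonneg) auto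
  have \<epsilon>: "0 < \<epsilon>" unfolding \<epsilon>_def using den by simp
  obtain C where C: "0 \<le> C" "\<And>y. 0 \<le> y \<Longrightarrow> exp (q * y) - 1 \<le> exp 1 * q * (exp y - 1) + \<epsilon> * (exp (2 * q * y) - 1) + C * (exp y - 1)\<^sup>2"
    using exp_overshoot_bound[OF q \<epsilon>] by blast
  \<comment> \<open>One index more than the number of cells: each cell will be weighted by Z at its
    right end, so the indices run up to K * 2 ^ n inclusive.\<close>
  define N where "N n = K * 2 ^ n + 1" for n :: nat
  define W where "W n = (\<integral>w. negative_part (X (1 / 2 ^ n) w) \<partial>\<Omega>)" for n :: nat
  define E where "E p n = (exp (\<kappa> p / 2 ^ n) - 1) * real (N n)" for p and n :: nat
  define R where "R n = exp 1 * q * (1 + E 1 n) + \<epsilon> * (1 + E (2 * q) n) + C * (real (N n) * W n)" for n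
  have N_lim: "(\<lambda>n. real (N n) / 2 ^ n) \<longlonglongrightarrow> real K"
  proof -
    have "(\<lambda>n. real K + 1 / 2 ^ n) \<longlonglongrightarrow> real K + 0" by (intro tendsto_add tendsto_const tendsto_inverse_2_power)
    moreover have "real (N n) / 2 ^ n = real K + 1 / 2 ^ n" for n unfolding N_def by (simp add: add_divide_distrib)
    ultimately show ?thesis by simp
  qed
  have E_lim: "(\<lambda>n. E p n) \<longlonglongrightarrow> \<kappa> p * real K" for p
  proof -
    have "(\<lambda>n. (2 ^ n * (exp (\<kappa> p / 2 ^ n) - 1)) * (real (N n) / 2 ^ n)) \<longlonglongrightarrow> \<kappa> p * real K"
      by (intro tendsto_mult tendsto_scaled_exp_minus_one N_lim)
    moreover have "(2 ^ n * (exp (\<kappa> p / 2 ^ n) - 1)) * (real (N n) / 2 ^ n) = E p n" for n unfolding E_def by simp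
    ultimately show ?thesis by simp
  qed
  have W_lim: "(\<lambda>n. real (N n) * W n) \<longlonglongrightarrow> 0"
  proof -
    have "(\<lambda>n. (real (N n) / 2 ^ n) * (2 ^ n * W n)) \<longlonglongrightarrow> real K * 0"
      unfolding W_def by (intro tendsto_mult N_lim negative_part_limit)
    moreover have "(real (N n) / 2 ^ n) * (2 ^ n * W n) = real (N n) * W n" for n by simp
    ultimately show ?thesis by simp
  qed
  have R_lim: "R \<longlonglongrightarrow> exp 1 * q * (1 + \<kappa> 1 * real K) + \<epsilon> * (1 + \<kappa> (2 * q) * real K) + C * 0"
    unfolding R_def by (intro tendsto_add tendsto_mult_left tendsto_const E_lim W_lim)
  have eb: "\<epsilon> * (1 + \<kappa> (2 * q) * real K) = 1" unfolding \<epsilon>_def using den by simp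
  have le: "(exp (\<kappa> q / 2 ^ n) - 1) * (\<Sum>j<N n. mean_exp q n j) \<le> R n" for n
  proof -
    have "(exp (\<kappa> q / 2 ^ n) - 1) * (\<Sum>j<N n. mean_exp q n j) \<le> (\<Sum>j<N n. \<integral>w. exp (q * overshoot n j w) - 1 \<partial>\<Omega>)"
      using overshoot_sum[of q n "N n"] exp_Z(3)[of q n "N n"] q by linarith
    also have "\<dots> \<le> (\<Sum>j<N n. exp 1 * q * (\<integral>w. exp (1 * overshoot n j w) - 1 \<partial>\<Omega>) + \<epsilon> * (\<integral>w. exp (2 * q * overshoot n j w) - 1 \<partial>\<Omega>) + C * W n)"
    proof (rule sum_mono)
      fix j
      have i: "integrable \<Omega> (\<lambda>w. exp 1 * q * (exp (1 * overshoot n j w) - 1))" "integrable \<Omega> (\<lambda>w. \<epsilon> * (exp (2 * q * overshoot n j w) - 1))"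
        "integrable \<Omega> (\<lambda>w. C * negative_part (incr (path w) n j))"
        using overshoot_step(1)[of 1 n j] overshoot_step(1)[of "2 * q" n j] negative_part_incr(1)[of n j] q by auto
      have "(\<integral>w. exp (q * overshoot n j w) - 1 \<partial>\<Omega>) \<le> (\<integral>w. exp 1 * q * (exp (1 * overshoot n j w) - 1) + \<epsilon> * (exp (2 * q * overshoot n j w) - 1) + C * negative_part (incr (path w) n j) \<partial>\<Omega>)"
      proof (rule integral_mono)
        show "integrable \<Omega> (\<lambda>w. exp (q * overshoot n j w) - 1)" using overshoot_step(1)[of q n j] q by simp
        show "integrable \<Omega> (\<lambda>w. exp 1 * q * (exp (1 * overshoot n j w) - 1) + \<epsilon> * (exp (2 * q * overshoot n j w) - 1) + C * negative_part (incr (path w) n j))"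
          by (intro Bochner_Integration.integrable_add i)
        fix w
        define y where "y = overshoot n j w"
        define x where "x = incr (path w) n j"
        have y: "0 \<le> y" "y \<le> - min x 0"
          unfolding y_def overshoot_def x_def Z_def using reflected_nonneg[of "incr (path w) n" j] by auto
        have "(exp y - 1)\<^sup>2 \<le> (exp (- min x 0) - 1)\<^sup>2" using y by (intro power_mono) auto
        also have "\<dots> = negative_part x" unfolding negative_part_def test_fun_def by (simp add: power2_commute)
        finally have "C * (exp y - 1)\<^sup>2 \<le> C * negative_part x" using C(1) by (intro mult_left_mono)
        then have "exp (q * y) - 1 \<le> exp 1 * q * (exp (1 * y) - 1) + \<epsilon> * (exp (2 * q * y) - 1) + C * negative_part x" using C(2)[OF y(1)] by simp
        then show "exp (q * overshoot n j w) - 1 \<le> exp 1 * q * (exp (1 * overshoot n j w) - 1) + \<epsilon> * (exp (2 * q * overshoot n j w) - 1) + C * negative_part (incr (path w) n j)"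
          unfolding y_def x_def .
      qed
      also have "\<dots> = (\<integral>w. exp 1 * q * (exp (1 * overshoot n j w) - 1) \<partial>\<Omega>) + (\<integral>w. \<epsilon> * (exp (2 * q * overshoot n j w) - 1) \<partial>\<Omega>) + (\<integral>w. C * negative_part (incr (path w) n j) \<partial>\<Omega>)"
        using Bochner_Integration.integral_add[OF Bochner_Integration.integrable_add[OF i(1,2)] i(3)] Bochner_Integration.integral_add[OF i(1,2)] by simp
      also have "(\<integral>w. C * negative_part (incr (path w) n j) \<partial>\<Omega>) = C * W n" unfolding W_def by (simp add: negative_part_incr(2))
      finally show "(\<integral>w. exp (q * overshoot n j w) - 1 \<partial>\<Omega>) \<le> exp 1 * q * (\<integral>w. exp (1 * overshoot n j w) - 1 \<partial>\<Omega>) + \<epsilon> * (\<integral>w. exp (2 * q * overshoot n j w) - 1 \<partial>\<Omega>) + C * W n"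
        by simp
    qed
    also have "\<dots> = exp 1 * q * (\<Sum>j<N n. \<integral>w. exp (1 * overshoot n j w) - 1 \<partial>\<Omega>) + \<epsilon> * (\<Sum>j<N n. \<integral>w. exp (2 * q * overshoot n j w) - 1 \<partial>\<Omega>) + C * (real (N n) * W n)"
      by (simp add: sum.distrib sum_distrib_left)
    also have "\<dots> \<le> R n"
    proof -
      have "exp 1 * q * (\<Sum>j<N n. \<integral>w. exp (1 * overshoot n j w) - 1 \<partial>\<Omega>) \<le> exp 1 * q * (1 + E 1 n)"
        unfolding E_def using q by (intro mult_left_mono overshoot_sum_le) auto
      moreover have "\<epsilon> * (\<Sum>j<N n. \<integral>w. exp (2 * q * overshoot n j w) - 1 \<partial>\<Omega>) \<le> \<epsilon> * (1 + E (2 * q) n)"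
        unfolding E_def using q \<epsilon> by (intro mult_left_mono overshoot_sum_le) auto
      ultimately show ?thesis unfolding R_def by linarith
    qed
    finally show ?thesis .
  qed
  define c where "c n = 2 ^ n * (exp (\<kappa> q / 2 ^ n) - 1)" for n :: nat
  have c_lim: "c \<longlonglongrightarrow> \<kappa> q" unfolding c_def by (rule tendsto_scaled_exp_minus_one)
  have c: "0 < c n" for n unfolding c_def using \<kappa>q by simp
  have le2: "(\<Sum>j<N n. mean_exp q n j) / 2 ^ n \<le> R n / c n" for n
  proof -
    have "c n * ((\<Sum>j<N n. mean_exp q n j) / 2 ^ n) \<le> R n" using le[of n] unfolding c_def by simp
    then show ?thesis using c[of n] by (simp add: pos_le_divide_eq mult.commute)
  qed
  have "(\<lambda>n. R n / c n) \<longlonglongrightarrow> (exp 1 * q * (1 + \<kappa> 1 * real K) + \<epsilon> * (1 + \<kappa> (2 * q) * real K) + C * 0) / \<kappa> q"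
    by (rule tendsto_divide[OF R_lim c_lim]) (use \<kappa>q in simp)
  then have "(\<lambda>n. R n / c n) \<longlonglongrightarrow> b" unfolding eb b_def by simp
  then have lim: "(\<lambda>n. ennreal (R n / c n)) \<longlonglongrightarrow> ennreal b" by (rule tendsto_ennrealI)
  have "liminf (\<lambda>n. ennreal ((\<Sum>j<N n. mean_exp q n j) / 2 ^ n)) \<le> liminf (\<lambda>n. ennreal (R n / c n))"
    using le2 by (intro Liminf_mono always_eventually allI ennreal_leI)
  also have "\<dots> = ennreal b" using lim_imp_Liminf[OF _ lim] by simp
  finally show ?thesis unfolding N_def .
qed

text \<open>At an infimum time r the reflected walk at the right end of the cell of r tends to 0, so
  the weights exp (- q Z) tend to 1 for every q. The iterated lower limit of these weights, in the
  mesh and then in q, has integral 0 by repeated use of Fatou.\<close>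

lemma AE_infimum_times_null:
  "AE w in \<Omega>. AE r in lborel. \<not> (0 < r \<and> (\<forall>u. 0 \<le> u \<and> u \<le> r \<longrightarrow> X r w \<le> X u w))"
proof -
  define h where "h q K n w = ennreal ((\<Sum>j<K * 2 ^ n + 1. exp (- real (Suc q) * Z n j w)) / 2 ^ n)" for q K n :: nat and w
  have [measurable]: "h q K n \<in> borel_measurable \<Omega>" for q K n unfolding h_def[abs_def] by measurable
  have int_h: "(\<integral>\<^sup>+w. h q K n w \<partial>\<Omega>) = ennreal ((\<Sum>j<K * 2 ^ n + 1. mean_exp (real (Suc q)) n j) / 2 ^ n)" for q K n
  proof -
    have i: "integrable \<Omega> (\<lambda>w. exp (- real (Suc q) * Z n j w))" for j by (rule exp_Z(1)) simp
    have "(\<integral>\<^sup>+w. h q K n w \<partial>\<Omega>) = ennreal (\<integral>w. (\<Sum>j<K * 2 ^ n + 1. exp (- real (Suc q) * Z n j w)) / 2 ^ n \<partial>\<Omega>)"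
      unfolding h_def
    proof (rule nn_integral_eq_integral)
      show "integrable \<Omega> (\<lambda>w. (\<Sum>j<K * 2 ^ n + 1. exp (- real (Suc q) * Z n j w)) / 2 ^ n)" using i by simp
      show "AE w in \<Omega>. 0 \<le> (\<Sum>j<K * 2 ^ n + 1. exp (- real (Suc q) * Z n j w)) / 2 ^ n"
        by (intro AE_I2 divide_nonneg_nonneg sum_nonneg) auto
    qed
    also have "(\<integral>w. (\<Sum>j<K * 2 ^ n + 1. exp (- real (Suc q) * Z n j w)) / 2 ^ n \<partial>\<Omega>) = (\<Sum>j<K * 2 ^ n + 1. mean_exp (real (Suc q)) n j) / 2 ^ n"
      unfolding mean_exp_def using i by simp
    finally show ?thesis .
  qed
  define H where "H K w = liminf (\<lambda>q. liminf (\<lambda>n. h q K n w))" for K w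
  have [measurable]: "H K \<in> borel_measurable \<Omega>" for K unfolding H_def[abs_def] by measurable
  have H0: "(\<integral>\<^sup>+w. H K w \<partial>\<Omega>) = 0" for K
  proof -
    define b where "b q = (exp 1 * real (Suc q) * (1 + \<kappa> 1 * real K) + 1) / \<kappa> (real (Suc q))" for q :: nat
    have "(\<integral>\<^sup>+w. H K w \<partial>\<Omega>) \<le> liminf (\<lambda>q. \<integral>\<^sup>+w. liminf (\<lambda>n. h q K n w) \<partial>\<Omega>)"
      unfolding H_def by (rule nn_integral_liminf) measurable
    also have "\<dots> \<le> liminf (\<lambda>q. ennreal (b q))"
    proof (intro Liminf_mono always_eventually allI)
      fix q
      have "(\<integral>\<^sup>+w. liminf (\<lambda>n. h q K n w) \<partial>\<Omega>) \<le> liminf (\<lambda>n. \<integral>\<^sup>+w. h q K n w \<partial>\<Omega>)"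
        by (rule nn_integral_liminf) measurable
      also have "\<dots> \<le> ennreal (b q)" unfolding int_h b_def by (rule mean_exp_sum_bound) simp
      finally show "(\<integral>\<^sup>+w. liminf (\<lambda>n. h q K n w) \<partial>\<Omega>) \<le> ennreal (b q)" .
    qed
    \<comment> \<open>The bound b is of order q^(1 - \<beta>).\<close>
    also have "\<dots> = ennreal 0"
    proof (rule lim_imp_Liminf, simp, rule tendsto_ennrealI)
      define a where "a = exp 1 * (1 + \<kappa> 1 * real K)"
      have "b = (\<lambda>q. (a * real (Suc q) + 1) / (Gamma (- \<beta>) * real (Suc q) powr \<beta>))"
        unfolding b_def \<kappa>_def a_def by (simp add: fun_eq_iff algebra_simps)
      moreover have "(\<lambda>q. (a * real (Suc q) + 1) / (Gamma (- \<beta>) * real (Suc q) powr \<beta>)) \<longlonglongrightarrow> 0"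
        using \<beta> Gamma_pos by real_asymp
      ultimately show "b \<longlonglongrightarrow> 0" by simp
    qed
    finally show ?thesis by simp
  qed
  have "AE w in \<Omega>. \<forall>K. H K w = 0"
  proof (rule AE_all_countable[THEN iffD2], intro allI)
    fix K show "AE w in \<Omega>. H K w = 0" using H0[of K] by (subst (asm) nn_integral_0_iff_AE) auto
  qed
  then show ?thesis using AE_space
  proof eventually_elim
    case (elim w)
    define f where "f = path w"
    have f: "cadlag f" unfolding f_def by (rule X_cadlag) fact
    have cell_m [measurable]: "cell n \<in> measurable borel (count_space UNIV)" for n unfolding cell_def[abs_def] by measurable
    define wt where "wt q n r = exp (- real (Suc q) * reflected (incr f n) (Suc (cell n r)))" for q n r
    have [measurable]: "wt q n \<in> borel_measurable borel" for q n
      unfolding wt_def[abs_def] by (rule measurable_compose[OF cell_m]) simp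
    define L where "L r = liminf (\<lambda>q. liminf (\<lambda>n. ennreal (wt q n r)))" for r
    have [measurable]: "L \<in> borel_measurable borel" unfolding L_def[abs_def] by measurable
    have wt_int: "(\<integral>\<^sup>+r. ennreal (wt q n r) * indicator {0<..real K} r \<partial>lborel) \<le> h q K n w" for q n K
    proof -
      define e where "e j = exp (- real (Suc q) * Z n j w)" for j
      define I where "I j = {real j / 2 ^ n <.. (real j + 1) / 2 ^ n}" for j :: nat
      have "(\<integral>\<^sup>+r. ennreal (wt q n r) * indicator {0<..real K} r \<partial>lborel) \<le> (\<integral>\<^sup>+r. (\<Sum>j<K * 2 ^ n. ennreal (e (Suc j)) * indicator (I j) r) \<partial>lborel)"
      proof (rule nn_integral_mono)
        fix r :: real
        show "ennreal (wt q n r) * indicator {0<..real K} r \<le> (\<Sum>j<K * 2 ^ n. ennreal (e (Suc j)) * indicator (I j) r)"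
        proof (cases "r \<in> {0<..real K}")
          case True
          then have r: "0 < r" "r \<le> real K" by auto
          define j where "j = cell n r"
          have rj: "r \<in> I j" unfolding I_def j_def using cell_bounds[OF r(1), of n] by simp
          have "real j / 2 ^ n < real (K * 2 ^ n) / 2 ^ n" using cell_bounds(1)[OF r(1), of n] r(2) unfolding j_def by simp
          then have j: "j < K * 2 ^ n" by (simp only: grid_less_iff)
          have "ennreal (wt q n r) * indicator {0<..real K} r = ennreal (e (Suc j)) * indicator (I j) r"
            using True rj unfolding wt_def e_def Z_def j_def f_def by simp
          also have "\<dots> \<le> (\<Sum>j<K * 2 ^ n. ennreal (e (Suc j)) * indicator (I j) r)"
            using j by (intro member_le_sum) auto
          finally show ?thesis .
        qed simp
      qed
      also have "\<dots> = (\<Sum>j<K * 2 ^ n. \<integral>\<^sup>+r. ennreal (e (Suc j)) * indicator (I j) r \<partial>lborel)"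
        by (rule nn_integral_sum) (simp add: I_def)
      also have "\<dots> = (\<Sum>j<K * 2 ^ n. ennreal (e (Suc j) / 2 ^ n))"
      proof (rule sum.cong)
        fix j
        have "emeasure lborel (I j) = ennreal (1 / 2 ^ n)"
          unfolding I_def by (subst emeasure_lborel_Ioc) (auto simp: divide_right_mono add_divide_distrib)
        then show "(\<integral>\<^sup>+r. ennreal (e (Suc j)) * indicator (I j) r \<partial>lborel) = ennreal (e (Suc j) / 2 ^ n)"
          by (subst nn_integral_cmult_indicator) (simp_all add: I_def e_def ennreal_mult'[symmetric])
      qed simp
      also have "\<dots> = ennreal ((\<Sum>j<K * 2 ^ n. e (Suc j)) / 2 ^ n)"
        by (subst sum_ennreal) (simp_all add: e_def sum_divide_distrib)
      also have "\<dots> \<le> h q K n w"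
      proof -
        have "(\<Sum>j<K * 2 ^ n. e (Suc j)) \<le> (\<Sum>j<K * 2 ^ n + 1. e j)"
          using sum.lessThan_Suc_shift[of e "K * 2 ^ n"] by (simp add: e_def)
        then show ?thesis unfolding h_def e_def[symmetric] by (intro ennreal_leI divide_right_mono) auto
      qed
      finally show ?thesis .
    qed
    have "AE r in lborel. \<forall>K::nat. L r * indicator {0<..real K} r = 0"
    proof (rule AE_all_countable[THEN iffD2], intro allI)
      fix K :: nat
      have "(\<integral>\<^sup>+r. L r * indicator {0<..real K} r \<partial>lborel) \<le> (\<integral>\<^sup>+r. liminf (\<lambda>q. liminf (\<lambda>n. ennreal (wt q n r) * indicator {0<..real K} r)) \<partial>lborel)"
        by (intro nn_integral_mono) (simp add: L_def indicator_def)
      also have "\<dots> \<le> liminf (\<lambda>q. \<integral>\<^sup>+r. liminf (\<lambda>n. ennreal (wt q n r) * indicator {0<..real K} r) \<partial>lborel)"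
        by (rule nn_integral_liminf) measurable
      also have "\<dots> \<le> liminf (\<lambda>q. liminf (\<lambda>n. h q K n w))"
      proof (intro Liminf_mono always_eventually allI)
        fix q
        have "(\<integral>\<^sup>+r. liminf (\<lambda>n. ennreal (wt q n r) * indicator {0<..real K} r) \<partial>lborel)
          \<le> liminf (\<lambda>n. \<integral>\<^sup>+r. ennreal (wt q n r) * indicator {0<..real K} r \<partial>lborel)"
          by (rule nn_integral_liminf) measurable
        also have "\<dots> \<le> liminf (\<lambda>n. h q K n w)" by (intro Liminf_mono always_eventually allI wt_int)
        finally show "(\<integral>\<^sup>+r. liminf (\<lambda>n. ennreal (wt q n r) * indicator {0<..real K} r) \<partial>lborel) \<le> liminf (\<lambda>n. h q K n w)" .
      qed
      also have "\<dots> = 0" using elim(1) unfolding H_def by blast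
      finally show "AE r in lborel. L r * indicator {0<..real K} r = 0"
        by (subst (asm) le_zero_eq, subst (asm) nn_integral_0_iff_AE) auto
    qed
    then show ?case
    proof eventually_elim
      case (elim r)
      show ?case
      proof
        assume r: "0 < r \<and> (\<forall>u. 0 \<le> u \<and> u \<le> r \<longrightarrow> X r w \<le> X u w)"
        have lim: "(\<lambda>n. reflected (incr f n) (Suc (cell n r))) \<longlonglongrightarrow> 0"
          by (rule reflected_incr_tendsto[OF f]) (use r in \<open>auto simp: f_def\<close>)
        have "liminf (\<lambda>n. ennreal (wt q n r)) = 1" for q
        proof -
          have "(\<lambda>n. wt q n r) \<longlonglongrightarrow> exp (- real (Suc q) * 0)" unfolding wt_def by (intro tendsto_exp tendsto_mult_left lim)
          then have "(\<lambda>n. ennreal (wt q n r)) \<longlonglongrightarrow> ennreal 1" by (intro tendsto_ennrealI) simp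
          then show ?thesis by (simp add: lim_imp_Liminf)
        qed
        then have "L r = 1" unfolding L_def by (simp add: Liminf_const)
        moreover obtain K :: nat where "r \<le> real K" using real_arch_simple by blast
        ultimately show False using elim[rule_format, of K] r by simp
      qed
    qed
  qed
qed

end

section \<open>Decomposition of a path into excursions\<close>

lemma excursion_duration:
  assumes "e \<in> excursions"
  shows "0 < duration e" "\<And>t. 0 < t \<Longrightarrow> t < duration e \<Longrightarrow> 0 < e t" "\<And>t. duration e \<le> t \<Longrightarrow> e t = 0"
proof -
  obtain D where D: "0 < D" "\<And>t. 0 < t \<Longrightarrow> t < D \<Longrightarrow> 0 < e t" "\<And>t. D \<le> t \<Longrightarrow> e t = 0"
    using assms unfolding excursions_def by blast
  have "duration e = Inf {D..}"
    unfolding duration_def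
  proof (rule arg_cong[of _ _ Inf], rule set_eqI)
    fix t show "t \<in> {t. 0 < t \<and> e t = 0} \<longleftrightarrow> t \<in> {D..}"
      using D(1) D(2)[of t] D(3)[of t] by (cases "t < D") auto
  qed
  then have d: "duration e = D" by simp
  show "0 < duration e" "\<And>t. 0 < t \<Longrightarrow> t < duration e \<Longrightarrow> 0 < e t" "\<And>t. duration e \<le> t \<Longrightarrow> e t = 0"
    unfolding d by (fact D)+
qed

lemma jump_eqI: "(f \<longlongrightarrow> l) (at_left t) \<Longrightarrow> jump f t = f t - l"
  unfolding jump_def by (simp add: tendsto_Lim)

text \<open>The almost sure properties of the path are collected here, so that the decomposition
  into excursions becomes a deterministic statement about one path.\<close>

locale excursion_path =
  fixes f :: "real \<Rightarrow> real"
  assumes cadlag: "cadlag f" and start: "f 0 = 0" and pos: "\<forall>t>0. 0 \<le> jump f t"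
    and hits: "\<And>s. 0 \<le> s \<Longrightarrow> hits s f" and regular: "inverse_local_time f 0 = 0"
    and null: "AE r in lborel. \<not> (0 < r \<and> (\<forall>u. 0 \<le> u \<and> u \<le> r \<longrightarrow> f r \<le> f u))"
begin

abbreviation (input) T :: "real \<Rightarrow> real" where "T \<equiv> inverse_local_time f"
abbreviation (input) Tl :: "real \<Rightarrow> real" where "Tl \<equiv> inverse_local_time_left f"

lemma T_facts:
  assumes s: "0 \<le> s"
  shows "0 \<le> T s" "f (T s) = - s" "\<And>t. 0 \<le> t \<Longrightarrow> f t < - s \<Longrightarrow> T s \<le> t" "\<And>t. 0 \<le> t \<Longrightarrow> t \<le> T s \<Longrightarrow> - s \<le> f t"
proof -
  obtain K :: nat where K: "passage s (real K) f = T s" "passage s (real K) f < real K"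
    using eventually_happens'[OF sequentially_bot passage_eventually[OF cadlag hits[OF s]]] by blast
  have K0: "0 \<le> real K" by simp
  show "0 \<le> T s" using passage_bounds(1)[OF K0, of s f] unfolding K(1) .
  show "f (T s) = - s" using passage_eq[OF cadlag start pos s K(2) K0] unfolding K(1) .
  show "T s \<le> t" if "0 \<le> t" "f t < - s" for t using passage_bounds(3)[of "real K" t f s, OF K0 that] unfolding K(1) .
  show "- s \<le> f t" if "0 \<le> t" "t \<le> T s" for t
    by (rule passage_ge[OF cadlag start pos s K0 that(1)]) (use that(2) K(1) in simp)
qed

lemma T_mono: "0 \<le> s \<Longrightarrow> s \<le> s' \<Longrightarrow> T s \<le> T s'"
proof (rule ccontr)
  assume s: "0 \<le> s" "s \<le> s'" and n: "\<not> T s \<le> T s'"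
  have s': "0 \<le> s'" using s by simp
  have "- s \<le> f (T s')" using T_facts(4)[OF s(1), of "T s'"] T_facts(1)[OF s'] n by simp
  then have "s = s'" using T_facts(2)[OF s'] s by simp
  with n show False by simp
qed

lemma T_strict_mono: "0 \<le> s \<Longrightarrow> s < s' \<Longrightarrow> T s < T s'"
  using T_mono[of s s'] T_facts(2)[of s] T_facts(2)[of s'] by (cases "T s = T s'") auto

text \<open>T is monotone, so the left limit exists as the supremum over smaller levels and the
  \<open>Lim\<close> in the definition is genuine.\<close>

lemma Tl_tendsto:
  assumes l: "0 < l"
  shows "(T \<longlongrightarrow> Tl l) (at_left l)"
proof -
  define S where "S = Sup (T ` {0..<l})"
  have bdd: "bdd_above (T ` {0..<l})"
    by (rule bdd_aboveI[of _ "T l"]) (auto intro!: T_mono)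
  have "(T \<longlongrightarrow> S) (at_left l)"
  proof (rule order_tendstoI)
    fix y assume "y < S"
    then obtain s where s: "s \<in> {0..<l}" "y < T s"
      unfolding S_def using less_cSup_iff[OF _ bdd] l by auto
    have "y < T u" if "s < u" "u < l" for u
      using T_mono[of s u] s that by simp
    then show "\<forall>\<^sub>F u in at_left l. y < T u" unfolding eventually_at_left_field using s by auto
  next
    fix y assume "S < y"
    then have "T u < y" if "0 < u" "u < l" for u
      using cSup_upper[OF _ bdd, of "T u"] that unfolding S_def[symmetric] by force
    then show "\<forall>\<^sub>F u in at_left l. T u < y" unfolding eventually_at_left_field using l by blast
  qed
  then show ?thesis unfolding inverse_local_time_left_def by (simp add: tendsto_Lim)
qed

lemma Tl_bounds:
  assumes l: "0 < l"
  shows "\<And>s. 0 \<le> s \<Longrightarrow> s < l \<Longrightarrow> T s < Tl l" "\<And>x. (\<And>s. 0 \<le> s \<Longrightarrow> s < l \<Longrightarrow> T s \<le> x) \<Longrightarrow> Tl l \<le> x"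
    "Tl l \<le> T l" "0 < Tl l"
proof -
  have le: "T s \<le> Tl l" if "0 \<le> s" "s < l" for s
  proof (rule tendsto_lowerbound[OF Tl_tendsto[OF l]])
    have "T s \<le> T u" if "s < u" for u using T_mono[of s u] \<open>0 \<le> s\<close> that by simp
    then show "\<forall>\<^sub>F u in at_left l. T s \<le> T u" unfolding eventually_at_left_field using that by blast
  qed simp
  show lt: "T s < Tl l" if "0 \<le> s" "s < l" for s
    using T_strict_mono[of s "(s + l) / 2"] le[of "(s + l) / 2"] that by simp
  show up: "Tl l \<le> x" if x: "\<And>s. 0 \<le> s \<Longrightarrow> s < l \<Longrightarrow> T s \<le> x" for x
  proof (rule tendsto_upperbound[OF Tl_tendsto[OF l]])
    have "T u \<le> x" if "0 < u" "u < l" for u using x[of u] that by simp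
    then show "\<forall>\<^sub>F u in at_left l. T u \<le> x" unfolding eventually_at_left_field using l by blast
  qed simp
  show "Tl l \<le> T l" by (rule up) (rule T_mono, auto)
  show "0 < Tl l" using lt[of 0] regular l by simp
qed

text \<open>By time Tl l all levels below l have been passed, and before T l the path does not go
  below - l.\<close>

lemma running_inf_excursion:
  assumes l: "0 < l" and r: "Tl l \<le> r" "r < T l"
  shows "running_inf f r = - l"
proof -
  have r0: "0 \<le> r" using Tl_bounds(4)[OF l] r by simp
  have l0: "0 \<le> l" using l by simp
  show ?thesis
  proof (rule antisym)
    show "running_inf f r \<le> - l"
    proof (rule ccontr)
      assume "\<not> ?thesis"
      then have n: "- l < running_inf f r" by simp
      define s where "s = max 0 ((l - running_inf f r) / 2)"
      have s: "0 \<le> s" "s < l" "- s < running_inf f r \<or> s = 0" unfolding s_def using l n by (auto simp: max_def field_simps)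
      define s' where "s' = (s + l) / 2"
      have s': "0 \<le> s'" "s' < l" "s < s'" unfolding s'_def using s by auto
      have "T s' \<le> r" using Tl_bounds(1)[OF l s'(1,2)] r by simp
      have "running_inf f r < - s"
        unfolding running_inf_less_iff[OF cadlag r0]
        using T_facts(1,2)[OF s'(1)] s'(3) \<open>T s' \<le> r\<close> by (intro bexI[of _ "T s'"]) auto
      with s n show False unfolding s_def by (auto simp: max_def split: if_splits)
    qed
    show "- l \<le> running_inf f r"
    proof (rule ccontr)
      assume "\<not> ?thesis"
      then obtain u where u: "0 \<le> u" "u \<le> r" "f u < - l"
        using running_inf_less_iff[OF cadlag r0, of "- l"] by auto
      show False using T_facts(3)[OF l0 u(1,3)] u(2) r(2) by simp
    qed
  qed
qed

definition levels :: "real set" where "levels = {l. 0 < l \<and> Tl l < T l}"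

text \<open>Closed on the left, because an excursion may begin with a jump at its starting time and
  this jump must be counted; open on the right, where the excursion has no positive jump.\<close>

definition span :: "real \<Rightarrow> real set" where "span l = {Tl l..<T l}"

lemma sets_span [measurable]: "span l \<in> sets borel"
  unfolding span_def by simp

lemma span_disjoint: "l \<in> levels \<Longrightarrow> l' \<in> levels \<Longrightarrow> l \<noteq> l' \<Longrightarrow> span l \<inter> span l' = {}"
proof -
  have "span l \<inter> span l' = {}" if "l \<in> levels" "l' \<in> levels" "l < l'" for l l'
  proof -
    have "T l < Tl l'" using Tl_bounds(1)[of l' l] that unfolding levels_def by auto
    then show ?thesis unfolding span_def by auto
  qed
  then show "l \<in> levels \<Longrightarrow> l' \<in> levels \<Longrightarrow> l \<noteq> l' \<Longrightarrow> span l \<inter> span l' = {}"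
    by (metis Int_commute linorder_neqE_linordered_idom)
qed

lemma countable_levels: "countable levels"
proof -
  have inj: "inj_on (\<lambda>l. {Tl l<..<T l}) levels"
  proof (rule inj_onI, rule ccontr)
    fix l l' assume l: "l \<in> levels" "l' \<in> levels" "{Tl l<..<T l} = {Tl l'<..<T l'}" "l \<noteq> l'"
    have "(Tl l + T l) / 2 \<in> {Tl l<..<T l}" using l(1) unfolding levels_def by auto
    moreover from this have "(Tl l + T l) / 2 \<in> {Tl l'<..<T l'}" using l(3) by simp
    ultimately show False using span_disjoint[OF l(1,2,4)] unfolding span_def by auto
  qed
  have "countable ((\<lambda>l. {Tl l<..<T l}) ` levels)"
  proof (rule countable_disjoint_open_subsets)
    show "disjoint ((\<lambda>l. {Tl l<..<T l}) ` levels)"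
    proof (rule disjointI)
      fix A B assume AB: "A \<in> (\<lambda>l. {Tl l<..<T l}) ` levels" "B \<in> (\<lambda>l. {Tl l<..<T l}) ` levels" "A \<noteq> B"
      then obtain l l' where l: "l \<in> levels" "l' \<in> levels" "A = {Tl l<..<T l}" "B = {Tl l'<..<T l'}" by blast
      with AB have "l \<noteq> l'" by blast
      then show "A \<inter> B = {}" using span_disjoint[OF l(1,2)] l unfolding span_def by auto
    qed
  qed auto
  then show ?thesis using countable_image_inj_eq[OF inj] by simp
qed

text \<open>The level is l = - running_inf f r. It is positive, since T 0 = 0 lies before r.
  Moreover r < T l: otherwise r would be T l, an infimum time, or the running infimum would already
  be below - l.\<close>

lemma span_cover:
  assumes r: "0 < r" "r < T 1" and not_inf: "\<not> (\<forall>u. 0 \<le> u \<and> u \<le> r \<longrightarrow> f r \<le> f u)"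
  shows "\<exists>l\<in>levels. l \<le> 1 \<and> r \<in> span l"
proof -
  define l where "l = - running_inf f r"
  have r0: "0 \<le> r" using r by simp
  have ge: "- l \<le> f u" if "0 \<le> u" "u \<le> r" for u
    using running_inf_less_iff[OF cadlag r0, of "- l"] that unfolding l_def by force
  have l0: "0 \<le> l" using ge[of 0] start r by simp
  have l1: "l \<le> 1"
  proof (rule ccontr)
    assume "\<not> ?thesis"
    then have "running_inf f r < - 1" unfolding l_def by simp
    then obtain u where u: "0 \<le> u" "u \<le> r" "f u < - 1" using running_inf_less_iff[OF cadlag r0, of "- 1"] by auto
    show False using T_facts(3)[OF zero_le_one u(1,3)] u(2) r by simp
  qed
  have rT: "r < T l"
  proof (rule ccontr)
    assume n: "\<not> r < T l"
    have "r \<le> T l"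
    proof (rule ccontr)
      assume "\<not> ?thesis"
      then have lt: "T l < r" by simp
      obtain u where u: "u \<in> {t. 0 \<le> t \<and> - running_inf f t > l}" "u < r"
        using lt cInf_lessD[of "{t. 0 \<le> t \<and> - running_inf f t > l}" r]
      proof -
        obtain t where "0 \<le> t" "f t < - l" using hits[OF l0] unfolding hits_def by blast
        then have "t \<in> {t. 0 \<le> t \<and> - running_inf f t > l}"
          using running_inf_less_iff[OF cadlag, of t "- l"] by auto
        then have "{t. 0 \<le> t \<and> - running_inf f t > l} \<noteq> {}" by blast
        from cInf_lessD[OF this] lt show ?thesis using that unfolding inverse_local_time_def by blast
      qed
      then have "running_inf f u < - l" "0 \<le> u" by auto
      then obtain v where "0 \<le> v" "v \<le> u" "f v < - l" using running_inf_less_iff[OF cadlag, of u "- l"] by auto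
      then show False using ge[of v] u(2) by simp
    qed
    with n have "r = T l" by simp
    then have "f r = - l" using T_facts(2)[OF l0] by simp
    with ge not_inf show False by simp
  qed
  have lpos: "0 < l" using rT regular r l0 by (cases "l = 0") auto
  have "Tl l \<le> r"
  proof (rule Tl_bounds(2)[OF lpos])
    fix s assume s: "0 \<le> s" "s < l"
    then have "running_inf f r < - s" unfolding l_def by simp
    then obtain v where "0 \<le> v" "v \<le> r" "f v < - s" using running_inf_less_iff[OF cadlag r0] by auto
    then show "T s \<le> r" using T_facts(3)[OF s(1), of v] by simp
  qed
  with rT lpos l1 show ?thesis unfolding levels_def span_def by auto
qed

lemma excursion_at_eq:
  assumes l: "l \<in> levels"
  shows "excursion_at f l r = (if 0 \<le> r \<and> r < T l - Tl l then f (Tl l + r) + l else 0)"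
proof -
  have l0: "0 < l" using l unfolding levels_def by simp
  show ?thesis unfolding excursion_at_def Let_def using running_inf_excursion[OF l0, of "Tl l + r"] by auto
qed

text \<open>Evaluate the left limit along the times T s with s increasing to l, where the path
  equals - s. Hence the initial value of the excursion is precisely the jump of the path at Tl
  l.\<close>

lemma left_limit:
  assumes l: "0 < l"
  shows "f (Tl l) - jump f (Tl l) = - l"
proof -
  have "filterlim T (at_left (Tl l)) (at_left l)"
  proof -
    have "\<forall>\<^sub>F s in at_left l. T s \<in> {..<Tl l} \<and> T s \<noteq> Tl l"
      unfolding eventually_at_left_field using Tl_bounds(1)[OF l] l by (intro exI[of _ 0]) (auto simp: less_imp_neq)
    then show ?thesis unfolding filterlim_at using Tl_tendsto[OF l] by simp
  qed
  from filterlim_compose[OF cadlag_left[OF cadlag Tl_bounds(4)[OF l]] this]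
  have 1: "((\<lambda>s. f (T s)) \<longlongrightarrow> f (Tl l) - jump f (Tl l)) (at_left l)" .
  have "\<forall>\<^sub>F s in at_left l. f (T s) = - s"
    unfolding eventually_at_left_field using T_facts(2) l by (intro exI[of _ 0]) force
  then have "((\<lambda>s. f (T s)) \<longlongrightarrow> - l) (at_left l)"
    by (subst tendsto_cong[of _ "\<lambda>s. - s"]) (auto intro!: tendsto_intros)
  from tendsto_unique[OF _ 1 this] show ?thesis by simp
qed

text \<open>At r = 0 the extension by zero to negative times turns the initial value into a jump,
  which is the jump of the path. At the end of the excursion the value is 0 and the left limit is
  nonnegative, so no positive jump is created there.\<close>

lemma jump_excursion:
  assumes l: "l \<in> levels"
  shows "0 \<le> r \<Longrightarrow> r < T l - Tl l \<Longrightarrow> jump (excursion_at f l) r = jump f (Tl l + r)"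
    and "\<not> (0 \<le> r \<and> r < T l - Tl l) \<Longrightarrow> jump (excursion_at f l) r \<le> 0"
proof -
  have l0: "0 < l" "Tl l < T l" using l unfolding levels_def by auto
  note e = excursion_at_eq[OF l]
  have left: "((\<lambda>u. f (Tl l + u) + l) \<longlongrightarrow> f (Tl l + r) - jump f (Tl l + r) + l) (at_left r)" if "- Tl l < r" for r
  proof -
    have "filterlim (\<lambda>u. Tl l + u) (at_left (Tl l + r)) (at_left r)"
      unfolding filterlim_at by (auto intro!: tendsto_intros simp: eventually_at_left_field) (use lt_ex in blast)
    from filterlim_compose[OF cadlag_left[OF cadlag] this] that
    show ?thesis by (intro tendsto_add tendsto_const) simp
  qed
  show "jump (excursion_at f l) r = jump f (Tl l + r)" if r: "0 \<le> r" "r < T l - Tl l"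
  proof (cases "r = 0")
    case True
    have "(excursion_at f l \<longlongrightarrow> 0) (at_left 0)"
      by (rule tendsto_eventually) (auto simp: eventually_at_left_field e intro!: exI[of _ "-1"])
    from jump_eqI[OF this] show ?thesis using True left_limit[OF l0(1)] l0 by (simp add: e)
  next
    case False
    with r have r0: "0 < r" by simp
    have "\<forall>\<^sub>F u in at_left r. excursion_at f l u = f (Tl l + u) + l"
      unfolding eventually_at_left_field using r0 r(2) by (intro exI[of _ 0]) (simp add: e)
    then have "(excursion_at f l \<longlongrightarrow> f (Tl l + r) - jump f (Tl l + r) + l) (at_left r)"
      using left[of r] r0 Tl_bounds(4)[OF l0(1)] by (subst tendsto_cong) auto
    from jump_eqI[OF this] show ?thesis using r by (simp add: e)
  qed
  show "jump (excursion_at f l) r \<le> 0" if r: "\<not> (0 \<le> r \<and> r < T l - Tl l)"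
  proof -
    consider "r < 0" | "r = T l - Tl l" | "T l - Tl l < r" using r by linarith
    then show ?thesis
    proof cases
      case 1
      have "(excursion_at f l \<longlongrightarrow> 0) (at_left r)"
        by (rule tendsto_eventually) (use 1 in \<open>auto simp: eventually_at_left_field e intro!: exI[of _ "r - 1"]\<close>)
      from jump_eqI[OF this] show ?thesis using 1 by (simp add: e)
    next
      case 2
      have r0: "0 < r" using 2 l0 by simp
      have Tlr: "Tl l + r = T l" using 2 by simp
      have T0: "0 < T l" using Tl_bounds(4)[OF l0(1)] l0 by simp
      have "\<forall>\<^sub>F u in at_left r. excursion_at f l u = f (Tl l + u) + l"
        unfolding eventually_at_left_field using r0 2 by (intro exI[of _ 0]) (simp add: e)
      then have "(excursion_at f l \<longlongrightarrow> f (T l) - jump f (T l) + l) (at_left r)"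
        using left[of r, unfolded Tlr] r0 Tl_bounds(4)[OF l0(1)] by (subst tendsto_cong) auto
      from jump_eqI[OF this] have J: "jump (excursion_at f l) r = jump f (T l)"
        using 2 T_facts(2)[of l] l0 by (simp add: e)
      have "- l \<le> f (T l) - jump f (T l)"
      proof (rule tendsto_lowerbound[OF cadlag_left[OF cadlag T0]])
        show "\<forall>\<^sub>F u in at_left (T l). - l \<le> f u"
          unfolding eventually_at_left_field using T_facts(4)[of l] l0 T0 by (intro exI[of _ 0]) auto
      qed simp
      then show ?thesis using J T_facts(2)[of l] l0 by simp
    next
      case 3
      have "(excursion_at f l \<longlongrightarrow> 0) (at_left r)"
        by (rule tendsto_eventually) (use 3 in \<open>auto simp: eventually_at_left_field e intro!: exI[of _ "T l - Tl l"]\<close>)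
      from jump_eqI[OF this] show ?thesis using 3 by (simp add: e)
    qed
  qed
qed

text \<open>After its duration an element of \<open>excursions\<close> stays at zero. If this
  happened before T l, the path would rest at its infimum on an interval of positive length,
  contrary to \<open>null\<close>.\<close>

lemma duration_excursion:
  assumes l: "l \<in> levels" and exc: "excursion_at f l \<in> excursions"
  shows "duration (excursion_at f l) = T l - Tl l"
proof -
  have l0: "0 < l" "Tl l < T l" using l unfolding levels_def by auto
  define D where "D = duration (excursion_at f l)"
  note D = excursion_duration[OF exc, folded D_def]
  have "D \<le> T l - Tl l"
  proof (rule ccontr)
    assume n: "\<not> ?thesis"
    then have "0 < excursion_at f l (T l - Tl l)" using D(2)[of "T l - Tl l"] l0 by simp
    then show False by (simp add: excursion_at_eq[OF l])
  qed
  moreover have "\<not> D < T l - Tl l"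
  proof
    assume n: "D < T l - Tl l"
    have inf: "0 < r \<and> (\<forall>u. 0 \<le> u \<and> u \<le> r \<longrightarrow> f r \<le> f u)" if r: "r \<in> {Tl l + D<..<T l}" for r
    proof -
      have r0: "0 < r" using r D(1) Tl_bounds(4)[OF l0(1)] by simp
      have "excursion_at f l (r - Tl l) = 0" using r by (intro D(3)) simp
      then have "f r = - l" using r D(1) unfolding excursion_at_eq[OF l] by (auto split: if_splits)
      moreover have "- l \<le> f u" if "0 \<le> u" "u \<le> r" for u using T_facts(4)[of l u] that r l0 by simp
      ultimately show ?thesis using r0 by simp
    qed
    have "AE r in lborel. r \<notin> {Tl l + D<..<T l}" using null by eventually_elim (use inf in blast)
    then have "emeasure lborel {Tl l + D<..<T l} = 0" 
      using AE_iff_measurable[of "{Tl l + D<..<T l}" lborel "\<lambda>r. r \<notin> {Tl l + D<..<T l}"] by (simp add: set_eq_iff)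
    then show False using n by (simp add: emeasure_lborel_Ioo)
  qed
  ultimately show ?thesis unfolding D_def by simp
qed

lemma jump_sum_excursion:
  assumes l: "l \<in> levels" and F: "\<And>x. x \<le> 0 \<Longrightarrow> F x = 0"
  shows "jump_sum F (excursion_at f l) UNIV = jump_sum F f (span l)"
proof -
  have "jump_sum F (excursion_at f l) UNIV = (\<integral>\<^sup>+r. ennreal (F (jump (excursion_at f l) r)) * indicator {0..<T l - Tl l} r \<partial>count_space UNIV)"
    unfolding jump_sum_def using F[OF jump_excursion(2)[OF l]] by (intro nn_integral_cong) (auto simp: indicator_def)
  also have "\<dots> = (\<integral>\<^sup>+r. ennreal (F (jump (excursion_at f l) r)) \<partial>count_space {0..<T l - Tl l})"
    by (simp add: nn_integral_count_space_indicator)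
  also have "\<dots> = (\<integral>\<^sup>+r. ennreal (F (jump f (Tl l + r))) \<partial>count_space {0..<T l - Tl l})"
    by (intro nn_integral_cong) (simp add: jump_excursion(1)[OF l])
  also have "\<dots> = jump_sum F f (span l)" unfolding jump_sum_def
  proof (rule nn_integral_bij_count_space)
    show "bij_betw ((+) (Tl l)) {0..<T l - Tl l} (span l)"
      unfolding span_def by (rule bij_betwI[where g="\<lambda>r. r - Tl l"]) auto
  qed
  finally show ?thesis .
qed

text \<open>The spans of the levels up to 1 miss only infimum times between 0 and T 1. These form a
  null set, and none of them carries a positive jump, because just before an upward jump the path is
  lower.\<close>

theorem excursion_decomposition:
  assumes exc: "\<And>l. l \<in> levels \<Longrightarrow> excursion_at f l \<in> excursions"
    and F: "\<And>x. x \<le> 0 \<Longrightarrow> F x = 0" and c: "0 \<le> c"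
  shows "(\<integral>\<^sup>+p. (if fst p \<le> 1 then ennreal (c * duration (snd p)) + jump_sum F (snd p) UNIV else 0) \<partial>count_space (excursion_points f))
     = ennreal (c * T 1) + jump_sum F f {0<..T 1}"
proof -
  define L where "L = levels \<inter> {..1}"
  have cL: "countable L" unfolding L_def using countable_levels by blast
  have disj: "disjoint_family_on span L" unfolding disjoint_family_on_def L_def using span_disjoint by blast
  \<comment> \<open>The jump sum as a measure, so that countable additivity over the disjoint spans
    applies to jumps and to Lebesgue measure in the same way.\<close>
  define J where "J = density (count_space UNIV) (\<lambda>t. ennreal (F (jump f t)))"
  have J: "emeasure J A = jump_sum F f A" for A
    unfolding J_def jump_sum_def by (subst emeasure_density) (auto simp: nn_integral_count_space_indicator)
  have sub: "(\<Union>l\<in>L. span l) \<subseteq> {0<..<T 1}"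
  proof -
    have "span l \<subseteq> {0<..<T 1}" if "l \<in> L" for l
      using that Tl_bounds(4)[of l] T_mono[of l 1] unfolding L_def levels_def span_def by auto
    then show ?thesis by blast
  qed
  have T1: "0 \<le> T 1" "f (T 1) = - 1" using T_facts[of 1] by auto
  have meas: "emeasure lborel (\<Union>l\<in>L. span l) = ennreal (T 1)"
  proof -
    have U: "(\<Union>l\<in>L. span l) \<in> sets lborel" by (rule sets.countable_UN'[OF cL]) (auto simp: span_def)
    have "emeasure lborel (\<Union>l\<in>L. span l) = emeasure lborel {0<..<T 1}"
    proof (rule emeasure_eq_AE)
      show "AE r in lborel. (r \<in> (\<Union>l\<in>L. span l)) = (r \<in> {0<..<T 1})" using null
      proof eventually_elim
        case (elim r)
        show ?case
        proof
          assume r: "r \<in> {0<..<T 1}"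
          with elim have "\<exists>l\<in>levels. l \<le> 1 \<and> r \<in> span l" by (intro span_cover) auto
          then show "r \<in> (\<Union>l\<in>L. span l)" unfolding L_def by auto
        qed (use sub in blast)
      qed
    qed (use U in auto)
    then show ?thesis using T1 by simp
  qed
  have jumps: "jump_sum F f (\<Union>l\<in>L. span l) = jump_sum F f {0<..T 1}"
  proof -
    have "ennreal (F (jump f t)) * indicator (\<Union>l\<in>L. span l) t = ennreal (F (jump f t)) * indicator {0<..T 1} t" for t
    proof (cases "t \<in> {0<..T 1} - (\<Union>l\<in>L. span l)")
      case True
      then have t: "0 < t" "t \<le> T 1" and n: "t \<notin> (\<Union>l\<in>L. span l)" by auto
      have "jump f t \<le> 0"
      proof (rule ccontr)
        assume "\<not> ?thesis"
        then have jp: "0 < jump f t" by simp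
        have lim: "(f \<longlongrightarrow> f t - jump f t) (at_left t)" by (rule cadlag_left[OF cadlag t(1)])
        have "\<forall>\<^sub>F u in at_left t. f u < f t" by (rule order_tendstoD(2)[OF lim]) (use jp in simp)
        then obtain b where b: "b < t" "\<And>u. b < u \<Longrightarrow> u < t \<Longrightarrow> f u < f t" unfolding eventually_at_left_field by blast
        define u where "u = (max b 0 + t) / 2"
        have u: "0 < u" "u < t" "b < u" unfolding u_def using b(1) t(1) by (auto simp: max_def)
        have fu: "f u < f t" using b(2) u by blast
        have "t \<noteq> T 1"
        proof
          assume "t = T 1"
          then show False using T_facts(4)[of 1 u] u fu T1 by simp
        qed
        then have "\<exists>l\<in>levels. l \<le> 1 \<and> t \<in> span l"
          using t u fu by (intro span_cover) (auto intro!: exI[of _ u])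
        then show False using n unfolding L_def by auto
      qed
      then show ?thesis by (simp add: F)
    next
      case False
      then show ?thesis using sub by (auto simp: indicator_def)
    qed
    then show ?thesis unfolding jump_sum_def by (simp add: nn_integral_count_space_indicator)
  qed
  define V where "V p = (if fst p \<le> 1 then ennreal (c * duration (snd p)) + jump_sum F (snd p) UNIV else 0)" for p :: "real \<times> (real \<Rightarrow> real)"
  have "(\<integral>\<^sup>+p. V p \<partial>count_space (excursion_points f)) = (\<integral>\<^sup>+l. V (l, excursion_at f l) \<partial>count_space levels)"
  proof (rule nn_integral_bij_count_space[symmetric])
    show "bij_betw (\<lambda>l. (l, excursion_at f l)) levels (excursion_points f)"
      unfolding excursion_points_def levels_def by (rule bij_betwI') auto
  qed
  also have "\<dots> = (\<integral>\<^sup>+l. V (l, excursion_at f l) * indicator L l \<partial>count_space levels)"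
    by (intro nn_integral_cong) (auto simp: V_def L_def indicator_def)
  also have "\<dots> = (\<integral>\<^sup>+l. V (l, excursion_at f l) \<partial>count_space L)"
    by (subst (1 2) nn_integral_count_space_indicator) (auto intro!: nn_integral_cong simp: L_def indicator_def)
  also have "\<dots> = (\<integral>\<^sup>+l. ennreal c * emeasure lborel (span l) + emeasure J (span l) \<partial>count_space L)"
  proof (rule nn_integral_cong)
    fix l assume "l \<in> space (count_space L)"
    then have l: "l \<in> levels" "l \<le> 1" unfolding L_def by auto
    have "Tl l < T l" using l unfolding levels_def by simp
    then show "V (l, excursion_at f l) = ennreal c * emeasure lborel (span l) + emeasure J (span l)"
      unfolding V_def J span_def[of l] using l c
      by (simp add: duration_excursion[OF l(1) exc[OF l(1)]] jump_sum_excursion[OF l(1) F] span_def ennreal_mult'')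
  qed
  also have "\<dots> = ennreal c * (\<integral>\<^sup>+l. emeasure lborel (span l) \<partial>count_space L) + (\<integral>\<^sup>+l. emeasure J (span l) \<partial>count_space L)"
    by (simp add: nn_integral_add nn_integral_cmult)
  also have "(\<integral>\<^sup>+l. emeasure lborel (span l) \<partial>count_space L) = emeasure lborel (\<Union>l\<in>L. span l)"
    by (rule emeasure_UN_countable[symmetric]) (use cL disj in auto)
  also have "(\<integral>\<^sup>+l. emeasure J (span l) \<partial>count_space L) = emeasure J (\<Union>l\<in>L. span l)"
    by (rule emeasure_UN_countable[symmetric]) (use cL disj in \<open>auto simp: J_def\<close>)
  finally show ?thesis unfolding V_def meas J jumps using c T1 by (simp add: ennreal_mult'')
qed

end

section \<open>The exponential formula for Poisson point processes\<close>

lemma exp_neg_0 [simp]: "exp_neg 0 = 1"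
  using exp_neg_ennreal[of 0] by simp

lemma exp_neg_sum: "exp_neg (\<Sum>i\<in>I. y i) = (\<Prod>i\<in>I. exp_neg (y i))"
  by (induction I rule: infinite_finite_induct) (auto simp: exp_neg_add)

lemma exp_neg_of_nat_mult: "exp_neg (c * of_nat k) = exp_neg c ^ k"
  using exp_neg_sum[of "\<lambda>_. c" "{..<k}"] by (simp add: mult.commute)

lemma exp_neg_antimono: "x \<le> y \<Longrightarrow> exp_neg y \<le> exp_neg x"
proof -
  assume "x \<le> y"
  then obtain z where "y = x + z" using le_iff_add by blast
  then show ?thesis using exp_neg_bounds[of x] exp_neg_bounds[of z] by (simp add: exp_neg_add mult_left_le)
qed

locale poisson_process = prob_space \<Omega>
  for \<Omega> :: "'w measure" +
  fixes \<Lambda> :: "'a measure" and P :: "'w \<Rightarrow> 'a set"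
  assumes ppp: "poisson_point_process \<Omega> \<Lambda> P" and sigma_finite: "sigma_finite_measure \<Lambda>"
begin

definition count :: "'a set \<Rightarrow> 'w \<Rightarrow> ennreal" where
  "count A w = emeasure (count_space UNIV) (P w \<inter> A)"

lemma ppp_facts:
  fixes B :: "nat \<Rightarrow> 'a set"
  shows "AE w in \<Omega>. P w \<subseteq> space \<Lambda>"
    and count_measurable: "A \<in> sets \<Lambda> \<Longrightarrow> count A \<in> borel_measurable \<Omega>"
    and count_law: "A \<in> sets \<Lambda> \<Longrightarrow> emeasure \<Lambda> A < \<infinity> \<Longrightarrow>
        measure \<Omega> {w\<in>space \<Omega>. count A w = of_nat k} = exp (- measure \<Lambda> A) * measure \<Lambda> A ^ k / fact k"
    and count_indep: "disjoint_family_on B {..<n} \<Longrightarrow> (\<And>i. i < n \<Longrightarrow> B i \<in> sets \<Lambda>) \<Longrightarrow>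
        indep_vars (\<lambda>_. borel) (\<lambda>i. count (B i)) {..<n}"
proof -
  note p = ppp[unfolded poisson_point_process_def]
  show "AE w in \<Omega>. P w \<subseteq> space \<Lambda>" using p by blast
  show "A \<in> sets \<Lambda> \<Longrightarrow> count A \<in> borel_measurable \<Omega>" using p unfolding count_def[abs_def] by blast
  show "A \<in> sets \<Lambda> \<Longrightarrow> emeasure \<Lambda> A < \<infinity> \<Longrightarrow>
      measure \<Omega> {w\<in>space \<Omega>. count A w = of_nat k} = exp (- measure \<Lambda> A) * measure \<Lambda> A ^ k / fact k"
    using p unfolding count_def by blast
  assume "disjoint_family_on B {..<n}" "\<And>i. i < n \<Longrightarrow> B i \<in> sets \<Lambda>"
  then show "indep_vars (\<lambda>_. borel) (\<lambda>i. count (B i)) {..<n}"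
    using p[THEN conjunct2, THEN conjunct2, THEN conjunct2, rule_format, of B n] unfolding count_def[abs_def] by simp
qed

text \<open>The generating function of the Poisson law. The count may be infinite as a function, but
  the Poisson weights already add up to 1, so it is almost surely finite.\<close>

lemma count_laplace:
  assumes A: "A \<in> sets \<Lambda>" "emeasure \<Lambda> A < \<infinity>"
  shows "(\<integral>w. exp_neg (c * count A w) \<partial>\<Omega>) = exp (- ((1 - exp_neg c) * measure \<Lambda> A))"
proof -
  define m where "m = measure \<Lambda> A"
  define p where "p k = exp (- m) * m ^ k / fact k" for k :: nat
  define E where "E k = {w\<in>space \<Omega>. count A w = of_nat k}" for k :: nat
  have m0: "0 \<le> m" unfolding m_def by simp
  have p0: "0 \<le> p k" for k unfolding p_def using m0 by simp
  have [measurable]: "count A \<in> borel_measurable \<Omega>" by (rule count_measurable) fact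
  have [measurable]: "E k \<in> sets \<Omega>" for k unfolding E_def by measurable
  have pE: "measure \<Omega> (E k) = p k" for k unfolding E_def p_def m_def by (rule count_law[OF A])
  have disj: "disjoint_family E" unfolding disjoint_family_on_def E_def by auto
  have p_sums: "(\<lambda>k. p k * z ^ k) sums exp (- ((1 - z) * m))" for z
  proof -
    have "(\<lambda>k. exp (- m) * ((m * z) ^ k / fact k)) sums (exp (- m) * exp (m * z))"
      by (intro sums_mult) (use exp_converges[of "m * z"] in \<open>simp add: divide_inverse mult.commute\<close>)
    then show ?thesis unfolding p_def by (simp add: power_mult_distrib algebra_simps flip: exp_add)
  qed
  have "prob (\<Union>k. E k) = 1"
  proof -
    have "(\<lambda>k. prob (E k)) sums prob (\<Union>k. E k)" by (rule finite_measure_UNION) (use disj in auto)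
    moreover have "(\<lambda>k. prob (E k)) sums 1" using p_sums[of 1] unfolding pE by simp
    ultimately show ?thesis by (rule sums_unique2)
  qed
  then have AE_E: "AE w in \<Omega>. w \<in> (\<Union>k. E k)" by (subst prob_eq_1[symmetric]) auto
  have "(\<integral>\<^sup>+w. ennreal (exp_neg (c * count A w)) \<partial>\<Omega>) = (\<integral>\<^sup>+w. (\<Sum>k. ennreal (exp_neg c ^ k) * indicator (E k) w) \<partial>\<Omega>)"
  proof (rule nn_integral_cong_AE)
    show "AE w in \<Omega>. ennreal (exp_neg (c * count A w)) = (\<Sum>k. ennreal (exp_neg c ^ k) * indicator (E k) w)"
      using AE_E
    proof eventually_elim
      case (elim w)
      then obtain k where k: "w \<in> E k" by blast
      then have "w \<notin> E j" if "j \<noteq> k" for j using disj that unfolding disjoint_family_on_def by auto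
      then have "(\<Sum>j. ennreal (exp_neg c ^ j) * indicator (E j) w) = (\<Sum>j\<in>{k}. ennreal (exp_neg c ^ j) * indicator (E j) w)"
        by (intro suminf_finite) auto
      also have "\<dots> = ennreal (exp_neg (c * count A w))" using k by (simp add: E_def exp_neg_of_nat_mult)
      finally show ?case by simp
    qed
  qed
  also have "\<dots> = (\<Sum>k. \<integral>\<^sup>+w. ennreal (exp_neg c ^ k) * indicator (E k) w \<partial>\<Omega>)"
    by (rule nn_integral_suminf) measurable
  also have "\<dots> = (\<Sum>k. ennreal (p k * exp_neg c ^ k))"
    using exp_neg_bounds(1)[of c] p0
    by (subst nn_integral_cmult_indicator) (simp_all add: emeasure_eq_measure pE ennreal_mult mult.commute)
  also have "\<dots> = ennreal (exp (- ((1 - exp_neg c) * m)))"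
    using p_sums[of "exp_neg c"] p0 exp_neg_bounds(1)[of c] by (simp add: suminf_ennreal_eq sums_iff)
  finally have "(\<integral>\<^sup>+w. ennreal (exp_neg (c * count A w)) \<partial>\<Omega>) = ennreal (exp (- ((1 - exp_neg c) * m)))" .
  then have "has_bochner_integral \<Omega> (\<lambda>w. exp_neg (c * count A w)) (exp (- ((1 - exp_neg c) * m)))"
    by (intro has_bochner_integral_nn_integral) (auto simp: exp_neg_bounds)
  then show ?thesis unfolding m_def by (simp add: has_bochner_integral_iff)
qed

lemma exp_neg_count_integrable: "A \<in> sets \<Lambda> \<Longrightarrow> integrable \<Omega> (\<lambda>w. exp_neg (c * count A w))"
  by (rule integrable_const_bound[where B=1])
     (use exp_neg_bounds count_measurable[of A] in auto)

text \<open>The level sets of V are disjoint, so their counts are independent and the formula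
  factorises. The sum over the points is not known to be measurable in w; the first claim supplies a
  measurable version, and the second holds for any such version.\<close>

lemma simple_exponential_formula:
  assumes V: "simple_function \<Lambda> V" and B: "B \<in> sets \<Lambda>" "emeasure \<Lambda> B < \<infinity>" "\<And>x. x \<in> space \<Lambda> \<Longrightarrow> x \<notin> B \<Longrightarrow> V x = 0"
  shows "\<exists>Y\<in>borel_measurable \<Omega>. AE w in \<Omega>. (\<integral>\<^sup>+x. V x \<partial>count_space (P w)) = Y w"
    and "\<And>Y. Y \<in> borel_measurable \<Omega> \<Longrightarrow> (AE w in \<Omega>. (\<integral>\<^sup>+x. V x \<partial>count_space (P w)) = Y w) \<Longrightarrow>
      (\<integral>w. exp_neg (Y w) \<partial>\<Omega>) = exp_neg (\<integral>\<^sup>+x. ennreal (1 - exp_neg (V x)) \<partial>\<Lambda>)"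
proof -
  define S where "S = V ` space \<Lambda> - {0}"
  define n where "n = card S"
  have fS: "finite S" using V unfolding S_def simple_function_def by simp
  obtain h where h: "bij_betw h {..<n} S" using ex_bij_betw_nat_finite[OF fS] unfolding n_def lessThan_atLeast0 by blast
  define A where "A i = V -` {h i} \<inter> space \<Lambda>" for i
  have Vm: "V \<in> borel_measurable \<Lambda>" using V by (rule borel_measurable_simple_function)
  have hS: "h i \<in> S" if "i < n" for i using h that unfolding bij_betw_def by auto
  have inj: "h i = h j \<Longrightarrow> i < n \<Longrightarrow> j < n \<Longrightarrow> i = j" for i j using h unfolding bij_betw_def inj_on_def by auto
  have Am: "A i \<in> sets \<Lambda>" if "i < n" for i
    unfolding A_def using V by (rule simple_functionD)
  have Af: "emeasure \<Lambda> (A i) < \<infinity>" if "i < n" for i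
  proof -
    have "h i \<noteq> 0" using hS[OF that] unfolding S_def by simp
    moreover have "x \<in> B" if "x \<in> A i" for x
      using that B(3)[of x] \<open>h i \<noteq> 0\<close> unfolding A_def by (cases "x \<in> B") auto
    ultimately have "A i \<subseteq> B" by blast
    from emeasure_mono[OF this B(1)] B(2) show ?thesis by simp
  qed
  have disj: "disjoint_family_on A {..<n}" unfolding disjoint_family_on_def A_def using inj by auto
  have Veq: "g (V x) = (\<Sum>i<n. g (h i) * indicator (A i) x)" if x: "x \<in> space \<Lambda>" and g: "g 0 = 0" for x and g :: "ennreal \<Rightarrow> ennreal"
  proof (cases "V x = 0")
    case True
    then have "x \<notin> A i" if "i < n" for i using hS[OF that] unfolding A_def S_def by auto
    then show ?thesis using True g by simp
  next
    case False
    then have "V x \<in> S" unfolding S_def using x by simp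
    then obtain k where k: "k < n" "V x = h k" using h unfolding bij_betw_def by auto
    have "x \<notin> A j" if "j < n" "j \<noteq> k" for j using inj[of j k] that k unfolding A_def by auto
    then have "(\<Sum>i<n. g (h i) * indicator (A i) x) = (\<Sum>i\<in>{k}. g (h i) * indicator (A i) x)"
      using k by (intro sum.mono_neutral_right) auto
    then show ?thesis using k x by (simp add: A_def)
  qed
  define Y where "Y w = (\<Sum>i<n. h i * count (A i) w)" for w
  have cm: "count (A i) \<in> borel_measurable \<Omega>" if "i < n" for i using count_measurable Am that by blast
  have Ym: "Y \<in> borel_measurable \<Omega>" unfolding Y_def[abs_def] by (intro borel_measurable_sum borel_measurable_times) (use cm in auto)
  have YV: "AE w in \<Omega>. (\<integral>\<^sup>+x. V x \<partial>count_space (P w)) = Y w"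
    using ppp_facts(1)
  proof eventually_elim
    case (elim w)
    have "(\<integral>\<^sup>+x. V x \<partial>count_space (P w)) = (\<integral>\<^sup>+x. (\<Sum>i<n. h i * indicator (A i) x) \<partial>count_space (P w))"
      by (rule nn_integral_cong) (use elim Veq[of _ "\<lambda>x. x"] in auto)
    also have "\<dots> = (\<Sum>i<n. \<integral>\<^sup>+x. h i * indicator (A i) x \<partial>count_space (P w))" by (rule nn_integral_sum) simp
    also have "\<dots> = Y w" unfolding Y_def
    proof (rule sum.cong)
      fix i
      have "(\<integral>\<^sup>+x. h i * indicator (A i) x \<partial>count_space (P w)) = (\<integral>\<^sup>+x. h i * indicator (P w \<inter> A i) x \<partial>count_space UNIV)"
        by (subst nn_integral_count_space_indicator) (auto intro!: nn_integral_cong simp: indicator_def)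
      also have "\<dots> = h i * count (A i) w" unfolding count_def by (rule nn_integral_cmult_indicator) simp
      finally show "(\<integral>\<^sup>+x. h i * indicator (A i) x \<partial>count_space (P w)) = h i * count (A i) w" .
    qed simp
    finally show ?case .
  qed
  show "\<exists>Y\<in>borel_measurable \<Omega>. AE w in \<Omega>. (\<integral>\<^sup>+x. V x \<partial>count_space (P w)) = Y w" using Ym YV by blast
  fix Y' assume Y': "Y' \<in> borel_measurable \<Omega>" "AE w in \<Omega>. (\<integral>\<^sup>+x. V x \<partial>count_space (P w)) = Y' w"
  have "(\<integral>w. exp_neg (Y' w) \<partial>\<Omega>) = (\<integral>w. exp_neg (Y w) \<partial>\<Omega>)"
  proof (rule integral_cong_AE)
    show "AE w in \<Omega>. exp_neg (Y' w) = exp_neg (Y w)" using Y'(2) YV by eventually_elim simp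
  qed (use Y'(1) Ym in measurable)
  also have "\<dots> = (\<integral>w. (\<Prod>i\<in>{..<n}. exp_neg (h i * count (A i) w)) \<partial>\<Omega>)"
    unfolding Y_def exp_neg_sum by simp
  also have "\<dots> = (\<Prod>i\<in>{..<n}. \<integral>w. exp_neg (h i * count (A i) w) \<partial>\<Omega>)"
  proof (cases "n = 0")
    case False
    have "indep_vars (\<lambda>_. borel) (\<lambda>i w. exp_neg (h i * count (A i) w)) {..<n}"
      by (rule indep_vars_compose2[OF count_indep[OF disj Am]]) auto
    then show ?thesis
      by (intro indep_vars_lebesgue_integral) (use False Am exp_neg_count_integrable in auto)
  qed (simp add: prob_space)
  also have "\<dots> = (\<Prod>i\<in>{..<n}. exp_neg (ennreal (1 - exp_neg (h i)) * emeasure \<Lambda> (A i)))"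
  proof (rule prod.cong)
    fix i assume "i \<in> {..<n}"
    then have i: "i < n" by simp
    have "emeasure \<Lambda> (A i) = ennreal (measure \<Lambda> (A i))" using Af[OF i] by (simp add: emeasure_eq_ennreal_measure)
    then have "exp_neg (ennreal (1 - exp_neg (h i)) * emeasure \<Lambda> (A i)) = exp_neg (ennreal ((1 - exp_neg (h i)) * measure \<Lambda> (A i)))"
      using exp_neg_bounds(2)[of "h i"] by (simp add: ennreal_mult)
    also have "\<dots> = exp (- ((1 - exp_neg (h i)) * measure \<Lambda> (A i)))"
      using exp_neg_bounds(2)[of "h i"] by (intro exp_neg_ennreal) simp
    finally show "(\<integral>w. exp_neg (h i * count (A i) w) \<partial>\<Omega>) = exp_neg (ennreal (1 - exp_neg (h i)) * emeasure \<Lambda> (A i))"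
      using count_laplace[OF Am[OF i] Af[OF i]] by simp
  qed simp
  also have "\<dots> = exp_neg (\<Sum>i<n. ennreal (1 - exp_neg (h i)) * emeasure \<Lambda> (A i))" by (simp add: exp_neg_sum)
  also have "(\<Sum>i<n. ennreal (1 - exp_neg (h i)) * emeasure \<Lambda> (A i)) = (\<Sum>i<n. \<integral>\<^sup>+x. ennreal (1 - exp_neg (h i)) * indicator (A i) x \<partial>\<Lambda>)"
    using Am by (intro sum.cong) (auto simp: nn_integral_cmult_indicator)
  also have "\<dots> = (\<integral>\<^sup>+x. (\<Sum>i<n. ennreal (1 - exp_neg (h i)) * indicator (A i) x) \<partial>\<Lambda>)"
    using Am by (intro nn_integral_sum[symmetric]) auto
  also have "\<dots> = (\<integral>\<^sup>+x. ennreal (1 - exp_neg (V x)) \<partial>\<Lambda>)"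
    by (rule nn_integral_cong) (use Veq[of _ "\<lambda>x. ennreal (1 - exp_neg x)"] in auto)
  finally show "(\<integral>w. exp_neg (Y' w) \<partial>\<Omega>) = exp_neg (\<integral>\<^sup>+x. ennreal (1 - exp_neg (V x)) \<partial>\<Lambda>)" .
qed

theorem exponential_formula:
  assumes V: "V \<in> borel_measurable \<Lambda>"
    and Y: "Y \<in> borel_measurable \<Omega>" "AE w in \<Omega>. Y w = exp_neg (\<integral>\<^sup>+x. V x \<partial>count_space (P w))"
  shows "(\<integral>w. Y w \<partial>\<Omega>) = exp_neg (\<integral>\<^sup>+x. ennreal (1 - exp_neg (V x)) \<partial>\<Lambda>)"
proof -
  interpret \<Lambda>: sigma_finite_measure \<Lambda> by (rule sigma_finite)
  obtain B :: "nat \<Rightarrow> 'a set" where B: "range B \<subseteq> sets \<Lambda>" "(\<Union>i. B i) = space \<Lambda>" "\<And>i. emeasure \<Lambda> (B i) \<noteq> \<infinity>" "incseq B"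
    using \<Lambda>.sigma_finite_incseq by blast
  obtain U where U: "\<And>k. simple_function \<Lambda> (U k)" "incseq U" "\<And>x. (SUP k. U k x) = V x"
    using borel_measurable_implies_simple_function_sequence'[OF V] by metis
  \<comment> \<open>Restricting the simple functions to sets of finite measure makes their counts
    Poisson with finite parameter and keeps the sequence increasing to V.\<close>
  define W where "W k x = U k x * indicator (B k) x" for k x
  have Bm: "B k \<in> sets \<Lambda>" for k using B(1) by auto
  have Ws: "simple_function \<Lambda> (W k)" for k
    unfolding W_def[abs_def] using U(1) Bm by (intro simple_function_mult simple_function_indicator)
  have Wm: "W k \<in> borel_measurable \<Lambda>" for k using Ws by (rule borel_measurable_simple_function)
  have Winc: "incseq (\<lambda>k. W k x)" for x
  proof (rule incseq_SucI)
    fix k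
    have "U k x \<le> U (Suc k) x" using U(2) by (simp add: incseq_Suc_iff le_fun_def)
    moreover have "B k \<subseteq> B (Suc k)" using B(4) by (simp add: incseq_Suc_iff)
    ultimately show "W k x \<le> W (Suc k) x" unfolding W_def by (auto simp: indicator_def)
  qed
  have Wsup: "(SUP k. W k x) = V x" if x: "x \<in> space \<Lambda>" for x
  proof (rule antisym)
    have "W k x \<le> V x" for k
      using SUP_upper[of k UNIV "\<lambda>k. U k x"] unfolding U(3) W_def by (auto simp: indicator_def)
    then show "(SUP k. W k x) \<le> V x" by (rule SUP_least)
    obtain j where j: "x \<in> B j" using B(2) x by blast
    have "U k x \<le> (SUP k. W k x)" for k
    proof -
      have "U k x \<le> U (max j k) x" using U(2) by (simp add: incseq_def le_fun_def)
      also have "\<dots> = W (max j k) x" using incseqD[OF B(4), of j "max j k"] j unfolding W_def by (auto simp: indicator_def)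
      also have "\<dots> \<le> (SUP k. W k x)" by (rule SUP_upper) simp
      finally show ?thesis .
    qed
    then show "V x \<le> (SUP k. W k x)" unfolding U(3)[symmetric] by (rule SUP_least)
  qed
  have W0: "W k x = 0" if "x \<notin> B k" for k x using that unfolding W_def by simp
  have fin: "emeasure \<Lambda> (B k) < \<infinity>" for k using B(3)[of k] by (simp add: less_top)
  have "\<exists>Z\<in>borel_measurable \<Omega>. AE w in \<Omega>. (\<integral>\<^sup>+x. W k x \<partial>count_space (P w)) = Z w" for k
    by (rule simple_exponential_formula(1)[OF Ws Bm fin W0])
  then obtain Z where Z: "\<And>k. Z k \<in> borel_measurable \<Omega>" "\<And>k. AE w in \<Omega>. (\<integral>\<^sup>+x. W k x \<partial>count_space (P w)) = Z k w" by metis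
  have lim1: "(\<lambda>k. \<integral>w. exp_neg (Z k w) \<partial>\<Omega>) \<longlonglongrightarrow> (\<integral>w. Y w \<partial>\<Omega>)"
  proof (rule integral_dominated_convergence[where w="\<lambda>_. 1"])
    have "AE w in \<Omega>. \<forall>k. (\<integral>\<^sup>+x. W k x \<partial>count_space (P w)) = Z k w" using Z(2) by (simp add: AE_all_countable)
    then show "AE w in \<Omega>. (\<lambda>k. exp_neg (Z k w)) \<longlonglongrightarrow> Y w" using Y(2) ppp_facts(1)
    proof eventually_elim
      case (elim w)
      have "(\<integral>\<^sup>+x. V x \<partial>count_space (P w)) = (\<integral>\<^sup>+x. (SUP k. W k x) \<partial>count_space (P w))"
        by (rule nn_integral_cong) (use elim(3) Wsup in auto)
      also have "\<dots> = (SUP k. \<integral>\<^sup>+x. W k x \<partial>count_space (P w))"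
        by (rule nn_integral_monotone_convergence_SUP) (use Winc in \<open>auto simp: incseq_def le_fun_def\<close>)
      finally have e: "Y w = exp_neg (SUP k. \<integral>\<^sup>+x. W k x \<partial>count_space (P w))" using elim(2) by simp
      have "incseq (\<lambda>k. \<integral>\<^sup>+x. W k x \<partial>count_space (P w))"
        using Winc by (auto simp: incseq_def intro!: nn_integral_mono)
      from exp_neg_SUP_tendsto[OF this] show ?case unfolding e using elim(1) by simp
    qed
  qed (use Z(1) Y(1) exp_neg_bounds in auto)
  have lim2: "(\<lambda>k. exp_neg (\<integral>\<^sup>+x. ennreal (1 - exp_neg (W k x)) \<partial>\<Lambda>)) \<longlonglongrightarrow> exp_neg (\<integral>\<^sup>+x. ennreal (1 - exp_neg (V x)) \<partial>\<Lambda>)"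
  proof -
    have mono: "exp_neg (W k' x) \<le> exp_neg (W k x)" if "k \<le> k'" for k k' x
      by (rule exp_neg_antimono) (use Winc[of x] that in \<open>simp add: incseq_def\<close>)
    have inc: "incseq (\<lambda>k x. ennreal (1 - exp_neg (W k x)))"
      using mono by (auto simp: incseq_def le_fun_def intro!: ennreal_leI)
    have "(\<integral>\<^sup>+x. ennreal (1 - exp_neg (V x)) \<partial>\<Lambda>) = (\<integral>\<^sup>+x. (SUP k. ennreal (1 - exp_neg (W k x))) \<partial>\<Lambda>)"
    proof (rule nn_integral_cong)
      fix x assume x: "x \<in> space \<Lambda>"
      have "(\<lambda>k. ennreal (1 - exp_neg (W k x))) \<longlonglongrightarrow> ennreal (1 - exp_neg (V x))"
        unfolding Wsup[OF x, symmetric] by (intro tendsto_ennrealI tendsto_diff tendsto_const exp_neg_SUP_tendsto Winc)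
      moreover have "(\<lambda>k. ennreal (1 - exp_neg (W k x))) \<longlonglongrightarrow> (SUP k. ennreal (1 - exp_neg (W k x)))"
        by (rule LIMSEQ_SUP) (use inc in \<open>auto simp: incseq_def le_fun_def\<close>)
      ultimately show "ennreal (1 - exp_neg (V x)) = (SUP k. ennreal (1 - exp_neg (W k x)))" by (rule LIMSEQ_unique)
    qed
    also have "\<dots> = (SUP k. \<integral>\<^sup>+x. ennreal (1 - exp_neg (W k x)) \<partial>\<Lambda>)"
      by (rule nn_integral_monotone_convergence_SUP[OF inc]) (use Wm in measurable)
    finally have e: "(\<integral>\<^sup>+x. ennreal (1 - exp_neg (V x)) \<partial>\<Lambda>) = (SUP k. \<integral>\<^sup>+x. ennreal (1 - exp_neg (W k x)) \<partial>\<Lambda>)" .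
    show ?thesis unfolding e
      by (rule exp_neg_SUP_tendsto) (use inc in \<open>auto simp: incseq_def le_fun_def intro!: nn_integral_mono\<close>)
  qed
  have "(\<integral>w. exp_neg (Z k w) \<partial>\<Omega>) = exp_neg (\<integral>\<^sup>+x. ennreal (1 - exp_neg (W k x)) \<partial>\<Lambda>)" for k
    by (rule simple_exponential_formula(2)[OF Ws Bm fin W0 Z(1) Z(2)])
  with lim1 have "(\<lambda>k. exp_neg (\<integral>\<^sup>+x. ennreal (1 - exp_neg (W k x)) \<partial>\<Lambda>)) \<longlonglongrightarrow> (\<integral>w. Y w \<partial>\<Omega>)" by simp
  from LIMSEQ_unique[OF this lim2] show ?thesis .
qed

end

section \<open>The excursion functional\<close>

text \<open>This links the unordered product to the extended sum over the jumps. If the sum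
  diverges, finite partial sums are unbounded and the products tend to 0, in agreement with
  \<open>exp_neg\<close> at infinity.\<close>

lemma exp_neg_sum_limit:
  fixes h :: "'a \<Rightarrow> real"
  assumes h: "\<And>x. 0 \<le> h x"
  shows "((\<lambda>F. exp (- sum h F)) \<longlongrightarrow> exp_neg (\<integral>\<^sup>+x. ennreal (h x) \<partial>count_space A)) (finite_subsets_at_top A)"
proof (cases "integrable (count_space A) h")
  case True
  have abs: "Infinite_Set_Sum.abs_summable_on h A" using True unfolding Infinite_Set_Sum.abs_summable_on_def .
  then have s: "h summable_on A" using h by (simp add: abs_summable_equivalent[symmetric])
  have "(\<integral>\<^sup>+x. ennreal (h x) \<partial>count_space A) = ennreal (integral\<^sup>L (count_space A) h)"
    by (rule nn_integral_eq_integral[OF True]) (simp add: h)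
  also have "integral\<^sup>L (count_space A) h = infsum h A"
    using infsetsum_infsum[OF abs] unfolding infsetsum_def by simp
  finally have e: "(\<integral>\<^sup>+x. ennreal (h x) \<partial>count_space A) = ennreal (infsum h A)" .
  have "(sum h \<longlongrightarrow> infsum h A) (finite_subsets_at_top A)"
    using has_sum_infsum[OF s] unfolding has_sum_def .
  then show ?thesis unfolding e using h by (simp add: exp_neg_ennreal infsum_nonneg) (intro tendsto_exp tendsto_minus)
next
  case False
  have e: "(\<integral>\<^sup>+x. ennreal (h x) \<partial>count_space A) = \<top>"
  proof (rule ccontr)
    assume "\<not> ?thesis"
    then have "integrable (count_space A) h" by (intro integrableI_nonneg) (auto simp: h less_top)
    with False show False by simp
  qed
  have ns: "\<not> h summable_on A"
  proof
    assume "h summable_on A"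
    then have "Infinite_Set_Sum.abs_summable_on h A" using h by (simp add: abs_summable_equivalent[symmetric])
    then show False using False unfolding Infinite_Set_Sum.abs_summable_on_def by simp
  qed
  have unbounded: "\<exists>F. finite F \<and> F \<subseteq> A \<and> B < sum h F" for B
  proof (rule ccontr)
    assume "\<not> ?thesis"
    then have "bdd_above (sum h ` {F. F \<subseteq> A \<and> finite F})"
      by (intro bdd_aboveI[of _ B]) (auto simp: not_less)
    from nonneg_bdd_above_summable_on[OF h this] ns show False by blast
  qed
  have "((\<lambda>F. exp (- sum h F)) \<longlongrightarrow> 0) (finite_subsets_at_top A)"
  proof (rule tendstoI)
    fix r :: real assume r: "0 < r"
    obtain F0 where F0: "finite F0" "F0 \<subseteq> A" "- ln r < sum h F0" using unbounded by blast
    have "dist (exp (- sum h F)) 0 < r" if "finite F" "F0 \<subseteq> F" for F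
    proof -
      have "sum h F0 \<le> sum h F" by (rule sum_mono2) (use that h in auto)
      then have "- sum h F < ln r" using F0(3) by linarith
      then have "exp (- sum h F) < exp (ln r)" by simp
      then show ?thesis using r by simp
    qed
    then show "\<forall>\<^sub>F F in finite_subsets_at_top A. dist (exp (- sum h F)) 0 < r"
      unfolding eventually_finite_subsets_at_top using F0 by blast
  qed
  then show ?thesis unfolding e by simp
qed

section \<open>Measurability on the space of excursions\<close>

lemma space_excursion_space [simp]: "space excursion_space = excursions"
  unfolding excursion_space_def by (simp add: space_restrict_space space_PiM)

lemma excursion_eval_measurable [measurable]: "(\<lambda>e. e t) \<in> borel_measurable excursion_space"
  unfolding excursion_space_def by (intro measurable_restrict_space1 measurable_component_singleton) simp

text \<open>For a > 0 an excursion has ended by time a exactly when its value at a is 0, so a single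
  evaluation decides.\<close>

lemma duration_measurable [measurable]: "duration \<in> borel_measurable excursion_space"
proof (rule borel_measurableI_le)
  fix a :: real
  have "{e \<in> space excursion_space. duration e \<le> a} = (if 0 < a then {e \<in> space excursion_space. e a = 0} else {})"
  proof (intro set_eqI)
    fix e
    show "e \<in> {e \<in> space excursion_space. duration e \<le> a} \<longleftrightarrow> e \<in> (if 0 < a then {e \<in> space excursion_space. e a = 0} else {})"
    proof (cases "e \<in> excursions")
      case True
      show ?thesis using excursion_duration(1)[OF True] excursion_duration(2)[OF True, of a] excursion_duration(3)[OF True, of a] True
        by (cases "duration e \<le> a") auto
    qed simp
  qed
  also have "\<dots> \<in> sets excursion_space"
  proof -
    have "Measurable.pred excursion_space (\<lambda>e. e a = 0)" by measurable
    then show ?thesis unfolding pred_def by simp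
  qed
  finally show "{e \<in> space excursion_space. duration e \<le> a} \<in> sets excursion_space" .
qed

lemma excursion_left_limit:
  assumes e: "e \<in> excursions"
  shows "(e \<longlongrightarrow> e t - jump e t) (at_left t)"
proof (cases "0 < t")
  case True
  then show ?thesis using e unfolding excursions_def by (intro cadlag_left) auto
next
  case False
  then have "(e \<longlongrightarrow> 0) (at_left t)"
    using e unfolding excursions_def
    by (intro tendsto_eventually) (auto simp: eventually_at_left_field intro!: exI[of _ "t - 1"])
  with jump_eqI[OF this] show ?thesis by simp
qed

text \<open>Delaying an excursion by 1 moves a possible jump at time 0 to time 1, into the range of
  positive times that the grid approximation of jump sums covers.\<close>

lemma shifted_excursion:
  assumes e: "e \<in> excursions"
  shows "cadlag (\<lambda>t. e (t - 1))" "jump (\<lambda>t. e (t - 1)) t = jump e (t - 1)"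
proof -
  have left: "((\<lambda>t. e (t - 1)) \<longlongrightarrow> e (t - 1) - jump e (t - 1)) (at_left t)" for t
  proof -
    have "filterlim (\<lambda>u. u - 1) (at_left (t - 1)) (at_left t)"
      unfolding filterlim_at by (auto intro!: tendsto_intros simp: eventually_at_left_field) (use lt_ex in blast)
    from filterlim_compose[OF excursion_left_limit[OF e] this] show ?thesis .
  qed
  show "jump (\<lambda>t. e (t - 1)) t = jump e (t - 1)" using jump_eqI[OF left[of t]] by simp
  have right: "(e \<longlongrightarrow> e t) (at_right t)" for t
  proof (cases "0 \<le> t")
    case True
    then show ?thesis using e unfolding excursions_def by (intro cadlag_right) auto
  next
    case False
    then show ?thesis using e unfolding excursions_def
      by (intro tendsto_eventually) (auto simp: eventually_at_right_field intro!: exI[of _ 0])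
  qed
  show "cadlag (\<lambda>t. e (t - 1))"
    unfolding cadlag_def
  proof (intro conjI allI impI)
    fix t :: real
    have "filterlim (\<lambda>u. u - 1) (at_right (t - 1)) (at_right t)"
      unfolding filterlim_at by (auto intro!: tendsto_intros simp: eventually_at_right_field) (use gt_ex in blast)
    from filterlim_compose[OF right this] show "((\<lambda>t. e (t - 1)) \<longlongrightarrow> e (t - 1)) (at_right t)" .
    show "\<exists>l. ((\<lambda>t. e (t - 1)) \<longlongrightarrow> l) (at_left t)" using left by blast
  qed
qed

lemma jump_sum_Ioi: "jump_sum F f {0<..} = (SUP K. jump_sum F f {0<..real K})"
proof -
  have "jump_sum F f {0<..} = (\<integral>\<^sup>+t. (SUP K. ennreal (F (jump f t)) * indicator {0<..real K} t) \<partial>count_space UNIV)"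
    unfolding jump_sum_def
  proof (subst nn_integral_count_space_indicator[of "{0<..}"], simp, rule nn_integral_cong)
    fix t :: real
    show "ennreal (F (jump f t)) * indicator {0<..} t = (SUP K. ennreal (F (jump f t)) * indicator {0<..real K} t)"
    proof (cases "0 < t")
      case True
      obtain K :: nat where "t \<le> real K" using real_arch_simple by blast
      then have "ennreal (F (jump f t)) * indicator {0<..} t \<le> ennreal (F (jump f t)) * indicator {0<..real K} t" using True by simp
      also have "\<dots> \<le> (SUP K. ennreal (F (jump f t)) * indicator {0<..real K} t)" by (rule SUP_upper) simp
      finally show ?thesis by (intro antisym SUP_least) (auto simp: indicator_def)
    qed simp
  qed
  also have "\<dots> = (SUP K. \<integral>\<^sup>+t. ennreal (F (jump f t)) * indicator {0<..real K} t \<partial>count_space UNIV)"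
    by (rule nn_integral_monotone_convergence_SUP) (auto simp: incseq_def le_fun_def indicator_def)
  finally show ?thesis unfolding jump_sum_def by (simp add: nn_integral_count_space_indicator)
qed

lemma jump_sum_excursion_measurable:
  assumes F: "\<And>x. 0 \<le> F x" "\<And>x. x \<le> 0 \<Longrightarrow> F x = 0" and cont: "\<And>x. isCont F x"
  shows "(\<lambda>e. jump_sum F e UNIV) \<in> borel_measurable excursion_space"
proof -
  have [measurable]: "F \<in> borel_measurable borel" by (rule isCont_borel) (rule cont)
  have [measurable]: "cutoff m \<in> borel_measurable borel" for m by (rule isCont_borel) (rule cutoff_continuous)
  define sh where "sh e t = e (t - 1)" for e :: "real \<Rightarrow> real" and t :: real
  have [measurable]: "(\<lambda>e. incr (sh e) n i) \<in> borel_measurable excursion_space" for n i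
    unfolding incr_def sh_def by measurable
  have grid: "jump_sum (\<lambda>x. cutoff m x * F x) (sh e) {0<..real K} < \<infinity>"
      "(\<lambda>n. \<Sum>i<K * 2 ^ n. cutoff m (incr (sh e) n i) * F (incr (sh e) n i)) \<longlonglongrightarrow> enn2real (jump_sum (\<lambda>x. cutoff m x * F x) (sh e) {0<..real K})"
    if e: "e \<in> excursions" for e m K
  proof -
    have c: "cadlag (sh e)" unfolding sh_def[abs_def] by (rule shifted_excursion(1)[OF e])
    have k: "real (K * 2 ^ n) / 2 ^ n = real K" for n by simp
    have T: "0 \<le> real K" "\<And>n. real K \<le> real (K * 2 ^ n) / 2 ^ n" "(\<lambda>n. real (K * 2 ^ n) / 2 ^ n) \<longlonglongrightarrow> real K" "\<And>n. real (K * 2 ^ n) / 2 ^ n \<le> real K"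
      unfolding k by auto
    show "jump_sum (\<lambda>x. cutoff m x * F x) (sh e) {0<..real K} < \<infinity>"
      by (rule jump_sum_cutoff(1)[OF c F(1) cont T])
    show "(\<lambda>n. \<Sum>i<K * 2 ^ n. cutoff m (incr (sh e) n i) * F (incr (sh e) n i)) \<longlonglongrightarrow> enn2real (jump_sum (\<lambda>x. cutoff m x * F x) (sh e) {0<..real K})"
      by (rule jump_sum_cutoff(2)[OF c F(1) cont T])
  qed
  have cm: "(\<lambda>e. jump_sum (\<lambda>x. cutoff m x * F x) (sh e) {0<..real K}) \<in> borel_measurable excursion_space" for m K
  proof -
    have "(\<lambda>e. ennreal (enn2real (jump_sum (\<lambda>x. cutoff m x * F x) (sh e) {0<..real K}))) \<in> borel_measurable excursion_space"
      by (intro measurable_compose[OF _ measurable_ennreal] borel_measurable_LIMSEQ_real[OF grid(2)]) auto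
    also have "?this \<longleftrightarrow> ?thesis" by (intro measurable_cong) (use grid(1) in auto)
    finally show ?thesis .
  qed
  have eq: "jump_sum F e UNIV = (SUP K. SUP m. jump_sum (\<lambda>x. cutoff m x * F x) (sh e) {0<..real K})" if e: "e \<in> excursions" for e
  proof -
    have J: "jump (sh e) t = jump e (t - 1)" for t unfolding sh_def[abs_def] by (rule shifted_excursion(2)[OF e])
    have neg: "jump e t = 0" if "t < 0" for t
    proof -
      have "(e \<longlongrightarrow> 0) (at_left t)"
        using e that unfolding excursions_def
        by (intro tendsto_eventually) (auto simp: eventually_at_left_field intro!: exI[of _ "t - 1"])
      from jump_eqI[OF this] show ?thesis using e that unfolding excursions_def by simp
    qed
    have "jump_sum F e UNIV = (\<integral>\<^sup>+t. ennreal (F (jump (sh e) t)) \<partial>count_space UNIV)"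
      unfolding jump_sum_def J
      by (rule nn_integral_bij_count_space[symmetric]) (rule bij_betwI[where g="\<lambda>t. t + 1"], auto)
    also have "\<dots> = jump_sum F (sh e) {0<..}"
      unfolding jump_sum_def
      by (subst nn_integral_count_space_indicator[of "{0<..}"], simp, rule nn_integral_cong)
         (auto simp: J indicator_def neg F(2))
    also have "\<dots> = (SUP K. jump_sum F (sh e) {0<..real K})" by (rule jump_sum_Ioi)
    finally show ?thesis using jump_sum_SUP[of F, OF F(1) F(2)[OF order_refl]] by simp
  qed
  have "(\<lambda>e. SUP K. SUP m. jump_sum (\<lambda>x. cutoff m x * F x) (sh e) {0<..real K}) \<in> borel_measurable excursion_space"
    using cm by measurable
  also have "?this \<longleftrightarrow> ?thesis" by (intro measurable_cong) (simp add: eq)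
  finally show ?thesis .
qed

lemma prod_over_jumps_eq:
  assumes F: "\<And>x. 0 \<le> F x" "\<And>x. x \<le> 0 \<Longrightarrow> F x = 0" and h: "\<And>x. 0 < x \<Longrightarrow> h x = exp (- F x)"
  shows "prod_over_jumps h e = exp_neg (jump_sum F e UNIV)"
proof -
  define A where "A = {t. 0 < jump e t}"
  have "jump_sum F e UNIV = (\<integral>\<^sup>+t. ennreal (F (jump e t)) \<partial>count_space A)"
    unfolding jump_sum_def
    by (subst (2) nn_integral_count_space_indicator, simp, rule nn_integral_cong) (auto simp: A_def F(2) indicator_def not_less)
  then have lim: "((\<lambda>S. exp (- (\<Sum>t\<in>S. F (jump e t)))) \<longlongrightarrow> exp_neg (jump_sum F e UNIV)) (finite_subsets_at_top A)"
    using exp_neg_sum_limit[of "\<lambda>t. F (jump e t)" A] F(1) by simp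
  have "\<forall>\<^sub>F S in finite_subsets_at_top A. exp (- (\<Sum>t\<in>S. F (jump e t))) = (\<Prod>t\<in>S. h (jump e t))"
  proof (rule eventually_finite_subsets_at_top_weakI)
    fix S assume S: "finite S" "S \<subseteq> A"
    have "(\<Prod>t\<in>S. h (jump e t)) = (\<Prod>t\<in>S. exp (- F (jump e t)))"
      by (rule prod.cong) (use S h in \<open>auto simp: A_def\<close>)
    also have "\<dots> = exp (- (\<Sum>t\<in>S. F (jump e t)))" using S(1) by (simp add: exp_sum[symmetric] sum_negf)
    finally show "exp (- (\<Sum>t\<in>S. F (jump e t))) = (\<Prod>t\<in>S. h (jump e t))" by simp
  qed
  from Lim_transform_eventually[OF lim this]
  have "((\<lambda>S. \<Prod>t\<in>S. h (jump e t)) \<longlongrightarrow> exp_neg (jump_sum F e UNIV)) (finite_subsets_at_top A)" .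
  then show ?thesis unfolding prod_over_jumps_def unordered_prod_def A_def[symmetric] by (intro tendsto_Lim) auto
qed

context weighted_levy
begin

theorem excursion_functional_eq:
  assumes N: "is_excursion_measure \<Omega> X N" and h: "\<And>x. 0 < x \<Longrightarrow> h x = exp (- F x)"
    and q: "0 < q" and \<psi>: "0 \<le> \<psi> q"
  shows "excursion_functional N h (- \<psi> q) = - q"
proof -
  define c where "c = \<psi> q"
  have c: "0 \<le> c" using \<psi> unfolding c_def .
  have setsN: "sets N = sets excursion_space" and sN: "sigma_finite_measure N"
    and ppp: "poisson_point_process \<Omega> (restrict_space lborel {0<..} \<Otimes>\<^sub>M N) (\<lambda>w. excursion_points (path w))"
    using N unfolding is_excursion_measure_def by auto
  have spaceN: "space N = excursions" using sets_eq_imp_space_eq[OF setsN] by simp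
  interpret N: sigma_finite_measure N by (rule sN)
  define R where "R = restrict_space lborel {0 :: real<..}"
  have setsR: "sets R = sets (restrict_space borel {0 :: real<..})" unfolding R_def by (intro sets_restrict_space_cong) simp
  interpret R: sigma_finite_measure R unfolding R_def
    by (rule sigma_finite_measure_restrict_space) (auto intro: lborel.sigma_finite_measure_axioms)
  interpret RN: pair_sigma_finite R N by unfold_locales
  interpret PP: poisson_process \<Omega> "R \<Otimes>\<^sub>M N" "\<lambda>w. excursion_points (path w)"
    by unfold_locales (use ppp RN.sigma_finite_measure_axioms in \<open>auto simp: R_def\<close>)
  define H where "H e = ennreal (c * duration e) + jump_sum F e UNIV" for e
  have Hm [measurable]: "H \<in> borel_measurable N"
    unfolding H_def[abs_def] measurable_cong_sets[OF setsN refl]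
    using jump_sum_excursion_measurable[of F, OF F_nonneg F_nonpos F_cont] by measurable
  \<comment> \<open>Levels up to 1 correspond to the passage below - 1. The level then contributes
    length 1 to the intensity integral, which leaves an integral against N alone.\<close>
  define V where "V p = (if fst p \<le> 1 then H (snd p) else 0)" for p :: "real \<times> (real \<Rightarrow> real)"
  have idR [measurable]: "(\<lambda>x. x) \<in> borel_measurable R"
    unfolding R_def by (intro measurable_restrict_space1) simp
  have Vm: "V \<in> borel_measurable (R \<Otimes>\<^sub>M N)"
    unfolding V_def[abs_def] by measurable
  have AE_eq: "AE w in \<Omega>. passage_weight q 1 w = exp_neg (\<integral>\<^sup>+p. V p \<partial>count_space (excursion_points (path w)))"
  proof -
    have "AE w in \<Omega>. \<forall>n :: nat. hits (real n) (path w)"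
      by (rule AE_all_countable[THEN iffD2]) (simp add: AE_hits(1))
    then show ?thesis
      using AE_hits(2)[OF order_refl] AE_no_negative_jump AE_infimum_times_null PP.ppp_facts(1) AE_space
    proof eventually_elim
      case (elim w)
      interpret E: excursion_path "path w"
      proof
        fix s :: real assume "0 \<le> s"
        obtain n :: nat where "s \<le> real n" using real_arch_simple by blast
        moreover obtain t where "0 \<le> t" "X t w < - real n" using elim(1) unfolding hits_def by blast
        ultimately show "hits s (path w)" unfolding hits_def by (intro exI[of _ t]) simp
      qed (use elim X_cadlag[OF elim(6)] X_0[OF elim(6)] in auto)
      \<comment> \<open>That the pieces of the path are excursions is taken from the Poisson
        process, whose points almost surely lie in the space of the intensity.\<close>
      have exc: "excursion_at (path w) l \<in> excursions" if l: "l \<in> E.levels" for l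
      proof -
        have "(l, excursion_at (path w) l) \<in> excursion_points (path w)"
          using l unfolding excursion_points_def E.levels_def by auto
        then have "(l, excursion_at (path w) l) \<in> space (R \<Otimes>\<^sub>M N)" using elim(5) by blast
        then show ?thesis by (simp add: space_pair_measure spaceN)
      qed
      have "(\<integral>\<^sup>+p. V p \<partial>count_space (excursion_points (path w)))
        = ennreal (c * inverse_local_time (path w) 1) + jump_sum F (path w) {0<..inverse_local_time (path w) 1}"
        unfolding V_def H_def by (rule E.excursion_decomposition[of F c, OF exc F_nonpos c])
      then show ?case using E.hits[of 1] E.T_facts(1)[of 1] c
        unfolding passage_weight_def c_def[symmetric] by (simp add: exp_neg_add exp_neg_ennreal mult.commute)
    qed
  qed
  have "exp (- q) = (\<integral>w. passage_weight q 1 w \<partial>\<Omega>)"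
    using passage_weight_integral[OF q zero_le_one \<psi>] by simp
  also have "\<dots> = exp_neg (\<integral>\<^sup>+p. ennreal (1 - exp_neg (V p)) \<partial>(R \<Otimes>\<^sub>M N))"
    by (rule PP.exponential_formula[OF Vm passage_weight_measurable[OF q zero_le_one] AE_eq])
  also have "(\<integral>\<^sup>+p. ennreal (1 - exp_neg (V p)) \<partial>(R \<Otimes>\<^sub>M N)) = (\<integral>\<^sup>+l. \<integral>\<^sup>+e. ennreal (1 - exp_neg (V (l, e))) \<partial>N \<partial>R)"
    by (rule N.nn_integral_fst[symmetric]) (use Vm in measurable)
  also have "\<dots> = (\<integral>\<^sup>+l. (\<integral>\<^sup>+e. ennreal (1 - exp_neg (H e)) \<partial>N) * indicator {..1} l \<partial>R)"
    by (intro nn_integral_cong) (simp add: V_def indicator_def)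
  also have "\<dots> = (\<integral>\<^sup>+e. ennreal (1 - exp_neg (H e)) \<partial>N)"
  proof -
    have "(\<integral>\<^sup>+l. z * indicator {..1} l \<partial>R) = z" for z :: ennreal
    proof -
      have "(\<integral>\<^sup>+l. z * indicator {..1} l \<partial>R) = (\<integral>\<^sup>+l. z * indicator {0<..1 :: real} l \<partial>lborel)"
        unfolding R_def by (subst nn_integral_restrict_space) (auto intro!: nn_integral_cong simp: indicator_def)
      also have "\<dots> = z" by (subst nn_integral_cmult_indicator) auto
      finally show ?thesis .
    qed
    then show ?thesis .
  qed
  finally have q_eq: "exp (- q) = exp_neg (\<integral>\<^sup>+e. ennreal (1 - exp_neg (H e)) \<partial>N)" .
  \<comment> \<open>An infinite integral would give exp_neg the value 0, but exp (- q) is positive.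
    This finiteness makes the Bochner integral in \<open>excursion_functional\<close> a true
    integral instead of the default 0.\<close>
  then have "(\<integral>\<^sup>+e. ennreal (1 - exp_neg (H e)) \<partial>N) \<noteq> \<top>" using exp_gt_zero[of "- q"] by force
  then obtain z where z: "0 \<le> z" "(\<integral>\<^sup>+e. ennreal (1 - exp_neg (H e)) \<partial>N) = ennreal z" by (cases "\<integral>\<^sup>+e. ennreal (1 - exp_neg (H e)) \<partial>N") auto
  with q_eq have zq: "z = q" by (simp add: exp_neg_ennreal)
  have "has_bochner_integral N (\<lambda>e. 1 - exp_neg (H e)) q"
    by (rule has_bochner_integral_nn_integral) (use z zq exp_neg_bounds q in auto)
  then have int: "(\<integral>e. 1 - exp_neg (H e) \<partial>N) = q" by (simp add: has_bochner_integral_iff)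
  have "excursion_functional N h (- c) = (\<integral>e. - (1 - exp_neg (H e)) \<partial>N)"
    unfolding excursion_functional_def
  proof (rule Bochner_Integration.integral_cong)
    fix e assume "e \<in> space N"
    then have d: "0 \<le> c * duration e" using excursion_duration(1)[of e] c spaceN by simp
    show "exp (- c * duration e) * prod_over_jumps h e - 1 = - (1 - exp_neg (H e))"
      unfolding H_def using exp_neg_ennreal[OF d] prod_over_jumps_eq[of F h e, OF F_nonneg F_nonpos h]
      by (simp add: exp_neg_add)
  qed simp
  also have "\<dots> = - q" using int by (simp only: integral_minus)
  finally show ?thesis unfolding c_def .
qed

end

context disk
begin

text \<open>The weight function is F = - ln g. Its abstract exponent equals \<psi> because
  \<open>NU\<close> integrates e^(- q x) (1 - g x) to \<open>A\<close> q.\<close>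

lemma excursion_functional_disk:
  assumes stable: "spectrally_positive_stable \<beta> \<Omega> \<zeta>" and N: "is_excursion_measure \<Omega> \<zeta> N"
    and q: "0 < q" and \<psi>: "0 \<le> \<psi> q"
  shows "excursion_functional N (disk_laplace \<gamma> M) (- \<psi> q) = - q"
proof -
  define F where "F x = - ln (g x)" for x
  have F: "exp (- F x) = g x" for x unfolding F_def using g_pos by simp
  interpret S: stable_levy \<beta> \<Omega> \<zeta>
  proof
    show "1 < \<beta>" "\<beta> < 2" using \<beta> by auto
    show "has_bochner_integral lborel (\<lambda>x. indicator {0<..} x * (test_fun x * x powr (- 1 - \<beta>))) (Gamma (- \<beta>) * 2 powr \<beta> - 2 * Gamma (- \<beta>))"
      using stable_second_difference unfolding test_fun_def \<kappa>_def by simp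
  qed (rule stable, rule Gamma_\<beta>_pos)
  interpret W: weighted_levy \<beta> \<Omega> \<zeta> F C
  proof
    fix x
    have "isCont g x" using continuous_g by (simp add: continuous_on_eq_continuous_at)
    then show "isCont F x" unfolding F_def[abs_def] using g_pos[of x] by (intro continuous_intros) auto
    show "0 \<le> F x" unfolding F_def using g_le_1[of x] g_pos[of x] by simp
    show "x \<le> 0 \<Longrightarrow> F x = 0" unfolding F_def by simp
    show "1 - exp (- F x) \<le> C * x\<^sup>2" unfolding F by (rule g_quadratic)
  qed (rule C_pos)
  have "(\<integral>x. exp (- q * x) * (1 - g x) \<partial>S.NU) = A q"
    unfolding S.NU_def A_def laplace_def k0_def
    by (subst integral_density) (auto intro!: Bochner_Integration.integral_cong)
  then have e: "W.\<psi> q = \<psi> q" unfolding W.\<psi>_def W.\<phi>_def F S.\<kappa>_def \<psi>_def by simp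
  have h: "disk_laplace \<gamma> M x = exp (- F x)" if "0 < x" for x unfolding F g_def using that by simp
  show ?thesis using W.excursion_functional_eq[of N "disk_laplace \<gamma> M" q, OF N h q] \<psi> unfolding e by blast
qed

end

theorem theorem1p2:
  fixes \<gamma> \<mu> M L \<beta> :: real
    and \<Omega> :: "'w measure" and \<zeta> :: "real \<Rightarrow> 'w \<Rightarrow> real"
    and N :: "(real \<Rightarrow> real) measure" and u u_st :: "real \<Rightarrow> real"
  assumes \<gamma>: "sqrt (8 / 3) < \<gamma>" "\<gamma> < 2"
    and \<mu>: "0 < \<mu>"
    and M: "M = sqrt (\<mu> / sin (pi * \<gamma>\<^sup>2 / 4))"
    and \<beta>: "\<beta> = 4 / \<gamma>\<^sup>2 + 1 / 2"
    and \<zeta>: "spectrally_positive_stable \<beta> \<Omega> \<zeta>"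
    and N: "is_excursion_measure \<Omega> \<zeta> N"
    and u: "\<And>s. s \<le> 0 \<Longrightarrow> u s = excursion_functional N (disk_laplace \<gamma> M) s"
    and L: "L = 2 powr (1 - 4 / \<gamma>\<^sup>2) / Gamma (4 / \<gamma>\<^sup>2) * sqrt (2 * pi) * M powr (4 / \<gamma>\<^sup>2 + 1 / 2)
              * (pi / cos (4 * pi / \<gamma>\<^sup>2)) * (\<gamma> ^ 4 * pi\<^sup>2 / 8)"
    and u_st: "\<And>x. x \<le> 0 \<Longrightarrow> u_st x = - (16 / (\<gamma> ^ 4 * pi\<^sup>2)) * ((M + u (- x * L)) / (2 * M))"
  shows "L < 0 \<and> u_st 0 = 0 \<and>
    (\<forall>x\<le>0. complex_of_real (- x) =
       complex_of_real (u_st x) / 2 *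
       hyp2F1 (complex_of_real (1 / 2 - 4 / \<gamma>\<^sup>2)) (complex_of_real (1 / 2 + 4 / \<gamma>\<^sup>2)) 2
         (complex_of_real (- (\<gamma> ^ 4 * pi\<^sup>2 / 16) * u_st x)))"
proof -
  define \<nu> where "\<nu> = 4 / \<gamma>\<^sup>2"
  have \<gamma>0: "0 < \<gamma>" by (rule le_less_trans[OF _ \<gamma>(1)]) simp
  have \<gamma>2: "8 / 3 < \<gamma>\<^sup>2" "\<gamma>\<^sup>2 < 4"
  proof -
    have "(sqrt (8 / 3))\<^sup>2 < \<gamma>\<^sup>2" using \<gamma>(1) by (intro power_strict_mono) auto
    then show "8 / 3 < \<gamma>\<^sup>2" by simp
    have "\<gamma>\<^sup>2 < 2\<^sup>2" using \<gamma>(2) \<gamma>0 by (intro power_strict_mono) auto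
    then show "\<gamma>\<^sup>2 < 4" by simp
  qed
  have \<nu>: "1 < \<nu>" "\<nu> < 3 / 2" unfolding \<nu>_def using \<gamma>2 \<gamma>0 by (auto simp: pos_less_divide_eq pos_divide_less_eq)
  \<comment> \<open>The argument lies between 0 and pi, so M is the root of a positive
    number.\<close>
  have "0 < sin (pi * \<gamma>\<^sup>2 / 4)" using \<gamma>2 \<gamma>0 by (intro sin_gt_zero) auto
  then have M0: "0 < M" unfolding M using \<mu> by simp
  note \<beta>_eq = \<beta>
  interpret disk \<gamma> M \<nu> by unfold_locales (use M0 \<nu> in \<open>auto simp: \<nu>_def\<close>)
  have \<beta>': "disk.\<beta> \<nu> = \<beta>" unfolding \<beta>_def \<beta>_eq by (simp add: \<nu>_def)
  define k where "k = 2 powr (1 - \<nu>) / Gamma \<nu> * sqrt (2 * pi) * M powr \<beta> * (pi / cos (pi * \<nu>))"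
  define c where "c = \<gamma> ^ 4 * pi\<^sup>2"
  have c: "0 < c" unfolding c_def using \<gamma>0 by simp
  have L_eq: "L = k * (c / 8)" unfolding L k_def c_def \<beta>_eq \<nu>_def by (simp add: mult.commute)
  \<comment> \<open>As \<nu> is between 1 and 3/2, the angle lies in the third quadrant; this
    decides the sign of L.\<close>
  have "cos (pi * \<nu>) < 0"
  proof -
    have "0 < cos (pi * \<nu> - pi)" using \<nu> by (intro cos_gt_zero_pi) (auto simp: field_simps)
    then show ?thesis by (simp add: cos_diff)
  qed
  then have k: "k < 0"
    unfolding k_def using Gamma_\<nu>_pos M0 by (intro mult_pos_neg mult_pos_pos divide_pos_pos divide_pos_neg) auto
  have L0: "L < 0" unfolding L_eq using k c by (simp add: mult_neg_pos)
  have hyp: "complex_of_real (\<psi> q) = complex_of_real (k * ((M - q) / (2 * M))) *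
      hyp2F1 (complex_of_real (1 / 2 - \<nu>)) (complex_of_real (1 / 2 + \<nu>)) 2 (complex_of_real ((M - q) / (2 * M)))" if "0 < q" for q
    using \<psi>_hyp2F1[OF that] unfolding k_def \<beta>' by simp
  have u_eq: "u (- \<psi> q) = - q" if "0 < q" "0 \<le> \<psi> q" for q
    using u[of "- \<psi> q"] excursion_functional_disk[of \<Omega> \<zeta> N q, unfolded \<beta>', OF \<zeta> N that] that by simp
  \<comment> \<open>At q = M the factor (M - q) / (2 M) in front of the hypergeometric function is
    0.\<close>
  have "\<psi> M = 0" using hyp[OF M0] by simp
  then have "u 0 = - M" using u_eq[of M] M0 by simp
  then have st0: "u_st 0 = 0" using u_st[of 0] by simp
  have "complex_of_real (- x) = complex_of_real (u_st x) / 2 *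
       hyp2F1 (complex_of_real (1 / 2 - 4 / \<gamma>\<^sup>2)) (complex_of_real (1 / 2 + 4 / \<gamma>\<^sup>2)) 2
         (complex_of_real (- (\<gamma> ^ 4 * pi\<^sup>2 / 16) * u_st x))" if x: "x \<le> 0" for x
  proof -
    have "0 \<le> x * L" using x L0 by (simp add: mult_nonpos_nonpos)
    then obtain q where q: "M \<le> q" "\<psi> q = x * L" using \<psi>_surj by blast
    have q0: "0 < q" using q(1) M0 by simp
    define z where "z = (M - q) / (2 * M)"
    have "u (- x * L) = - q" using u_eq[OF q0] \<open>0 \<le> x * L\<close> q(2) by simp
    \<comment> \<open>\<open>u_st\<close> is a rescaling of z, normalised so that the argument of
      the hypergeometric function in the claim becomes z itself. It then remains to cancel k, the
      factor common to \<psi> and L.\<close>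
    then have st: "u_st x = - (16 / c) * z" using u_st[OF x] unfolding z_def c_def by simp
    have z: "- (\<gamma> ^ 4 * pi\<^sup>2 / 16) * u_st x = z" unfolding st c_def[symmetric] using c by simp
    define H where "H = hyp2F1 (complex_of_real (1 / 2 - \<nu>)) (complex_of_real (1 / 2 + \<nu>)) 2 (complex_of_real z)"
    have "complex_of_real (x * (k * (c / 8))) = complex_of_real (k * z) * H"
      using hyp[OF q0] unfolding q(2) L_eq z_def[symmetric] H_def .
    then have "complex_of_real k * (complex_of_real x * complex_of_real (c / 8)) = complex_of_real k * (complex_of_real z * H)"
      by (simp only: of_real_mult mult_ac)
    then have "complex_of_real x * complex_of_real (c / 8) = complex_of_real z * H" using k by simp
    then have "complex_of_real x = complex_of_real z * H / complex_of_real (c / 8)" using c by (simp add: field_simps)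
    then have "complex_of_real (- x) = complex_of_real (u_st x) / 2 * H" unfolding st using c by (simp add: field_simps)
    then show ?thesis unfolding z H_def \<nu>_def .
  qed
  with L0 st0 show ?thesis by blast
qed

end
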